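(* If $\mathcal V$ is a semi-abelian variety of algebras and $X$ is an object of $\mathcal V$, then the functor $X\otimes(-)\colon\mathcal V\to\mathsf{Ab}(\mathcal V)$ preserves all colimits, where $\otimes$ is the bilinear product on $\mathcal V$.
   Context: A semi-abelian variety is a variety of universal algebras which is a semi-abelian category (pointed, Barr-exact, Bourn-protomodular with finite coproducts). $\mathsf{Ab}(\mathcal V)$ is the full subcategory of objects admitting an internal abelian group structure. The cosmash product $X\diamond Y$ is the kernel of the canonical morphism $X+Y\to X\times Y$; the ternary cosmash product $X\diamond Y\diamond Z$ is the kernel of the canonical morphism $X+Y+Z\to(X+Y)\times(X+Z)\times(Y+Z)$ whose components kill $Z$, $Y$, $X$ respectively. The commutator $[X,X,X]$ is the image of $X\diamond X\diamond X\to X+X+X\to X$ (the last arrow being the codiagonal). $X$ is two-nilpotent if $[X,X,X]=0$; the two-nilpotent objects form a full reflective subcategory $\mathsf{Nil}_2(\mathcal V)$, itself semi-abelian, with reflector $\mathrm{nil}_2(X)=X/[X,X,X]$. The bilinear product $X\otimes Y$ is the cosmash product of $\mathrm{nil}_2(X)$ and $\mathrm{nil}_2(Y)$ computed in $\mathsf{Nil}_2(\mathcal V)$; it is always an abelian object, so $\otimes$ is viewed as a bifunctor $\mathcal V\times\mathcal V\to\mathsf{Ab}(\mathcal V)$. *)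

theory Defs
  imports Main "HOL-Library.FuncSet" "HOL-Library.Equipollence"
begin

section \<open>Categories\<close>

record ('o, 'm) cat =
  Obj :: "'o set"
  Arr :: "'m set"
  Dom :: "'m \<Rightarrow> 'o"
  Cod :: "'m \<Rightarrow> 'o"
  Ide :: "'o \<Rightarrow> 'm"
  Comp :: "'m \<Rightarrow> 'm \<Rightarrow> 'm" (infixl "\<cdot>\<index>" 70)

definition hom :: "('o, 'm) cat \<Rightarrow> 'o \<Rightarrow> 'o \<Rightarrow> 'm set" where
  "hom C A B = {f \<in> Arr C. Dom C f = A \<and> Cod C f = B}"

definition category :: "('o, 'm) cat \<Rightarrow> bool" where
  "category C \<longleftrightarrow>
     (\<forall>f\<in>Arr C. Dom C f \<in> Obj C \<and> Cod C f \<in> Obj C) \<and>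
     (\<forall>A\<in>Obj C. Ide C A \<in> hom C A A) \<and>
     (\<forall>f\<in>Arr C. \<forall>g\<in>Arr C. Cod C f = Dom C g \<longrightarrow> g \<cdot>\<^bsub>C\<^esub> f \<in> hom C (Dom C f) (Cod C g)) \<and>
     (\<forall>f\<in>Arr C. f \<cdot>\<^bsub>C\<^esub> Ide C (Dom C f) = f \<and> Ide C (Cod C f) \<cdot>\<^bsub>C\<^esub> f = f) \<and>
     (\<forall>f\<in>Arr C. \<forall>g\<in>Arr C. \<forall>h\<in>Arr C. Cod C f = Dom C g \<longrightarrow> Cod C g = Dom C h \<longrightarrow>
        (h \<cdot>\<^bsub>C\<^esub> g) \<cdot>\<^bsub>C\<^esub> f = h \<cdot>\<^bsub>C\<^esub> (g \<cdot>\<^bsub>C\<^esub> f))"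

definition full_subcat :: "('o, 'm) cat \<Rightarrow> ('o \<Rightarrow> bool) \<Rightarrow> ('o, 'm) cat" where
  "full_subcat C P = C\<lparr>Obj := {A \<in> Obj C. P A},
                       Arr := {f \<in> Arr C. P (Dom C f) \<and> P (Cod C f)}\<rparr>"

definition iso :: "('o, 'm) cat \<Rightarrow> 'm \<Rightarrow> bool" where
  "iso C f \<longleftrightarrow> f \<in> Arr C \<and>
     (\<exists>g\<in>hom C (Cod C f) (Dom C f). g \<cdot>\<^bsub>C\<^esub> f = Ide C (Dom C f) \<and> f \<cdot>\<^bsub>C\<^esub> g = Ide C (Cod C f))"

definition mono_arr :: "('o, 'm) cat \<Rightarrow> 'm \<Rightarrow> bool" where
  "mono_arr C m \<longleftrightarrow> m \<in> Arr C \<and>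
     (\<forall>f\<in>Arr C. \<forall>g\<in>Arr C. Dom C f = Dom C g \<and> Cod C f = Dom C m \<and> Cod C g = Dom C m \<and>
        m \<cdot>\<^bsub>C\<^esub> f = m \<cdot>\<^bsub>C\<^esub> g \<longrightarrow> f = g)"


section \<open>Limits and colimits of finite shapes\<close>

definition is_initial :: "('o, 'm) cat \<Rightarrow> 'o \<Rightarrow> bool" where
  "is_initial C Z \<longleftrightarrow> Z \<in> Obj C \<and> (\<forall>A\<in>Obj C. \<exists>!f. f \<in> hom C Z A)"

definition is_terminal :: "('o, 'm) cat \<Rightarrow> 'o \<Rightarrow> bool" where
  "is_terminal C T \<longleftrightarrow> T \<in> Obj C \<and> (\<forall>A\<in>Obj C. \<exists>!f. f \<in> hom C A T)"

definition is_zero :: "('o, 'm) cat \<Rightarrow> 'o \<Rightarrow> bool" where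
  "is_zero C Z \<longleftrightarrow> is_initial C Z \<and> is_terminal C Z"

definition is_product :: "('o, 'm) cat \<Rightarrow> 'o \<Rightarrow> 'o \<Rightarrow> 'm \<Rightarrow> 'm \<Rightarrow> bool" where
  "is_product C A B p q \<longleftrightarrow>
     p \<in> Arr C \<and> q \<in> Arr C \<and> Dom C p = Dom C q \<and> Cod C p = A \<and> Cod C q = B \<and>
     (\<forall>f\<in>Arr C. \<forall>g\<in>Arr C. Dom C f = Dom C g \<and> Cod C f = A \<and> Cod C g = B \<longrightarrow>
        (\<exists>!h. h \<in> hom C (Dom C f) (Dom C p) \<and> p \<cdot>\<^bsub>C\<^esub> h = f \<and> q \<cdot>\<^bsub>C\<^esub> h = g))"

definition is_coproduct :: "('o, 'm) cat \<Rightarrow> 'o \<Rightarrow> 'o \<Rightarrow> 'm \<Rightarrow> 'm \<Rightarrow> bool" where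
  "is_coproduct C A B i j \<longleftrightarrow>
     i \<in> Arr C \<and> j \<in> Arr C \<and> Cod C i = Cod C j \<and> Dom C i = A \<and> Dom C j = B \<and>
     (\<forall>f\<in>Arr C. \<forall>g\<in>Arr C. Cod C f = Cod C g \<and> Dom C f = A \<and> Dom C g = B \<longrightarrow>
        (\<exists>!h. h \<in> hom C (Cod C i) (Cod C f) \<and> h \<cdot>\<^bsub>C\<^esub> i = f \<and> h \<cdot>\<^bsub>C\<^esub> j = g))"

definition is_pullback :: "('o, 'm) cat \<Rightarrow> 'm \<Rightarrow> 'm \<Rightarrow> 'm \<Rightarrow> 'm \<Rightarrow> bool" where
  "is_pullback C f g a b \<longleftrightarrow>
     f \<in> Arr C \<and> g \<in> Arr C \<and> a \<in> Arr C \<and> b \<in> Arr C \<and> Cod C f = Cod C g \<and>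
     Dom C a = Dom C b \<and> Cod C a = Dom C f \<and> Cod C b = Dom C g \<and> f \<cdot>\<^bsub>C\<^esub> a = g \<cdot>\<^bsub>C\<^esub> b \<and>
     (\<forall>x\<in>Arr C. \<forall>y\<in>Arr C. Dom C x = Dom C y \<and> Cod C x = Dom C f \<and> Cod C y = Dom C g \<and>
        f \<cdot>\<^bsub>C\<^esub> x = g \<cdot>\<^bsub>C\<^esub> y \<longrightarrow>
        (\<exists>!h. h \<in> hom C (Dom C x) (Dom C a) \<and> a \<cdot>\<^bsub>C\<^esub> h = x \<and> b \<cdot>\<^bsub>C\<^esub> h = y))"

definition is_coequalizer :: "('o, 'm) cat \<Rightarrow> 'm \<Rightarrow> 'm \<Rightarrow> 'm \<Rightarrow> bool" where
  "is_coequalizer C f g q \<longleftrightarrow>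
     f \<in> Arr C \<and> g \<in> Arr C \<and> q \<in> Arr C \<and> Dom C f = Dom C g \<and> Cod C f = Cod C g \<and>
     Dom C q = Cod C f \<and> q \<cdot>\<^bsub>C\<^esub> f = q \<cdot>\<^bsub>C\<^esub> g \<and>
     (\<forall>h\<in>Arr C. Dom C h = Cod C f \<and> h \<cdot>\<^bsub>C\<^esub> f = h \<cdot>\<^bsub>C\<^esub> g \<longrightarrow>
        (\<exists>!u. u \<in> hom C (Cod C q) (Cod C h) \<and> u \<cdot>\<^bsub>C\<^esub> q = h))"

definition regular_epi :: "('o, 'm) cat \<Rightarrow> 'm \<Rightarrow> bool" where
  "regular_epi C e \<longleftrightarrow> (\<exists>f g. is_coequalizer C f g e)"


section \<open>Semi-abelian categories\<close>

definition pointed :: "('o, 'm) cat \<Rightarrow> bool" where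
  "pointed C \<longleftrightarrow> (\<exists>Z. is_zero C Z)"

definition has_finite_coproducts :: "('o, 'm) cat \<Rightarrow> bool" where
  "has_finite_coproducts C \<longleftrightarrow>
     (\<exists>Z. is_initial C Z) \<and> (\<forall>A\<in>Obj C. \<forall>B\<in>Obj C. \<exists>i j. is_coproduct C A B i j)"

definition finitely_complete :: "('o, 'm) cat \<Rightarrow> bool" where
  "finitely_complete C \<longleftrightarrow>
     (\<exists>T. is_terminal C T) \<and>
     (\<forall>f\<in>Arr C. \<forall>g\<in>Arr C. Cod C f = Cod C g \<longrightarrow> (\<exists>a b. is_pullback C f g a b))"

definition regular_cat :: "('o, 'm) cat \<Rightarrow> bool" where
  "regular_cat C \<longleftrightarrow> finitely_complete C \<and>
     (\<forall>f a b. is_pullback C f f a b \<longrightarrow> (\<exists>q. is_coequalizer C a b q)) \<and>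
     (\<forall>f g a b. is_pullback C f g a b \<and> regular_epi C f \<longrightarrow> regular_epi C b)"

definition internal_equivalence :: "('o, 'm) cat \<Rightarrow> 'm \<Rightarrow> 'm \<Rightarrow> bool" where
  "internal_equivalence C r s \<longleftrightarrow>
     r \<in> Arr C \<and> s \<in> Arr C \<and> Dom C r = Dom C s \<and> Cod C r = Cod C s \<and>
     (\<forall>x\<in>Arr C. \<forall>y\<in>Arr C. Dom C x = Dom C y \<and> Cod C x = Dom C r \<and> Cod C y = Dom C r \<and>
        r \<cdot>\<^bsub>C\<^esub> x = r \<cdot>\<^bsub>C\<^esub> y \<and> s \<cdot>\<^bsub>C\<^esub> x = s \<cdot>\<^bsub>C\<^esub> y \<longrightarrow> x = y) \<and>
     (\<exists>d\<in>hom C (Cod C r) (Dom C r).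
        r \<cdot>\<^bsub>C\<^esub> d = Ide C (Cod C r) \<and> s \<cdot>\<^bsub>C\<^esub> d = Ide C (Cod C r)) \<and>
     (\<exists>t\<in>hom C (Dom C r) (Dom C r). r \<cdot>\<^bsub>C\<^esub> t = s \<and> s \<cdot>\<^bsub>C\<^esub> t = r) \<and>
     (\<forall>a b. is_pullback C s r a b \<longrightarrow>
        (\<exists>t\<in>hom C (Dom C a) (Dom C r). r \<cdot>\<^bsub>C\<^esub> t = r \<cdot>\<^bsub>C\<^esub> a \<and> s \<cdot>\<^bsub>C\<^esub> t = s \<cdot>\<^bsub>C\<^esub> b))"

definition barr_exact :: "('o, 'm) cat \<Rightarrow> bool" where
  "barr_exact C \<longleftrightarrow> regular_cat C \<and>
     (\<forall>r s. internal_equivalence C r s \<longrightarrow> (\<exists>f. is_pullback C f f r s))"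

text \<open>A point over \<open>B\<close> is a split epimorphism \<open>p\<close> onto \<open>B\<close> with a chosen section \<open>s\<close>.\<close>

definition is_point :: "('o, 'm) cat \<Rightarrow> 'm \<Rightarrow> 'm \<Rightarrow> bool" where
  "is_point C p s \<longleftrightarrow>
     p \<in> Arr C \<and> s \<in> hom C (Cod C p) (Dom C p) \<and> p \<cdot>\<^bsub>C\<^esub> s = Ide C (Cod C p)"

text \<open>Bourn's condition: for every \<open>f : E \<rightarrow> B\<close> the pullback functor \<open>f\<^sup>*\<close> from points over
  \<open>B\<close> to points over \<open>E\<close> reflects isomorphisms. Below, \<open>h\<close> is a morphism of points over
  \<open>B\<close> from \<open>(p, s)\<close> to \<open>(p', s')\<close>, and \<open>k\<close> is \<open>f\<^sup>* h\<close>; a morphism of points is invertible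
  iff its underlying arrow is.\<close>

definition protomodular :: "('o, 'm) cat \<Rightarrow> bool" where
  "protomodular C \<longleftrightarrow>
     (\<forall>f p s p' s' h a b a' b' k.
        is_point C p s \<and> is_point C p' s' \<and>
        h \<in> hom C (Dom C p) (Dom C p') \<and> p' \<cdot>\<^bsub>C\<^esub> h = p \<and> h \<cdot>\<^bsub>C\<^esub> s = s' \<and>
        is_pullback C f p a b \<and> is_pullback C f p' a' b' \<and>
        k \<in> hom C (Dom C a) (Dom C a') \<and> a' \<cdot>\<^bsub>C\<^esub> k = a \<and> b' \<cdot>\<^bsub>C\<^esub> k = h \<cdot>\<^bsub>C\<^esub> b \<and>
        iso C k \<longrightarrow> iso C h)"

definition semi_abelian :: "('o, 'm) cat \<Rightarrow> bool" where
  "semi_abelian C \<longleftrightarrow> category C \<and> pointed C \<and> barr_exact C \<and> protomodular C \<and>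
     has_finite_coproducts C"


section \<open>Chosen (co)limits\<close>

text \<open>The constructions are fixed by a choice among the isomorphic candidates. The values are
  meaningful in categories where the respective (co)limits exist.\<close>

definition product :: "('o, 'm) cat \<Rightarrow> 'o \<Rightarrow> 'o \<Rightarrow> 'm \<times> 'm" where
  "product C A B = (SOME (p, q). is_product C A B p q)"

definition proj1 :: "('o, 'm) cat \<Rightarrow> 'o \<Rightarrow> 'o \<Rightarrow> 'm" where
  "proj1 C A B = fst (product C A B)"

definition proj2 :: "('o, 'm) cat \<Rightarrow> 'o \<Rightarrow> 'o \<Rightarrow> 'm" where
  "proj2 C A B = snd (product C A B)"

definition prod_obj :: "('o, 'm) cat \<Rightarrow> 'o \<Rightarrow> 'o \<Rightarrow> 'o" where
  "prod_obj C A B = Dom C (proj1 C A B)"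

definition pairing :: "('o, 'm) cat \<Rightarrow> 'm \<Rightarrow> 'm \<Rightarrow> 'm" where
  "pairing C f g = (THE h. h \<in> hom C (Dom C f) (prod_obj C (Cod C f) (Cod C g)) \<and>
     proj1 C (Cod C f) (Cod C g) \<cdot>\<^bsub>C\<^esub> h = f \<and> proj2 C (Cod C f) (Cod C g) \<cdot>\<^bsub>C\<^esub> h = g)"

definition coproduct :: "('o, 'm) cat \<Rightarrow> 'o \<Rightarrow> 'o \<Rightarrow> 'm \<times> 'm" where
  "coproduct C A B = (SOME (i, j). is_coproduct C A B i j)"

definition inj1 :: "('o, 'm) cat \<Rightarrow> 'o \<Rightarrow> 'o \<Rightarrow> 'm" where
  "inj1 C A B = fst (coproduct C A B)"

definition inj2 :: "('o, 'm) cat \<Rightarrow> 'o \<Rightarrow> 'o \<Rightarrow> 'm" where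
  "inj2 C A B = snd (coproduct C A B)"

definition coprod_obj :: "('o, 'm) cat \<Rightarrow> 'o \<Rightarrow> 'o \<Rightarrow> 'o" where
  "coprod_obj C A B = Cod C (inj1 C A B)"

definition copairing :: "('o, 'm) cat \<Rightarrow> 'm \<Rightarrow> 'm \<Rightarrow> 'm" where
  "copairing C f g = (THE h. h \<in> hom C (coprod_obj C (Dom C f) (Dom C g)) (Cod C f) \<and>
     h \<cdot>\<^bsub>C\<^esub> inj1 C (Dom C f) (Dom C g) = f \<and> h \<cdot>\<^bsub>C\<^esub> inj2 C (Dom C f) (Dom C g) = g)"

definition coprod_map :: "('o, 'm) cat \<Rightarrow> 'm \<Rightarrow> 'm \<Rightarrow> 'm" where
  "coprod_map C f g = copairing C (inj1 C (Cod C f) (Cod C g) \<cdot>\<^bsub>C\<^esub> f)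
                                  (inj2 C (Cod C f) (Cod C g) \<cdot>\<^bsub>C\<^esub> g)"

definition zero_arr :: "('o, 'm) cat \<Rightarrow> 'o \<Rightarrow> 'o \<Rightarrow> 'm" where
  "zero_arr C A B = (THE f. \<exists>Z u v. is_zero C Z \<and> u \<in> hom C A Z \<and> v \<in> hom C Z B \<and> f = v \<cdot>\<^bsub>C\<^esub> u)"

definition is_kernel :: "('o, 'm) cat \<Rightarrow> 'm \<Rightarrow> 'm \<Rightarrow> bool" where
  "is_kernel C f k \<longleftrightarrow>
     f \<in> Arr C \<and> k \<in> Arr C \<and> Cod C k = Dom C f \<and>
     f \<cdot>\<^bsub>C\<^esub> k = zero_arr C (Dom C k) (Cod C f) \<and>
     (\<forall>h\<in>Arr C. Cod C h = Dom C f \<and> f \<cdot>\<^bsub>C\<^esub> h = zero_arr C (Dom C h) (Cod C f) \<longrightarrow>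
        (\<exists>!u. u \<in> hom C (Dom C h) (Dom C k) \<and> k \<cdot>\<^bsub>C\<^esub> u = h))"

definition is_cokernel :: "('o, 'm) cat \<Rightarrow> 'm \<Rightarrow> 'm \<Rightarrow> bool" where
  "is_cokernel C f q \<longleftrightarrow>
     f \<in> Arr C \<and> q \<in> Arr C \<and> Dom C q = Cod C f \<and>
     q \<cdot>\<^bsub>C\<^esub> f = zero_arr C (Dom C f) (Cod C q) \<and>
     (\<forall>h\<in>Arr C. Dom C h = Cod C f \<and> h \<cdot>\<^bsub>C\<^esub> f = zero_arr C (Dom C f) (Cod C h) \<longrightarrow>
        (\<exists>!u. u \<in> hom C (Cod C q) (Cod C h) \<and> u \<cdot>\<^bsub>C\<^esub> q = h))"

definition kernel :: "('o, 'm) cat \<Rightarrow> 'm \<Rightarrow> 'm" where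
  "kernel C f = (SOME k. is_kernel C f k)"

definition cokernel :: "('o, 'm) cat \<Rightarrow> 'm \<Rightarrow> 'm" where
  "cokernel C f = (SOME q. is_cokernel C f q)"

text \<open>The image of \<open>f\<close>, as a subobject of its codomain: the monomorphism in a factorization of
  \<open>f\<close> into a regular epimorphism followed by a monomorphism.\<close>

definition image :: "('o, 'm) cat \<Rightarrow> 'm \<Rightarrow> 'm" where
  "image C f = (SOME m. mono_arr C m \<and> Cod C m = Cod C f \<and>
     (\<exists>e\<in>hom C (Dom C f) (Dom C m). regular_epi C e \<and> m \<cdot>\<^bsub>C\<^esub> e = f))"


section \<open>Abelian objects\<close>

text \<open>\<open>A\<close> carries an internal abelian group structure with multiplication \<open>m : A \<times> A \<rightarrow> A\<close>,
  unit \<open>e : T \<rightarrow> A\<close> (\<open>T\<close> terminal) and inversion \<open>i\<close>. Here \<open>u : A \<rightarrow> T\<close> is the unique arrow,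
  \<open>p, q\<close> are the projections of \<open>A \<times> A\<close>, and \<open>r, s\<close> are those of \<open>(A \<times> A) \<times> A\<close>, on which
  associativity is stated.\<close>

definition abelian_obj :: "('o, 'm) cat \<Rightarrow> 'o \<Rightarrow> bool" where
  "abelian_obj C A \<longleftrightarrow> A \<in> Obj C \<and>
     (\<exists>T m e i u. is_terminal C T \<and>
        m \<in> hom C (prod_obj C A A) A \<and> e \<in> hom C T A \<and> i \<in> hom C A A \<and> u \<in> hom C A T \<and>
        (let p = proj1 C A A; q = proj2 C A A;
             r = proj1 C (prod_obj C A A) A; s = proj2 C (prod_obj C A A) A
         in m \<cdot>\<^bsub>C\<^esub> pairing C (m \<cdot>\<^bsub>C\<^esub> r) s =
              m \<cdot>\<^bsub>C\<^esub> pairing C (p \<cdot>\<^bsub>C\<^esub> r) (m \<cdot>\<^bsub>C\<^esub> pairing C (q \<cdot>\<^bsub>C\<^esub> r) s) \<and>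
            m \<cdot>\<^bsub>C\<^esub> pairing C (Ide C A) (e \<cdot>\<^bsub>C\<^esub> u) = Ide C A \<and>
            m \<cdot>\<^bsub>C\<^esub> pairing C (e \<cdot>\<^bsub>C\<^esub> u) (Ide C A) = Ide C A \<and>
            m \<cdot>\<^bsub>C\<^esub> pairing C (Ide C A) i = e \<cdot>\<^bsub>C\<^esub> u \<and>
            m \<cdot>\<^bsub>C\<^esub> pairing C i (Ide C A) = e \<cdot>\<^bsub>C\<^esub> u \<and>
            m \<cdot>\<^bsub>C\<^esub> pairing C q p = m))"

definition Ab :: "('o, 'm) cat \<Rightarrow> ('o, 'm) cat" where
  "Ab C = full_subcat C (abelian_obj C)"


section \<open>Cosmash products, two-nilpotent objects and the bilinear product\<close>

definition cosmash_incl :: "('o, 'm) cat \<Rightarrow> 'o \<Rightarrow> 'o \<Rightarrow> 'm" where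
  "cosmash_incl C X Y = kernel C (pairing C
     (copairing C (Ide C X) (zero_arr C Y X))
     (copairing C (zero_arr C X Y) (Ide C Y)))"

definition cosmash :: "('o, 'm) cat \<Rightarrow> 'o \<Rightarrow> 'o \<Rightarrow> 'o" where
  "cosmash C X Y = Dom C (cosmash_incl C X Y)"

definition cosmash_map :: "('o, 'm) cat \<Rightarrow> 'm \<Rightarrow> 'm \<Rightarrow> 'm" where
  "cosmash_map C f g = (THE h.
     h \<in> hom C (cosmash C (Dom C f) (Dom C g)) (cosmash C (Cod C f) (Cod C g)) \<and>
     cosmash_incl C (Cod C f) (Cod C g) \<cdot>\<^bsub>C\<^esub> h =
       coprod_map C f g \<cdot>\<^bsub>C\<^esub> cosmash_incl C (Dom C f) (Dom C g))"

text \<open>The ternary sum is \<open>(X + Y) + Z\<close> and the ternary product is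
  \<open>((X + Y) \<times> (X + Z)) \<times> (Y + Z)\<close>.\<close>

definition cosmash3_incl :: "('o, 'm) cat \<Rightarrow> 'o \<Rightarrow> 'o \<Rightarrow> 'o \<Rightarrow> 'm" where
  "cosmash3_incl C X Y Z =
     (let XY = coprod_obj C X Y; XZ = coprod_obj C X Z; YZ = coprod_obj C Y Z;
          killZ = copairing C (Ide C XY) (zero_arr C Z XY);
          killY = copairing C (copairing C (inj1 C X Z) (zero_arr C Y XZ)) (inj2 C X Z);
          killX = copairing C (copairing C (zero_arr C X YZ) (inj1 C Y Z)) (inj2 C Y Z)
      in kernel C (pairing C (pairing C killZ killY) killX))"

definition codiagonal3 :: "('o, 'm) cat \<Rightarrow> 'o \<Rightarrow> 'm" where
  "codiagonal3 C X = copairing C (copairing C (Ide C X) (Ide C X)) (Ide C X)"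

text \<open>The commutator \<open>[X, X, X]\<close>, as a subobject of \<open>X\<close>.\<close>

definition commutator3 :: "('o, 'm) cat \<Rightarrow> 'o \<Rightarrow> 'm" where
  "commutator3 C X = image C (codiagonal3 C X \<cdot>\<^bsub>C\<^esub> cosmash3_incl C X X X)"

definition two_nilpotent :: "('o, 'm) cat \<Rightarrow> 'o \<Rightarrow> bool" where
  "two_nilpotent C X \<longleftrightarrow> X \<in> Obj C \<and> is_zero C (Dom C (commutator3 C X))"

definition Nil2 :: "('o, 'm) cat \<Rightarrow> ('o, 'm) cat" where
  "Nil2 C = full_subcat C (two_nilpotent C)"

text \<open>The quotient \<open>X \<rightarrow> X / [X, X, X]\<close>, which is the unit of the reflection onto \<open>Nil2 C\<close>.\<close>

definition nil2_unit :: "('o, 'm) cat \<Rightarrow> 'o \<Rightarrow> 'm" where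
  "nil2_unit C X = cokernel C (commutator3 C X)"

definition nil2 :: "('o, 'm) cat \<Rightarrow> 'o \<Rightarrow> 'o" where
  "nil2 C X = Cod C (nil2_unit C X)"

definition nil2_map :: "('o, 'm) cat \<Rightarrow> 'm \<Rightarrow> 'm" where
  "nil2_map C f = (THE g. g \<in> hom C (nil2 C (Dom C f)) (nil2 C (Cod C f)) \<and>
     g \<cdot>\<^bsub>C\<^esub> nil2_unit C (Dom C f) = nil2_unit C (Cod C f) \<cdot>\<^bsub>C\<^esub> f)"

definition tensor :: "('o, 'm) cat \<Rightarrow> 'o \<Rightarrow> 'o \<Rightarrow> 'o" where
  "tensor C X Y = cosmash (Nil2 C) (nil2 C X) (nil2 C Y)"

definition tensor_map :: "('o, 'm) cat \<Rightarrow> 'm \<Rightarrow> 'm \<Rightarrow> 'm" where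
  "tensor_map C f g = cosmash_map (Nil2 C) (nil2_map C f) (nil2_map C g)"


section \<open>Functors and preservation of colimits\<close>

record ('o, 'm, 'p, 'n) fctr =
  on_obj :: "'o \<Rightarrow> 'p"
  on_arr :: "'m \<Rightarrow> 'n"

definition is_functor :: "('o, 'm) cat \<Rightarrow> ('p, 'n) cat \<Rightarrow> ('o, 'm, 'p, 'n) fctr \<Rightarrow> bool" where
  "is_functor C D F \<longleftrightarrow>
     (\<forall>A\<in>Obj C. on_obj F A \<in> Obj D \<and> on_arr F (Ide C A) = Ide D (on_obj F A)) \<and>
     (\<forall>f\<in>Arr C. on_arr F f \<in> hom D (on_obj F (Dom C f)) (on_obj F (Cod C f))) \<and>
     (\<forall>f\<in>Arr C. \<forall>g\<in>Arr C. Cod C f = Dom C g \<longrightarrow>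
        on_arr F (g \<cdot>\<^bsub>C\<^esub> f) = on_arr F g \<cdot>\<^bsub>D\<^esub> on_arr F f)"

definition fctr_comp ::
  "('p, 'n, 'q, 'k) fctr \<Rightarrow> ('o, 'm, 'p, 'n) fctr \<Rightarrow> ('o, 'm, 'q, 'k) fctr" where
  "fctr_comp F G = \<lparr>on_obj = on_obj F \<circ> on_obj G, on_arr = on_arr F \<circ> on_arr G\<rparr>"

definition is_cocone ::
  "('i, 'j) cat \<Rightarrow> ('o, 'm) cat \<Rightarrow> ('i, 'j, 'o, 'm) fctr \<Rightarrow> 'o \<Rightarrow> ('i \<Rightarrow> 'm) \<Rightarrow> bool" where
  "is_cocone J C G L c \<longleftrightarrow> L \<in> Obj C \<and>
     (\<forall>i\<in>Obj J. c i \<in> hom C (on_obj G i) L) \<and>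
     (\<forall>a\<in>Arr J. c (Cod J a) \<cdot>\<^bsub>C\<^esub> on_arr G a = c (Dom J a))"

definition is_colimit ::
  "('i, 'j) cat \<Rightarrow> ('o, 'm) cat \<Rightarrow> ('i, 'j, 'o, 'm) fctr \<Rightarrow> 'o \<Rightarrow> ('i \<Rightarrow> 'm) \<Rightarrow> bool" where
  "is_colimit J C G L c \<longleftrightarrow> is_cocone J C G L c \<and>
     (\<forall>M d. is_cocone J C G M d \<longrightarrow>
        (\<exists>!h. h \<in> hom C L M \<and> (\<forall>i\<in>Obj J. h \<cdot>\<^bsub>C\<^esub> c i = d i)))"

definition preserves_colimits ::
  "('i, 'j) cat \<Rightarrow> ('o, 'm) cat \<Rightarrow> ('p, 'n) cat \<Rightarrow> ('o, 'm, 'p, 'n) fctr \<Rightarrow> bool" where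
  "preserves_colimits J C D F \<longleftrightarrow>
     (\<forall>G L c. is_functor J C G \<and> is_colimit J C G L c \<longrightarrow>
        is_colimit J D (fctr_comp F G) (on_obj F L) (on_arr F \<circ> c))"

definition tensor_functor :: "('o, 'm) cat \<Rightarrow> 'o \<Rightarrow> ('o, 'm, 'o, 'm) fctr" where
  "tensor_functor C X = \<lparr>on_obj = tensor C X, on_arr = tensor_map C (Ide C X)\<rparr>"


section \<open>Varieties of algebras\<close>

text \<open>A signature is a type \<open>'f\<close> of operation symbols with finite arities; a variety is given by a
  set of equations between terms in variables indexed by \<open>nat\<close>. Algebras may be empty, so the
  category is pointed only if the variety has a constant.\<close>

datatype 'f tm = Var nat | Op 'f "'f tm list"

fun wf_tm :: "('f \<Rightarrow> nat) \<Rightarrow> 'f tm \<Rightarrow> bool" where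
  "wf_tm ar (Var n) = True"
| "wf_tm ar (Op f ts) = (length ts = ar f \<and> (\<forall>t\<in>set ts. wf_tm ar t))"

record ('f, 'u) alg =
  carrier :: "'u set"
  oper :: "'f \<Rightarrow> 'u list \<Rightarrow> 'u"

fun tm_val :: "('f, 'u) alg \<Rightarrow> (nat \<Rightarrow> 'u) \<Rightarrow> 'f tm \<Rightarrow> 'u" where
  "tm_val A v (Var n) = v n"
| "tm_val A v (Op f ts) = oper A f (map (tm_val A v) ts)"

definition is_alg :: "('f \<Rightarrow> nat) \<Rightarrow> ('f, 'u) alg \<Rightarrow> bool" where
  "is_alg ar A \<longleftrightarrow>
     (\<forall>f xs. set xs \<subseteq> carrier A \<and> length xs = ar f \<longrightarrow> oper A f xs \<in> carrier A)"

definition models :: "('f, 'u) alg \<Rightarrow> ('f tm \<times> 'f tm) set \<Rightarrow> bool" where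
  "models A E \<longleftrightarrow> (\<forall>(s, t)\<in>E. \<forall>v. range v \<subseteq> carrier A \<longrightarrow> tm_val A v s = tm_val A v t)"

definition alg_homs ::
  "('f \<Rightarrow> nat) \<Rightarrow> ('f, 'u) alg \<Rightarrow> ('f, 'u) alg \<Rightarrow> ('u \<Rightarrow> 'u) set" where
  "alg_homs ar A B = {h \<in> carrier A \<rightarrow>\<^sub>E carrier B.
     \<forall>f xs. set xs \<subseteq> carrier A \<and> length xs = ar f \<longrightarrow> h (oper A f xs) = oper B f (map h xs)}"

text \<open>The category of all algebras satisfying \<open>E\<close> whose carrier is a subset of the type \<open>'u\<close>,
  which plays the role of the universe. If \<open>'u\<close> is infinite and at least as large as the
  signature, these are, up to isomorphism, all algebras of the variety of cardinality at most
  that of \<open>'u\<close>. An arrow is a triple (domain, function, codomain), the function being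
  \<open>undefined\<close> outside the carrier of the domain. Values of operations outside the carrier are
  irrelevant, so the category contains redundant isomorphic copies of each algebra.\<close>

definition Variety ::
  "('f \<Rightarrow> nat) \<Rightarrow> ('f tm \<times> 'f tm) set \<Rightarrow>
   (('f, 'u) alg, ('f, 'u) alg \<times> ('u \<Rightarrow> 'u) \<times> ('f, 'u) alg) cat" where
  "Variety ar E =
     \<lparr>Obj = {A. is_alg ar A \<and> models A E},
      Arr = {(A, h, B). is_alg ar A \<and> models A E \<and> is_alg ar B \<and> models B E \<and> h \<in> alg_homs ar A B},
      Dom = (\<lambda>(A, h, B). A),
      Cod = (\<lambda>(A, h, B). B),
      Ide = (\<lambda>A. (A, restrict id (carrier A), A)),
      Comp = (\<lambda>(B', g, C) (A, f, B). (A, compose (carrier A) g f, C))\<rparr>"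

end

theory Submission
  imports Defs
begin

text \<open>
  Pointedness and protomodularity are used only through terms: a zero, binary differences \<open>D k\<close> which
  detect equality, and a Mal'tsev operation, which gives a natural subtraction with \<open>a - 0 = a\<close> and
  \<open>a - a = 0\<close>. In the two-nilpotent objects, a ternary coproduct embeds into the product of the
  three binary ones: differences can be lifted to the ternary cosmash product of the variety by
  subtracting their components. It follows that \<open>X \<diamond> Y\<close>, the kernel of \<open>X + Y \<rightarrow> X \<times> Y\<close>, is abelian,
  that \<open>X \<diamond> (Y + Z)\<close> is generated by \<open>X \<diamond> Y\<close> and \<open>X \<diamond> Z\<close>, and more generally that \<open>X \<diamond> -\<close> maps
  jointly generating families to jointly generating families. This gives uniqueness of factorizations
  through \<open>X \<diamond> colim G\<close>.

  For existence, let \<open>d\<^sub>i : X \<diamond> G\<^sub>i \<rightarrow> A\<close> be a cocone. On the coproduct \<open>B0\<close> of the \<open>G\<^sub>i\<close> with retractions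
  \<open>\<rho>\<^sub>i\<close>, the sum of the \<open>d\<^sub>i \<circ> (X \<diamond> \<rho>\<^sub>i)\<close> is a map \<open>X \<diamond> B0 \<rightarrow> A\<close>. The reflexive relation \<open>R\<close> on \<open>B0\<close> generated by
  the arrows of the diagram is a congruence, and since \<open>X + -\<close> preserves its coequalizer \<open>B\<close>, that map
  descends to \<open>X \<diamond> B \<rightarrow> A\<close>. Now compose with the canonical map from the colimit to \<open>B\<close>.
\<close>

text \<open>The universe is the fixed type \<open>'u\<close>, and no construction may leave it:
  terms are coded in \<open>'u\<close>, quotients consist of representatives, and closure of a class
  is phrased by separating homomorphisms instead of products over large families. The bound on
  \<open>Arr J\<close> serves the coproduct \<open>B0\<close> of a diagram. Everything is set up for
  a class \<open>P\<close> of algebras because it is needed twice, for the variety and for its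
  two-nilpotent part, where the tensor product lives. The obstacle to existence is that the cocone
  \<open>d\<close> is given on \<open>X \<diamond> G\<^sub>i\<close> only and need not extend to
  \<open>X + G\<^sub>i\<close>, so no universal property of a coproduct yields the map on
  \<open>X \<diamond> B0\<close>. Its replacement, a sum of homomorphisms, is a homomorphism because
  the target is abelian, and it is finite at each element because a word mentions finitely many
  \<open>G\<^sub>i\<close>. To descend along \<open>B0 \<rightarrow> B\<close> one must know which
  pairs of \<open>X + B0\<close> become equal in \<open>X + B\<close>. Since a Mal'tsev operation
  turns reflexive relations into congruences, these pairs are just the image of
  \<open>X + R\<close>.\<close>

section \<open>Homomorphisms, subalgebras and quotients\<close>

text \<open>Homomorphisms as plain functions: in contrast to \<^const>\<open>alg_homs\<close> there is no condition
  on the values outside the carrier.\<close>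

definition hm :: "('f \<Rightarrow> nat) \<Rightarrow> ('f, 'a) alg \<Rightarrow> ('f, 'b) alg \<Rightarrow> ('a \<Rightarrow> 'b) \<Rightarrow> bool" where
  "hm ar A B h \<longleftrightarrow> (\<forall>x\<in>carrier A. h x \<in> carrier B) \<and>
     (\<forall>f xs. set xs \<subseteq> carrier A \<and> length xs = ar f \<longrightarrow> h (oper A f xs) = oper B f (map h xs))"

lemma hm_in: "hm ar A B h \<Longrightarrow> x \<in> carrier A \<Longrightarrow> h x \<in> carrier B"
  by (simp add: hm_def)

lemma hm_op: "hm ar A B h \<Longrightarrow> set xs \<subseteq> carrier A \<Longrightarrow> length xs = ar f \<Longrightarrow>
    h (oper A f xs) = oper B f (map h xs)"
  by (simp add: hm_def)

lemma hmI:
  assumes "\<And>x. x \<in> carrier A \<Longrightarrow> h x \<in> carrier B"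
    and "\<And>f xs. set xs \<subseteq> carrier A \<Longrightarrow> length xs = ar f \<Longrightarrow> h (oper A f xs) = oper B f (map h xs)"
  shows "hm ar A B h"
  using assms by (simp add: hm_def)

lemma alg_op: "is_alg ar A \<Longrightarrow> set xs \<subseteq> carrier A \<Longrightarrow> length xs = ar f \<Longrightarrow> oper A f xs \<in> carrier A"
  by (simp add: is_alg_def)

lemma hm_id [simp]: "hm ar A A (\<lambda>x. x)"
  by (simp add: hm_def)

lemma hm_comp: "hm ar A B f \<Longrightarrow> hm ar B C g \<Longrightarrow> hm ar A C (\<lambda>x. g (f x))"
proof (rule hmI)
  fix fo xs assume f: "hm ar A B f" and g: "hm ar B C g" and *: "set xs \<subseteq> carrier A" "length xs = ar fo"
  have "set (map f xs) \<subseteq> carrier B" using * f by (auto simp: hm_in)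
  then show "g (f (oper A fo xs)) = oper C fo (map (\<lambda>x. g (f x)) xs)"
    using hm_op[OF f *] hm_op[OF g, of "map f xs" fo] * by (simp add: comp_def)
qed (auto simp: hm_in)

lemma hm_cong:
  assumes "hm ar A B h" "is_alg ar A" "\<And>x. x \<in> carrier A \<Longrightarrow> h x = h' x"
  shows "hm ar A B h'"
proof (rule hmI)
  show "h' x \<in> carrier B" if "x \<in> carrier A" for x
    using that assms by (metis hm_in)
next
  fix f xs assume *: "set xs \<subseteq> carrier A" "length xs = ar f"
  then have "map h xs = map h' xs" using assms(3) by auto
  then show "h' (oper A f xs) = oper B f (map h' xs)"
    using assms(3)[OF alg_op[OF assms(2) *]] hm_op[OF assms(1) *] by metis
qed

inductive_set gen :: "('f \<Rightarrow> nat) \<Rightarrow> ('f, 'a) alg \<Rightarrow> 'a set \<Rightarrow> 'a set"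
  for ar A S where
  base: "x \<in> S \<Longrightarrow> x \<in> gen ar A S"
| op: "(\<And>x. x \<in> set xs \<Longrightarrow> x \<in> gen ar A S) \<Longrightarrow> length xs = ar f \<Longrightarrow> oper A f xs \<in> gen ar A S"

definition closed :: "('f \<Rightarrow> nat) \<Rightarrow> ('f, 'a) alg \<Rightarrow> 'a set \<Rightarrow> bool" where
  "closed ar A T \<longleftrightarrow> T \<subseteq> carrier A \<and>
     (\<forall>f xs. set xs \<subseteq> T \<and> length xs = ar f \<longrightarrow> oper A f xs \<in> T)"

lemma closedI:
  assumes "T \<subseteq> carrier A"
    and "\<And>f xs. set xs \<subseteq> T \<Longrightarrow> length xs = ar f \<Longrightarrow> oper A f xs \<in> T"
  shows "closed ar A T"
  using assms by (simp add: closed_def)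

lemma gen_least:
  assumes "closed ar A T" "S \<subseteq> T" shows "gen ar A S \<subseteq> T"
proof
  fix x assume "x \<in> gen ar A S"
  then show "x \<in> T"
    by induct (use assms in \<open>auto simp: closed_def subset_iff\<close>)
qed

lemma gen_closed: assumes "is_alg ar A" "S \<subseteq> carrier A" shows "closed ar A (gen ar A S)"
proof (rule closedI)
  have "closed ar A (carrier A)" using assms(1) by (simp add: closed_def is_alg_def)
  then show "gen ar A S \<subseteq> carrier A" using gen_least assms(2) by blast
qed (auto intro: gen.op)

lemma gen_mono: "S \<subseteq> T \<Longrightarrow> gen ar A S \<subseteq> gen ar A T"
proof
  fix x assume "S \<subseteq> T" "x \<in> gen ar A S"
  from this(2) show "x \<in> gen ar A T" by induct (use \<open>S \<subseteq> T\<close> in \<open>auto intro: gen.intros\<close>)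
qed

text \<open>The elements on which two homomorphisms agree form a subalgebra. This gives the
  uniqueness half of the universal properties below.\<close>

lemma hm_agree_gen:
  assumes "is_alg ar A" "S \<subseteq> carrier A" "hm ar A B f" "hm ar A B g" "\<And>x. x \<in> S \<Longrightarrow> f x = g x"
    and "x \<in> gen ar A S"
  shows "f x = g x"
proof -
  have "closed ar A {x \<in> carrier A. f x = g x}"
  proof (rule closedI)
    fix fo xs assume *: "set xs \<subseteq> {x \<in> carrier A. f x = g x}" "length xs = ar fo"
    then have "map f xs = map g xs" "set xs \<subseteq> carrier A" by auto
    then show "oper A fo xs \<in> {x \<in> carrier A. f x = g x}"
      using alg_op[OF assms(1) _ *(2)] hm_op[OF assms(3) _ *(2)] hm_op[OF assms(4) _ *(2)]
      by (simp del: map_eq_conv)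
  qed auto
  from gen_least[OF this, of S] assms show ?thesis by auto
qed

lemma hm_gen:
  assumes "is_alg ar A" "S \<subseteq> carrier A" "hm ar A B f" "x \<in> gen ar A S"
  shows "f x \<in> gen ar B (f ` S)"
proof -
  have "closed ar A {x \<in> carrier A. f x \<in> gen ar B (f ` S)}"
    by (rule closedI) (use assms in \<open>auto intro!: alg_op gen.op simp: hm_op subset_iff\<close>)
  from gen_least[OF this, of S] assms show ?thesis by (auto intro: gen.base)
qed

abbreviation sub_alg :: "('f, 'a) alg \<Rightarrow> 'a set \<Rightarrow> ('f, 'a) alg" where
  "sub_alg A T \<equiv> A\<lparr>carrier := T\<rparr>"

lemma sub_is_alg: "closed ar A T \<Longrightarrow> is_alg ar (sub_alg A T)"
  by (simp add: closed_def is_alg_def)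

lemma sub_hm: "closed ar A T \<Longrightarrow> hm ar (sub_alg A T) A (\<lambda>x. x)"
  by (auto simp: closed_def hm_def)

lemma hm_into_sub: "hm ar B A h \<Longrightarrow> (\<And>x. x \<in> carrier B \<Longrightarrow> h x \<in> T) \<Longrightarrow> hm ar B (sub_alg A T) h"
  by (simp add: hm_def)

lemma hm_sub: "hm ar A B h \<Longrightarrow> closed ar A T \<Longrightarrow> hm ar (sub_alg A T) B h"
  by (auto simp: hm_def closed_def)

text \<open>For the relation \<open>R\<close>, which is a generated subalgebra and must be known to
  be generated as an algebra in its own right.\<close>

lemma gen_sub:
  assumes "is_alg ar A" "S \<subseteq> carrier A"
  shows "gen ar (sub_alg A (gen ar A S)) S = gen ar A S"
proof
  show "gen ar (sub_alg A (gen ar A S)) S \<subseteq> gen ar A S"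
  proof
    fix x assume "x \<in> gen ar (sub_alg A (gen ar A S)) S"
    then show "x \<in> gen ar A S" by induct (auto intro: gen.intros)
  qed
  show "gen ar A S \<subseteq> gen ar (sub_alg A (gen ar A S)) S"
  proof
    fix x assume "x \<in> gen ar A S"
    then show "x \<in> gen ar (sub_alg A (gen ar A S)) S"
    proof induct
      case (op xs f)
      then have "oper (sub_alg A (gen ar A S)) f xs \<in> gen ar (sub_alg A (gen ar A S)) S"
        by (intro gen.op) auto
      then show ?case by simp
    qed (auto intro: gen.intros)
  qed
qed

lemma list_preimage:
  assumes "set xs \<subseteq> h ` A" obtains ys where "set ys \<subseteq> A" "xs = map h ys"
proof
  show "set (map (inv_into A h) xs) \<subseteq> A" using assms by (auto intro!: inv_into_into)
  show "xs = map h (map (inv_into A h) xs)"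
    using assms by (simp add: comp_def f_inv_into_f subset_iff map_idI)
qed

lemma hm_range_closed:
  assumes "is_alg ar A" "hm ar A B h" "is_alg ar B" shows "closed ar B (h ` carrier A)"
proof (rule closedI)
  fix f xs assume *: "set xs \<subseteq> h ` carrier A" "length xs = ar f"
  then obtain ys where ys: "set ys \<subseteq> carrier A" "xs = map h ys"
    using list_preimage by metis
  then have "oper B f xs = h (oper A f ys)" using hm_op[OF assms(2) ys(1)] * by simp
  then show "oper B f xs \<in> h ` carrier A" using alg_op[OF assms(1) ys(1)] * ys by auto
qed (use assms in \<open>auto simp: hm_in\<close>)

lemma hm_surj_gen:
  assumes "is_alg ar A" "hm ar A B h" "is_alg ar B" "carrier B = gen ar B S" "S \<subseteq> h ` carrier A"
  shows "h ` carrier A = carrier B"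
  using gen_least[OF hm_range_closed[OF assms(1-3)] assms(5)] assms(2,4) by (auto simp: hm_in)

lemma hm_factor:
  assumes \<pi>: "hm ar A Q \<pi>" "\<pi> ` carrier A = carrier Q" and A: "is_alg ar A"
    and g: "hm ar A B g"
    and ker: "\<And>x y. x \<in> carrier A \<Longrightarrow> y \<in> carrier A \<Longrightarrow> \<pi> x = \<pi> y \<Longrightarrow> g x = g y"
  shows "\<exists>h. hm ar Q B h \<and> (\<forall>x\<in>carrier A. h (\<pi> x) = g x)"
proof -
  \<comment> \<open>Only a set-theoretic section of \<open>\<pi>\<close>; by \<open>ker\<close> the
    composite \<open>g \<circ> s\<close> does not depend on its choice, which is why it respects the
    operations.\<close>
  define s where "s = inv_into (carrier A) \<pi>"
  have s: "s q \<in> carrier A" "\<pi> (s q) = q" if "q \<in> carrier Q" for q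
    using that \<pi>(2) by (auto simp: s_def inv_into_into f_inv_into_f)
  define h where "h = (\<lambda>q. g (s q))"
  have h: "h (\<pi> x) = g x" if "x \<in> carrier A" for x
    unfolding h_def using that s[of "\<pi> x"] \<pi> by (auto intro: ker simp: hm_in)
  have "hm ar Q B h"
  proof (rule hmI)
    fix f xs assume *: "set xs \<subseteq> carrier Q" "length xs = ar f"
    define ys where "ys = map s xs"
    have ys: "set ys \<subseteq> carrier A" "xs = map \<pi> ys" "map h xs = map g ys" "length ys = ar f"
      using * s by (auto simp: ys_def map_idI subset_iff h_def)
    show "h (oper Q f xs) = oper B f (map h xs)"
      using hm_op[OF \<pi>(1) ys(1,4)] h[of "oper A f ys"] hm_op[OF g ys(1,4)] alg_op[OF A ys(1,4)] ys(2,3)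
      by metis
  qed (use s g in \<open>auto simp: h_def hm_in\<close>)
  with h show ?thesis by blast
qed

section \<open>Terms and equations under homomorphisms\<close>

lemma tm_val_in:
  assumes "is_alg ar A" "wf_tm ar t" "range v \<subseteq> carrier A"
  shows "tm_val A v t \<in> carrier A"
  using assms(2) by (induct t) (use assms in \<open>auto intro!: alg_op simp: subset_iff\<close>)

lemma tm_val_hm:
  assumes "is_alg ar A" "hm ar A B h" "wf_tm ar t" "range v \<subseteq> carrier A"
  shows "h (tm_val A v t) = tm_val B (\<lambda>n. h (v n)) t"
  using assms(3)
proof (induct t)
  case (Op f ts)
  then have "set (map (tm_val A v) ts) \<subseteq> carrier A" using assms by (auto intro: tm_val_in)
  from hm_op[OF assms(2) this, of f] Op show ?case by (auto cong: map_cong)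
qed auto

definition wfE :: "('f \<Rightarrow> nat) \<Rightarrow> ('f tm \<times> 'f tm) set \<Rightarrow> bool" where
  "wfE ar E \<longleftrightarrow> (\<forall>(s, t)\<in>E. wf_tm ar s \<and> wf_tm ar t)"

text \<open>An equation failing in \<open>A\<close> would fail in \<open>M\<close>, because some
  \<open>h\<close> separates the two values. In this form, closure under subdirect products involves
  no product of all the \<open>M\<close>, which might not fit into the universe.\<close>

lemma models_sep:
  assumes E: "wfE ar E" and A: "is_alg ar A"
    and sep: "\<And>x y. x \<in> carrier A \<Longrightarrow> y \<in> carrier A \<Longrightarrow> x \<noteq> y \<Longrightarrow>
      \<exists>(M :: ('f, 'b) alg) h. models M E \<and> hm ar A M h \<and> h x \<noteq> h y"
  shows "models A E"
proof -
  have "tm_val A v s = tm_val A v t" if st: "(s, t) \<in> E" and v: "range v \<subseteq> carrier A" for s t v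
  proof (rule ccontr)
    assume ne: "\<not> ?thesis"
    have wf: "wf_tm ar s" "wf_tm ar t" using E st by (auto simp: wfE_def)
    obtain M :: "('f, 'b) alg" and h where M: "models M E" "hm ar A M h" "h (tm_val A v s) \<noteq> h (tm_val A v t)"
      using sep[OF tm_val_in[OF A wf(1) v] tm_val_in[OF A wf(2) v] ne] by blast
    have "range (\<lambda>n. h (v n)) \<subseteq> carrier M" using v M(2) by (auto simp: hm_in)
    then have "tm_val M (\<lambda>n. h (v n)) s = tm_val M (\<lambda>n. h (v n)) t"
      using M(1) st by (auto simp: models_def)
    then show False using M(3) tm_val_hm[OF A M(2) _ v] wf by simp
  qed
  then show ?thesis by (auto simp: models_def)
qed

text \<open>A valuation in \<open>B\<close> lifts pointwise along the surjection to one in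
  \<open>A\<close>, where the equation holds.\<close>

lemma models_surj:
  assumes E: "wfE ar E" and A: "is_alg ar A" "models A E" and h: "hm ar A B h" "h ` carrier A = carrier B"
  shows "models B E"
proof -
  have "tm_val B v s = tm_val B v t" if st: "(s, t) \<in> E" and v: "range v \<subseteq> carrier B" for s t v
  proof -
    have wf: "wf_tm ar s" "wf_tm ar t" using E st by (auto simp: wfE_def)
    have "\<forall>n. \<exists>a\<in>carrier A. h a = v n" using v h(2) by (metis imageE range_subsetD)
    then obtain w where w: "\<And>n. w n \<in> carrier A" "\<And>n. h (w n) = v n" by metis
    have "tm_val A w s = tm_val A w t" using A(2) st w(1) by (auto simp: models_def image_subset_iff)
    moreover have "range w \<subseteq> carrier A" using w by auto
    ultimately show ?thesis
      using tm_val_hm[OF A(1) h(1) wf(1), of w] tm_val_hm[OF A(1) h(1) wf(2), of w] w(2) by simp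
  qed
  then show ?thesis by (auto simp: models_def)
qed

text \<open>The target type is arbitrary: quotients arise from non-injective \<open>\<rho>\<close>, while an injective \<open>\<rho>\<close>
  transports an algebra to another type.\<close>

definition img_alg :: "('a \<Rightarrow> 'b) \<Rightarrow> ('f, 'a) alg \<Rightarrow> ('f, 'b) alg" where
  "img_alg \<rho> A = \<lparr>carrier = \<rho> ` carrier A,
     oper = \<lambda>f xs. \<rho> (oper A f (map (inv_into (carrier A) \<rho>) xs))\<rparr>"

lemma img_alg:
  assumes A: "is_alg ar A"
    and c: "\<And>f xs ys. set xs \<subseteq> carrier A \<Longrightarrow> set ys \<subseteq> carrier A \<Longrightarrow> length xs = ar f \<Longrightarrow>
      map \<rho> xs = map \<rho> ys \<Longrightarrow> \<rho> (oper A f xs) = \<rho> (oper A f ys)"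
  shows "is_alg ar (img_alg \<rho> A)" "hm ar A (img_alg \<rho> A) \<rho>" "\<rho> ` carrier A = carrier (img_alg \<rho> A)"
proof -
  show "is_alg ar (img_alg \<rho> A)"
    unfolding is_alg_def
  proof (intro allI impI, elim conjE)
    fix f xs assume *: "set xs \<subseteq> carrier (img_alg \<rho> A)" "length xs = ar f"
    have "set (map (inv_into (carrier A) \<rho>) xs) \<subseteq> carrier A"
      using *(1) by (auto simp: img_alg_def intro!: inv_into_into)
    from alg_op[OF A this, of f] * show "oper (img_alg \<rho> A) f xs \<in> carrier (img_alg \<rho> A)"
      by (simp add: img_alg_def)
  qed
  show "hm ar A (img_alg \<rho> A) \<rho>"
  proof (rule hmI)
    fix f xs assume *: "set xs \<subseteq> carrier A" "length xs = ar f"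
    have "\<rho> (oper A f xs) = \<rho> (oper A f (map (inv_into (carrier A) \<rho>) (map \<rho> xs)))"
      by (rule c[OF *(1) _ *(2)])
        (use *(1) in \<open>auto simp: comp_def f_inv_into_f subset_iff intro!: inv_into_into\<close>)
    then show "\<rho> (oper A f xs) = oper (img_alg \<rho> A) f (map \<rho> xs)"
      by (simp add: img_alg_def)
  qed (simp add: img_alg_def)
  show "\<rho> ` carrier A = carrier (img_alg \<rho> A)" by (simp add: img_alg_def)
qed

section \<open>Terms over an arbitrary set of generators\<close>

text \<open>The variables of \<open>tm\<close> are natural numbers; free algebras on generating sets
  as large as the universe call for variables from an arbitrary type.\<close>

datatype ('f, gvars: 'g) gt = GV 'g | GO 'f "('f, 'g) gt list"

fun gwf :: "('f \<Rightarrow> nat) \<Rightarrow> ('f, 'g) gt \<Rightarrow> bool" where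
  "gwf ar (GV g) = True"
| "gwf ar (GO f ts) = (length ts = ar f \<and> (\<forall>t\<in>set ts. gwf ar t))"

fun gval :: "('f, 'u) alg \<Rightarrow> ('g \<Rightarrow> 'u) \<Rightarrow> ('f, 'g) gt \<Rightarrow> 'u" where
  "gval A v (GV g) = v g"
| "gval A v (GO f ts) = oper A f (map (gval A v) ts)"

lemma gval_in:
  assumes "is_alg ar A" "gwf ar t" "\<And>g. g \<in> gvars t \<Longrightarrow> v g \<in> carrier A"
  shows "gval A v t \<in> carrier A"
  using assms(2,3)
proof (induct t)
  case (GO f ts)
  then have "set (map (gval A v) ts) \<subseteq> carrier A" by auto
  from alg_op[OF assms(1) this, of f] GO.prems show ?case by simp
qed auto

lemma gval_hm:
  assumes "is_alg ar A" "hm ar A B h" "gwf ar t" "\<And>g. g \<in> gvars t \<Longrightarrow> v g \<in> carrier A"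
  shows "h (gval A v t) = gval B (\<lambda>g. h (v g)) t"
  using assms(3,4)
proof (induct t)
  case (GO f ts)
  then have "set (map (gval A v) ts) \<subseteq> carrier A"
    using assms(1) by (auto intro!: gval_in)
  moreover have "map (\<lambda>x. h (gval A v x)) ts = map (gval B (\<lambda>g. h (v g))) ts"
    using GO by auto
  ultimately show ?case using hm_op[OF assms(2), of "map (gval A v) ts" f] GO.prems
    by (simp add: comp_def del: map_eq_conv)
qed auto

lemma gval_cong: "(\<And>g. g \<in> gvars t \<Longrightarrow> v g = w g) \<Longrightarrow> gval A v t = gval A w t"
proof (induct t)
  case (GO f ts)
  then have "map (gval A v) ts = map (gval A w) ts" by auto
  then show ?case by (simp del: map_eq_conv)
qed auto

lemma gen_gval:
  assumes "x \<in> gen ar A S"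
  shows "\<exists>t. gwf ar t \<and> gvars t \<subseteq> S \<and> gval A (\<lambda>g. g) t = x"
  using assms
proof induct
  case (base x)
  then show ?case by (intro exI[of _ "GV x"]) simp
next
  case (op xs f)
  then have "\<forall>x. x \<in> set xs \<longrightarrow> (\<exists>t. gwf ar t \<and> gvars t \<subseteq> S \<and> gval A (\<lambda>g. g) t = x)" by blast
  then obtain T where "\<And>x. x \<in> set xs \<Longrightarrow> gwf ar (T x) \<and> gvars (T x) \<subseteq> S \<and> gval A (\<lambda>g. g) (T x) = x"
    by metis
  then show ?case using op.hyps
    by (intro exI[of _ "GO f (map T xs)"]) (auto simp: comp_def map_idI)
qed

definition term_alg :: "('f \<Rightarrow> nat) \<Rightarrow> ('f, ('f, 'g) gt) alg" where
  "term_alg ar = \<lparr>carrier = {t. gwf ar t}, oper = GO\<rparr>"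

lemma term_is_alg: "is_alg ar (term_alg ar)"
  by (auto simp: is_alg_def term_alg_def)

lemma gval_term_hm: "is_alg ar A \<Longrightarrow> range v \<subseteq> carrier A \<Longrightarrow> hm ar (term_alg ar) A (gval A v)"
  by (auto simp: hm_def term_alg_def intro: gval_in)

lemma term_gen: "gwf ar t \<Longrightarrow> t \<in> gen ar (term_alg ar) (range GV)"
proof (induct t)
  case (GO f ts)
  then have "oper (term_alg ar) f ts \<in> gen ar (term_alg ar) (range GV)"
    by (intro gen.op) auto
  then show ?case by (simp add: term_alg_def)
qed (auto intro: gen.base)

lemma pair_encoding:
  assumes "infinite (UNIV :: 'u set)"
  obtains pr :: "'u \<times> 'u \<Rightarrow> 'u" where "inj pr"
proof -
  obtain f :: "'u \<times> 'u \<Rightarrow> 'u" where "bij_betw f (UNIV \<times> UNIV) UNIV"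
    using card_of_Times_same_infinite[OF assms] card_of_ordIso by blast
  then show thesis using that[of f] by (simp add: bij_betw_def)
qed

text \<open>Here the size hypotheses on the universe are spent. An injective pairing codes lists and
  trees, with the tags \<open>a\<close> and \<open>b\<close> separating nil from cons and generators
  from operations.\<close>

lemma term_encoding:
  assumes inf: "infinite (UNIV :: 'u set)" and F: "(UNIV :: 'f set) \<lesssim> (UNIV :: 'u set)"
    and G: "(UNIV :: 'g set) \<lesssim> (UNIV :: 'u set)"
  obtains enc :: "('f, 'g) gt \<Rightarrow> 'u" where "inj enc"
proof -
  obtain pr :: "'u \<times> 'u \<Rightarrow> 'u" where pr: "inj pr" using pair_encoding[OF inf] .
  obtain jf :: "'f \<Rightarrow> 'u" where jf: "inj jf" using F by (auto simp: lepoll_def)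
  obtain jg :: "'g \<Rightarrow> 'u" where jg: "inj jg" using G by (auto simp: lepoll_def)
  obtain a b :: 'u where ab: "a \<noteq> b"
    using inf by (metis UNIV_I finite.emptyI finite.insertI finite_subset insertI1 subsetI)
  define le where "le = rec_list (pr (a, a)) (\<lambda>x _ r. pr (b, pr (x, r)))"
  have le: "le [] = pr (a, a)" "\<And>x xs. le (x # xs) = pr (b, pr (x, le xs))" by (simp_all add: le_def)
  have prI: "pr p = pr q \<longleftrightarrow> p = q" for p q using pr by (simp add: inj_eq)
  have leI: "le xs = le ys \<longleftrightarrow> xs = ys" for xs ys
  proof (induct xs arbitrary: ys)
    case Nil then show ?case using ab by (cases ys) (auto simp: le prI)
  next
    case (Cons x xs) then show ?case using ab by (cases ys) (auto simp: le prI)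
  qed
  \<comment> \<open>In this nested recursion \<open>rec_gt\<close> hands over the arguments as pairs
    of a subterm and its code, whence \<open>map snd\<close>.\<close>
  define enc where "enc = rec_gt (\<lambda>g. pr (a, jg g)) (\<lambda>f ts. pr (b, pr (jf f, le (map snd ts))))"
  have enc: "enc (GV g) = pr (a, jg g)" "enc (GO f ts) = pr (b, pr (jf f, le (map enc ts)))" for g f ts
    by (simp_all add: enc_def comp_def)
  have "enc s = enc t \<longrightarrow> s = t" for s t
  proof (induct s arbitrary: t)
    case (GV x) then show ?case using ab jg by (cases t) (auto simp: enc prI inj_eq)
  next
    case (GO f ts)
    show ?case
    proof (cases t)
      case (GO f' ts')
      have "map enc ts = map enc ts' \<longrightarrow> ts = ts'"
        using GO.hyps list.inj_map_strong[of ts ts' enc enc] by blast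
      then show ?thesis using GO jf by (auto simp: enc prI leI inj_eq)
    qed (use ab in \<open>auto simp: enc prI\<close>)
  qed
  then show thesis using that[of enc] by (auto simp: inj_def)
qed

section \<open>Classes of algebras closed under subdirect products\<close>

definition vob :: "('f \<Rightarrow> nat) \<Rightarrow> ('f tm \<times> 'f tm) set \<Rightarrow> ('f, 'u) alg \<Rightarrow> bool" where
  "vob ar E A \<longleftrightarrow> is_alg ar A \<and> models A E"

text \<open>\<open>sepP\<close> is closure under subdirect products, put in terms of separating
  homomorphisms so that no product over a large family is formed. The locale is used with
  \<open>P\<close> constantly true for the variety itself and with \<open>nilp\<close> for the
  two-nilpotent algebras.\<close>

locale alg_class =
  fixes ar :: "'f \<Rightarrow> nat" and E :: "('f tm \<times> 'f tm) set" and P :: "('f, 'u) alg \<Rightarrow> bool"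
  assumes inf: "infinite (UNIV :: 'u set)"
    and card: "(UNIV :: 'f set) \<lesssim> (UNIV :: 'u set)"
    and wfE: "wfE ar E"
    and sepP: "\<And>A. vob ar E A \<Longrightarrow>
      (\<And>x y. x \<in> carrier A \<Longrightarrow> y \<in> carrier A \<Longrightarrow> x \<noteq> y \<Longrightarrow>
        \<exists>M h. vob ar E M \<and> P M \<and> hm ar A M h \<and> h x \<noteq> h y) \<Longrightarrow> P A"
begin

abbreviation ob :: "('f, 'u) alg \<Rightarrow> bool" where "ob A \<equiv> vob ar E A \<and> P A"

abbreviation H :: "('f, 'u) alg \<Rightarrow> ('f, 'u) alg \<Rightarrow> ('u \<Rightarrow> 'u) \<Rightarrow> bool" where "H \<equiv> hm ar"

lemma vob_alg [simp]: "vob ar E A \<Longrightarrow> is_alg ar A"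
  by (simp add: vob_def)

lemma ob_sep:
  assumes "is_alg ar A"
    and "\<And>x y. x \<in> carrier A \<Longrightarrow> y \<in> carrier A \<Longrightarrow> x \<noteq> y \<Longrightarrow> \<exists>M h. ob M \<and> H A M h \<and> h x \<noteq> h y"
  shows "ob A"
proof -
  have "models A E"
    by (rule models_sep[OF wfE assms(1)]) (use assms(2) in \<open>unfold vob_def, blast\<close>)
  then have "vob ar E A" using assms(1) by (simp add: vob_def)
  then show ?thesis using sepP[of A] assms(2) by blast
qed

lemma vob_sep:
  assumes "is_alg ar A"
    and "\<And>x y. x \<in> carrier A \<Longrightarrow> y \<in> carrier A \<Longrightarrow> x \<noteq> y \<Longrightarrow>
      \<exists>M h. vob ar E M \<and> H A M h \<and> h x \<noteq> h y"
  shows "vob ar E A"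
proof -
  have "models A E"
    by (rule models_sep[OF wfE assms(1)]) (use assms(2) in \<open>unfold vob_def, blast\<close>)
  then show ?thesis using assms(1) by (simp add: vob_def)
qed

lemma vob_surj: "vob ar E A \<Longrightarrow> hm ar A B h \<Longrightarrow> h ` carrier A = carrier B \<Longrightarrow> is_alg ar B \<Longrightarrow> vob ar E B"
  unfolding vob_def using models_surj[OF wfE] by blast

lemma ob_sub: assumes "ob A" "closed ar A T" shows "ob (sub_alg A T)"
  by (rule ob_sep[OF sub_is_alg[OF assms(2)]]) (use assms sub_hm[OF assms(2)] in blast)

lemma vob_sub: fixes A :: "('f, 'u) alg" assumes "vob ar E A" "closed ar A T" shows "vob ar E (sub_alg A T)"
  by (rule vob_sep[OF sub_is_alg[OF assms(2)]]) (use assms sub_hm[OF assms(2)] in blast)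

text \<open>Terms modulo the identities that hold under every valuation in \<open>K\<close>. With
  \<open>K\<close> all valuations this is a free algebra; with \<open>K\<close> the valuations that
  are homomorphic on each summand it is a coproduct. Since \<open>K\<close> separates the points of
  \<open>F\<close>, the class contains \<open>F\<close>.\<close>

lemma free_ex:
  fixes K :: "(('f, 'u) alg \<times> ('g \<Rightarrow> 'u)) set"
  assumes G: "(UNIV :: 'g set) \<lesssim> (UNIV :: 'u set)"
    and K: "\<And>M v. (M, v) \<in> K \<Longrightarrow> ob M \<and> range v \<subseteq> carrier M"
  obtains F \<eta> where "ob F" "range \<eta> \<subseteq> carrier F" "carrier F = gen ar F (range \<eta>)"
    "\<And>M v. (M, v) \<in> K \<Longrightarrow> \<exists>h. H F M h \<and> (\<forall>g. h (\<eta> g) = v g)"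
    "\<And>x y. x \<in> carrier F \<Longrightarrow> y \<in> carrier F \<Longrightarrow> x \<noteq> y \<Longrightarrow>
       \<exists>M v h. (M, v) \<in> K \<and> H F M h \<and> (\<forall>g. h (\<eta> g) = v g) \<and> h x \<noteq> h y"
proof -
  obtain enc :: "('f, 'g) gt \<Rightarrow> 'u" where enc: "inj enc" using term_encoding[OF inf card G] .
  let ?T = "term_alg ar :: ('f, ('f, 'g) gt) alg"
  define eq where "eq = (\<lambda>t t' :: ('f, 'g) gt. \<forall>M v. (M, v) \<in> K \<longrightarrow> gval M v t' = gval M v t)"
  \<comment> \<open>\<open>eq t\<close> determines the class of \<open>t\<close> as a predicate, so
    \<open>r\<close> picks the same representative throughout a class; the codes of the
    representatives form a carrier inside \<open>'u\<close>.\<close>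
  define r where "r = (\<lambda>t. SOME t'. gwf ar t' \<and> eq t t')"
  define \<rho> where "\<rho> = (\<lambda>t. enc (r t))"
  have r: "gwf ar (r t) \<and> eq t (r t)" if "gwf ar t" for t
    unfolding r_def by (rule someI[of _ t]) (simp add: that eq_def)
  have r1: "r t = r t'" if "eq t t'" for t t'
  proof -
    have "eq t = eq t'" using that by (auto simp: eq_def fun_eq_iff)
    then show ?thesis by (simp add: r_def)
  qed
  have \<rho>: "\<rho> t = \<rho> t' \<longleftrightarrow> eq t t'" if "gwf ar t" "gwf ar t'" for t t'
  proof
    assume "\<rho> t = \<rho> t'"
    then have "r t = r t'" using enc by (simp add: \<rho>_def inj_eq)
    then show "eq t t'" using r[OF that(1)] r[OF that(2)] unfolding eq_def by metis
  qed (simp add: \<rho>_def r1)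
  define F where "F = img_alg \<rho> ?T"
  have c: "\<rho> (oper ?T f xs) = \<rho> (oper ?T f ys)"
    if "set xs \<subseteq> carrier ?T" "set ys \<subseteq> carrier ?T" "length xs = ar f" "map \<rho> xs = map \<rho> ys" for f xs ys
  proof -
    have len: "length ys = length xs" using that(4) map_eq_imp_length_eq by metis
    have "eq (xs ! i) (ys ! i)" if i: "i < length xs" for i
    proof -
      have "\<rho> (xs ! i) = \<rho> (ys ! i)" using i len that \<open>map \<rho> xs = map \<rho> ys\<close> by (metis nth_map)
      moreover have "gwf ar (xs ! i)" "gwf ar (ys ! i)"
        using i len \<open>set xs \<subseteq> _\<close> \<open>set ys \<subseteq> _\<close> nth_mem[of i xs] nth_mem[of i ys] by (auto simp: term_alg_def subset_iff)
      ultimately show ?thesis using \<rho> by blast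
    qed
    then have "map (gval M v) xs = map (gval M v) ys" if "(M, v) \<in> K" for M v
      using that len by (intro nth_equalityI) (auto simp: eq_def)
    then have "eq (GO f xs) (GO f ys)" by (simp add: eq_def)
    moreover have "gwf ar (GO f xs)" "gwf ar (GO f ys)"
      using that len by (auto simp: term_alg_def)
    ultimately show ?thesis using \<rho> by (simp add: term_alg_def)
  qed
  have F: "is_alg ar F" "hm ar ?T F \<rho>" "\<rho> ` carrier ?T = carrier F"
    unfolding F_def using img_alg[of ar ?T \<rho>, OF term_is_alg] c by blast+
  have ext: "\<exists>h. H F M h \<and> (\<forall>t. gwf ar t \<longrightarrow> h (\<rho> t) = gval M v t)" if "(M, v) \<in> K" for M v
  proof -
    have M: "is_alg ar M" "range v \<subseteq> carrier M" using K[OF that] by auto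
    have "\<exists>h. H F M h \<and> (\<forall>t\<in>carrier ?T. h (\<rho> t) = gval M v t)"
    proof (rule hm_factor[OF F(2,3) term_is_alg gval_term_hm[OF M]])
      fix x y assume "x \<in> carrier ?T" "y \<in> carrier ?T" "\<rho> x = \<rho> y"
      then have "eq x y" using \<rho> by (simp add: term_alg_def)
      then show "gval M v x = gval M v y" using that by (auto simp: eq_def)
    qed
    then show ?thesis by (auto simp: term_alg_def)
  qed
  have sep: "\<exists>M v h. (M, v) \<in> K \<and> H F M h \<and> (\<forall>g. h (\<rho> (GV g)) = v g) \<and> h x \<noteq> h y"
    if xy: "x \<in> carrier F" "y \<in> carrier F" "x \<noteq> y" for x y
  proof -
    obtain t t' where t: "x = \<rho> t" "y = \<rho> t'" "gwf ar t" "gwf ar t'"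
      using xy(1,2)[folded F(3)] by (auto simp: term_alg_def)
    then have "\<not> eq t t'" using xy(3) \<rho> by blast
    then obtain M v where Mv: "(M, v) \<in> K" "gval M v t \<noteq> gval M v t'" by (auto simp: eq_def)
    obtain h where "H F M h" "\<And>t. gwf ar t \<Longrightarrow> h (\<rho> t) = gval M v t" using ext[OF Mv(1)] by blast
    then show ?thesis using Mv t by (intro exI[of _ M] exI[of _ v] exI[of _ h]) auto
  qed
  show thesis
  proof
    show "ob F" by (rule ob_sep[OF F(1)]) (use sep K in blast)
    show ran: "range (\<lambda>g. \<rho> (GV g)) \<subseteq> carrier F"
      by (auto simp: F(3)[symmetric] term_alg_def)
    show "carrier F = gen ar F (range (\<lambda>g. \<rho> (GV g)))"
    proof
      show "gen ar F (range (\<lambda>g. \<rho> (GV g))) \<subseteq> carrier F"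
        using gen_closed[OF F(1) ran] by (simp add: closed_def)
      show "carrier F \<subseteq> gen ar F (range (\<lambda>g. \<rho> (GV g)))"
      proof
        fix x assume "x \<in> carrier F"
        then obtain t where t: "x = \<rho> t" "gwf ar t" by (auto simp: F(3)[symmetric] term_alg_def)
        have "\<rho> t \<in> gen ar F (\<rho> ` range GV)"
          by (rule hm_gen[OF term_is_alg _ F(2) term_gen[OF t(2)]]) (auto simp: term_alg_def)
        then show "x \<in> gen ar F (range (\<lambda>g. \<rho> (GV g)))" using t by (simp add: image_image)
      qed
    qed
    show "\<exists>h. H F M h \<and> (\<forall>g. h (\<rho> (GV g)) = v g)" if Mv: "(M, v) \<in> K" for M v
    proof -
      obtain h where "H F M h" "\<And>t. gwf ar t \<Longrightarrow> h (\<rho> t) = gval M v t" using ext[OF Mv] by blast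
      then show ?thesis by (intro exI[of _ h]) simp
    qed
    show "\<exists>M v h. (M, v) \<in> K \<and> H F M h \<and> (\<forall>g. h (\<rho> (GV g)) = v g) \<and> h x \<noteq> h y"
      if "x \<in> carrier F" "y \<in> carrier F" "x \<noteq> y" for x y
      using sep[OF that] .
  qed
qed

lemma prod_ex:
  assumes A: "ob A" and B: "ob B"
  obtains Q p q where "ob Q" "H Q A p" "H Q B q"
    "\<And>a b. a \<in> carrier A \<Longrightarrow> b \<in> carrier B \<Longrightarrow> \<exists>z\<in>carrier Q. p z = a \<and> q z = b"
    "\<And>z z'. z \<in> carrier Q \<Longrightarrow> z' \<in> carrier Q \<Longrightarrow> p z = p z' \<Longrightarrow> q z = q z' \<Longrightarrow> z = z'"
proof -
  obtain pr :: "'u \<times> 'u \<Rightarrow> 'u" where pr: "inj pr" using pair_encoding[OF inf] .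
  define W where "W = \<lparr>carrier = carrier A \<times> carrier B,
    oper = \<lambda>f xs. (oper A f (map fst xs), oper B f (map snd xs))\<rparr>"
  have W: "is_alg ar W"
    unfolding is_alg_def
  proof (intro allI impI, elim conjE)
    fix f xs assume "set xs \<subseteq> carrier W" "length xs = ar f"
    then have "set (map fst xs) \<subseteq> carrier A" "set (map snd xs) \<subseteq> carrier B"
      by (auto simp: W_def)
    then show "oper W f xs \<in> carrier W"
      using A B \<open>length xs = ar f\<close> alg_op[of ar A "map fst xs" f] alg_op[of ar B "map snd xs" f]
      by (simp add: W_def)
  qed
  define Q where "Q = img_alg pr W"
  have Q: "is_alg ar Q" "hm ar W Q pr" "pr ` carrier W = carrier Q"
    unfolding Q_def by (rule img_alg[OF W]; use pr in \<open>simp add: inj_map_eq_map\<close>)+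
  have "\<exists>h. hm ar Q A h \<and> (\<forall>x\<in>carrier W. h (pr x) = fst x)"
    by (rule hm_factor[OF Q(2,3) W]) (use pr in \<open>auto simp: inj_eq W_def hm_def\<close>)
  then obtain p where p: "H Q A p" "\<And>a b. a \<in> carrier A \<Longrightarrow> b \<in> carrier B \<Longrightarrow> p (pr (a, b)) = a"
    by (force simp: W_def)
  have "\<exists>h. hm ar Q B h \<and> (\<forall>x\<in>carrier W. h (pr x) = snd x)"
    by (rule hm_factor[OF Q(2,3) W]) (use pr in \<open>auto simp: inj_eq W_def hm_def\<close>)
  then obtain q where q: "H Q B q" "\<And>a b. a \<in> carrier A \<Longrightarrow> b \<in> carrier B \<Longrightarrow> q (pr (a, b)) = b"
    by (force simp: W_def)
  have Qc: "\<exists>a\<in>carrier A. \<exists>b\<in>carrier B. z = pr (a, b)" if "z \<in> carrier Q" for z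
    using that Q(3)[symmetric] by (auto simp: W_def)
  have inj: "z = z'" if "z \<in> carrier Q" "z' \<in> carrier Q" "p z = p z'" "q z = q z'" for z z'
    using that Qc[OF that(1)] Qc[OF that(2)] p(2) q(2) by force
  show thesis
  proof
    show "ob Q" by (rule ob_sep[OF Q(1)]) (use inj p(1) q(1) A B in blast)
    show "\<exists>z\<in>carrier Q. p z = a \<and> q z = b" if "a \<in> carrier A" "b \<in> carrier B" for a b
      using that p(2) q(2) Q(3) by (intro bexI[of _ "pr (a, b)"]) (auto simp: W_def)
  qed (use p q inj in auto)
qed

lemma quot_ex:
  assumes A: "vob ar E A"
    and refl: "\<And>x. x \<in> carrier A \<Longrightarrow> rel x x"
    and sym: "\<And>x y. x \<in> carrier A \<Longrightarrow> y \<in> carrier A \<Longrightarrow> rel x y \<Longrightarrow> rel y x"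
    and trans: "\<And>x y z. x \<in> carrier A \<Longrightarrow> y \<in> carrier A \<Longrightarrow> z \<in> carrier A \<Longrightarrow> rel x y \<Longrightarrow> rel y z \<Longrightarrow> rel x z"
    and cong: "\<And>f xs ys. set xs \<subseteq> carrier A \<Longrightarrow> set ys \<subseteq> carrier A \<Longrightarrow> length xs = ar f \<Longrightarrow>
      list_all2 rel xs ys \<Longrightarrow> rel (oper A f xs) (oper A f ys)"
  obtains Q \<pi> where "vob ar E Q" "H A Q \<pi>" "\<pi> ` carrier A = carrier Q"
    "\<And>x y. x \<in> carrier A \<Longrightarrow> y \<in> carrier A \<Longrightarrow> \<pi> x = \<pi> y \<longleftrightarrow> rel x y"
proof -
  \<comment> \<open>Classes are named by one of their elements, so the quotient keeps its carrier in
    \<open>'u\<close>.\<close>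
  define \<rho> where "\<rho> = (\<lambda>x. SOME y. y \<in> carrier A \<and> rel x y)"
  have r: "\<rho> x \<in> carrier A \<and> rel x (\<rho> x)" if "x \<in> carrier A" for x
    unfolding \<rho>_def by (rule someI[of _ x]) (simp add: that refl)
  have \<rho>: "\<rho> x = \<rho> y \<longleftrightarrow> rel x y" if "x \<in> carrier A" "y \<in> carrier A" for x y
  proof
    assume "\<rho> x = \<rho> y"
    then show "rel x y" using r[OF that(1)] r[OF that(2)] that sym trans by metis
  next
    assume "rel x y"
    then have "(\<lambda>z. z \<in> carrier A \<and> rel x z) = (\<lambda>z. z \<in> carrier A \<and> rel y z)"
      using that sym trans by (metis (no_types, opaque_lifting))
    then show "\<rho> x = \<rho> y" by (simp add: \<rho>_def)
  qed
  have c: "\<rho> (oper A f xs) = \<rho> (oper A f ys)"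
    if "set xs \<subseteq> carrier A" "set ys \<subseteq> carrier A" "length xs = ar f" "map \<rho> xs = map \<rho> ys" for f xs ys
  proof -
    have len: "length ys = length xs" using that(4) map_eq_imp_length_eq by metis
    have "rel (xs ! i) (ys ! i)" if "i < length xs" for i
    proof -
      have "\<rho> (xs ! i) = \<rho> (ys ! i)" using \<open>map \<rho> xs = map \<rho> ys\<close> that len by (metis nth_map)
      then show ?thesis using \<rho> \<open>set xs \<subseteq> _\<close> \<open>set ys \<subseteq> _\<close> that len by (metis nth_mem subsetD)
    qed
    then have "list_all2 rel xs ys" using len by (simp add: list_all2_conv_all_nth)
    then have "rel (oper A f xs) (oper A f ys)" using cong that by blast
    then show ?thesis using \<rho> alg_op[of ar A] A that len by auto
  qed
  have Q: "is_alg ar (img_alg \<rho> A)" "hm ar A (img_alg \<rho> A) \<rho>" "\<rho> ` carrier A = carrier (img_alg \<rho> A)"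
    using img_alg[of ar A \<rho>, OF vob_alg[OF A]] c by blast+
  show thesis
    using that[OF vob_surj[OF A Q(2,3,1)] Q(2,3)] \<rho> by blast
qed

definition triv :: "'u \<Rightarrow> ('f, 'u) alg" where
  "triv u = \<lparr>carrier = {u}, oper = \<lambda>_ _. u\<rparr>"

lemma triv_carrier [simp]: "carrier (triv u) = {u}" by (simp add: triv_def)

lemma triv_ob: "ob (triv u)"
  by (rule ob_sep) (auto simp: triv_def is_alg_def)

lemma triv_hm: "hm ar A (triv u) (\<lambda>_. u)"
  by (simp add: triv_def hm_def)

end

section \<open>Pointed classes: the zero element and coproducts of families\<close>

text \<open>The signature need not have a constant for zero. In a pointed variety, zero is the only element of
  the unique one-element subalgebra.\<close>

definition zr :: "('f \<Rightarrow> nat) \<Rightarrow> ('f, 'u) alg \<Rightarrow> 'u" where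
  "zr ar A = (THE z. z \<in> carrier A \<and> (\<forall>f. oper A f (replicate (ar f) z) = z))"

locale pointed_class = alg_class ar E P
  for ar :: "'f \<Rightarrow> nat" and E and P :: "('f, 'u) alg \<Rightarrow> bool" +
  assumes pt: "\<And>A :: ('f, 'u) alg. vob ar E A \<Longrightarrow>
    \<exists>!z. z \<in> carrier A \<and> (\<forall>f. oper A f (replicate (ar f) z) = z)"
begin

abbreviation z :: "('f, 'u) alg \<Rightarrow> 'u" where "z \<equiv> zr ar"

lemma z_prop: assumes "vob ar E A" shows "z A \<in> carrier A \<and> (\<forall>f. oper A f (replicate (ar f) (z A)) = z A)"
  unfolding zr_def by (rule theI'[OF pt[OF assms]])

lemma z_in [simp]: "vob ar E A \<Longrightarrow> z A \<in> carrier A"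
  using z_prop by blast

lemma z_eq: "vob ar E A \<Longrightarrow> x \<in> carrier A \<Longrightarrow> (\<And>f. oper A f (replicate (ar f) x) = x) \<Longrightarrow> x = z A"
  using pt[of A] z_prop[of A] by blast

lemma z_op: assumes "vob ar E A" "set xs \<subseteq> {z A}" "length xs = ar f" shows "oper A f xs = z A"
proof -
  have "xs = replicate (ar f) (z A)" using assms(2,3) by (intro replicate_eqI) auto
  then show ?thesis using z_prop[OF assms(1)] by simp
qed

lemma z_hm: fixes A B :: "('f, 'u) alg" assumes "vob ar E A" "vob ar E B" "hm ar A B h" shows "h (z A) = z B"
proof (rule z_eq[OF assms(2)])
  show "h (z A) \<in> carrier B" using assms by (simp add: hm_in)
  fix f
  have "h (oper A f (replicate (ar f) (z A))) = oper B f (map h (replicate (ar f) (z A)))"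
    by (rule hm_op[OF assms(3)]) (use assms in auto)
  then show "oper B f (replicate (ar f) (h (z A))) = h (z A)" using z_prop[OF assms(1)] by simp
qed

lemma hm_z: assumes "vob ar E B" shows "hm ar A B (\<lambda>_. z B)"
  by (rule hmI) (use assms in \<open>auto intro!: z_op[symmetric]\<close>)

lemma closed_z: assumes "vob ar E A" "closed ar A T" shows "z A \<in> T" "z (sub_alg A T) = z A"
proof -
  have s: "vob ar E (sub_alg A T)" using vob_sub assms by blast
  show e: "z (sub_alg A T) = z A" using z_hm[OF s assms(1) sub_hm[OF assms(2)]] by simp
  show "z A \<in> T" using z_in[OF s] e by simp
qed

lemma closed_ker:
  fixes A B :: "('f, 'u) alg"
  assumes "vob ar E A" "vob ar E B" "hm ar A B h" shows "closed ar A {x \<in> carrier A. h x = z B}"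
proof (rule closedI)
  fix f xs assume *: "set xs \<subseteq> {x \<in> carrier A. h x = z B}" "length xs = ar f"
  then have "h (oper A f xs) = oper B f (map h xs)" by (intro hm_op[OF assms(3)]) auto
  also have "\<dots> = z B" by (rule z_op[OF assms(2)]) (use * in auto)
  finally show "oper A f xs \<in> {x \<in> carrier A. h x = z B}"
    using * assms alg_op[of ar A xs f] by auto
qed auto

lemma closed_agree:
  fixes A B :: "('f, 'u) alg"
  assumes "vob ar E A" "hm ar A B h" "hm ar A B h'" shows "closed ar A {x \<in> carrier A. h x = h' x}"
proof (rule closedI)
  fix f xs assume *: "set xs \<subseteq> {x \<in> carrier A. h x = h' x}" "length xs = ar f"
  then have "map h xs = map h' xs" "set xs \<subseteq> carrier A" by auto
  then show "oper A f xs \<in> {x \<in> carrier A. h x = h' x}"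
    using alg_op[of ar A xs f] hm_op[OF assms(2) _ *(2)] hm_op[OF assms(3) _ *(2)] assms(1) *(2)
    by (simp del: map_eq_conv)
qed auto

text \<open>The summands are glued by \<open>free_ex\<close>: a generator \<open>(e i, x)\<close>
  stands for the element \<open>x\<close> of summand \<open>i\<close>, where \<open>e\<close> embeds
  the index set into the universe. The bound on \<open>I\<close> is what provides
  \<open>e\<close>.\<close>

lemma cop_ex:
  fixes I :: "'k set"
  assumes I: "I \<lesssim> (UNIV :: 'u set)" and G: "\<And>i. i \<in> I \<Longrightarrow> ob (G i)"
  obtains S \<iota> where "ob S" "\<And>i. i \<in> I \<Longrightarrow> H (G i) S (\<iota> i)"
    "carrier S = gen ar S (\<Union>i\<in>I. \<iota> i ` carrier (G i))"
    "\<And>M f. ob M \<Longrightarrow> (\<And>i. i \<in> I \<Longrightarrow> H (G i) M (f i)) \<Longrightarrow>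
       \<exists>h. H S M h \<and> (\<forall>i\<in>I. \<forall>x\<in>carrier (G i). h (\<iota> i x) = f i x)"
proof -
  obtain e :: "'k \<Rightarrow> 'u" where e: "inj_on e I" using I by (auto simp: lepoll_def)
  define \<Gamma> where "\<Gamma> = {(e i, x) |i x. i \<in> I \<and> x \<in> carrier (G i)}"
  \<comment> \<open>A member of \<open>K\<close> is a cocone on the family. Pairs outside
    \<open>\<Gamma>\<close> name nothing and are sent to zero, so that they add no new
    generators.\<close>
  define K where "K = {(M, v). ob M \<and> range v \<subseteq> carrier M \<and>
    (\<forall>i\<in>I. H (G i) M (\<lambda>x. v (e i, x))) \<and> (\<forall>g. g \<notin> \<Gamma> \<longrightarrow> v g = z M)}"
  have UU: "(UNIV :: ('u \<times> 'u) set) \<lesssim> (UNIV :: 'u set)"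
    using pair_encoding[OF inf] by (auto simp: lepoll_def)
  obtain F \<eta> where F: "ob F" "range \<eta> \<subseteq> carrier F" "carrier F = gen ar F (range \<eta>)"
    and ext: "\<And>M v. (M, v) \<in> K \<Longrightarrow> \<exists>h. H F M h \<and> (\<forall>g. h (\<eta> g) = v g)"
    and sep: "\<And>x y. x \<in> carrier F \<Longrightarrow> y \<in> carrier F \<Longrightarrow> x \<noteq> y \<Longrightarrow>
       \<exists>M v h. (M, v) \<in> K \<and> H F M h \<and> (\<forall>g. h (\<eta> g) = v g) \<and> h x \<noteq> h y"
    by (rule free_ex[OF UU, of K]) (auto simp: K_def)
  \<comment> \<open>A failure of the homomorphism law would be visible under some cocone in
    \<open>K\<close>, and these are homomorphic on \<open>G i\<close>.\<close>
  have hom: "H (G i) F (\<lambda>x. \<eta> (e i, x))" if i: "i \<in> I" for i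
  proof (rule hmI)
    fix f xs assume *: "set xs \<subseteq> carrier (G i)" "length xs = ar f"
    show "\<eta> (e i, oper (G i) f xs) = oper F f (map (\<lambda>x. \<eta> (e i, x)) xs)"
    proof (rule ccontr)
      assume ne: "\<not> ?thesis"
      have sub: "set (map (\<lambda>x. \<eta> (e i, x)) xs) \<subseteq> carrier F" using F(2) by auto
      then have "oper F f (map (\<lambda>x. \<eta> (e i, x)) xs) \<in> carrier F"
        using F(1) * by (intro alg_op) auto
      then obtain M v h where h: "(M, v) \<in> K" "H F M h" "\<And>g. h (\<eta> g) = v g"
        "h (\<eta> (e i, oper (G i) f xs)) \<noteq> h (oper F f (map (\<lambda>x. \<eta> (e i, x)) xs))"
        using sep[OF _ _ ne] F(2) by blast
      have "h (oper F f (map (\<lambda>x. \<eta> (e i, x)) xs)) = oper M f (map (\<lambda>x. v (e i, x)) xs)"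
        using hm_op[OF h(2) sub] * h(3) by (simp add: comp_def)
      moreover have "v (e i, oper (G i) f xs) = oper M f (map (\<lambda>x. v (e i, x)) xs)"
        using h(1) i hm_op[of ar "G i" M "\<lambda>x. v (e i, x)", OF _ *] by (auto simp: K_def)
      ultimately show False using h(3,4) by simp
    qed
  qed (use F(2) in auto)
  have junk: "\<eta> g = z F" if "g \<notin> \<Gamma>" for g
  proof (rule ccontr)
    assume "\<eta> g \<noteq> z F"
    then obtain M v h where h: "(M, v) \<in> K" "H F M h" "\<And>g. h (\<eta> g) = v g" "h (\<eta> g) \<noteq> h (z F)"
      using sep[of "\<eta> g" "z F"] F(1,2) z_in[of F] by blast
    then have "v g = z M" "h (z F) = z M" 
      using that z_hm[of F M h] F(1) h(1,2) unfolding K_def by blast+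
    then show False using h by simp
  qed
  let ?U = "\<Union>i\<in>I. (\<lambda>x. \<eta> (e i, x)) ` carrier (G i)"
  have Ucl: "closed ar F (gen ar F ?U)"
    using F by (intro gen_closed) auto
  show thesis
  proof
    show "ob F" by (rule F)
    show "H (G i) F (\<lambda>x. \<eta> (e i, x))" if "i \<in> I" for i using hom that .
    show "carrier F = gen ar F ?U"
    proof
      have "\<eta> g \<in> gen ar F ?U" for g
      proof (cases "g \<in> \<Gamma>")
        case True then show ?thesis by (auto simp: \<Gamma>_def intro!: gen.base)
      next
        case False then show ?thesis using junk closed_z(1)[OF _ Ucl] F(1) by simp
      qed
      then show "carrier F \<subseteq> gen ar F ?U" using gen_least[OF Ucl] F(3) by blast
    qed (use Ucl in \<open>simp add: closed_def\<close>)
    fix M f assume M: "ob M" "\<And>i. i \<in> I \<Longrightarrow> H (G i) M (f i)"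
    define v where "v = (\<lambda>(a, x). if (a, x) \<in> \<Gamma> then f (inv_into I e a) x else z M)"
    have v: "v (e i, x) = f i x" if "i \<in> I" "x \<in> carrier (G i)" for i x
      using that e by (auto simp: v_def \<Gamma>_def)
    have v2: "v g = z M" if "g \<notin> \<Gamma>" for g
      using that by (auto simp: v_def split: prod.splits)
    have "v g \<in> carrier M" for g
    proof (cases "g \<in> \<Gamma>")
      case True
      then obtain i x where ix: "g = (e i, x)" "i \<in> I" "x \<in> carrier (G i)" by (auto simp: \<Gamma>_def)
      then show ?thesis using v hm_in[OF M(2)[OF ix(2)] ix(3)] by simp
    qed (use v2 M in auto)
    moreover have "H (G i) M (\<lambda>x. v (e i, x))" if "i \<in> I" for i
      by (rule hm_cong[OF M(2)[OF that]]) (use v that G in auto)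
    ultimately have vK: "(M, v) \<in> K"
      unfolding K_def using M(1) v2 by blast
    show "\<exists>h. H F M h \<and> (\<forall>i\<in>I. \<forall>x\<in>carrier (G i). h (\<eta> (e i, x)) = f i x)"
      using ext[OF vK] by (metis v)
  qed
qed

end

text \<open>Of a Mal'tsev term only naturality in homomorphisms is kept. This is enough to compute
  \<open>mal\<close> in subalgebras, products and quotients.\<close>

locale maltsev_class = pointed_class ar E P
  for ar :: "'f \<Rightarrow> nat" and E and P :: "('f, 'u) alg \<Rightarrow> bool" +
  fixes mal :: "('f, 'u) alg \<Rightarrow> 'u \<Rightarrow> 'u \<Rightarrow> 'u \<Rightarrow> 'u"
  assumes mal_in: "\<And>A a b c. vob ar E A \<Longrightarrow> a \<in> carrier A \<Longrightarrow> b \<in> carrier A \<Longrightarrow> c \<in> carrier A \<Longrightarrow>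
      mal A a b c \<in> carrier A"
    and mal_hm: "\<And>A B h a b c. vob ar E A \<Longrightarrow> vob ar E B \<Longrightarrow> hm ar A B h \<Longrightarrow>
      a \<in> carrier A \<Longrightarrow> b \<in> carrier A \<Longrightarrow> c \<in> carrier A \<Longrightarrow> h (mal A a b c) = mal B (h a) (h b) (h c)"
    and mal1: "\<And>A a b. vob ar E A \<Longrightarrow> a \<in> carrier A \<Longrightarrow> b \<in> carrier A \<Longrightarrow> mal A a b b = a"
    and mal2: "\<And>A a b. vob ar E A \<Longrightarrow> a \<in> carrier A \<Longrightarrow> b \<in> carrier A \<Longrightarrow> mal A a a b = b"
begin

text \<open>\<open>pl\<close> has \<open>z A\<close> as a two-sided unit, and \<open>sb\<close>
  obeys the two laws \<open>a - 0 = a\<close> and \<open>a - a = 0\<close>. Associativity and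
  commutativity of \<open>pl\<close> become available only on abelian algebras.\<close>

definition pl :: "('f, 'u) alg \<Rightarrow> 'u \<Rightarrow> 'u \<Rightarrow> 'u" where "pl A a b = mal A a (z A) b"
definition sb :: "('f, 'u) alg \<Rightarrow> 'u \<Rightarrow> 'u \<Rightarrow> 'u" where "sb A a b = mal A a b (z A)"

lemma pl_in: "vob ar E A \<Longrightarrow> a \<in> carrier A \<Longrightarrow> b \<in> carrier A \<Longrightarrow> pl A a b \<in> carrier A"
  by (simp add: pl_def mal_in)

lemma sb_in: "vob ar E A \<Longrightarrow> a \<in> carrier A \<Longrightarrow> b \<in> carrier A \<Longrightarrow> sb A a b \<in> carrier A"
  by (simp add: sb_def mal_in)

lemma pl_hm: "vob ar E A \<Longrightarrow> vob ar E B \<Longrightarrow> hm ar A B h \<Longrightarrow> a \<in> carrier A \<Longrightarrow> b \<in> carrier A \<Longrightarrow>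
    h (pl A a b) = pl B (h a) (h b)"
  by (simp add: pl_def mal_hm z_hm)

lemma sb_hm: "vob ar E A \<Longrightarrow> vob ar E B \<Longrightarrow> hm ar A B h \<Longrightarrow> a \<in> carrier A \<Longrightarrow> b \<in> carrier A \<Longrightarrow>
    h (sb A a b) = sb B (h a) (h b)"
  by (simp add: sb_def mal_hm z_hm)

lemma pl_z [simp]: "vob ar E A \<Longrightarrow> a \<in> carrier A \<Longrightarrow> pl A a (z A) = a"
    "vob ar E A \<Longrightarrow> a \<in> carrier A \<Longrightarrow> pl A (z A) a = a"
  by (simp_all add: pl_def mal1 mal2)

lemma sb_z [simp]: "vob ar E A \<Longrightarrow> a \<in> carrier A \<Longrightarrow> sb A a (z A) = a"
    "vob ar E A \<Longrightarrow> a \<in> carrier A \<Longrightarrow> sb A a a = z A"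
  by (simp_all add: sb_def mal1 mal2)

lemma mal_closed:
  assumes "vob ar E A" "closed ar A T" "a \<in> T" "b \<in> T" "c \<in> T"
  shows "mal A a b c \<in> T" "mal (sub_alg A T) a b c = mal A a b c"
proof -
  have s: "vob ar E (sub_alg A T)" using vob_sub assms by blast
  show e: "mal (sub_alg A T) a b c = mal A a b c"
    using mal_hm[OF s assms(1) sub_hm[OF assms(2)]] assms by simp
  show "mal A a b c \<in> T" using mal_in[OF s, of a b c] e assms by simp
qed

lemma pl_closed:
  assumes "vob ar E A" "closed ar A T" "a \<in> T" "b \<in> T"
  shows "pl A a b \<in> T" "pl (sub_alg A T) a b = pl A a b"
  using mal_closed[OF assms(1,2), of a "z A" b] closed_z[OF assms(1,2)] assms by (auto simp: pl_def)

text \<open>In a Mal'tsev variety a reflexive compatible relation is already a congruence.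
  \<open>R\<close> is a span, not necessarily a subalgebra of \<open>A \<times> A\<close>; only its
  image matters, and this freedom is used later for \<open>S R\<close> over
  \<open>S B0\<close>.\<close>

lemma rel_quot:
  assumes A: "vob ar E A" and R: "vob ar E R" and p: "H R A p" and q: "H R A q"
    and d: "\<And>x. x \<in> carrier A \<Longrightarrow> \<exists>r\<in>carrier R. p r = x \<and> q r = x"
  obtains Q \<pi> where "vob ar E Q" "H A Q \<pi>" "\<pi> ` carrier A = carrier Q"
    "\<And>x y. x \<in> carrier A \<Longrightarrow> y \<in> carrier A \<Longrightarrow> \<pi> x = \<pi> y \<longleftrightarrow> (\<exists>r\<in>carrier R. p r = x \<and> q r = y)"
proof -
  \<comment> \<open>With diagonal elements \<open>u\<close> over \<open>p a\<close> and
    \<open>v\<close> over \<open>q a\<close>, the two components of \<open>mal R u a v\<close> are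
    \<open>mal A (p a) (p a) (q a) = q a\<close> and
    \<open>mal A (p a) (q a) (q a) = p a\<close>.\<close>
  have sym: "\<exists>r\<in>carrier R. p r = q a \<and> q r = p a" if "a \<in> carrier R" for a
  proof -
    obtain u v where u: "u \<in> carrier R" "p u = p a" "q u = p a"
      and v: "v \<in> carrier R" "p v = q a" "q v = q a"
      using d[OF hm_in[OF p \<open>a \<in> carrier R\<close>]] d[OF hm_in[OF q \<open>a \<in> carrier R\<close>]] by blast
    show ?thesis
      by (rule bexI[of _ "mal R u a v"])
        (use u v that p q A R in \<open>simp_all add: mal_hm mal_in mal1 mal2 hm_in\<close>)
  qed
  \<comment> \<open>The diagonal element \<open>u\<close> over the common value
    \<open>q a = p b\<close> cancels in \<open>mal R a u b\<close>, against \<open>b\<close> in the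
    first component and against \<open>a\<close> in the second.\<close>
  have trans: "\<exists>r\<in>carrier R. p r = p a \<and> q r = q b"
    if "a \<in> carrier R" "b \<in> carrier R" "q a = p b" for a b
  proof -
    obtain u where u: "u \<in> carrier R" "p u = q a" "q u = q a"
      using d[OF hm_in[OF q \<open>a \<in> carrier R\<close>]] by blast
    show ?thesis
      by (rule bexI[of _ "mal R a u b"])
        (use u that p q A R mal1[OF A, of "p a" "p b"] mal2[OF A, of "p b" "q b"] in
          \<open>auto simp: mal_hm mal_in hm_in\<close>)
  qed
  show thesis
  proof (rule quot_ex[OF A, of "\<lambda>x y. \<exists>r\<in>carrier R. p r = x \<and> q r = y"])
    fix f xs ys assume *: "set xs \<subseteq> carrier A" "set ys \<subseteq> carrier A" "length xs = ar f"
      "list_all2 (\<lambda>x y. \<exists>r\<in>carrier R. p r = x \<and> q r = y) xs ys"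
    from *(4) have "\<exists>rs. set rs \<subseteq> carrier R \<and> xs = map p rs \<and> ys = map q rs"
    proof (induct rule: list_all2_induct)
      case (Cons x xs y ys)
      then obtain r rs where "r \<in> carrier R" "p r = x" "q r = y" "set rs \<subseteq> carrier R" "xs = map p rs" "ys = map q rs"
        by blast
      then show ?case by (intro exI[of _ "r # rs"]) simp
    qed simp
    then obtain rs where rs: "set rs \<subseteq> carrier R" "xs = map p rs" "ys = map q rs" by blast
    have len: "length rs = ar f" using rs(2) *(3) by simp
    show "\<exists>r\<in>carrier R. p r = oper A f xs \<and> q r = oper A f ys"
      using hm_op[OF p rs(1) len] hm_op[OF q rs(1) len] alg_op[OF vob_alg[OF R] rs(1) len] rs(2,3)
      by blast
  next
    fix x y assume "\<exists>r\<in>carrier R. p r = x \<and> q r = y"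
    then obtain a where "a \<in> carrier R" "p a = x" "q a = y" by blast
    then show "\<exists>r\<in>carrier R. p r = y \<and> q r = x" using sym[of a] by simp
  next
    fix x y w assume "\<exists>r\<in>carrier R. p r = x \<and> q r = y" "\<exists>r\<in>carrier R. p r = y \<and> q r = w"
    then obtain a b where "a \<in> carrier R" "p a = x" "q a = y" "b \<in> carrier R" "p b = y" "q b = w" by blast
    then show "\<exists>r\<in>carrier R. p r = x \<and> q r = w" using trans[of a b] by simp
  qed (use d that in auto)
qed

end

section \<open>Coproducts and the binary cosmash product, elementwise\<close>

context alg_class
begin

text \<open>Generation replaces uniqueness of the induced map: it implies uniqueness by
  \<open>cop_ext\<close>, and it is also what surjectivity arguments on coproducts use.\<close>

definition cop where
  "cop A B S i j \<longleftrightarrow> ob S \<and> H A S i \<and> H B S j \<and> carrier S = gen ar S (i ` carrier A \<union> j ` carrier B) \<and>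
     (\<forall>M f g. ob M \<and> H A M f \<and> H B M g \<longrightarrow>
        (\<exists>h. H S M h \<and> (\<forall>a\<in>carrier A. h (i a) = f a) \<and> (\<forall>b\<in>carrier B. h (j b) = g b)))"

lemma copD:
  assumes "cop A B S i j"
  shows "ob S" "vob ar E S" "H A S i" "H B S j" "carrier S = gen ar S (i ` carrier A \<union> j ` carrier B)"
    "i ` carrier A \<union> j ` carrier B \<subseteq> carrier S"
  using assms by (auto simp: cop_def hm_in)

lemma cop_univ:
  assumes "cop A B S i j" "ob M" "H A M f" "H B M g"
  obtains h where "H S M h" "\<And>a. a \<in> carrier A \<Longrightarrow> h (i a) = f a" "\<And>b. b \<in> carrier B \<Longrightarrow> h (j b) = g b"
  using assms unfolding cop_def by blast

lemma cop_ext: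
  assumes c: "cop A B S i j" and "H S M h" "H S M h'"
    and "\<And>a. a \<in> carrier A \<Longrightarrow> h (i a) = h' (i a)" "\<And>b. b \<in> carrier B \<Longrightarrow> h (j b) = h' (j b)"
    and "s \<in> carrier S"
  shows "h s = h' s"
  by (rule hm_agree_gen[of ar S "i ` carrier A \<union> j ` carrier B"])
    (use assms copD[OF c] in auto)

text \<open>Without brackets, since bilinearity needs \<open>X + (Q + Q')\<close> while the
  commutator is defined through \<open>(X + X) + X\<close>.\<close>

definition tri where
  "tri A B C W a b c \<longleftrightarrow> ob W \<and> H A W a \<and> H B W b \<and> H C W c \<and>
     carrier W = gen ar W (a ` carrier A \<union> b ` carrier B \<union> c ` carrier C) \<and>
     (\<forall>M f g h. ob M \<and> H A M f \<and> H B M g \<and> H C M h \<longrightarrow>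
        (\<exists>k. H W M k \<and> (\<forall>x\<in>carrier A. k (a x) = f x) \<and> (\<forall>x\<in>carrier B. k (b x) = g x) \<and>
             (\<forall>x\<in>carrier C. k (c x) = h x)))"

lemma triD:
  assumes "tri A B C W a b c"
  shows "ob W" "vob ar E W" "H A W a" "H B W b" "H C W c"
    "carrier W = gen ar W (a ` carrier A \<union> b ` carrier B \<union> c ` carrier C)"
    "a ` carrier A \<union> b ` carrier B \<union> c ` carrier C \<subseteq> carrier W"
  using assms by (auto simp: tri_def hm_in)

lemma tri_univ:
  assumes "tri A B C W a b c" "ob M" "H A M f" "H B M g" "H C M h"
  obtains k where "H W M k" "\<And>x. x \<in> carrier A \<Longrightarrow> k (a x) = f x"
    "\<And>x. x \<in> carrier B \<Longrightarrow> k (b x) = g x" "\<And>x. x \<in> carrier C \<Longrightarrow> k (c x) = h x"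
  using assms unfolding tri_def by blast

lemma tri_ext:
  assumes t: "tri A B C W a b c" and "H W M h" "H W M h'"
    and "\<And>x. x \<in> carrier A \<Longrightarrow> h (a x) = h' (a x)" "\<And>x. x \<in> carrier B \<Longrightarrow> h (b x) = h' (b x)"
    and "\<And>x. x \<in> carrier C \<Longrightarrow> h (c x) = h' (c x)"
    and "s \<in> carrier W"
  shows "h s = h' s"
  by (rule hm_agree_gen[of ar W "a ` carrier A \<union> b ` carrier B \<union> c ` carrier C"])
    (use assms triD[OF t] in auto)

lemma cop_tri:
  assumes c: "cop A D W a u" and d: "cop B C D b c"
  shows "tri A B C W a (\<lambda>x. u (b x)) (\<lambda>x. u (c x))"
proof -
  note C = copD[OF c] and D = copD[OF d]
  let ?U = "a ` carrier A \<union> (\<lambda>x. u (b x)) ` carrier B \<union> (\<lambda>x. u (c x)) ` carrier C"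
  have U: "?U \<subseteq> carrier W"
    using hm_in[OF C(3)] hm_in[OF C(4)] hm_in[OF D(3)] hm_in[OF D(4)] by auto
  have cl: "closed ar W (gen ar W ?U)" by (rule gen_closed[OF _ U]) (use C in auto)
  have "u ` carrier D \<subseteq> gen ar W ?U"
  proof
    fix y assume "y \<in> u ` carrier D"
    then obtain x where "x \<in> gen ar D (b ` carrier B \<union> c ` carrier C)" "y = u x" using D(5) by auto
    then have "y \<in> gen ar W (u ` (b ` carrier B \<union> c ` carrier C))"
      using hm_gen[OF _ D(6) C(4)] D(1) by auto
    moreover have "u ` (b ` carrier B \<union> c ` carrier C) \<subseteq> ?U" by auto
    ultimately show "y \<in> gen ar W ?U" using gen_mono[of "u ` (b ` carrier B \<union> c ` carrier C)" ?U ar W] by blast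
  qed
  then have "a ` carrier A \<union> u ` carrier D \<subseteq> gen ar W ?U" by (auto intro: gen.base)
  then have "carrier W = gen ar W ?U"
    using gen_least[OF cl, of "a ` carrier A \<union> u ` carrier D"] C(5) cl[unfolded closed_def]
    by (intro subset_antisym) simp_all
  moreover have "\<exists>k. H W M k \<and> (\<forall>x\<in>carrier A. k (a x) = f x) \<and> (\<forall>x\<in>carrier B. k (u (b x)) = g x) \<and>
             (\<forall>x\<in>carrier C. k (u (c x)) = h x)" if M: "ob M" "H A M f" "H B M g" "H C M h" for M f g h
  proof -
    obtain l where l: "H D M l" "\<And>x. x \<in> carrier B \<Longrightarrow> l (b x) = g x" "\<And>x. x \<in> carrier C \<Longrightarrow> l (c x) = h x"
      by (rule cop_univ[OF d M(1,3,4)]) (rule that)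
    obtain k where k: "H W M k" "\<And>x. x \<in> carrier A \<Longrightarrow> k (a x) = f x" "\<And>x. x \<in> carrier D \<Longrightarrow> k (u x) = l x"
      by (rule cop_univ[OF c M(1,2) l(1)]) (rule that)
    show ?thesis using k l D by (intro exI[of _ k]) (auto simp: hm_in)
  qed
  ultimately show ?thesis
    unfolding tri_def using C(1,3) hm_comp[OF D(3) C(4)] hm_comp[OF D(4) C(4)] by blast
qed

end

lemma (in pointed_class) cop2_ex:
  assumes A: "ob A" and B: "ob B"
  obtains S i j where "cop A B S i j"
proof -
  have bu: "(UNIV :: bool set) \<lesssim> (UNIV :: 'u set)"
    using inf by (simp add: finite_lepoll_infinite)
  define G where "G = (\<lambda>b. if b then A else B)"
  obtain S \<iota> where S: "ob S" "\<And>i. H (G i) S (\<iota> i)"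
    "carrier S = gen ar S (\<Union>i\<in>UNIV. \<iota> i ` carrier (G i))"
    "\<And>M f. ob M \<Longrightarrow> (\<And>i. H (G i) M (f i)) \<Longrightarrow> \<exists>h. H S M h \<and> (\<forall>i\<in>UNIV. \<forall>x\<in>carrier (G i). h (\<iota> i x) = f i x)"
    by (rule cop_ex[OF bu, of G]) (use A B in \<open>auto simp: G_def\<close>)
  have "cop A B S (\<iota> True) (\<iota> False)"
    unfolding cop_def
  proof (intro conjI allI impI)
    show "carrier S = gen ar S (\<iota> True ` carrier A \<union> \<iota> False ` carrier B)"
      using S(3) by (simp add: UNIV_bool G_def Un_commute)
    fix M f g assume M: "ob M \<and> H A M f \<and> H B M g"
    have "\<exists>h. H S M h \<and> (\<forall>i\<in>UNIV. \<forall>x\<in>carrier (G i). h (\<iota> i x) = (if i then f else g) x)"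
      by (rule S(4)) (use M in \<open>auto simp: G_def\<close>)
    then obtain h where "H S M h" "\<And>i x. x \<in> carrier (G i) \<Longrightarrow> h (\<iota> i x) = (if i then f else g) x" by blast
    from this(1) this(2)[where i = True] this(2)[where i = False] show
      "\<exists>h. H S M h \<and> (\<forall>a\<in>carrier A. h (\<iota> True a) = f a) \<and> (\<forall>b\<in>carrier B. h (\<iota> False b) = g b)"
      by (intro exI[of _ h]) (simp add: G_def)
  qed (use S(1) S(2)[of True] S(2)[of False] in \<open>auto simp: G_def\<close>)
  then show thesis using that by blast
qed

lemma (in pointed_class) tri_ex:
  assumes "ob A" "ob B" "ob C" obtains W a b c where "tri A B C W a b c"
  using cop2_ex[OF assms(2,3)] cop2_ex[OF assms(1)] cop_tri copD(1) by metis

text \<open>\<open>e1\<close>, \<open>e2\<close>, \<open>e3\<close> are the projections to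
  \<open>A + B\<close>, \<open>A + C\<close>, \<open>B + C\<close> followed by the inclusions back
  into \<open>W\<close>. These inclusions are split, so the kernels are those of the projections,
  and no binary coproduct has to be chosen. The elements killed by all three form the ternary
  cosmash product.\<close>

definition (in pointed_class) kills where
  "kills A B C W a b c e1 e2 e3 \<longleftrightarrow> H W W e1 \<and> H W W e2 \<and> H W W e3 \<and>
     (\<forall>x\<in>carrier A. e1 (a x) = a x \<and> e2 (a x) = a x \<and> e3 (a x) = z W) \<and>
     (\<forall>x\<in>carrier B. e1 (b x) = b x \<and> e2 (b x) = z W \<and> e3 (b x) = b x) \<and>
     (\<forall>x\<in>carrier C. e1 (c x) = z W \<and> e2 (c x) = c x \<and> e3 (c x) = c x)"

lemma (in pointed_class) kills_ex:
  assumes t: "tri A B C W a b c" obtains e1 e2 e3 where "kills A B C W a b c e1 e2 e3"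
proof -
  note T = triD[OF t]
  note zz = hm_z[OF T(2)]
  obtain e1 where "H W W e1" "\<And>x. x \<in> carrier A \<Longrightarrow> e1 (a x) = a x"
    "\<And>x. x \<in> carrier B \<Longrightarrow> e1 (b x) = b x" "\<And>x. x \<in> carrier C \<Longrightarrow> e1 (c x) = z W"
    by (rule tri_univ[OF t T(1) T(3) T(4) zz]) (rule that)
  moreover obtain e2 where "H W W e2" "\<And>x. x \<in> carrier A \<Longrightarrow> e2 (a x) = a x"
    "\<And>x. x \<in> carrier B \<Longrightarrow> e2 (b x) = z W" "\<And>x. x \<in> carrier C \<Longrightarrow> e2 (c x) = c x"
    by (rule tri_univ[OF t T(1) T(3) zz T(5)]) (rule that)
  moreover obtain e3 where "H W W e3" "\<And>x. x \<in> carrier A \<Longrightarrow> e3 (a x) = z W"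
    "\<And>x. x \<in> carrier B \<Longrightarrow> e3 (b x) = b x" "\<And>x. x \<in> carrier C \<Longrightarrow> e3 (c x) = c x"
    by (rule tri_univ[OF t T(1) zz T(4) T(5)]) (rule that)
  ultimately have "kills A B C W a b c e1 e2 e3" by (simp add: kills_def)
  then show thesis using that by blast
qed

text \<open>This makes \<open>pl\<close> a homomorphism \<open>A \<times> A \<rightarrow> A\<close>,
  written without a product object. It is the elementwise form of an internal abelian group, since
  the multiplication of such a group can only be \<open>pl\<close>.\<close>

definition (in maltsev_class) abl :: "('f, 'u) alg \<Rightarrow> bool" where
  "abl A \<longleftrightarrow> vob ar E A \<and> (\<forall>f xs ys. set xs \<subseteq> carrier A \<and> set ys \<subseteq> carrier A \<and> length xs = ar f \<and>
     length ys = ar f \<longrightarrow> oper A f (map2 (pl A) xs ys) = pl A (oper A f xs) (oper A f ys))"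

lemma (in maltsev_class) map2_pl_in:
  assumes "vob ar E A" "set xs \<subseteq> carrier A" "set ys \<subseteq> carrier A"
  shows "set (map2 (pl A) xs ys) \<subseteq> carrier A"
proof
  fix a assume "a \<in> set (map2 (pl A) xs ys)"
  then obtain x y where "(x, y) \<in> set (zip xs ys)" "a = pl A x y" by auto
  then show "a \<in> carrier A"
    using assms set_zip_leftD[of x y xs ys] set_zip_rightD[of x y xs ys] pl_in[OF assms(1), of x y] by auto
qed

lemma (in maltsev_class) map2_pl_hm:
  assumes "vob ar E A" "vob ar E B" "hm ar A B h" "set xs \<subseteq> carrier A" "set ys \<subseteq> carrier A"
    "length xs = ar f" "length ys = ar f"
  shows "h (oper A f (map2 (pl A) xs ys)) = oper B f (map2 (pl B) (map h xs) (map h ys))"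
    "h (pl A (oper A f xs) (oper A f ys)) = pl B (oper B f (map h xs)) (oper B f (map h ys))"
proof -
  have s: "set (map2 (pl A) xs ys) \<subseteq> carrier A"
    by (rule map2_pl_in[OF assms(1,4,5)])
  have "map h (map2 (pl A) xs ys) = map2 (pl B) (map h xs) (map h ys)"
  proof (rule nth_equalityI)
    fix i assume "i < length (map h (map2 (pl A) xs ys))"
    moreover from this have "xs ! i \<in> carrier A" "ys ! i \<in> carrier A" using assms by (auto simp: subset_iff)
    ultimately show "map h (map2 (pl A) xs ys) ! i = map2 (pl B) (map h xs) (map h ys) ! i"
      using pl_hm[OF assms(1-3)] by simp
  qed simp
  then show "h (oper A f (map2 (pl A) xs ys)) = oper B f (map2 (pl B) (map h xs) (map h ys))"
    using hm_op[OF assms(3) s] assms by (simp del: map_map)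
  show "h (pl A (oper A f xs) (oper A f ys)) = pl B (oper B f (map h xs)) (oper B f (map h ys))"
    using pl_hm[OF assms(1-3) alg_op[OF vob_alg[OF assms(1)] assms(4,6)] alg_op[OF vob_alg[OF assms(1)] assms(5,7)]]
      hm_op[OF assms(3,4,6)] hm_op[OF assms(3,5,7)] assms(1) by simp
qed

lemma (in maltsev_class) map2_pl_z:
  assumes "vob ar E A" "set xs \<subseteq> carrier A" "length ys = length xs" "set ys \<subseteq> {z A}"
  shows "map2 (pl A) xs ys = xs" "map2 (pl A) ys xs = xs"
proof -
  have "xs ! i \<in> carrier A \<and> ys ! i = z A" if "i < length xs" for i
  proof -
    have "xs ! i \<in> set xs" "ys ! i \<in> set ys" using that assms(3) by simp_all
    then show ?thesis using assms by blast
  qed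
  then show "map2 (pl A) xs ys = xs" "map2 (pl A) ys xs = xs"
    using assms(1,3) by (auto intro!: nth_equalityI)
qed

text \<open>In a two-nilpotent variety the ternary coproduct embeds into the product of the three binary
  ones, which is what \<open>NIL\<close> says. \<open>S Y\<close> is a chosen coproduct of \<open>X\<close> and \<open>Y\<close>.\<close>

locale nilpotent_class = maltsev_class ar E P mal
  for ar :: "'f \<Rightarrow> nat" and E and P :: "('f, 'u) alg \<Rightarrow> bool" and mal +
  fixes X :: "('f, 'u) alg" and S :: "('f, 'u) alg \<Rightarrow> ('f, 'u) alg"
    and inn jn :: "('f, 'u) alg \<Rightarrow> 'u \<Rightarrow> 'u"
  assumes X: "ob X"
    and quoP: "\<And>A B h. ob A \<Longrightarrow> vob ar E B \<Longrightarrow> H A B h \<Longrightarrow> h ` carrier A = carrier B \<Longrightarrow> P B"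
    and Scop: "\<And>Y. ob Y \<Longrightarrow> cop X Y (S Y) (inn Y) (jn Y)"
    and NIL: "\<And>A B C W a b c e1 e2 e3 w v. ob A \<Longrightarrow> ob B \<Longrightarrow> ob C \<Longrightarrow> tri A B C W a b c \<Longrightarrow>
      kills A B C W a b c e1 e2 e3 \<Longrightarrow> w \<in> carrier W \<Longrightarrow> v \<in> carrier W \<Longrightarrow>
      e1 w = e1 v \<Longrightarrow> e2 w = e2 v \<Longrightarrow> e3 w = e3 v \<Longrightarrow> w = v"
begin

lemma vX: "vob ar E X" using X by blast

lemma S_ob: "ob Y \<Longrightarrow> ob (S Y)" "ob Y \<Longrightarrow> vob ar E (S Y)"
  and inn: "ob Y \<Longrightarrow> H X (S Y) (inn Y)" and jn: "ob Y \<Longrightarrow> H Y (S Y) (jn Y)"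
  and S_gen: "ob Y \<Longrightarrow> carrier (S Y) = gen ar (S Y) (inn Y ` carrier X \<union> jn Y ` carrier Y)"
  using copD[OF Scop] by simp_all

lemma inn_in: "ob Y \<Longrightarrow> x \<in> carrier X \<Longrightarrow> inn Y x \<in> carrier (S Y)"
  and jn_in: "ob Y \<Longrightarrow> y \<in> carrier Y \<Longrightarrow> jn Y y \<in> carrier (S Y)"
  using hm_in[OF inn] hm_in[OF jn] by simp_all

lemma S_ext:
  assumes "ob Y" "H (S Y) M h" "H (S Y) M h'"
    "\<And>x. x \<in> carrier X \<Longrightarrow> h (inn Y x) = h' (inn Y x)" "\<And>y. y \<in> carrier Y \<Longrightarrow> h (jn Y y) = h' (jn Y y)"
    "s \<in> carrier (S Y)"
  shows "h s = h' s"
  using cop_ext[OF Scop] assms by blast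

definition ext where
  "ext Y M f g = (SOME h. H (S Y) M h \<and> (\<forall>x\<in>carrier X. h (inn Y x) = f x) \<and> (\<forall>y\<in>carrier Y. h (jn Y y) = g y))"

lemma ext:
  assumes "ob Y" "ob M" "H X M f" "H Y M g"
  shows "H (S Y) M (ext Y M f g)" "x \<in> carrier X \<Longrightarrow> ext Y M f g (inn Y x) = f x"
    "y \<in> carrier Y \<Longrightarrow> ext Y M f g (jn Y y) = g y"
proof -
  have "\<exists>h. H (S Y) M h \<and> (\<forall>x\<in>carrier X. h (inn Y x) = f x) \<and> (\<forall>y\<in>carrier Y. h (jn Y y) = g y)"
    using Scop[OF assms(1)] assms unfolding cop_def by blast
  from someI_ex[OF this, folded ext_def]
  show "H (S Y) M (ext Y M f g)" "x \<in> carrier X \<Longrightarrow> ext Y M f g (inn Y x) = f x"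
    "y \<in> carrier Y \<Longrightarrow> ext Y M f g (jn Y y) = g y" by blast+
qed

text \<open>\<open>r1\<close> and \<open>r2\<close> are the components of
  \<open>X + Y \<rightarrow> X \<times> Y\<close>, and \<open>Smap Y Y' f\<close> is
  \<open>X + f\<close>.\<close>

definition r1 where "r1 Y = ext Y X (\<lambda>x. x) (\<lambda>_. z X)"
definition r2 where "r2 Y = ext Y Y (\<lambda>_. z Y) (\<lambda>y. y)"
definition Smap where "Smap Y Y' f = ext Y (S Y') (inn Y') (\<lambda>y. jn Y' (f y))"

lemma r1: assumes "ob Y"
  shows "H (S Y) X (r1 Y)" "x \<in> carrier X \<Longrightarrow> r1 Y (inn Y x) = x" "y \<in> carrier Y \<Longrightarrow> r1 Y (jn Y y) = z X"
  unfolding r1_def using ext[OF assms X hm_id hm_z[OF vX]] by blast+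

lemma r2: assumes "ob Y"
  shows "H (S Y) Y (r2 Y)" "x \<in> carrier X \<Longrightarrow> r2 Y (inn Y x) = z Y" "y \<in> carrier Y \<Longrightarrow> r2 Y (jn Y y) = y"
  unfolding r2_def using ext[OF assms assms hm_z hm_id] assms by blast+

lemma Smap:
  assumes "ob Y" "ob Y'" "H Y Y' f"
  shows "H (S Y) (S Y') (Smap Y Y' f)" "x \<in> carrier X \<Longrightarrow> Smap Y Y' f (inn Y x) = inn Y' x"
    "y \<in> carrier Y \<Longrightarrow> Smap Y Y' f (jn Y y) = jn Y' (f y)"
  unfolding Smap_def
  by (simp_all add: ext[OF assms(1) S_ob(1)[OF assms(2)] inn[OF assms(2)] hm_comp[OF assms(3) jn[OF assms(2)]]])

lemma Smap_in: "ob Y \<Longrightarrow> ob Y' \<Longrightarrow> H Y Y' f \<Longrightarrow> w \<in> carrier (S Y) \<Longrightarrow> Smap Y Y' f w \<in> carrier (S Y')"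
  by (rule hm_in[OF Smap(1)])

lemma Smap_comp:
  assumes o: "ob Y" "ob Y'" "ob Y''" and f: "H Y Y' f" and g: "H Y' Y'' g" and w: "w \<in> carrier (S Y)"
  shows "Smap Y' Y'' g (Smap Y Y' f w) = Smap Y Y'' (\<lambda>y. g (f y)) w"
proof -
  note F = Smap[OF o(1,2) f] and G = Smap[OF o(2,3) g] and FG = Smap[OF o(1,3) hm_comp[OF f g]]
  show ?thesis
    by (rule S_ext[OF o(1) hm_comp[OF F(1) G(1)] FG(1) _ _ w])
      (use F G FG in \<open>auto simp: hm_in[OF f]\<close>)
qed

lemma Smap_cong:
  assumes o: "ob Y" "ob Y'" and f: "H Y Y' f" and g: "\<And>y. y \<in> carrier Y \<Longrightarrow> g y = f y"
    and w: "w \<in> carrier (S Y)"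
  shows "Smap Y Y' g w = Smap Y Y' f w"
proof -
  have g': "H Y Y' g" by (rule hm_cong[OF f]) (use o g in auto)
  show ?thesis
    by (rule S_ext[OF o(1) Smap(1)[OF o g'] Smap(1)[OF o f] _ _ w])
      (use Smap[OF o f] Smap[OF o g'] g in auto)
qed

lemma Smap_id: assumes o: "ob Y" and w: "w \<in> carrier (S Y)" shows "Smap Y Y (\<lambda>y. y) w = w"
  by (rule S_ext[OF o Smap(1)[OF o o hm_id] hm_id _ _ w]) (use Smap[OF o o hm_id] in auto)

lemma Smap_z:
  assumes o: "ob Y" "ob Y'" and w: "w \<in> carrier (S Y)"
  shows "Smap Y Y' (\<lambda>_. z Y') w = inn Y' (r1 Y w)"
proof -
  have zh: "H Y Y' (\<lambda>_. z Y')" using hm_z o by blast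
  show ?thesis
    by (rule S_ext[OF o(1) Smap(1)[OF o zh] hm_comp[OF r1(1)[OF o(1)] inn[OF o(2)]] _ _ w])
      (use Smap[OF o zh] r1[OF o(1)] z_hm[OF _ _ jn[OF o(2)]] z_hm[OF vX _ inn[OF o(2)]] o S_ob in auto)
qed

lemma r1_Smap:
  assumes o: "ob Y" "ob Y'" and f: "H Y Y' f" and w: "w \<in> carrier (S Y)"
  shows "r1 Y' (Smap Y Y' f w) = r1 Y w"
  by (rule S_ext[OF o(1) hm_comp[OF Smap(1)[OF o f] r1(1)[OF o(2)]] r1(1)[OF o(1)] _ _ w])
    (use Smap[OF o f] r1[OF o(1)] r1[OF o(2)] hm_in[OF f] in auto)

lemma r2_Smap:
  assumes o: "ob Y" "ob Y'" and f: "H Y Y' f" and w: "w \<in> carrier (S Y)"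
  shows "r2 Y' (Smap Y Y' f w) = f (r2 Y w)"
  by (rule S_ext[OF o(1) hm_comp[OF Smap(1)[OF o f] r2(1)[OF o(2)]] hm_comp[OF r2(1)[OF o(1)] f] _ _ w])
    (use Smap[OF o f] r2[OF o(1)] r2[OF o(2)] hm_in[OF f] z_hm[OF _ _ f] o in auto)

text \<open>The cosmash product \<open>X \<diamond> Y\<close>, taken literally as a subset of
  \<open>X + Y\<close>, so that the maps \<open>X \<diamond> f\<close> are restrictions of
  \<open>Smap\<close>.\<close>

definition TT where "TT Y = {w \<in> carrier (S Y). r1 Y w = z X \<and> r2 Y w = z Y}"

abbreviation TA where "TA Y \<equiv> sub_alg (S Y) (TT Y)"

lemma TT_S: "w \<in> TT Y \<Longrightarrow> w \<in> carrier (S Y)" by (simp add: TT_def)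

lemma TT_closed: assumes o: "ob Y" shows "closed ar (S Y) (TT Y)"
proof -
  have c: "closed ar (S Y) {w \<in> carrier (S Y). r1 Y w = z X}"
    "closed ar (S Y) {w \<in> carrier (S Y). r2 Y w = z Y}"
    using closed_ker[OF S_ob(2)[OF o] vX r1(1)[OF o]] closed_ker[OF S_ob(2)[OF o] _ r2(1)[OF o]] o by simp_all
  show ?thesis
  proof (rule closedI)
    fix f xs assume "set xs \<subseteq> TT Y" "length xs = ar f"
    moreover from this have "set xs \<subseteq> {w \<in> carrier (S Y). r1 Y w = z X}"
      "set xs \<subseteq> {w \<in> carrier (S Y). r2 Y w = z Y}" by (auto simp: TT_def)
    ultimately show "oper (S Y) f xs \<in> TT Y" using c unfolding closed_def TT_def by blast
  qed (simp add: TT_def)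
qed

lemma TA_vob: "ob Y \<Longrightarrow> vob ar E (TA Y)"
  by (rule vob_sub[OF S_ob(2) TT_closed])

lemma TA_z: "ob Y \<Longrightarrow> z (TA Y) = z (S Y)"
  using closed_z(2) S_ob(2) TT_closed by blast

lemma Smap_TT:
  assumes "ob Y" "ob Y'" "H Y Y' f" "w \<in> TT Y" shows "Smap Y Y' f w \<in> TT Y'"
  using assms z_hm[of Y Y' f] by (auto simp: TT_def r1_Smap r2_Smap Smap_in)

lemma Smap_TA: assumes "ob Y" "ob Y'" "H Y Y' f" shows "hm ar (TA Y) (TA Y') (Smap Y Y' f)"
  by (rule hm_into_sub[OF hm_sub[OF Smap(1)[OF assms] TT_closed[OF assms(1)]]])
    (use Smap_TT[OF assms] in auto)

text \<open>A further copy of \<open>X + Y\<close> as third summand separates the two arguments of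
  \<open>pl\<close>. In \<open>X + Y + (X + Y)\<close> both sides of the law agree after killing any
  one summand: the third contains one argument, and killing \<open>X\<close> or \<open>Y\<close>
  annihilates the other, which lies in the kernel of
  \<open>X + Y \<rightarrow> X \<times> Y\<close>. Then \<open>NIL\<close> and the fold map
  \<open>\<psi>\<close> give the law in \<open>S Y\<close>.\<close>

lemma TT_abl: assumes o: "ob Y" shows "abl (TA Y)"
  unfolding abl_def
proof (intro conjI allI impI TA_vob[OF o], elim conjE)
  fix f xs ys assume xs: "set xs \<subseteq> carrier (TA Y)" and ys: "set ys \<subseteq> carrier (TA Y)"
    and len: "length xs = ar f" "length ys = ar f"
  note S = S_ob[OF o]
  have xS: "set xs \<subseteq> carrier (S Y)" "set ys \<subseteq> carrier (S Y)" using xs ys TT_S by auto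
  obtain W a b c where t: "tri X Y (S Y) W a b c" using tri_ex[OF X o S(1)] .
  note T = triD[OF t]
  obtain e1 e2 e3 where k: "kills X Y (S Y) W a b c e1 e2 e3" using kills_ex[OF t] .
  define \<phi> where "\<phi> = ext Y W a b"
  note \<phi> = ext[OF o T(1,3,4), folded \<phi>_def]
  obtain \<psi> where \<psi>: "H W (S Y) \<psi>" "\<And>x. x \<in> carrier X \<Longrightarrow> \<psi> (a x) = inn Y x"
    "\<And>x. x \<in> carrier Y \<Longrightarrow> \<psi> (b x) = jn Y x" "\<And>x. x \<in> carrier (S Y) \<Longrightarrow> \<psi> (c x) = x"
    by (rule tri_univ[OF t S(1) inn[OF o] jn[OF o] hm_id]) (rule that)
  have \<psi>\<phi>: "\<psi> (\<phi> w) = w" if "w \<in> carrier (S Y)" for w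
    by (rule S_ext[OF o hm_comp[OF \<phi>(1) \<psi>(1)] hm_id _ _ that]) (use \<phi> \<psi> in auto)
  have e1: "e1 (\<phi> w) = \<phi> w" if "w \<in> carrier (S Y)" for w
    by (rule S_ext[OF o hm_comp[OF \<phi>(1)] \<phi>(1) _ _ that]) (use \<phi> k in \<open>auto simp: kills_def\<close>)
  have e2: "e2 (\<phi> w) = a (r1 Y w)" if "w \<in> carrier (S Y)" for w
    by (rule S_ext[OF o hm_comp[OF \<phi>(1)] hm_comp[OF r1(1)[OF o] T(3)] _ _ that])
      (use \<phi> k r1[OF o] z_hm[OF vX T(2,3)] in \<open>auto simp: kills_def\<close>)
  have e3: "e3 (\<phi> w) = b (r2 Y w)" if "w \<in> carrier (S Y)" for w
    by (rule S_ext[OF o hm_comp[OF \<phi>(1)] hm_comp[OF r2(1)[OF o] T(4)] _ _ that])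
      (use \<phi> k r2[OF o] z_hm[OF _ T(2,4)] o in \<open>auto simp: kills_def\<close>)
  define u u' where "u = map \<phi> xs" and "u' = map c ys"
  have u: "set u \<subseteq> carrier W" "length u = ar f" and u': "set u' \<subseteq> carrier W" "length u' = ar f"
    using xS len \<phi>(1) T(5) by (auto simp: u_def u'_def hm_in)
  define w v where "w = oper W f (map2 (pl W) u u')" and "v = pl W (oper W f u) (oper W f u')"
  have E: "H W W e1" "H W W e2" "H W W e3" using k by (auto simp: kills_def)
  \<comment> \<open>Once one of the two lists becomes zero under \<open>e\<close>, both expressions
    reduce to the operation applied to the other list, \<open>z W\<close> being neutral for
    \<open>pl\<close>.\<close>
  have eq: "e w = e v" if e: "H W W e" and zs: "set (map e u) \<subseteq> {z W} \<or> set (map e u') \<subseteq> {z W}" for e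
  proof -
    have eu: "set (map e u) \<subseteq> carrier W" "set (map e u') \<subseteq> carrier W" using u u' hm_in[OF e] by auto
    note * = map2_pl_hm[OF T(2,2) e u(1) u'(1) u(2) u'(2)]
    have ou: "oper W f (map e u) \<in> carrier W" "oper W f (map e u') \<in> carrier W"
      using alg_op[OF vob_alg[OF T(2)]] eu u(2) u'(2) by auto
    from zs show ?thesis
    proof
      assume zs: "set (map e u) \<subseteq> {z W}"
      have "oper W f (map e u) = z W" using z_op[OF T(2) zs] u by simp
      moreover have "map2 (pl W) (map e u) (map e u') = map e u'"
        using map2_pl_z(2)[OF T(2) eu(2) _ zs] u(2) u'(2) by simp
      ultimately show ?thesis using * ou T(2) by (simp add: w_def v_def del: map_map)
    next
      assume zs: "set (map e u') \<subseteq> {z W}"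
      have "oper W f (map e u') = z W" using z_op[OF T(2) zs] u' by simp
      moreover have "map2 (pl W) (map e u) (map e u') = map e u"
        using map2_pl_z(1)[OF T(2) eu(1) _ zs] u(2) u'(2) by simp
      ultimately show ?thesis using * ou T(2) by (simp add: w_def v_def del: map_map)
    qed
  qed
  have 1: "set (map e1 u') \<subseteq> {z W}" using xS k by (auto simp: u'_def kills_def)
  have 2: "set (map e2 u) \<subseteq> {z W}" using xs xS e2 z_hm[OF vX T(2,3)] by (auto simp: u_def TT_def)
  have 3: "set (map e3 u) \<subseteq> {z W}" using xs xS e3 z_hm[OF _ T(2,4)] o by (auto simp: u_def TT_def)
  have su: "set (map2 (pl W) u u') \<subseteq> carrier W"
    by (rule map2_pl_in[OF T(2) u(1) u'(1)])
  have wv: "w = v"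
  proof (rule NIL[OF X o S(1) t k])
    show "w \<in> carrier W" unfolding w_def by (rule alg_op) (use su u u' T in auto)
    show "v \<in> carrier W" unfolding v_def by (intro pl_in T alg_op) (use u u' T in auto)
  qed (use eq E 1 2 3 in auto)
  have \<psi>u: "map \<psi> u = xs" "map \<psi> u' = ys"
    using xS \<psi>\<phi> \<psi>(4) by (auto simp: u_def u'_def comp_def subset_iff map_idI)
  have "oper (S Y) f (map2 (pl (S Y)) xs ys) = pl (S Y) (oper (S Y) f xs) (oper (S Y) f ys)"
    using map2_pl_hm[OF T(2) S(2) \<psi>(1) u(1) u'(1) u(2) u'(2)] wv by (simp add: w_def v_def \<psi>u)
  moreover have "map2 (pl (TA Y)) xs ys = map2 (pl (S Y)) xs ys"
    using pl_closed(2)[OF S(2) TT_closed[OF o]] xs ys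
    by (auto simp: in_set_zip subset_iff)
  moreover have "oper (S Y) f xs \<in> TT Y" "oper (S Y) f ys \<in> TT Y"
    using TT_closed[OF o] xs ys len by (auto simp: closed_def)
  ultimately show "oper (TA Y) f (map2 (pl (TA Y)) xs ys) = pl (TA Y) (oper (TA Y) f xs) (oper (TA Y) f ys)"
    using pl_closed(2)[OF S(2) TT_closed[OF o]] by (simp del: map_eq_conv)
qed

section \<open>Lifting, bilinearity and generation for cosmash products\<close>

text \<open>Subtracting the \<open>Y\<close>-component corrects a preimage to one in the cosmash product.\<close>

lemma TT_lift:
  assumes o: "ob Y" "ob Y'" and f: "H Y Y' f" and w: "w \<in> carrier (S Y)" and t: "Smap Y Y' f w \<in> TT Y'"
  shows "\<exists>w'\<in>TT Y. Smap Y Y' f w' = Smap Y Y' f w"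
proof
  note S = S_ob(2)[OF o(1)] and S' = S_ob(2)[OF o(2)]
  have r2w: "r2 Y w \<in> carrier Y" using hm_in[OF r2(1)[OF o(1)] w] .
  let ?j = "jn Y (r2 Y w)"
  have j: "?j \<in> carrier (S Y)" using r2w jn_in o by blast
  \<comment> \<open>\<open>Smap\<close> leaves the component in \<open>X\<close> unchanged, so it is
    already zero and only the component in \<open>Y\<close> needs correction.\<close>
  have r1w: "r1 Y w = z X" using t r1_Smap[OF o f w] by (simp add: TT_def)
  have "r1 Y (sb (S Y) w ?j) = z X"
    using sb_hm[OF S vX r1(1)[OF o(1)] w j] r1w r1(3)[OF o(1) r2w] vX by simp
  moreover have "r2 Y (sb (S Y) w ?j) = z Y"
    using sb_hm[OF S _ r2(1)[OF o(1)] w j] r2(3)[OF o(1) r2w] r2w o by simp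
  ultimately show "sb (S Y) w ?j \<in> TT Y" using sb_in[OF S w j] by (simp add: TT_def)
  have "Smap Y Y' f ?j = jn Y' (f (r2 Y w))" using Smap(3)[OF o f r2w] .
  also have "f (r2 Y w) = z Y'" using t r2_Smap[OF o f w] by (simp add: TT_def)
  also have "jn Y' (z Y') = z (S Y')" using z_hm[OF _ S' jn[OF o(2)]] o by blast
  finally show "Smap Y Y' f (sb (S Y) w ?j) = Smap Y Y' f w"
    using sb_hm[OF S S' Smap(1)[OF o f] w j] S' t TT_S by simp
qed

lemma S_surj:
  assumes o: "ob Y" "ob Y'" and f: "H Y Y' f" "f ` carrier Y = carrier Y'"
  shows "Smap Y Y' f ` carrier (S Y) = carrier (S Y')"
proof (rule hm_surj_gen[OF _ Smap(1)[OF o f(1)] _ S_gen[OF o(2)]])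
  show "inn Y' ` carrier X \<union> jn Y' ` carrier Y' \<subseteq> Smap Y Y' f ` carrier (S Y)"
  proof
    fix s assume "s \<in> inn Y' ` carrier X \<union> jn Y' ` carrier Y'"
    then consider x where "x \<in> carrier X" "s = inn Y' x" | y where "y \<in> carrier Y" "s = jn Y' (f y)"
      unfolding f(2)[symmetric] by auto
    then show "s \<in> Smap Y Y' f ` carrier (S Y)"
      by cases (metis Smap(2)[OF o f(1)] inn_in[OF o(1)] imageI, metis Smap(3)[OF o f(1)] jn_in[OF o(1)] imageI)
  qed
qed (use S_ob o in auto)

lemma TT_surj:
  assumes o: "ob Y" "ob Y'" and f: "H Y Y' f" "f ` carrier Y = carrier Y'" and w: "w \<in> TT Y'"
  shows "\<exists>w'\<in>TT Y. Smap Y Y' f w' = w"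
proof -
  have "w \<in> Smap Y Y' f ` carrier (S Y)" using S_surj[OF o f] TT_S[OF w] by blast
  then obtain v where "v \<in> carrier (S Y)" "Smap Y Y' f v = w" by blast
  then show ?thesis using TT_lift[OF o f(1), of v] w by auto
qed

text \<open>Bilinearity: both sides agree after killing any one of \<open>X\<close>, \<open>Q\<close>, \<open>Q'\<close>.\<close>

lemma TT_sum:
  assumes o: "ob Q" "ob Q'" and c: "cop Q Q' D i j" and w: "w \<in> TT D"
    and r: "H D Q r" "\<And>x. x \<in> carrier Q \<Longrightarrow> r (i x) = x" "\<And>x. x \<in> carrier Q' \<Longrightarrow> r (j x) = z Q"
    and r': "H D Q' r'" "\<And>x. x \<in> carrier Q \<Longrightarrow> r' (i x) = z Q'" "\<And>x. x \<in> carrier Q' \<Longrightarrow> r' (j x) = x"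
  shows "w = pl (S D) (Smap Q D i (Smap D Q r w)) (Smap Q' D j (Smap D Q' r' w))"
proof -
  note C = copD[OF c]
  note D = C(1)
  note SD = S_ob[OF D]
  have t: "tri X Q Q' (S D) (inn D) (\<lambda>x. jn D (i x)) (\<lambda>x. jn D (j x))"
    by (rule cop_tri[OF Scop[OF D] c])
  obtain e1 e2 e3 where k: "kills X Q Q' (S D) (inn D) (\<lambda>x. jn D (i x)) (\<lambda>x. jn D (j x)) e1 e2 e3"
    using kills_ex[OF t] .
  have E: "H (S D) (S D) e1" "H (S D) (S D) e2" "H (S D) (S D) e3" using k by (auto simp: kills_def)
  have wS: "w \<in> carrier (S D)" using TT_S[OF w] .
  let ?w1 = "Smap Q D i (Smap D Q r w)" and ?w2 = "Smap Q' D j (Smap D Q' r' w)"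
  have ir: "H D D (\<lambda>x. i (r x))" "H D D (\<lambda>x. j (r' x))"
    using hm_comp[OF r(1) C(3)] hm_comp[OF r'(1) C(4)] .
  have w1: "?w1 = Smap D D (\<lambda>x. i (r x)) w" by (rule Smap_comp[OF D o(1) D r(1) C(3) wS])
  have w2: "?w2 = Smap D D (\<lambda>x. j (r' x)) w" by (rule Smap_comp[OF D o(2) D r'(1) C(4) wS])
  have wT: "?w1 \<in> TT D" "?w2 \<in> TT D" unfolding w1 w2 using Smap_TT[OF D D] ir w by blast+
  then have wTS: "?w1 \<in> carrier (S D)" "?w2 \<in> carrier (S D)" using TT_S by blast+
  have iz: "i (z Q) = z D" "j (z Q') = z D" "jn D (z D) = z (S D)"
    using z_hm[OF _ C(2) C(3)] z_hm[OF _ C(2) C(4)] z_hm[OF C(2) SD(2) jn[OF D]] o by auto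
  have ext3: "h s = h' s" if "H (S D) (S D) h" "H (S D) (S D) h'"
      "\<And>x. x \<in> carrier X \<Longrightarrow> h (inn D x) = h' (inn D x)"
      "\<And>x. x \<in> carrier Q \<Longrightarrow> h (jn D (i x)) = h' (jn D (i x))"
      "\<And>x. x \<in> carrier Q' \<Longrightarrow> h (jn D (j x)) = h' (jn D (j x))" "s \<in> carrier (S D)" for h h' s
    using tri_ext[OF t, of "S D" h h' s] that by blast
  note s1 = Smap[OF D D ir(1)] and s2 = Smap[OF D D ir(2)]
  have ijD: "x \<in> carrier Q \<Longrightarrow> i x \<in> carrier D" "y \<in> carrier Q' \<Longrightarrow> j y \<in> carrier D" for x y
    using hm_in[OF C(3)] hm_in[OF C(4)] by blast+
  \<comment> \<open>On \<open>X + D\<close> the map killing \<open>Q'\<close> is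
    \<open>X + i r\<close>, the one killing \<open>Q\<close> is \<open>X + j r'\<close>, and the one
    killing \<open>X\<close> is the projection to \<open>D\<close> followed by \<open>jn D\<close>;
    the last vanishes on the cosmash product.\<close>
  have a1: "e1 s = Smap D D (\<lambda>x. i (r x)) s" if "s \<in> carrier (S D)" for s
    by (rule ext3[OF E(1) s1(1) _ _ _ that]) (use k s1 r iz ijD in \<open>auto simp: kills_def\<close>)
  have a2: "e2 s = Smap D D (\<lambda>x. j (r' x)) s" if "s \<in> carrier (S D)" for s
    by (rule ext3[OF E(2) s2(1) _ _ _ that]) (use k s2 r' iz ijD in \<open>auto simp: kills_def\<close>)
  have a3: "e3 s = jn D (r2 D s)" if "s \<in> carrier (S D)" for s
    by (rule ext3[OF E(3) hm_comp[OF r2(1)[OF D] jn[OF D]] _ _ _ that])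
      (use k r2[OF D] iz ijD in \<open>auto simp: kills_def\<close>)
  have zx: "Smap D D f s = z (S D)"
    if "s \<in> TT D" "\<And>x. x \<in> carrier D \<Longrightarrow> f x = z D" for f s
  proof -
    have "Smap D D f s = Smap D D (\<lambda>_. z D) s"
      by (rule Smap_cong[OF D D hm_z[OF C(2)]]) (use that TT_S in auto)
    also have "\<dots> = z (S D)"
      using Smap_z[OF D D TT_S[OF that(1)]] that(1) z_hm[OF vX SD(2) inn[OF D]] by (simp add: TT_def)
    finally show ?thesis .
  qed
  have rD: "x \<in> carrier D \<Longrightarrow> r x \<in> carrier Q" "x \<in> carrier D \<Longrightarrow> r' x \<in> carrier Q'" for x
    using hm_in[OF r(1)] hm_in[OF r'(1)] by blast+
  have "e1 ?w1 = ?w1" "e2 ?w2 = ?w2"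
    unfolding a1[OF wTS(1)] a2[OF wTS(2)] unfolding w1 w2
    using Smap_comp[OF D D D ir(1) ir(1) wS] Smap_comp[OF D D D ir(2) ir(2) wS] rD r(2) r'(3)
      Smap_cong[OF D D ir(1) _ wS, of "\<lambda>x. i (r (i (r x)))"] Smap_cong[OF D D ir(2) _ wS, of "\<lambda>x. j (r' (j (r' x)))"]
    by auto
  moreover have "e1 ?w2 = z (S D)" "e2 ?w1 = z (S D)"
    unfolding a1[OF wTS(2)] a2[OF wTS(1)] unfolding w1 w2
    using Smap_comp[OF D D D ir(2) ir(1) wS] Smap_comp[OF D D D ir(1) ir(2) wS]
      zx[OF w, of "\<lambda>x. i (r (j (r' x)))"] zx[OF w, of "\<lambda>x. j (r' (i (r x)))"] rD r r' iz by auto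
  moreover have "e3 s = z (S D)" if "s \<in> TT D" for s
    using a3[OF TT_S[OF that]] that iz by (simp add: TT_def)
  moreover have "e1 w = ?w1" "e2 w = ?w2" using a1[OF wS] a2[OF wS] w1 w2 by auto
  moreover note pl_hm[OF SD(2) SD(2) E(1) wTS] pl_hm[OF SD(2) SD(2) E(2) wTS] pl_hm[OF SD(2) SD(2) E(3) wTS]
  ultimately show ?thesis
    by (intro NIL[OF X o t k wS]) (use wT wTS SD(2) w in \<open>auto simp: pl_in\<close>)
qed

text \<open>Jointly generating families \<open>f\<^sub>k : Y\<^sub>k \<rightarrow> Y\<close> induce jointly generating families of cosmash
  products. Here \<open>good Y U Q f\<close> says that \<open>f : Q \<rightarrow> Y\<close> induces a map into the subalgebra \<open>U\<close>;
  good maps are closed under copairing, and every element of \<open>S Y\<close> comes from a good map.\<close>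

definition good where
  "good Y U Q f \<longleftrightarrow> ob Q \<and> H Q Y f \<and> (\<forall>w\<in>TT Q. Smap Q Y f w \<in> U)"

text \<open>By \<open>TT_sum\<close> an element of \<open>TT D\<close> is the \<open>pl\<close> of
  one coming from \<open>TT Q\<close> and one from \<open>TT Q'\<close>; \<open>h\<close> sends both
  into \<open>U\<close>, which is closed under \<open>pl\<close>.\<close>

lemma good_sum:
  assumes o: "ob Y" and U: "closed ar (S Y) U" and g: "good Y U Q f" and g': "good Y U Q' f'"
    and c: "cop Q Q' D i j" and h: "H D Y h" "\<And>x. x \<in> carrier Q \<Longrightarrow> h (i x) = f x"
      "\<And>x. x \<in> carrier Q' \<Longrightarrow> h (j x) = f' x"
  shows "good Y U D h"
  unfolding good_def
proof (intro conjI ballI)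
  note C = copD[OF c]
  have Q: "ob Q" "ob Q'" "H Q Y f" "H Q' Y f'" using g g' by (auto simp: good_def)
  then have vQ: "vob ar E Q" "vob ar E Q'" by auto
  obtain r where r: "H D Q r" "\<And>x. x \<in> carrier Q \<Longrightarrow> r (i x) = x" "\<And>x. x \<in> carrier Q' \<Longrightarrow> r (j x) = z Q"
    by (rule cop_univ[OF c Q(1) hm_id hm_z[OF vQ(1)]]) (rule that)
  obtain r' where r': "H D Q' r'" "\<And>x. x \<in> carrier Q \<Longrightarrow> r' (i x) = z Q'" "\<And>x. x \<in> carrier Q' \<Longrightarrow> r' (j x) = x"
    by (rule cop_univ[OF c Q(2) hm_z[OF vQ(2)] hm_id]) (rule that)
  fix w assume w: "w \<in> TT D"
  let ?a = "Smap D Q r w" and ?b = "Smap D Q' r' w"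
  have ab: "?a \<in> TT Q" "?b \<in> TT Q'" using Smap_TT[OF C(1) Q(1) r(1) w] Smap_TT[OF C(1) Q(2) r'(1) w] .
  have abS: "Smap Q D i ?a \<in> carrier (S D)" "Smap Q' D j ?b \<in> carrier (S D)"
    using Smap_in[OF Q(1) C(1,3)] Smap_in[OF Q(2) C(1,4)] ab TT_S by blast+
  have "w = pl (S D) (Smap Q D i ?a) (Smap Q' D j ?b)"
    by (rule TT_sum[OF Q(1,2) c w r r'])
  then have "Smap D Y h w = pl (S Y) (Smap D Y h (Smap Q D i ?a)) (Smap D Y h (Smap Q' D j ?b))"
    using pl_hm[OF S_ob(2)[OF C(1)] S_ob(2)[OF o] Smap(1)[OF C(1) o h(1)] abS] by simp
  also have "Smap D Y h (Smap Q D i ?a) = Smap Q Y f ?a"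
    using Smap_comp[OF Q(1) C(1) o C(3) h(1) TT_S[OF ab(1)]] Smap_cong[OF Q(1) o Q(3), of "\<lambda>x. h (i x)"] h(2) TT_S[OF ab(1)] by simp
  also have "Smap D Y h (Smap Q' D j ?b) = Smap Q' Y f' ?b"
    using Smap_comp[OF Q(2) C(1) o C(4) h(1) TT_S[OF ab(2)]] Smap_cong[OF Q(2) o Q(4), of "\<lambda>x. h (j x)"] h(3) TT_S[OF ab(2)] by simp
  finally show "Smap D Y h w \<in> U"
    using pl_closed(1)[OF S_ob(2)[OF o] U] g g' ab by (auto simp: good_def)
qed (use copD[OF c] h in auto)

lemma TT_generated:
  assumes o: "ob Y" and U: "closed ar (S Y) U"
    and F: "\<And>k. k \<in> K \<Longrightarrow> good Y U (Yk k) (f k)"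
    and gen: "carrier Y = gen ar Y (\<Union>k\<in>K. f k ` carrier (Yk k))"
  shows "TT Y \<subseteq> U"
proof -
  let ?T = "triv (z Y)"
  \<comment> \<open>The one-element algebra accounts for the elements of \<open>X\<close> and for
    the empty list.\<close>
  have triv: "good Y U ?T (\<lambda>_. z Y)"
    unfolding good_def
  proof (intro conjI ballI)
    fix w assume w: "w \<in> TT ?T"
    have "Smap ?T Y (\<lambda>_. z Y) w = inn Y (r1 ?T w)"
      by (rule Smap_z[OF triv_ob o TT_S[OF w]])
    then show "Smap ?T Y (\<lambda>_. z Y) w \<in> U"
      using w z_hm[OF vX S_ob(2)[OF o] inn[OF o]] closed_z(1)[OF S_ob(2)[OF o] U] by (simp add: TT_def)
  qed (use triv_ob hm_z o in auto)
  define V where "V = {u \<in> carrier (S Y). \<exists>Q g v. good Y U Q g \<and> v \<in> carrier (S Q) \<and> Smap Q Y g v = u}"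
  \<comment> \<open>Operations take several arguments, so closure of \<open>V\<close> requires that
    finitely many elements come from a single good map; such maps are merged by repeated
    copairing.\<close>
  have lists: "\<exists>Q g vs. good Y U Q g \<and> set vs \<subseteq> carrier (S Q) \<and> map (Smap Q Y g) vs = us" if "set us \<subseteq> V" for us
    using that
  proof (induct us)
    case Nil
    show ?case using triv by (intro exI[of _ ?T] exI[of _ "\<lambda>_. z Y"] exI[of _ "[]"]) simp
  next
    case (Cons u us)
    then obtain Q g vs where g: "good Y U Q g" "set vs \<subseteq> carrier (S Q)" "map (Smap Q Y g) vs = us" by auto
    obtain Q' g' v where g': "good Y U Q' g'" "v \<in> carrier (S Q')" "Smap Q' Y g' v = u"
      using Cons.prems by (auto simp: V_def)
    have Q: "ob Q" "ob Q'" "H Q Y g" "H Q' Y g'" using g g' by (auto simp: good_def)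
    obtain D i j where c: "cop Q Q' D i j" using cop2_ex[OF Q(1,2)] .
    note C = copD[OF c]
    obtain h where h: "H D Y h" "\<And>x. x \<in> carrier Q \<Longrightarrow> h (i x) = g x" "\<And>x. x \<in> carrier Q' \<Longrightarrow> h (j x) = g' x"
      by (rule cop_univ[OF c o Q(3,4)]) (rule that)
    have gd: "good Y U D h" by (rule good_sum[OF o U g(1) g'(1) c h])
    have a: "Smap D Y h (Smap Q D i x) = Smap Q Y g x" if "x \<in> carrier (S Q)" for x
      using Smap_comp[OF Q(1) C(1) o C(3) h(1) that] Smap_cong[OF Q(1) o Q(3) _ that, of "\<lambda>x. h (i x)"] h(2) by simp
    have b: "Smap D Y h (Smap Q' D j x) = Smap Q' Y g' x" if "x \<in> carrier (S Q')" for x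
      using Smap_comp[OF Q(2) C(1) o C(4) h(1) that] Smap_cong[OF Q(2) o Q(4) _ that, of "\<lambda>x. h (j x)"] h(3) by simp
    show ?case
    proof (intro exI conjI)
      show "good Y U D h" by (rule gd)
      show "set (Smap Q' D j v # map (Smap Q D i) vs) \<subseteq> carrier (S D)"
        using g(2) g'(2) Smap_in[OF Q(1) C(1,3)] Smap_in[OF Q(2) C(1,4)] by auto
      show "map (Smap D Y h) (Smap Q' D j v # map (Smap Q D i) vs) = u # us"
        using g(2,3) g'(2,3) a b by (auto simp: subset_iff)
    qed
  qed
  have Vcl: "closed ar (S Y) V"
  proof (rule closedI)
    fix fo us assume *: "set us \<subseteq> V" "length us = ar fo"
    then obtain Q g vs where g: "good Y U Q g" "set vs \<subseteq> carrier (S Q)" "map (Smap Q Y g) vs = us"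
      using lists by blast
    have Q: "ob Q" "H Q Y g" using g by (auto simp: good_def)
    have len: "length vs = ar fo" using g(3) *(2) by auto
    have 1: "oper (S Q) fo vs \<in> carrier (S Q)" by (rule alg_op[OF vob_alg[OF S_ob(2)[OF Q(1)]] g(2) len])
    have 2: "Smap Q Y g (oper (S Q) fo vs) = oper (S Y) fo us"
      using hm_op[OF Smap(1)[OF Q(1) o Q(2)] g(2) len] g(3) by simp
    show "oper (S Y) fo us \<in> V"
      unfolding V_def using 1 2 g(1) Smap_in[OF Q(1) o Q(2) 1] by (intro CollectI conjI exI[of _ Q] exI[of _ g] exI) auto
  qed (simp add: V_def)
  have inV: "inn Y x \<in> V" if "x \<in> carrier X" for x
  proof -
    have "Smap ?T Y (\<lambda>_. z Y) (inn ?T x) = inn Y x"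
      by (rule Smap(2)[OF triv_ob o hm_z that]) (use o in auto)
    then show ?thesis unfolding V_def using triv inn_in[OF o that] inn_in[OF triv_ob that]
      by (intro CollectI conjI exI[of _ ?T] exI[of _ "\<lambda>_. z Y"] exI[of _ "inn ?T x"]) auto
  qed
  let ?G = "\<Union>k\<in>K. f k ` carrier (Yk k)"
  have K: "ob (Yk k)" "H (Yk k) Y (f k)" if "k \<in> K" for k using F[OF that] by (auto simp: good_def)
  have jV: "jn Y y \<in> V" if "y \<in> ?G" for y
  proof -
    obtain k x where kx: "k \<in> K" "x \<in> carrier (Yk k)" "y = f k x" using \<open>y \<in> ?G\<close> by blast
    have "Smap (Yk k) Y (f k) (jn (Yk k) x) = jn Y y"
      using Smap(3)[OF K(1)[OF kx(1)] o K(2)[OF kx(1)] kx(2)] kx(3) by simp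
    moreover have "y \<in> carrier Y" using hm_in[OF K(2)[OF kx(1)] kx(2)] kx by simp
    ultimately show ?thesis unfolding V_def
      using F[OF kx(1)] jn_in[OF o] jn_in[OF K(1)[OF kx(1)] kx(2)]
      by (intro CollectI conjI exI[of _ "Yk k"] exI[of _ "f k"] exI[of _ "jn (Yk k) x"]) auto
  qed
  have GY: "?G \<subseteq> carrier Y" using hm_in[OF K(2)] by auto
  have "jn Y y \<in> V" if "y \<in> carrier Y" for y
  proof -
    have "jn Y y \<in> gen ar (S Y) (jn Y ` ?G)"
      by (rule hm_gen[OF _ GY jn[OF o]]) (use gen that o in \<open>simp_all only: vob_alg\<close>)
    moreover have "gen ar (S Y) (jn Y ` ?G) \<subseteq> V" by (rule gen_least[OF Vcl]) (use jV in auto)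
    ultimately show ?thesis by blast
  qed
  then have "gen ar (S Y) (inn Y ` carrier X \<union> jn Y ` carrier Y) \<subseteq> V"
    by (intro gen_least[OF Vcl]) (use inV in auto)
  then have all: "carrier (S Y) \<subseteq> V" using S_gen[OF o] by simp
  show ?thesis
  proof
    fix w assume w: "w \<in> TT Y"
    then obtain Q g v where g: "good Y U Q g" "v \<in> carrier (S Q)" "Smap Q Y g v = w"
      using subsetD[OF all TT_S[OF w]] unfolding V_def by blast
    have Q: "ob Q" "H Q Y g" using g by (auto simp: good_def)
    \<comment> \<open>The preimage \<open>v\<close> lies only in \<open>S Q\<close>;
      \<open>TT_lift\<close> moves it into the cosmash product, where goodness applies.\<close>
    obtain v' where "v' \<in> TT Q" "Smap Q Y g v' = w"
      using TT_lift[OF Q(1) o Q(2) g(2)] g(3) w by auto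
    then show "w \<in> U" using g(1) by (auto simp: good_def)
  qed
qed

end

section \<open>Abelian algebras and finite sums\<close>

text \<open>An abelian algebra is not assumed to satisfy \<open>P\<close>, so its square is formed
  in the class with trivial \<open>P\<close>.\<close>

lemma (in alg_class) vprod_ex:
  fixes A B :: "('f, 'u) alg"
  assumes "vob ar E A" and "vob ar E B"
  obtains Q p q where "vob ar E Q" "H Q A p" "H Q B q"
    "\<And>a b. a \<in> carrier A \<Longrightarrow> b \<in> carrier B \<Longrightarrow> \<exists>z\<in>carrier Q. p z = a \<and> q z = b"
    "\<And>z z'. z \<in> carrier Q \<Longrightarrow> z' \<in> carrier Q \<Longrightarrow> p z = p z' \<Longrightarrow> q z = q z' \<Longrightarrow> z = z'"
proof -
  have "alg_class ar E (\<lambda>_ :: ('f, 'u) alg. True)" by unfold_locales (use inf card wfE in auto)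
  then show thesis by (rule alg_class.prod_ex[of ar E "\<lambda>_. True" A B]) (use assms that in auto)
qed

lemma product_hm:
  assumes Q: "is_alg ar Q" "hm ar Q A p" "hm ar Q B q"
    and ex: "\<And>a b. a \<in> carrier A \<Longrightarrow> b \<in> carrier B \<Longrightarrow> \<exists>z\<in>carrier Q. p z = a \<and> q z = b"
    and inj: "\<And>z z'. z \<in> carrier Q \<Longrightarrow> z' \<in> carrier Q \<Longrightarrow> p z = p z' \<Longrightarrow> q z = q z' \<Longrightarrow> z = z'"
    and Y: "is_alg ar Y" "hm ar Y A f" "hm ar Y B g"
  obtains h where "hm ar Y Q h" "\<And>y. y \<in> carrier Y \<Longrightarrow> p (h y) = f y" "\<And>y. y \<in> carrier Y \<Longrightarrow> q (h y) = g y"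
proof -
  define h where "h = (\<lambda>y. SOME z. z \<in> carrier Q \<and> p z = f y \<and> q z = g y)"
  have h: "h y \<in> carrier Q \<and> p (h y) = f y \<and> q (h y) = g y" if "y \<in> carrier Y" for y
    unfolding h_def by (rule someI_ex) (use ex[OF hm_in[OF Y(2) that] hm_in[OF Y(3) that]] in blast)
  have "hm ar Y Q h"
  proof (rule hmI)
    fix fo xs assume *: "set xs \<subseteq> carrier Y" "length xs = ar fo"
    have hx: "set (map h xs) \<subseteq> carrier Q" "length (map h xs) = ar fo" using * h by auto
    have o: "oper Y fo xs \<in> carrier Y" using alg_op[OF Y(1) *] .
    have "map p (map h xs) = map f xs" "map q (map h xs) = map g xs" using * h by auto
    then show "h (oper Y fo xs) = oper Q fo (map h xs)"
      using h[OF o] hm_op[OF Y(2) *] hm_op[OF Y(3) *] hm_op[OF Q(2) hx] hm_op[OF Q(3) hx] alg_op[OF Q(1) hx]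
      by (intro inj) (simp_all del: map_map map_eq_conv)
  qed (use h in blast)
  then show thesis using that h by blast
qed

context maltsev_class
begin

lemma abl_vob: "abl A \<Longrightarrow> vob ar E A" by (simp add: abl_def)

lemma abl_hm:
  assumes A: "abl A" and Q: "is_alg ar Q" "H Q A p" "H Q A q"
  shows "H Q A (\<lambda>w. pl A (p w) (q w))"
proof (rule hmI)
  note vA = abl_vob[OF A]
  fix f ws assume *: "set ws \<subseteq> carrier Q" "length ws = ar f"
  have "set (map p ws) \<subseteq> carrier A" "set (map q ws) \<subseteq> carrier A"
    using * hm_in[OF Q(2)] hm_in[OF Q(3)] by auto
  moreover have "length (map p ws) = ar f" "length (map q ws) = ar f" using * by auto
  ultimately have "oper A f (map2 (pl A) (map p ws) (map q ws)) = pl A (oper A f (map p ws)) (oper A f (map q ws))"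
    using A unfolding abl_def by blast
  then show "pl A (p (oper Q f ws)) (q (oper Q f ws)) = oper A f (map (\<lambda>w. pl A (p w) (q w)) ws)"
    using hm_op[OF Q(2) *] hm_op[OF Q(3) *] by (simp add: map2_map_map)
qed (use pl_in[OF abl_vob[OF A]] hm_in[OF Q(2)] hm_in[OF Q(3)] in auto)

text \<open>\<open>mal\<close> is known to be natural but not to be a term, so the interchange law
  is obtained from naturality along the homomorphism \<open>pl\<close> on the product
  \<open>Q\<close>.\<close>

lemma abl_mal:
  assumes A: "abl A" and c: "a1 \<in> carrier A" "a2 \<in> carrier A" "a3 \<in> carrier A"
    "b1 \<in> carrier A" "b2 \<in> carrier A" "b3 \<in> carrier A"
  shows "mal A (pl A a1 b1) (pl A a2 b2) (pl A a3 b3) = pl A (mal A a1 a2 a3) (mal A b1 b2 b3)"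
proof -
  note vA = abl_vob[OF A]
  obtain Q p q where Q: "vob ar E Q" "H Q A p" "H Q A q"
    and ex: "\<And>a b. a \<in> carrier A \<Longrightarrow> b \<in> carrier A \<Longrightarrow> \<exists>z\<in>carrier Q. p z = a \<and> q z = b"
    by (rule vprod_ex[OF vA vA]) (rule that)
  obtain w1 w2 w3 where w: "w1 \<in> carrier Q" "p w1 = a1" "q w1 = b1" "w2 \<in> carrier Q" "p w2 = a2" "q w2 = b2"
    "w3 \<in> carrier Q" "p w3 = a3" "q w3 = b3"
    using ex[OF c(1,4)] ex[OF c(2,5)] ex[OF c(3,6)] by blast
  have m: "H Q A (\<lambda>w. pl A (p w) (q w))" by (rule abl_hm[OF A vob_alg[OF Q(1)] Q(2,3)])
  show ?thesis
    using mal_hm[OF Q(1) vA m w(1,4,7)] mal_hm[OF Q(1) vA Q(2) w(1,4,7)] mal_hm[OF Q(1) vA Q(3) w(1,4,7)] w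
    by simp
qed

text \<open>Eckmann-Hilton.\<close>

lemma abl_pl:
  assumes A: "abl A"
  shows abl_comm: "a \<in> carrier A \<Longrightarrow> b \<in> carrier A \<Longrightarrow> pl A a b = pl A b a"
    and abl_assoc: "a \<in> carrier A \<Longrightarrow> b \<in> carrier A \<Longrightarrow> c \<in> carrier A \<Longrightarrow>
      pl A (pl A a b) c = pl A a (pl A b c)"
    and abl_inv: "a \<in> carrier A \<Longrightarrow> pl A (sb A (z A) a) a = z A"
proof -
  note vA = abl_vob[OF A]
  have zz: "z A \<in> carrier A" using vA by simp
  have x: "pl A (pl A a b) (pl A c d) = pl A (pl A a c) (pl A b d)"
    if "a \<in> carrier A" "b \<in> carrier A" "c \<in> carrier A" "d \<in> carrier A" for a b c d
    using abl_mal[OF A that(1) zz that(3) that(2) zz that(4)] vA by (simp add: pl_def[of A "pl A a b"] pl_def[of A a c] pl_def[of A b d])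
  show "pl A a b = pl A b a" if "a \<in> carrier A" "b \<in> carrier A"
    using x[OF zz that(2,1) zz] vA that by simp
  show "pl A (pl A a b) c = pl A a (pl A b c)" if "a \<in> carrier A" "b \<in> carrier A" "c \<in> carrier A"
    using x[OF that(1,2) zz that(3)] vA that by (simp add: pl_in)
  \<comment> \<open>Interchange for \<open>mal 0 a 0\<close> and \<open>mal a 0 0\<close>: their sum
    is \<open>mal a a 0 = 0\<close>, and the second one equals \<open>a\<close>.\<close>
  show "pl A (sb A (z A) a) a = z A" if "a \<in> carrier A"
    using abl_mal[OF A zz that zz that zz zz] vA that by (simp add: sb_def mal1 mal2)
qed

text \<open>The guard makes the folded function commute with itself on the whole type
  \<open>'u\<close>, as \<open>comp_fun_commute\<close> demands; for summands in the carrier it is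
  always satisfied.\<close>

definition ssum :: "('f, 'u) alg \<Rightarrow> ('k \<Rightarrow> 'u) \<Rightarrow> 'k set \<Rightarrow> 'u" where
  "ssum A g I = Finite_Set.fold
     (\<lambda>i s. if s \<in> carrier A \<and> g i \<in> carrier A then pl A (g i) s else s) (z A) I"

lemma ssum_empty [simp]: "ssum A g {} = z A" by (simp add: ssum_def)

lemma ssum_in_insert:
  assumes A: "abl A" and I: "finite I" "\<And>i. i \<in> I \<Longrightarrow> g i \<in> carrier A"
  shows ssum_in: "ssum A g I \<in> carrier A"
    and ssum_insert: "i \<notin> I \<Longrightarrow> g i \<in> carrier A \<Longrightarrow> ssum A g (insert i I) = pl A (g i) (ssum A g I)"
proof -
  note vA = abl_vob[OF A]
  let ?f = "\<lambda>i s. if s \<in> carrier A \<and> g i \<in> carrier A then pl A (g i) s else s"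
  have l: "pl A (g i) (pl A (g j) s) = pl A (g j) (pl A (g i) s)"
    if "g i \<in> carrier A" "g j \<in> carrier A" "s \<in> carrier A" for i j s
    using abl_assoc[OF A, of "g i" "g j" s] abl_assoc[OF A, of "g j" "g i" s] abl_comm[OF A, of "g i" "g j"] that by simp
  interpret comp_fun_commute ?f
    by unfold_locales (auto simp: fun_eq_iff pl_in[OF vA] l)
  have ins: "ssum A g (insert i I) = ?f i (ssum A g I)" if "finite I" "i \<notin> I" for i I
    unfolding ssum_def using fold_insert[OF that] by simp
  show c: "ssum A g I \<in> carrier A"
    using I
  proof (induct rule: finite_induct)
    case (insert i I)
    then show ?case using ins[of I i] pl_in[OF vA, of "g i" "ssum A g I"] by simp
  qed (use vA in simp)
  show "ssum A g (insert i I) = pl A (g i) (ssum A g I)" if "i \<notin> I" "g i \<in> carrier A"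
    using ins[OF I(1) that(1)] that(2) c by simp
qed

lemma ssum_cong:
  assumes A: "abl A" and "finite I" "\<And>i. i \<in> I \<Longrightarrow> g i \<in> carrier A" "\<And>i. i \<in> I \<Longrightarrow> g i = g' i"
  shows "ssum A g I = ssum A g' I"
  using assms(2-4)
proof (induct rule: finite_induct)
  case (insert i I)
  then have "ssum A g (insert i I) = pl A (g i) (ssum A g I)"
    by (intro ssum_insert[OF A]) auto
  moreover have "ssum A g' (insert i I) = pl A (g' i) (ssum A g' I)"
    by (intro ssum_insert[OF A]) (use insert in \<open>auto; metis\<close>)+
  ultimately show ?case using insert by simp
qed simp

lemma ssum_neutral:
  assumes A: "abl A" and "finite K" "finite I" "\<And>i. i \<in> I \<union> K \<Longrightarrow> g i \<in> carrier A"
    "\<And>i. i \<in> K \<Longrightarrow> g i = z A" "I \<inter> K = {}"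
  shows "ssum A g (I \<union> K) = ssum A g I"
  using assms(2-)
proof (induct rule: finite_induct)
  case (insert k K)
  have "ssum A g (insert k (I \<union> K)) = pl A (g k) (ssum A g (I \<union> K))"
    by (intro ssum_insert[OF A]) (use insert abl_vob[OF A] in auto)
  also have "\<dots> = ssum A g (I \<union> K)"
    using insert pl_z(2)[OF abl_vob[OF A] ssum_in[OF A, of "I \<union> K" g]] by simp
  finally show ?case using insert by simp
qed simp

text \<open>The law in \<open>abl\<close>, iterated: finite sums of homomorphisms into an abelian
  algebra are homomorphisms, which is how it is applied to \<open>ev0\<close>.\<close>

lemma ssum_op:
  assumes A: "abl A" and I: "finite I" and len: "length ws = ar f"
    and g: "\<And>w i. w \<in> set ws \<Longrightarrow> i \<in> I \<Longrightarrow> g w i \<in> carrier A"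
  shows "oper A f (map (\<lambda>w. ssum A (g w) I) ws) = ssum A (\<lambda>i. oper A f (map (\<lambda>w. g w i) ws)) I"
  using I g
proof (induct rule: finite_induct)
  case empty
  then show ?case using z_op[OF abl_vob[OF A], of "map (\<lambda>w. z A) ws" f] len by auto
next
  case (insert k I)
  note vA = abl_vob[OF A]
  have s: "ssum A (g w) I \<in> carrier A" if "w \<in> set ws" for w
    using ssum_in[OF A insert(1)] insert(4) that by blast
  have o: "oper A f (map (\<lambda>w. g w i) ws) \<in> carrier A" if "i \<in> insert k I" for i
    by (rule alg_op) (use insert(4) that len vA in auto)
  let ?u = "map (\<lambda>w. g w k) ws" and ?v = "map (\<lambda>w. ssum A (g w) I) ws"
  have "map (\<lambda>w. ssum A (g w) (insert k I)) ws = map (\<lambda>w. pl A (g w k) (ssum A (g w) I)) ws"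
    using ssum_insert[OF A insert(1) _ insert(2)] insert(4) by auto
  then have 1: "map (\<lambda>w. ssum A (g w) (insert k I)) ws = map2 (pl A) ?u ?v"
    by (simp only: map2_map_map)
  have "set ?u \<subseteq> carrier A" "set ?v \<subseteq> carrier A" "length ?u = ar f" "length ?v = ar f"
    using insert(4) s len by auto
  then have 2: "oper A f (map2 (pl A) ?u ?v) = pl A (oper A f ?u) (oper A f ?v)"
    using A unfolding abl_def by blast
  have 3: "oper A f ?v = ssum A (\<lambda>i. oper A f (map (\<lambda>w. g w i) ws)) I"
    using insert(3,4) by blast
  have 4: "ssum A (\<lambda>i. oper A f (map (\<lambda>w. g w i) ws)) (insert k I) =
      pl A (oper A f ?u) (ssum A (\<lambda>i. oper A f (map (\<lambda>w. g w i) ws)) I)"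
    by (rule ssum_insert[OF A insert(1) _ insert(2)]) (use o in auto)
  show ?case unfolding 1 2 3 4 ..
qed

end

section \<open>The cosmash product preserves colimits\<close>

context nilpotent_class
begin

text \<open>The cocone \<open>d\<close> on the cosmash products is induced by a cocone \<open>e\<close> on the diagram itself: its
  apex \<open>B\<close> is the quotient of the coproduct \<open>B0\<close> of the diagram by the relation \<open>R\<close> generated by the
  diagonal and the arrows. On \<open>B0\<close> the map \<open>ev0\<close> is defined by means of the retractions \<open>\<rho>\<close>.\<close>

lemma cocone_factor:
  fixes I :: "'k set" and Ar :: "('k \<times> 'k \<times> ('u \<Rightarrow> 'u)) set"
  assumes I: "I \<lesssim> (UNIV :: 'u set)" and G: "\<And>i. i \<in> I \<Longrightarrow> ob (G i)"
    and Ar: "\<And>i j g. (i, j, g) \<in> Ar \<Longrightarrow> i \<in> I \<and> j \<in> I \<and> H (G i) (G j) g"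
    and A: "abl A" and d: "\<And>i. i \<in> I \<Longrightarrow> hm ar (TA (G i)) A (d i)"
    and dc: "\<And>i j g w. (i, j, g) \<in> Ar \<Longrightarrow> w \<in> TT (G i) \<Longrightarrow> d j (Smap (G i) (G j) g w) = d i w"
  obtains B e ev where "ob B" "\<And>i. i \<in> I \<Longrightarrow> H (G i) B (e i)"
    "\<And>i j g x. (i, j, g) \<in> Ar \<Longrightarrow> x \<in> carrier (G i) \<Longrightarrow> e j (g x) = e i x"
    "hm ar (TA B) A ev" "\<And>i w. i \<in> I \<Longrightarrow> w \<in> TT (G i) \<Longrightarrow> ev (Smap (G i) B (e i) w) = d i w"
proof -
  note vA = abl_vob[OF A]
  have vG: "vob ar E (G i)" if "i \<in> I" for i using G[OF that] by blast
  obtain B0 \<iota> where B0: "ob B0" and \<iota>: "\<And>i. i \<in> I \<Longrightarrow> H (G i) B0 (\<iota> i)"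
    and B0gen: "carrier B0 = gen ar B0 (\<Union>i\<in>I. \<iota> i ` carrier (G i))"
    and B0univ: "\<And>M f. ob M \<Longrightarrow> (\<And>i. i \<in> I \<Longrightarrow> H (G i) M (f i)) \<Longrightarrow>
       \<exists>h. H B0 M h \<and> (\<forall>i\<in>I. \<forall>x\<in>carrier (G i). h (\<iota> i x) = f i x)"
    by (rule cop_ex[OF I, of G]) (use G in auto)
  have vB0: "vob ar E B0" using B0 by blast
  \<comment> \<open>Zero maps between the summands make every coproduct injection split:
    \<open>r\<close> is the identity on summand \<open>i\<close> and zero on the others.\<close>
  have "\<exists>r. H B0 (G i) r \<and> (\<forall>k\<in>I. \<forall>x\<in>carrier (G k). r (\<iota> k x) = (if k = i then x else z (G i)))" if "i \<in> I" for i
  proof -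
    have "H (G k) (G i) (\<lambda>x. if k = i then x else z (G i))" if "k \<in> I" for k
      using hm_z[OF vG[OF \<open>i \<in> I\<close>]] by (cases "k = i") auto
    from B0univ[OF G[OF that], of "\<lambda>k x. if k = i then x else z (G i)", OF this] show ?thesis by blast
  qed
  then obtain \<rho> where \<rho>: "\<And>i. i \<in> I \<Longrightarrow> H B0 (G i) (\<rho> i)"
    and \<rho>\<iota>: "\<And>i k x. i \<in> I \<Longrightarrow> k \<in> I \<Longrightarrow> x \<in> carrier (G k) \<Longrightarrow> \<rho> i (\<iota> k x) = (if k = i then x else z (G i))"
    by metis
  note S\<rho> = Smap[OF B0 G \<rho>]
  \<comment> \<open>\<open>inn (G i) (r1 B0 w)\<close> is the image of \<open>w\<close> under
    \<open>X + 0\<close>, so \<open>supp w\<close> lists the indices whose retraction sees more of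
    \<open>w\<close> than its component in \<open>X\<close>. In this form supports behave well under
    all operations of \<open>S B0\<close>, also outside the cosmash product.\<close>
  define supp where "supp w = {i \<in> I. Smap B0 (G i) (\<rho> i) w \<noteq> inn (G i) (r1 B0 w)}" for w
  have supp_I: "supp w \<subseteq> I" for w by (auto simp: supp_def)
  have vS: "vob ar E (S B0)" using S_ob B0 by blast
  have supp_op: "supp (oper (S B0) f ws) \<subseteq> (\<Union>w\<in>set ws. supp w)"
    if ws: "set ws \<subseteq> carrier (S B0)" "length ws = ar f" for f ws
  proof
    fix i assume i: "i \<in> supp (oper (S B0) f ws)"
    then have iI: "i \<in> I" by (simp add: supp_def)
    have h: "H (S B0) (S (G i)) (\<lambda>w. inn (G i) (r1 B0 w))"
      by (rule hm_comp[OF r1(1)[OF B0] inn[OF G[OF iI]]])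
    show "i \<in> (\<Union>w\<in>set ws. supp w)"
    proof (rule ccontr)
      assume "i \<notin> (\<Union>w\<in>set ws. supp w)"
      then have "map (Smap B0 (G i) (\<rho> i)) ws = map (\<lambda>w. inn (G i) (r1 B0 w)) ws"
        using iI by (auto simp: supp_def)
      then have "Smap B0 (G i) (\<rho> i) (oper (S B0) f ws) = inn (G i) (r1 B0 (oper (S B0) f ws))"
        using hm_op[OF S\<rho>(1)[OF iI iI] ws] hm_op[OF h ws] by (simp del: map_eq_conv)
      then show False using i by (simp add: supp_def)
    qed
  qed
  \<comment> \<open>Finiteness is proved by generation: on the generators of \<open>S B0\<close> the
    support has at most one element, and the support of an operation lies in the union of those of
    its arguments.\<close>
  define Fin where "Fin = {w \<in> carrier (S B0). finite (supp w)}"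
  have Fincl: "closed ar (S B0) Fin"
  proof (rule closedI)
    fix f ws assume *: "set ws \<subseteq> Fin" "length ws = ar f"
    have ws: "set ws \<subseteq> carrier (S B0)" using *(1) by (auto simp: Fin_def)
    have "finite (\<Union>w\<in>set ws. supp w)" using *(1) by (auto simp: Fin_def)
    then show "oper (S B0) f ws \<in> Fin"
      using finite_subset[OF supp_op[OF ws *(2)]] alg_op[OF vob_alg[OF vS] ws *(2)] by (simp add: Fin_def)
  qed (simp add: Fin_def)
  have inF: "inn B0 x \<in> Fin" if x: "x \<in> carrier X" for x
  proof -
    have "supp (inn B0 x) = {}" using S\<rho>(2) x r1(2)[OF B0 x] by (auto simp: supp_def)
    then show ?thesis using inn_in[OF B0 x] by (simp add: Fin_def)
  qed
  have j\<iota>F: "jn B0 (\<iota> k x) \<in> Fin" if k: "k \<in> I" "x \<in> carrier (G k)" for k x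
  proof -
    have \<iota>x: "\<iota> k x \<in> carrier B0" using hm_in[OF \<iota>] k by blast
    have "supp (jn B0 (\<iota> k x)) \<subseteq> {k}"
    proof
      fix i assume i: "i \<in> supp (jn B0 (\<iota> k x))"
      then have iI: "i \<in> I" by (simp add: supp_def)
      show "i \<in> {k}"
      proof (rule ccontr)
        assume "i \<notin> {k}"
        then have "Smap B0 (G i) (\<rho> i) (jn B0 (\<iota> k x)) = z (S (G i))"
          using S\<rho>(3)[OF iI iI \<iota>x] \<rho>\<iota>[OF iI k] z_hm[OF vG[OF iI] S_ob(2)[OF G[OF iI]] jn[OF G[OF iI]]] by simp
        moreover have "inn (G i) (r1 B0 (jn B0 (\<iota> k x))) = z (S (G i))"
          using r1(3)[OF B0 \<iota>x] z_hm[OF vX S_ob(2)[OF G[OF iI]] inn[OF G[OF iI]]] by simp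
        ultimately show False using i by (simp add: supp_def)
      qed
    qed
    then have "finite (supp (jn B0 (\<iota> k x)))" using finite_subset by blast
    then show ?thesis using jn_in[OF B0 \<iota>x] by (simp add: Fin_def)
  qed
  have \<iota>B0: "(\<Union>i\<in>I. \<iota> i ` carrier (G i)) \<subseteq> carrier B0" using hm_in[OF \<iota>] by auto
  have jF: "jn B0 b \<in> Fin" if "b \<in> carrier B0" for b
  proof -
    have "jn B0 b \<in> gen ar (S B0) (jn B0 ` (\<Union>i\<in>I. \<iota> i ` carrier (G i)))"
      by (rule hm_gen[OF vob_alg[OF vB0] \<iota>B0 jn[OF B0]]) (use that B0gen in simp)
    moreover have "jn B0 ` (\<Union>i\<in>I. \<iota> i ` carrier (G i)) \<subseteq> Fin" using j\<iota>F by auto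
    ultimately show ?thesis using gen_least[OF Fincl] by blast
  qed
  have fin: "finite (supp w)" if "w \<in> carrier (S B0)" for w
  proof -
    have "inn B0 ` carrier X \<union> jn B0 ` carrier B0 \<subseteq> Fin" using inF jF by auto
    then have "w \<in> Fin" using gen_least[OF Fincl] that unfolding S_gen[OF B0] by blast
    then show ?thesis by (simp add: Fin_def)
  qed
  define dd where "dd w i = d i (Smap B0 (G i) (\<rho> i) w)" for w i
  define ev0 where "ev0 w = ssum A (dd w) (supp w)" for w
  have dd_hm: "hm ar (TA B0) A (\<lambda>w. dd w i)" if "i \<in> I" for i
    unfolding dd_def by (rule hm_comp[OF Smap_TA[OF B0 G[OF that] \<rho>[OF that]] d[OF that]])
  have dd_in: "dd w i \<in> carrier A" if "w \<in> TT B0" "i \<in> I" for w i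
    using hm_in[OF dd_hm[OF that(2)]] that(1) by simp
  have dd_z: "dd w i = z A" if w: "w \<in> TT B0" and i: "i \<in> I" "i \<notin> supp w" for w i
  proof -
    have "Smap B0 (G i) (\<rho> i) w = inn (G i) (z X)" using i w by (simp add: supp_def TT_def)
    also have "\<dots> = z (TA (G i))"
      using z_hm[OF vX S_ob(2)[OF G[OF i(1)]] inn[OF G[OF i(1)]]] TA_z[OF G[OF i(1)]] by simp
    finally show ?thesis
      using z_hm[OF TA_vob[OF G[OF i(1)]] vA d[OF i(1)]] by (simp add: dd_def)
  qed
  \<comment> \<open>The homomorphism law compares elements with different supports, so the sum must
    be allowed to run over any finite set of indices containing the support.\<close>
  have ev0_eq: "ev0 w = ssum A (dd w) F" if w: "w \<in> TT B0" and F: "finite F" "supp w \<subseteq> F" "F \<subseteq> I" for w F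
  proof -
    have "ssum A (dd w) (supp w \<union> (F - supp w)) = ssum A (dd w) (supp w)"
      by (rule ssum_neutral[OF A]) (use F w dd_in dd_z fin[OF TT_S[OF w]] in auto)
    moreover have "supp w \<union> (F - supp w) = F" using F by auto
    ultimately show ?thesis by (simp add: ev0_def)
  qed
  have ev0: "hm ar (TA B0) A ev0"
  proof (rule hmI)
    show "ev0 w \<in> carrier A" if "w \<in> carrier (TA B0)" for w
      unfolding ev0_def using that fin[OF TT_S] dd_in subsetD[OF supp_I] by (intro ssum_in[OF A]) auto
    fix f ws assume *: "set ws \<subseteq> carrier (TA B0)" "length ws = ar f"
    have T: "w \<in> TT B0" if "w \<in> set ws" for w using * that by auto
    let ?o = "oper (TA B0) f ws"
    have o: "?o \<in> TT B0" using alg_op[OF vob_alg[OF TA_vob[OF B0]] *] by simp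
    define F where "F = supp ?o \<union> (\<Union>w\<in>set ws. supp w)"
    have F: "finite F" "F \<subseteq> I" using fin[OF TT_S] T o supp_I by (auto simp: F_def)
    have "ev0 ?o = ssum A (dd ?o) F" by (rule ev0_eq[OF o F(1) _ F(2)]) (auto simp: F_def)
    also have "\<dots> = ssum A (\<lambda>i. oper A f (map (\<lambda>w. dd w i) ws)) F"
      by (rule ssum_cong[OF A F(1)]) (use F(2) dd_in[OF o] hm_op[OF dd_hm *] in auto)
    also have "\<dots> = oper A f (map (\<lambda>w. ssum A (dd w) F) ws)"
      by (rule ssum_op[OF A F(1) *(2), symmetric]) (use F(2) dd_in T in auto)
    also have "map (\<lambda>w. ssum A (dd w) F) ws = map ev0 ws"
    proof (rule map_cong[OF refl])
      fix w assume w: "w \<in> set ws"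
      then have "supp w \<subseteq> F" by (auto simp: F_def)
      then show "ssum A (dd w) F = ev0 w" using ev0_eq[OF T[OF w] F(1) _ F(2)] by simp
    qed
    finally show "ev0 ?o = oper A f (map ev0 ws)" .
  qed
  \<comment> \<open>Since \<open>\<rho> k \<circ> \<iota> i\<close> is zero for
    \<open>k \<noteq> i\<close> and the identity for \<open>k = i\<close>, a single term
    survives.\<close>
  have ev0\<iota>: "ev0 (Smap (G i) B0 (\<iota> i) w) = d i w" if i: "i \<in> I" and w: "w \<in> TT (G i)" for i w
  proof -
    let ?w = "Smap (G i) B0 (\<iota> i) w"
    have wT: "?w \<in> TT B0" by (rule Smap_TT[OF G[OF i] B0 \<iota>[OF i] w])
    have c: "Smap B0 (G k) (\<rho> k) ?w = Smap (G i) (G k) (\<lambda>x. \<rho> k (\<iota> i x)) w" if "k \<in> I" for k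
      by (rule Smap_comp[OF G[OF i] B0 G[OF that] \<iota>[OF i] \<rho>[OF that] TT_S[OF w]])
    have "supp ?w \<subseteq> {i}"
    proof
      fix k assume k: "k \<in> supp ?w"
      then have kI: "k \<in> I" by (simp add: supp_def)
      show "k \<in> {i}"
      proof (rule ccontr)
        assume "k \<notin> {i}"
        then have "Smap (G i) (G k) (\<lambda>x. \<rho> k (\<iota> i x)) w = Smap (G i) (G k) (\<lambda>_. z (G k)) w"
          using \<rho>\<iota>[OF kI i] by (intro Smap_cong[OF G[OF i] G[OF kI] hm_z[OF vG[OF kI]] _ TT_S[OF w]]) auto
        then have "Smap B0 (G k) (\<rho> k) ?w = inn (G k) (r1 (G i) w)"
          using c[OF kI] Smap_z[OF G[OF i] G[OF kI] TT_S[OF w]] by simp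
        then show False
          using k r1_Smap[OF G[OF i] B0 \<iota>[OF i] TT_S[OF w]] by (simp add: supp_def)
      qed
    qed
    then have "ev0 ?w = ssum A (dd ?w) {i}" using i by (intro ev0_eq[OF wT]) auto
    also have "\<dots> = dd ?w i"
      using ssum_insert[OF A, of "{}" "dd ?w" i] dd_in[OF wT i] vA by simp
    also have "Smap B0 (G i) (\<rho> i) ?w = w"
      using c[OF i] Smap_cong[OF G[OF i] G[OF i] hm_id _ TT_S[OF w], of "\<lambda>x. \<rho> i (\<iota> i x)"] \<rho>\<iota>[OF i i]
        Smap_id[OF G[OF i] TT_S[OF w]] by simp
    then have "dd ?w i = d i w" by (simp add: dd_def)
    finally show ?thesis .
  qed
  obtain Pr p q where Pr: "ob Pr" "H Pr B0 p" "H Pr B0 q"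
    and Prex: "\<And>a b. a \<in> carrier B0 \<Longrightarrow> b \<in> carrier B0 \<Longrightarrow> \<exists>z\<in>carrier Pr. p z = a \<and> q z = b"
    and Prinj: "\<And>z z'. z \<in> carrier Pr \<Longrightarrow> z' \<in> carrier Pr \<Longrightarrow> p z = p z' \<Longrightarrow> q z = q z' \<Longrightarrow> z = z'"
    by (rule prod_ex[OF B0 B0]) (rule that)
  have vPr: "vob ar E Pr" using Pr by blast
  \<comment> \<open>\<open>None\<close> indexes the diagonal of \<open>B0\<close>, which makes the
    relation reflexive; \<open>Some (i, j, g)\<close> indexes the pairs
    \<open>(\<iota> j (g x), \<iota> i x)\<close> to be identified.\<close>
  define K where "K = insert None (Some ` Ar)"
  define Yk where "Yk k = (case k of None \<Rightarrow> B0 | Some (i, j, g) \<Rightarrow> G i)" for k :: "('k \<times> 'k \<times> ('u \<Rightarrow> 'u)) option"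
  define ak where "ak k = (case k of None \<Rightarrow> (\<lambda>x. x) | Some (i, j, g) \<Rightarrow> (\<lambda>x. \<iota> j (g x)))"
    for k :: "('k \<times> 'k \<times> ('u \<Rightarrow> 'u)) option"
  define bk where "bk k = (case k of None \<Rightarrow> (\<lambda>x. x) | Some (i, j, g) \<Rightarrow> \<iota> i)"
    for k :: "('k \<times> 'k \<times> ('u \<Rightarrow> 'u)) option"
  have Kk: "ob (Yk k) \<and> H (Yk k) B0 (ak k) \<and> H (Yk k) B0 (bk k)" if "k \<in> K" for k
  proof (cases k)
    case None
    then show ?thesis using B0 by (simp add: Yk_def ak_def bk_def)
  next
    case (Some a)
    obtain i j g where a: "a = (i, j, g)" by (cases a)
    then have ij: "i \<in> I" "j \<in> I" "H (G i) (G j) g" using Ar[of i j g] that Some by (auto simp: K_def)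
    then show ?thesis using Some a G \<iota>[OF ij(1)] hm_comp[OF ij(3) \<iota>[OF ij(2)]] by (simp add: Yk_def ak_def bk_def)
  qed
  have "\<exists>h. H (Yk k) Pr h \<and> (\<forall>y\<in>carrier (Yk k). p (h y) = ak k y \<and> q (h y) = bk k y)" if k: "k \<in> K" for k
    by (rule product_hm[OF vob_alg[OF vPr] Pr(2,3) Prex Prinj, of "Yk k" "ak k" "bk k"]) (use Kk[OF k] in auto)
  then obtain fk where fk: "\<And>k. k \<in> K \<Longrightarrow> H (Yk k) Pr (fk k)"
    and pk: "\<And>k y. k \<in> K \<Longrightarrow> y \<in> carrier (Yk k) \<Longrightarrow> p (fk k y) = ak k y"
    and qk: "\<And>k y. k \<in> K \<Longrightarrow> y \<in> carrier (Yk k) \<Longrightarrow> q (fk k y) = bk k y"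
    by metis
  define Gs where "Gs = (\<Union>k\<in>K. fk k ` carrier (Yk k))"
  have Gs: "Gs \<subseteq> carrier Pr" using hm_in[OF fk] by (auto simp: Gs_def)
  define R where "R = sub_alg Pr (gen ar Pr Gs)"
  have Rcl: "closed ar Pr (gen ar Pr Gs)" by (rule gen_closed[OF vob_alg[OF vPr] Gs])
  have R: "ob R" unfolding R_def by (rule ob_sub[OF Pr(1) Rcl])
  then have vR: "vob ar E R" by blast
  have Rsub: "carrier R \<subseteq> carrier Pr" using Rcl by (auto simp: R_def closed_def)
  have pR: "H R B0 p" "H R B0 q" unfolding R_def by (rule hm_sub[OF _ Rcl], rule Pr)+
  have fkR: "H (Yk k) R (fk k)" if "k \<in> K" for k
    unfolding R_def by (rule hm_into_sub[OF fk[OF that]]) (use that in \<open>auto intro!: gen.base simp: Gs_def\<close>)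
  \<comment> \<open>\<open>R\<close> is generated by the images of the maps \<open>fk\<close>, so
    \<open>TT_generated\<close> reduces equality of the two maps from \<open>TT R\<close> to
    \<open>A\<close> to equality on each \<open>TT (Yk k)\<close>, where it is trivial or follows
    from \<open>dc\<close>.\<close>
  have RT: "TT R \<subseteq> {w \<in> TT R. ev0 (Smap R B0 p w) = ev0 (Smap R B0 q w)}" (is "_ \<subseteq> ?U")
  proof (rule TT_generated[OF R, of ?U K Yk fk])
    have "closed ar (TA R) {w \<in> carrier (TA R). ev0 (Smap R B0 p w) = ev0 (Smap R B0 q w)}"
      by (rule closed_agree[OF TA_vob[OF R] hm_comp[OF Smap_TA[OF R B0 pR(1)] ev0]
            hm_comp[OF Smap_TA[OF R B0 pR(2)] ev0]])
    then show "closed ar (S R) ?U" using TT_S by (auto simp: closed_def)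
    show "carrier R = gen ar R (\<Union>k\<in>K. fk k ` carrier (Yk k))"
      using gen_sub[OF vob_alg[OF vPr] Gs] by (simp add: R_def Gs_def)
    show "good R ?U (Yk k) (fk k)" if k: "k \<in> K" for k
      unfolding good_def
    proof (intro conjI ballI)
      show "vob ar E (Yk k)" "P (Yk k)" "H (Yk k) R (fk k)" using Kk[OF k] fkR[OF k] by auto
      fix w assume w: "w \<in> TT (Yk k)"
      have Yo: "ob (Yk k)" using Kk[OF k] by blast
      have a: "H (Yk k) B0 (ak k)" "H (Yk k) B0 (bk k)" using Kk[OF k] by auto
      have "Smap R B0 p (Smap (Yk k) R (fk k) w) = Smap (Yk k) B0 (ak k) w"
        using Smap_comp[OF Yo R B0 fkR[OF k] pR(1) TT_S[OF w]]
          Smap_cong[OF Yo B0 a(1) _ TT_S[OF w], of "\<lambda>x. p (fk k x)"] pk[OF k] by simp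
      moreover have "Smap R B0 q (Smap (Yk k) R (fk k) w) = Smap (Yk k) B0 (bk k) w"
        using Smap_comp[OF Yo R B0 fkR[OF k] pR(2) TT_S[OF w]]
          Smap_cong[OF Yo B0 a(2) _ TT_S[OF w], of "\<lambda>x. q (fk k x)"] qk[OF k] by simp
      moreover have "ev0 (Smap (Yk k) B0 (ak k) w) = ev0 (Smap (Yk k) B0 (bk k) w)"
      proof (cases k)
        case (Some a)
        obtain i j g where a: "a = (i, j, g)" by (cases a)
        then have ar: "(i, j, g) \<in> Ar" using k Some by (auto simp: K_def)
        have ij: "i \<in> I" "j \<in> I" "H (G i) (G j) g" using Ar[OF ar] by auto
        have w: "w \<in> TT (G i)" using w Some a by (simp add: Yk_def)
        have "Smap (G i) B0 (\<lambda>x. \<iota> j (g x)) w = Smap (G j) B0 (\<iota> j) (Smap (G i) (G j) g w)"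
          by (rule Smap_comp[OF G[OF ij(1)] G[OF ij(2)] B0 ij(3) \<iota>[OF ij(2)] TT_S[OF w], symmetric])
        then have "ev0 (Smap (G i) B0 (\<lambda>x. \<iota> j (g x)) w) = d j (Smap (G i) (G j) g w)"
          using ev0\<iota>[OF ij(2) Smap_TT[OF G[OF ij(1)] G[OF ij(2)] ij(3) w]] by simp
        also have "\<dots> = ev0 (Smap (G i) B0 (\<iota> i) w)" using dc[OF ar w] ev0\<iota>[OF ij(1) w] by simp
        finally show ?thesis using Some a by (simp add: Yk_def ak_def bk_def)
      qed (simp add: ak_def bk_def)
      ultimately show "Smap (Yk k) R (fk k) w \<in> ?U"
        using Smap_TT[OF Yo R fkR[OF k] w] by simp
    qed
  qed
  have N: "None \<in> K" by (simp add: K_def)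
  obtain B \<pi> where B: "vob ar E B" "H B0 B \<pi>" "\<pi> ` carrier B0 = carrier B"
    and \<pi>: "\<And>x y. x \<in> carrier B0 \<Longrightarrow> y \<in> carrier B0 \<Longrightarrow> \<pi> x = \<pi> y \<longleftrightarrow> (\<exists>r\<in>carrier R. p r = x \<and> q r = y)"
  proof (rule rel_quot[OF vB0 vR pR])
    fix x assume "x \<in> carrier B0"
    then show "\<exists>r\<in>carrier R. p r = x \<and> q r = x"
      using pk[OF N, of x] qk[OF N, of x] hm_in[OF fkR[OF N], of x]
      by (intro bexI[of _ "fk None x"]) (simp_all add: Yk_def ak_def bk_def)
  qed (rule that)
  have oB: "ob B" using quoP[OF B0 B] B(1) by blast
  note Sp = Smap[OF R B0 pR(1)] and Sq = Smap[OF R B0 pR(2)] and S\<pi> = Smap[OF B0 oB B(2)]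
  \<comment> \<open>The image of \<open>S R\<close> in \<open>S B0 \<times> S B0\<close> is again
    reflexive, through the diagonal in \<open>R\<close>, hence a congruence. Its quotient
    \<open>D\<close> has an explicitly known kernel relation, and \<open>\<tau>\<close> below
    compares it with \<open>S B\<close>.\<close>
  obtain D \<sigma> where D: "vob ar E D" "H (S B0) D \<sigma>" "\<sigma> ` carrier (S B0) = carrier D"
    and \<sigma>: "\<And>x y. x \<in> carrier (S B0) \<Longrightarrow> y \<in> carrier (S B0) \<Longrightarrow>
      \<sigma> x = \<sigma> y \<longleftrightarrow> (\<exists>r\<in>carrier (S R). Smap R B0 p r = x \<and> Smap R B0 q r = y)"
  proof (rule rel_quot[OF vS S_ob(2)[OF R] Sp(1) Sq(1)])
    fix x assume x: "x \<in> carrier (S B0)"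
    have f: "H B0 R (fk None)" using fkR[OF N] by (simp add: Yk_def)
    have "Smap R B0 p (Smap B0 R (fk None) x) = x"
      using Smap_comp[OF B0 R B0 f pR(1) x] Smap_cong[OF B0 B0 hm_id _ x, of "\<lambda>x. p (fk None x)"]
        pk[OF N] Smap_id[OF B0 x] by (simp add: Yk_def ak_def)
    moreover have "Smap R B0 q (Smap B0 R (fk None) x) = x"
      using Smap_comp[OF B0 R B0 f pR(2) x] Smap_cong[OF B0 B0 hm_id _ x, of "\<lambda>x. q (fk None x)"]
        qk[OF N] Smap_id[OF B0 x] by (simp add: Yk_def bk_def)
    ultimately show "\<exists>r\<in>carrier (S R). Smap R B0 p r = x \<and> Smap R B0 q r = x"
      using Smap_in[OF B0 R f x] by blast
  qed (rule that)
  have oD: "ob D" using quoP[OF S_ob(1)[OF B0] D] D(1) by blast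
  have j\<sigma>: "H B0 D (\<lambda>y. \<sigma> (jn B0 y))" by (rule hm_comp[OF jn[OF B0] D(2)])
  have "\<exists>h. hm ar B D h \<and> (\<forall>x\<in>carrier B0. h (\<pi> x) = \<sigma> (jn B0 x))"
  proof (rule hm_factor[OF B(2,3) vob_alg[OF vB0] j\<sigma>])
    fix x y assume xy: "x \<in> carrier B0" "y \<in> carrier B0" "\<pi> x = \<pi> y"
    then obtain r where r: "r \<in> carrier R" "p r = x" "q r = y" using \<pi>[OF xy(1,2)] by blast
    show "\<sigma> (jn B0 x) = \<sigma> (jn B0 y)"
      unfolding \<sigma>[OF jn_in[OF B0 xy(1)] jn_in[OF B0 xy(2)]]
      using Sp(3)[OF r(1)] Sq(3)[OF r(1)] r jn_in[OF R r(1)] by blast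
  qed
  then obtain t where t: "H B D t" "\<And>x. x \<in> carrier B0 \<Longrightarrow> t (\<pi> x) = \<sigma> (jn B0 x)" by blast
  define \<tau> where "\<tau> = ext B D (\<lambda>x. \<sigma> (inn B0 x)) t"
  note \<tau> = ext[OF oB oD hm_comp[OF inn[OF B0] D(2)] t(1), folded \<tau>_def]
  have \<tau>\<sigma>: "\<tau> (Smap B0 B \<pi> w) = \<sigma> w" if "w \<in> carrier (S B0)" for w
    by (rule S_ext[OF B0 hm_comp[OF S\<pi>(1) \<tau>(1)] D(2) _ _ that])
      (use S\<pi> \<tau> t(2) hm_in[OF B(2)] in auto)
  \<comment> \<open>\<open>\<tau>\<close> turns equality in \<open>S B\<close> into equality in
    \<open>D\<close>, that is, into an element \<open>r\<close> of \<open>S R\<close> over the pair.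
    Because \<open>R\<close> is embedded in \<open>B0 \<times> B0\<close>, the component of
    \<open>r\<close> in \<open>R\<close> is zero as soon as its two projections are; so
    \<open>r\<close> lies in \<open>TT R\<close> and \<open>RT\<close> applies.\<close>
  have ker: "ev0 w = ev0 w'" if w: "w \<in> TT B0" "w' \<in> TT B0" "Smap B0 B \<pi> w = Smap B0 B \<pi> w'" for w w'
  proof -
    have wS: "w \<in> carrier (S B0)" "w' \<in> carrier (S B0)" using w TT_S by auto
    have "\<sigma> w = \<sigma> w'" using \<tau>\<sigma>[OF wS(1)] \<tau>\<sigma>[OF wS(2)] w(3) by simp
    then obtain r where r: "r \<in> carrier (S R)" "Smap R B0 p r = w" "Smap R B0 q r = w'"
      using \<sigma>[OF wS] by blast
    have rR: "r2 R r \<in> carrier R" using hm_in[OF r2(1)[OF R] r(1)] .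
    have "p (r2 R r) = z B0" "q (r2 R r) = z B0"
      using r2_Smap[OF R B0 pR(1) r(1)] r2_Smap[OF R B0 pR(2) r(1)] r w by (simp_all add: TT_def)
    moreover have "p (z R) = z B0" "q (z R) = z B0" using z_hm[OF vR vB0] pR by blast+
    ultimately have "r2 R r = z R" using Prinj[of "r2 R r" "z R"] rR z_in[OF vR] Rsub by auto
    moreover have "r1 R r = z X" using r1_Smap[OF R B0 pR(1) r(1)] r w by (simp add: TT_def)
    ultimately have "r \<in> TT R" using r(1) by (simp add: TT_def)
    then show ?thesis using RT r by auto
  qed
  have "\<exists>h. hm ar (TA B) A h \<and> (\<forall>x\<in>carrier (TA B0). h (Smap B0 B \<pi> x) = ev0 x)"
  proof (rule hm_factor[OF Smap_TA[OF B0 oB B(2)] _ vob_alg[OF TA_vob[OF B0]] ev0])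
    show "Smap B0 B \<pi> ` carrier (TA B0) = carrier (TA B)"
      using TT_surj[OF B0 oB B(2,3)] Smap_TT[OF B0 oB B(2)] by force
  qed (rule ker, simp_all)
  then obtain ev where ev: "hm ar (TA B) A ev" "\<And>x. x \<in> TT B0 \<Longrightarrow> ev (Smap B0 B \<pi> x) = ev0 x" by auto
  show thesis
  proof (rule that[OF oB _ _ ev(1), of "\<lambda>i x. \<pi> (\<iota> i x)"])
    show "H (G i) B (\<lambda>x. \<pi> (\<iota> i x))" if "i \<in> I" for i by (rule hm_comp[OF \<iota>[OF that] B(2)])
    show "\<pi> (\<iota> j (g x)) = \<pi> (\<iota> i x)" if a: "(i, j, g) \<in> Ar" "x \<in> carrier (G i)" for i j g x
    proof -
      have ij: "i \<in> I" "j \<in> I" "H (G i) (G j) g" using Ar[OF a(1)] by auto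
      have k: "Some (i, j, g) \<in> K" using a by (simp add: K_def)
      have x: "x \<in> carrier (Yk (Some (i, j, g)))" using a by (simp add: Yk_def)
      have "\<iota> j (g x) \<in> carrier B0" "\<iota> i x \<in> carrier B0"
        using hm_in[OF \<iota>[OF ij(2)] hm_in[OF ij(3) a(2)]] hm_in[OF \<iota>[OF ij(1)] a(2)] .
      from \<pi>[OF this] show ?thesis
        using hm_in[OF fkR[OF k] x] pk[OF k x] qk[OF k x] by (auto simp: ak_def bk_def)
    qed
    show "ev (Smap (G i) B (\<lambda>x. \<pi> (\<iota> i x)) w) = d i w" if i: "i \<in> I" and w: "w \<in> TT (G i)" for i w
      using Smap_comp[OF G[OF i] B0 oB \<iota>[OF i] B(2) TT_S[OF w]] ev(2)[OF Smap_TT[OF G[OF i] B0 \<iota>[OF i] w]]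
        ev0\<iota>[OF i w] by simp
  qed
qed

text \<open>\<open>univ\<close> provides one map from \<open>L\<close> to the algebra
  \<open>B\<close> of \<open>cocone_factor\<close>, and that is the only way in which the colimit
  property enters existence; uniqueness rests on generation instead.\<close>

lemma TT_colimit:
  fixes I :: "'k set" and Ar :: "('k \<times> 'k \<times> ('u \<Rightarrow> 'u)) set"
  assumes I: "I \<lesssim> (UNIV :: 'u set)" and G: "\<And>i. i \<in> I \<Longrightarrow> ob (G i)"
    and Ar: "\<And>i j g. (i, j, g) \<in> Ar \<Longrightarrow> i \<in> I \<and> j \<in> I \<and> H (G i) (G j) g"
    and A: "abl A" and d: "\<And>i. i \<in> I \<Longrightarrow> hm ar (TA (G i)) A (d i)"
    and dc: "\<And>i j g w. (i, j, g) \<in> Ar \<Longrightarrow> w \<in> TT (G i) \<Longrightarrow> d j (Smap (G i) (G j) g w) = d i w"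
    and L: "ob L" "\<And>i. i \<in> I \<Longrightarrow> H (G i) L (c i)"
    and univ: "\<And>M m. ob M \<Longrightarrow> (\<And>i. i \<in> I \<Longrightarrow> H (G i) M (m i)) \<Longrightarrow>
      (\<And>i j g x. (i, j, g) \<in> Ar \<Longrightarrow> x \<in> carrier (G i) \<Longrightarrow> m j (g x) = m i x) \<Longrightarrow>
      \<exists>h. H L M h \<and> (\<forall>i\<in>I. \<forall>x\<in>carrier (G i). h (c i x) = m i x)"
  shows "\<exists>h. hm ar (TA L) A h \<and> (\<forall>i\<in>I. \<forall>w\<in>TT (G i). h (Smap (G i) L (c i) w) = d i w)"
proof -
  obtain B e ev where B: "ob B" and e: "\<And>i. i \<in> I \<Longrightarrow> H (G i) B (e i)"
    and ec: "\<And>i j g x. (i, j, g) \<in> Ar \<Longrightarrow> x \<in> carrier (G i) \<Longrightarrow> e j (g x) = e i x"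
    and ev: "hm ar (TA B) A ev" "\<And>i w. i \<in> I \<Longrightarrow> w \<in> TT (G i) \<Longrightarrow> ev (Smap (G i) B (e i) w) = d i w"
    by (rule cocone_factor[OF I G Ar A d dc]) (assumption | rule that)+
  obtain l where l: "H L B l" "\<And>i x. i \<in> I \<Longrightarrow> x \<in> carrier (G i) \<Longrightarrow> l (c i x) = e i x"
    using univ[OF B, of e] e ec by blast
  have "ev (Smap L B l (Smap (G i) L (c i) w)) = d i w" if i: "i \<in> I" and w: "w \<in> TT (G i)" for i w
    using Smap_comp[OF G[OF i] L(1) B L(2)[OF i] l(1) TT_S[OF w]]
      Smap_cong[OF G[OF i] B e[OF i] _ TT_S[OF w], of "\<lambda>x. l (c i x)"] l(2)[OF i] ev(2)[OF i w] by simp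
  then show ?thesis using hm_comp[OF Smap_TA[OF L(1) B l(1)] ev(1)] by blast
qed

text \<open>The equalizer of \<open>h\<close> and \<open>h'\<close> is a subalgebra for which every
  map \<open>c i\<close> is good, so \<open>TT_generated\<close> makes it everything.\<close>

lemma TT_colimit_unique:
  fixes A :: "('f, 'u) alg"
  assumes G: "\<And>i. i \<in> I \<Longrightarrow> ob (G i)" and L: "ob L" "\<And>i. i \<in> I \<Longrightarrow> H (G i) L (c i)"
    and gen: "carrier L = gen ar L (\<Union>i\<in>I. c i ` carrier (G i))"
    and h: "hm ar (TA L) A h" "hm ar (TA L) A h'"
    and eq: "\<And>i w. i \<in> I \<Longrightarrow> w \<in> TT (G i) \<Longrightarrow> h (Smap (G i) L (c i) w) = h' (Smap (G i) L (c i) w)"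
    and w: "w \<in> TT L"
  shows "h w = h' w"
proof -
  have "TT L \<subseteq> {w \<in> TT L. h w = h' w}" (is "_ \<subseteq> ?U")
  proof (rule TT_generated[OF L(1), of ?U I G c])
    have "closed ar (TA L) {w \<in> carrier (TA L). h w = h' w}"
      by (rule closed_agree[OF TA_vob[OF L(1)] h])
    then show "closed ar (S L) ?U" using TT_S by (auto simp: closed_def)
    show "good L ?U (G i) (c i)" if "i \<in> I" for i
      using G[OF that] L(2)[OF that] eq[OF that] Smap_TT[OF G[OF that] L(1) L(2)[OF that]] by (auto simp: good_def)
  qed (rule gen)
  then show ?thesis using w by blast
qed

end

section \<open>Two-nilpotent algebras\<close>

text \<open>The operations \<open>D k\<close> are the binary difference terms of a pointed protomodular variety.\<close>

locale protomodular_variety = maltsev_class ar E "\<lambda>_. True" mal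
  for ar :: "'f \<Rightarrow> nat" and E and mal :: "('f, 'u) alg \<Rightarrow> 'u \<Rightarrow> 'u \<Rightarrow> 'u \<Rightarrow> 'u" +
  fixes D :: "('f, 'u) alg \<Rightarrow> 'u \<Rightarrow> 'u \<Rightarrow> 'u \<Rightarrow> 'u" and KK :: "'u set"
  assumes D_in: "\<And>A a b k. vob ar E A \<Longrightarrow> a \<in> carrier A \<Longrightarrow> b \<in> carrier A \<Longrightarrow> k \<in> KK \<Longrightarrow> D A a b k \<in> carrier A"
    and D_hm: "\<And>A B h a b k. vob ar E A \<Longrightarrow> vob ar E B \<Longrightarrow> hm ar A B h \<Longrightarrow>
      a \<in> carrier A \<Longrightarrow> b \<in> carrier A \<Longrightarrow> k \<in> KK \<Longrightarrow> h (D A a b k) = D B (h a) (h b) k"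
    and D_same: "\<And>A a k. vob ar E A \<Longrightarrow> a \<in> carrier A \<Longrightarrow> k \<in> KK \<Longrightarrow> D A a a k = zr ar A"
    and D_zero: "\<And>A a b. vob ar E A \<Longrightarrow> a \<in> carrier A \<Longrightarrow> b \<in> carrier A \<Longrightarrow>
      (\<And>k. k \<in> KK \<Longrightarrow> D A a b k = zr ar A) \<Longrightarrow> a = b"
begin

text \<open>The commutator condition \<open>[M, M, M] = 0\<close>, quantified over all ternary
  coproducts mapping to \<open>M\<close> and not just over the codiagonal. This makes closure under
  separating homomorphisms immediate; by \<open>nilpI\<close> the codiagonal decides.\<close>

definition nilp :: "('f, 'u) alg \<Rightarrow> bool" where
  "nilp M \<longleftrightarrow> (\<forall>A B C U a b c \<psi> e1 e2 e3 u. vob ar E A \<and> vob ar E B \<and> vob ar E C \<and> tri A B C U a b c \<and>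
     kills A B C U a b c e1 e2 e3 \<and> H U M \<psi> \<and> u \<in> carrier U \<and> e1 u = z U \<and> e2 u = z U \<and> e3 u = z U \<longrightarrow>
     \<psi> u = z M)"

lemma nilpD:
  assumes "nilp M" "vob ar E A" "vob ar E B" "vob ar E C" "tri A B C U a b c"
     "kills A B C U a b c e1 e2 e3" "H U M \<psi>" "u \<in> carrier U" "e1 u = z U" "e2 u = z U" "e3 u = z U"
  shows "\<psi> u = z M"
  using assms unfolding nilp_def by blast

lemma nilp_sep:
  assumes A: "vob ar E A"
    and sep: "\<And>x y. x \<in> carrier A \<Longrightarrow> y \<in> carrier A \<Longrightarrow> x \<noteq> y \<Longrightarrow>
        \<exists>M h. vob ar E M \<and> nilp M \<and> hm ar A M h \<and> h x \<noteq> h y"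
  shows "nilp A"
  unfolding nilp_def
proof (intro allI impI, elim conjE)
  fix A' B C U a b c \<psi> e1 e2 e3 u
  assume o: "vob ar E A'" "vob ar E B" "vob ar E C" and t: "tri A' B C U a b c"
    and k: "kills A' B C U a b c e1 e2 e3" and \<psi>: "H U A \<psi>" and u: "u \<in> carrier U"
    and e: "e1 u = z U" "e2 u = z U" "e3 u = z U"
  show "\<psi> u = z A"
  proof (rule ccontr)
    assume "\<psi> u \<noteq> z A"
    then obtain M h where M: "vob ar E M" "nilp M" "H A M h" "h (\<psi> u) \<noteq> h (z A)"
      using sep[OF hm_in[OF \<psi> u] z_in[OF A]] by blast
    have "h (\<psi> u) = z M" by (rule nilpD[OF M(2) o t k hm_comp[OF \<psi> M(3)] u e])
    then show False using M z_hm[OF A M(1,3)] by simp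
  qed
qed

text \<open>Commuting idempotents allow corrections to be made one after another: removing the part
  seen by \<open>e2\<close> does not bring back a part seen by \<open>e1\<close>.\<close>

lemma kills_tri_commute:
  assumes t: "tri A B C U a b c" and k: "kills A B C U a b c e1 e2 e3" and u: "u \<in> carrier U"
  shows "e1 (e1 u) = e1 u" "e2 (e2 u) = e2 u" "e3 (e3 u) = e3 u"
    "e1 (e2 u) = e2 (e1 u)" "e1 (e3 u) = e3 (e1 u)" "e2 (e3 u) = e3 (e2 u)"
proof -
  note T = triD[OF t]
  have e: "H U U e1" "H U U e2" "H U U e3" using k by (auto simp: kills_def)
  have ez: "e1 (z U) = z U" "e2 (z U) = z U" "e3 (z U) = z U" using z_hm[OF T(2,2)] e by blast+
  note K = k[unfolded kills_def]
  show "e1 (e1 u) = e1 u" by (rule tri_ext[OF t hm_comp[OF e(1) e(1)] e(1) _ _ _ u]) (use K ez in auto)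
  show "e2 (e2 u) = e2 u" by (rule tri_ext[OF t hm_comp[OF e(2) e(2)] e(2) _ _ _ u]) (use K ez in auto)
  show "e3 (e3 u) = e3 u" by (rule tri_ext[OF t hm_comp[OF e(3) e(3)] e(3) _ _ _ u]) (use K ez in auto)
  show "e1 (e2 u) = e2 (e1 u)"
    by (rule tri_ext[OF t hm_comp[OF e(2) e(1)] hm_comp[OF e(1) e(2)] _ _ _ u]) (use K ez in auto)
  show "e1 (e3 u) = e3 (e1 u)"
    by (rule tri_ext[OF t hm_comp[OF e(3) e(1)] hm_comp[OF e(1) e(3)] _ _ _ u]) (use K ez in auto)
  show "e2 (e3 u) = e3 (e2 u)"
    by (rule tri_ext[OF t hm_comp[OF e(3) e(2)] hm_comp[OF e(2) e(3)] _ _ _ u]) (use K ez in auto)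
qed

text \<open>A preimage is corrected by successively subtracting its images under the \<open>e\<^sub>i\<close>.\<close>

lemma kill_correction:
  assumes t: "tri A B C U a b c" and k: "kills A B C U a b c e1 e2 e3"
    and W: "vob ar E W" and \<psi>: "H U W \<psi>"
    and f1: "\<And>x. x \<in> carrier U \<Longrightarrow> \<psi> (e1 x) = f1 (\<psi> x)"
    and f2: "\<And>x. x \<in> carrier U \<Longrightarrow> \<psi> (e2 x) = f2 (\<psi> x)"
    and f3: "\<And>x. x \<in> carrier U \<Longrightarrow> \<psi> (e3 x) = f3 (\<psi> x)"
    and u: "u \<in> carrier U" "f1 (\<psi> u) = z W" "f2 (\<psi> u) = z W" "f3 (\<psi> u) = z W"
  obtains v where "v \<in> carrier U" "e1 v = z U" "e2 v = z U" "e3 v = z U" "\<psi> v = \<psi> u"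
proof -
  note T = triD[OF t]
  note U = T(2)
  have e: "H U U e1" "H U U e2" "H U U e3" using k by (auto simp: kills_def)
  have ez: "e1 (z U) = z U" "e2 (z U) = z U" "e3 (z U) = z U" using z_hm[OF U U] e by blast+
  note c = kills_tri_commute[OF t k]
  note ein = hm_in[OF e(1)] hm_in[OF e(2)] hm_in[OF e(3)]
  note es = sb_hm[OF U U e(1)] sb_hm[OF U U e(2)] sb_hm[OF U U e(3)]
  have \<psi>u: "\<psi> u \<in> carrier W" using hm_in[OF \<psi> u(1)] .
  \<comment> \<open>\<open>e1\<close> kills \<open>u - e1 u\<close> because it is idempotent, and
    \<open>\<psi>\<close> does not notice the subtraction because
    \<open>\<psi> (e1 u) = f1 (\<psi> u) = 0\<close>.\<close>
  define u1 where "u1 = sb U u (e1 u)"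
  have u1: "u1 \<in> carrier U" using u ein by (simp add: u1_def sb_in[OF U])
  have 1: "e1 u1 = z U" "\<psi> u1 = \<psi> u"
    using es(1)[OF u(1) ein(1)[OF u(1)]] c(1)[OF u(1)] ein(1)[OF u(1)] U
      sb_hm[OF U W \<psi> u(1) ein(1)[OF u(1)]] f1[OF u(1)] u(2) \<psi>u W by (simp_all add: u1_def)
  define u2 where "u2 = sb U u1 (e2 u1)"
  have u2: "u2 \<in> carrier U" using u1 ein by (simp add: u2_def sb_in[OF U])
  have 2: "e1 u2 = z U" "e2 u2 = z U" "\<psi> u2 = \<psi> u"
    using es(1)[OF u1 ein(2)[OF u1]] c(4)[OF u1] 1 ez U
      es(2)[OF u1 ein(2)[OF u1]] c(2)[OF u1] ein(2)[OF u1]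
      sb_hm[OF U W \<psi> u1 ein(2)[OF u1]] f2[OF u1] u(3) \<psi>u W by (simp_all add: u2_def)
  define u3 where "u3 = sb U u2 (e3 u2)"
  have u3: "u3 \<in> carrier U" using u2 ein by (simp add: u3_def sb_in[OF U])
  have "e1 u3 = z U" "e2 u3 = z U" "e3 u3 = z U" "\<psi> u3 = \<psi> u"
    using es(1)[OF u2 ein(3)[OF u2]] c(5)[OF u2] 2 ez U
      es(2)[OF u2 ein(3)[OF u2]] c(6)[OF u2] es(3)[OF u2 ein(3)[OF u2]] c(3)[OF u2] ein(3)[OF u2]
      sb_hm[OF U W \<psi> u2 ein(3)[OF u2]] f3[OF u2] u(4) \<psi>u W by (simp_all add: u3_def)
  then show thesis using that u3 by blast
qed

lemma kills_map:
  assumes t: "tri A B C U a b c" and k: "kills A B C U a b c e1 e2 e3"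
    and t': "tri A' B' C' U' a' b' c'" and k': "kills A' B' C' U' a' b' c' e1' e2' e3'"
    and \<theta>: "H U U' \<theta>" "\<And>x. x \<in> carrier A \<Longrightarrow> \<theta> (a x) = a' (f x)" "\<And>x. x \<in> carrier B \<Longrightarrow> \<theta> (b x) = b' (g x)"
      "\<And>x. x \<in> carrier C \<Longrightarrow> \<theta> (c x) = c' (h x)"
    and fgh: "H A A' f" "H B B' g" "H C C' h"
    and u: "u \<in> carrier U"
  shows "\<theta> (e1 u) = e1' (\<theta> u)" "\<theta> (e2 u) = e2' (\<theta> u)" "\<theta> (e3 u) = e3' (\<theta> u)"
proof -
  have e: "H U U e1" "H U U e2" "H U U e3" "H U' U' e1'" "H U' U' e2'" "H U' U' e3'"
    using k k' by (auto simp: kills_def)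
  have \<theta>z: "\<theta> (z U) = z U'" using z_hm[OF triD(2)[OF t] triD(2)[OF t'] \<theta>(1)] .
  note i = hm_in[OF fgh(1)] hm_in[OF fgh(2)] hm_in[OF fgh(3)]
  note K = k[unfolded kills_def] k'[unfolded kills_def]
  show "\<theta> (e1 u) = e1' (\<theta> u)"
    by (rule tri_ext[OF t hm_comp[OF e(1) \<theta>(1)] hm_comp[OF \<theta>(1) e(4)] _ _ _ u]) (use K \<theta> \<theta>z i in auto)
  show "\<theta> (e2 u) = e2' (\<theta> u)"
    by (rule tri_ext[OF t hm_comp[OF e(2) \<theta>(1)] hm_comp[OF \<theta>(1) e(5)] _ _ _ u]) (use K \<theta> \<theta>z i in auto)
  show "\<theta> (e3 u) = e3' (\<theta> u)"
    by (rule tri_ext[OF t hm_comp[OF e(3) \<theta>(1)] hm_comp[OF \<theta>(1) e(6)] _ _ _ u]) (use K \<theta> \<theta>z i in auto)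
qed

text \<open>Any \<open>\<psi>\<close> on \<open>A + B + C\<close> factors as the sum of its three
  restrictions, a map into \<open>M + M + M\<close>, followed by the codiagonal; the first map
  commutes with the killing maps.\<close>

lemma nilpI:
  assumes M: "vob ar E M" and t: "tri M M M U0 a0 b0 c0" and k: "kills M M M U0 a0 b0 c0 f1 f2 f3"
    and \<kappa>: "H U0 M \<kappa>" "\<And>x. x \<in> carrier M \<Longrightarrow> \<kappa> (a0 x) = x" "\<And>x. x \<in> carrier M \<Longrightarrow> \<kappa> (b0 x) = x"
      "\<And>x. x \<in> carrier M \<Longrightarrow> \<kappa> (c0 x) = x"
    and nil: "\<And>u. u \<in> carrier U0 \<Longrightarrow> f1 u = z U0 \<Longrightarrow> f2 u = z U0 \<Longrightarrow> f3 u = z U0 \<Longrightarrow> \<kappa> u = z M"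
  shows "nilp M"
  unfolding nilp_def
proof (intro allI impI, elim conjE)
  fix A B C U a b c \<psi> e1 e2 e3 u
  assume t': "tri A B C U a b c" and k': "kills A B C U a b c e1 e2 e3" and \<psi>: "H U M \<psi>" and u: "u \<in> carrier U"
    and e: "e1 u = z U" "e2 u = z U" "e3 u = z U"
  note T = triD[OF t] and T' = triD[OF t']
  note \<psi>a = hm_comp[OF T'(3) \<psi>] hm_comp[OF T'(4) \<psi>] hm_comp[OF T'(5) \<psi>]
  obtain \<phi> where \<phi>: "H U U0 \<phi>" "\<And>x. x \<in> carrier A \<Longrightarrow> \<phi> (a x) = a0 (\<psi> (a x))"
    "\<And>x. x \<in> carrier B \<Longrightarrow> \<phi> (b x) = b0 (\<psi> (b x))" "\<And>x. x \<in> carrier C \<Longrightarrow> \<phi> (c x) = c0 (\<psi> (c x))"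
    by (rule tri_univ[OF t' T(1) hm_comp[OF \<psi>a(1) T(3)] hm_comp[OF \<psi>a(2) T(4)] hm_comp[OF \<psi>a(3) T(5)]]) (rule that)
  have \<phi>z: "\<phi> (z U) = z U0" by (rule z_hm[OF T'(2) T(2) \<phi>(1)])
  have \<kappa>\<phi>: "\<kappa> (\<phi> u) = \<psi> u"
    by (rule tri_ext[OF t' hm_comp[OF \<phi>(1) \<kappa>(1)] \<psi> _ _ _ u])
      (use \<phi> \<kappa> hm_in[OF \<psi>a(1)] hm_in[OF \<psi>a(2)] hm_in[OF \<psi>a(3)] in auto)
  have "f1 (\<phi> u) = z U0" "f2 (\<phi> u) = z U0" "f3 (\<phi> u) = z U0"
    using kills_map[OF t' k' t k \<phi> \<psi>a u] e \<phi>z by auto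
  then show "\<psi> u = z M" using nil[OF hm_in[OF \<phi>(1) u]] \<kappa>\<phi> by simp
qed

text \<open>An element of the ternary cosmash product of \<open>M\<close> lifts along
  \<open>q + q + q\<close> to that of \<open>X\<close>, since a lift in \<open>U\<close> can be
  corrected by \<open>kill_correction\<close>. This serves both for \<open>X / [X, X, X]\<close> and
  for quotients of nilpotent algebras.\<close>

lemma nilp_quot:
  assumes X: "vob ar E X" and M: "vob ar E M" and q: "H X M q" "q ` carrier X = carrier M"
    and t: "tri X X X U a b c" and k: "kills X X X U a b c e1 e2 e3"
    and \<kappa>: "H U X \<kappa>" "\<And>x. x \<in> carrier X \<Longrightarrow> \<kappa> (a x) = x" "\<And>x. x \<in> carrier X \<Longrightarrow> \<kappa> (b x) = x"
      "\<And>x. x \<in> carrier X \<Longrightarrow> \<kappa> (c x) = x"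
    and nil: "\<And>u. u \<in> carrier U \<Longrightarrow> e1 u = z U \<Longrightarrow> e2 u = z U \<Longrightarrow> e3 u = z U \<Longrightarrow> q (\<kappa> u) = z M"
  shows "nilp M"
proof -
  have oM: "ob M" using M by simp
  obtain U0 a0 b0 c0 where t0: "tri M M M U0 a0 b0 c0" using tri_ex[OF oM oM oM] .
  obtain f1 f2 f3 where k0: "kills M M M U0 a0 b0 c0 f1 f2 f3" using kills_ex[OF t0] .
  note T = triD[OF t] and T0 = triD[OF t0]
  obtain \<kappa>0 where \<kappa>0: "H U0 M \<kappa>0" "\<And>x. x \<in> carrier M \<Longrightarrow> \<kappa>0 (a0 x) = x"
    "\<And>x. x \<in> carrier M \<Longrightarrow> \<kappa>0 (b0 x) = x" "\<And>x. x \<in> carrier M \<Longrightarrow> \<kappa>0 (c0 x) = x"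
    by (rule tri_univ[OF t0 oM hm_id hm_id hm_id]) (rule that)
  obtain \<theta> where \<theta>: "H U U0 \<theta>" "\<And>x. x \<in> carrier X \<Longrightarrow> \<theta> (a x) = a0 (q x)"
    "\<And>x. x \<in> carrier X \<Longrightarrow> \<theta> (b x) = b0 (q x)" "\<And>x. x \<in> carrier X \<Longrightarrow> \<theta> (c x) = c0 (q x)"
    by (rule tri_univ[OF t T0(1) hm_comp[OF q(1) T0(3)] hm_comp[OF q(1) T0(4)] hm_comp[OF q(1) T0(5)]]) (rule that)
  have qx: "\<exists>x\<in>carrier X. q x = y" if "y \<in> carrier M" for y using that q(2) by (metis imageE)
  have surj: "\<theta> ` carrier U = carrier U0"
  proof (rule hm_surj_gen[OF vob_alg[OF T(2)] \<theta>(1) vob_alg[OF T0(2)] T0(6)])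
    show "a0 ` carrier M \<union> b0 ` carrier M \<union> c0 ` carrier M \<subseteq> \<theta> ` carrier U"
    proof
      fix s assume "s \<in> a0 ` carrier M \<union> b0 ` carrier M \<union> c0 ` carrier M"
      then obtain y where y: "y \<in> carrier M" "s = a0 y \<or> s = b0 y \<or> s = c0 y" by auto
      obtain x where x: "x \<in> carrier X" "q x = y" using qx[OF y(1)] by blast
      then have "s = \<theta> (a x) \<or> s = \<theta> (b x) \<or> s = \<theta> (c x)" using y \<theta> by auto
      then show "s \<in> \<theta> ` carrier U" using hm_in[OF T(3) x(1)] hm_in[OF T(4) x(1)] hm_in[OF T(5) x(1)] by blast
    qed
  qed
  note km = kills_map[OF t k t0 k0 \<theta> q(1) q(1) q(1)]
  have \<kappa>\<theta>: "\<kappa>0 (\<theta> u) = q (\<kappa> u)" if "u \<in> carrier U" for u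
    by (rule tri_ext[OF t hm_comp[OF \<theta>(1) \<kappa>0(1)] hm_comp[OF \<kappa>(1) q(1)] _ _ _ that])
      (use \<theta> \<kappa>0 \<kappa> hm_in[OF q(1)] in auto)
  show ?thesis
  proof (rule nilpI[OF M t0 k0 \<kappa>0])
    fix u assume u: "u \<in> carrier U0" "f1 u = z U0" "f2 u = z U0" "f3 u = z U0"
    then obtain u' where u': "u' \<in> carrier U" "\<theta> u' = u" using surj by (metis imageE)
    obtain v where "v \<in> carrier U" "e1 v = z U" "e2 v = z U" "e3 v = z U" "\<theta> v = \<theta> u'"
      by (rule kill_correction[OF t k T0(2) \<theta>(1) km, of u']) (use u u' in \<open>auto intro: that\<close>)
    then show "\<kappa>0 u = z M" using nil[of v] \<kappa>\<theta>[of v] u' by simp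
  qed
qed

lemma codiag_ex:
  assumes "tri M M M U a b c" "vob ar E M"
  obtains \<kappa> where "H U M \<kappa>" "\<And>x. x \<in> carrier M \<Longrightarrow> \<kappa> (a x) = x" "\<And>x. x \<in> carrier M \<Longrightarrow> \<kappa> (b x) = x"
      "\<And>x. x \<in> carrier M \<Longrightarrow> \<kappa> (c x) = x"
proof -
  have "ob M" using assms by simp
  show thesis by (rule tri_univ[OF assms(1) \<open>ob M\<close> hm_id hm_id hm_id]) (rule that)
qed

lemma nilp_surj:
  assumes A: "vob ar E A" "nilp A" and B: "vob ar E B" and h: "H A B h" "h ` carrier A = carrier B"
  shows "nilp B"
proof -
  have oA: "ob A" using A by simp
  obtain U a b c where t: "tri A A A U a b c" using tri_ex[OF oA oA oA] .
  obtain e1 e2 e3 where k: "kills A A A U a b c e1 e2 e3" using kills_ex[OF t] .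
  obtain \<kappa> where \<kappa>: "H U A \<kappa>" "\<And>x. x \<in> carrier A \<Longrightarrow> \<kappa> (a x) = x"
    "\<And>x. x \<in> carrier A \<Longrightarrow> \<kappa> (b x) = x" "\<And>x. x \<in> carrier A \<Longrightarrow> \<kappa> (c x) = x"
    by (rule codiag_ex[OF t A(1)]) (rule that)
  show ?thesis
    by (rule nilp_quot[OF A(1) B h t k \<kappa>])
      (use nilpD[OF A(2) A(1) A(1) A(1) t k \<kappa>(1)] z_hm[OF A(1) B h(1)] in auto)
qed

lemma nilp_alg_class: "alg_class ar E nilp"
  by unfold_locales (use inf card wfE nilp_sep in auto)

lemma nilp_pointed_class: "pointed_class ar E nilp"
  by (intro pointed_class.intro nilp_alg_class pointed_class_axioms.intro) (rule pt)

lemma nilp_maltsev_class: "maltsev_class ar E nilp mal"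
  by (intro maltsev_class.intro nilp_pointed_class maltsev_class_axioms.intro)
    (use mal_in mal_hm mal1 mal2 in blast)+

text \<open>This discharges \<open>NIL\<close>. The coproduct \<open>W\<close> is taken among
  two-nilpotent algebras, while nilpotency speaks of the coproduct \<open>U\<close> of the variety;
  \<open>W\<close> is a quotient of \<open>U\<close>, compatibly with the killing maps.\<close>

lemma nilp_jointly_monic:
  assumes o: "vob ar E A" "vob ar E B" "vob ar E C"
    and n: "nilp A" "nilp B" "nilp C"
    and t: "alg_class.tri ar E nilp A B C W a b c" and k: "kills A B C W a b c e1 e2 e3"
    and wv: "w \<in> carrier W" "v \<in> carrier W" "e1 w = e1 v" "e2 w = e2 v" "e3 w = e3 v"
  shows "w = v"
proof -
  interpret N: alg_class ar E nilp by (rule nilp_alg_class)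
  note T = N.triD[OF t]
  have W: "vob ar E W" "nilp W" using T(1) by auto
  have "ob A" "ob B" "ob C" using o by simp_all
  then obtain U a' b' c' where t': "tri A B C U a' b' c'" by (rule tri_ex)
  note T' = triD[OF t']
  obtain f1 f2 f3 where k': "kills A B C U a' b' c' f1 f2 f3" using kills_ex[OF t'] .
  have oW: "ob W" using W by simp
  obtain \<psi> where \<psi>: "H U W \<psi>" "\<And>x. x \<in> carrier A \<Longrightarrow> \<psi> (a' x) = a x"
    "\<And>x. x \<in> carrier B \<Longrightarrow> \<psi> (b' x) = b x" "\<And>x. x \<in> carrier C \<Longrightarrow> \<psi> (c' x) = c x"
    by (rule tri_univ[OF t' oW T(3,4,5)]) (rule that)
  have surj: "\<psi> ` carrier U = carrier W"
  proof (rule hm_surj_gen[OF vob_alg[OF T'(2)] \<psi>(1) vob_alg[OF W(1)] T(6)])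
    show "a ` carrier A \<union> b ` carrier B \<union> c ` carrier C \<subseteq> \<psi> ` carrier U"
    proof
      fix s assume "s \<in> a ` carrier A \<union> b ` carrier B \<union> c ` carrier C"
      then consider x where "x \<in> carrier A" "s = a x" | x where "x \<in> carrier B" "s = b x"
        | x where "x \<in> carrier C" "s = c x" by blast
      then show "s \<in> \<psi> ` carrier U"
      proof cases
        case 1 then show ?thesis using \<psi>(2) hm_in[OF T'(3)] by (metis imageI)
      next
        case 2 then show ?thesis using \<psi>(3) hm_in[OF T'(4)] by (metis imageI)
      next
        case 3 then show ?thesis using \<psi>(4) hm_in[OF T'(5)] by (metis imageI)
      qed
    qed
  qed
  have e: "H W W e1" "H W W e2" "H W W e3" using k by (auto simp: kills_def)
  have f: "H U U f1" "H U U f2" "H U U f3" using k' by (auto simp: kills_def)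
  have \<psi>z: "\<psi> (z U) = z W" by (rule z_hm[OF T'(2) W(1) \<psi>(1)])
  note K = k[unfolded kills_def] k'[unfolded kills_def]
  have c1: "\<psi> (f1 x) = e1 (\<psi> x)" if "x \<in> carrier U" for x
    by (rule tri_ext[OF t' hm_comp[OF f(1) \<psi>(1)] hm_comp[OF \<psi>(1) e(1)] _ _ _ that]) (use K \<psi> \<psi>z in auto)
  have c2: "\<psi> (f2 x) = e2 (\<psi> x)" if "x \<in> carrier U" for x
    by (rule tri_ext[OF t' hm_comp[OF f(2) \<psi>(1)] hm_comp[OF \<psi>(1) e(2)] _ _ _ that]) (use K \<psi> \<psi>z in auto)
  have c3: "\<psi> (f3 x) = e3 (\<psi> x)" if "x \<in> carrier U" for x
    by (rule tri_ext[OF t' hm_comp[OF f(3) \<psi>(1)] hm_comp[OF \<psi>(1) e(3)] _ _ _ that]) (use K \<psi> \<psi>z in auto)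
  show ?thesis
  proof (rule D_zero[OF W(1) wv(1,2)])
    fix l assume l: "l \<in> KK"
    let ?u = "D W w v l"
    have u: "?u \<in> carrier W" by (rule D_in[OF W(1) wv(1,2) l])
    \<comment> \<open>Difference terms vanish on the diagonal, so each difference of
      \<open>w\<close> and \<open>v\<close> is killed by all three maps.\<close>
    have eu: "e1 ?u = z W" "e2 ?u = z W" "e3 ?u = z W"
      using D_hm[OF W(1) W(1) e(1) wv(1,2) l] D_hm[OF W(1) W(1) e(2) wv(1,2) l] D_hm[OF W(1) W(1) e(3) wv(1,2) l]
        D_same[OF W(1) hm_in[OF e(1) wv(2)] l] D_same[OF W(1) hm_in[OF e(2) wv(2)] l]
        D_same[OF W(1) hm_in[OF e(3) wv(2)] l] wv by simp_all
    obtain u' where u': "u' \<in> carrier U" "\<psi> u' = ?u" using surj u by (metis imageE)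
    obtain y where y: "y \<in> carrier U" "f1 y = z U" "f2 y = z U" "f3 y = z U" "\<psi> y = \<psi> u'"
      by (rule kill_correction[OF t' k' W(1) \<psi>(1) c1 c2 c3, of u']) (use eu u' in \<open>auto intro: that\<close>)
    show "?u = z W" using nilpD[OF W(2) o t' k' \<psi>(1) y(1-4)] y(5) u'(2) by simp
  qed
qed

end

section \<open>The category of algebras\<close>

text \<open>Arrows carry functions that are undefined off the carrier. \<open>mk\<close> restricts,
  so that homomorphisms can be handled as plain functions and arrows compared on carriers.\<close>

definition mk :: "('f, 'u) alg \<Rightarrow> ('u \<Rightarrow> 'u) \<Rightarrow> ('f, 'u) alg \<Rightarrow> ('f, 'u) alg \<times> ('u \<Rightarrow> 'u) \<times> ('f, 'u) alg" where
  "mk A h B = (A, restrict h (carrier A), B)"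

definition ap :: "('f, 'u) alg \<times> ('u \<Rightarrow> 'u) \<times> ('f, 'u) alg \<Rightarrow> 'u \<Rightarrow> 'u" where
  "ap f = fst (snd f)"

lemma ap_mk [simp]: "x \<in> carrier A \<Longrightarrow> ap (mk A h B) x = h x"
  by (simp add: ap_def mk_def)

lemma mk_eq: "mk A h B = mk A h' B \<longleftrightarrow> (\<forall>x\<in>carrier A. h x = h' x)"
  by (auto simp: mk_def fun_eq_iff restrict_def)

lemma full_subcat_True: "full_subcat C (\<lambda>_. True) = C"
  by (simp add: full_subcat_def)

lemma hom_arr: "f \<in> hom C A B \<Longrightarrow> f \<in> Arr C" "f \<in> hom C A B \<Longrightarrow> Dom C f = A" "f \<in> hom C A B \<Longrightarrow> Cod C f = B"
  by (simp_all add: hom_def)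

lemma arr_hom: "f \<in> Arr C \<Longrightarrow> f \<in> hom C (Dom C f) (Cod C f)"
  by (simp add: hom_def)

context alg_class
begin

definition CP where "CP = full_subcat (Variety ar E) P"

lemma Obj_CP: "A \<in> Obj CP \<longleftrightarrow> ob A"
  by (auto simp: CP_def full_subcat_def Variety_def vob_def)

lemma hom_CP: "f \<in> hom CP A B \<longleftrightarrow> ob A \<and> ob B \<and> (\<exists>h. H A B h \<and> f = mk A h B)" (is "?L = ?R")
proof
  assume ?L
  then obtain h where h: "f = (A, h, B)" "ob A" "ob B" "h \<in> alg_homs ar A B"
    by (cases f) (auto simp: hom_def CP_def full_subcat_def Variety_def vob_def)
  then have "H A B h" "h = restrict h (carrier A)"
    by (auto simp: alg_homs_def hm_def extensional_restrict PiE_def)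
  then show ?R using h by (auto simp: mk_def)
next
  assume ?R
  then obtain h where h: "ob A" "ob B" "H A B h" "f = mk A h B" by blast
  have "H A B (restrict h (carrier A))" by (rule hm_cong[OF h(3)]) (use h in auto)
  then have "restrict h (carrier A) \<in> alg_homs ar A B"
    by (auto simp: alg_homs_def hm_def)
  then show ?L using h by (auto simp: hom_def CP_def full_subcat_def Variety_def vob_def mk_def)
qed

lemma mk_hom: "ob A \<Longrightarrow> ob B \<Longrightarrow> H A B h \<Longrightarrow> mk A h B \<in> hom CP A B"
  using hom_CP by blast

lemma hom_D:
  assumes "f \<in> hom CP A B"
  shows "ob A" "ob B" "H A B (ap f)" "f = mk A (ap f) B"
proof -
  obtain h where h: "ob A" "ob B" "H A B h" "f = mk A h B" using assms hom_CP by blast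
  show "ob A" "ob B" using h by blast+
  show "H A B (ap f)" by (rule hm_cong[OF h(3)]) (use h in auto)
  show "f = mk A (ap f) B" using h by (simp add: mk_eq)
qed

lemma ap_in: "f \<in> hom CP A B \<Longrightarrow> x \<in> carrier A \<Longrightarrow> ap f x \<in> carrier B"
  using hm_in[OF hom_D(3)] .

lemma hom_eqI: "f \<in> hom CP A B \<Longrightarrow> g \<in> hom CP A B \<Longrightarrow> (\<And>x. x \<in> carrier A \<Longrightarrow> ap f x = ap g x) \<Longrightarrow> f = g"
  using hom_D(4)[of f A B] hom_D(4)[of g A B] mk_eq by metis

lemma comp_mk:
  assumes "ob A" "ob B" "ob C" "H A B f" "H B C g"
  shows "Comp CP (mk B g C) (mk A f B) = mk A (\<lambda>x. g (f x)) C"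
  using hm_in[OF assms(4)]
  by (auto simp: CP_def full_subcat_def Variety_def mk_def compose_def fun_eq_iff restrict_def)

lemma comp_hom:
  assumes f: "f \<in> hom CP A B" and g: "g \<in> hom CP B C"
  shows "Comp CP g f \<in> hom CP A C" "x \<in> carrier A \<Longrightarrow> ap (Comp CP g f) x = ap g (ap f x)"
proof -
  note F = hom_D[OF f] and G = hom_D[OF g]
  have e: "Comp CP g f = mk A (\<lambda>x. ap g (ap f x)) C"
    using comp_mk[OF F(1,2) G(2) F(3) G(3)] F(4) G(4) by simp
  show "Comp CP g f \<in> hom CP A C" unfolding e by (rule mk_hom[OF F(1) G(2) hm_comp[OF F(3) G(3)]])
  show "x \<in> carrier A \<Longrightarrow> ap (Comp CP g f) x = ap g (ap f x)" by (simp add: e)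
qed

lemma Ide_CP: "Ide CP A = mk A (\<lambda>x. x) A"
  by (simp add: CP_def full_subcat_def Variety_def mk_def restrict_def fun_eq_iff)

lemma Ide_hom: "ob A \<Longrightarrow> Ide CP A \<in> hom CP A A"
  by (simp add: Ide_CP mk_hom)

lemma ap_Ide [simp]: "x \<in> carrier A \<Longrightarrow> ap (Ide CP A) x = x"
  by (simp add: Ide_CP)

lemma Dom_mk [simp]: "Dom CP (mk A h B) = A" and Cod_mk [simp]: "Cod CP (mk A h B) = B"
  by (simp_all add: CP_def full_subcat_def Variety_def mk_def)

lemma mk_Arr: "ob A \<Longrightarrow> ob B \<Longrightarrow> H A B h \<Longrightarrow> mk A h B \<in> Arr CP"
  using hom_arr(1)[OF mk_hom] .

text \<open>A zero object is a one-element algebra \<open>Z\<close>, and the arrows \<open>Z \<rightarrow> A\<close> are the one-element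
  subalgebras of \<open>A\<close>.\<close>

lemma pointed_pt:
  assumes "pointed CP" and A: "ob A"
  shows "\<exists>!x. x \<in> carrier A \<and> (\<forall>f. oper A f (replicate (ar f) x) = x)"
proof -
  obtain Z where Z: "is_zero CP Z" using assms(1) by (auto simp: pointed_def)
  then have oZ: "ob Z" by (simp add: is_zero_def is_initial_def Obj_CP)
  have ini: "\<exists>!f. f \<in> hom CP Z B" if "ob B" for B using Z that by (simp add: is_zero_def is_initial_def Obj_CP)
  have ter: "\<exists>!f. f \<in> hom CP B Z" if "ob B" for B using Z that by (simp add: is_zero_def is_terminal_def Obj_CP)
  fix u :: 'u
  let ?t = "triv u"
  obtain f where f: "f \<in> hom CP ?t Z" using ter[OF triv_ob] by blast
  have g: "mk Z (\<lambda>_. u) ?t \<in> hom CP Z ?t" by (rule mk_hom[OF oZ triv_ob triv_hm])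
  define z0 where "z0 = ap f u"
  have z0: "z0 \<in> carrier Z" using ap_in[OF f] by (simp add: z0_def)
  have "Comp CP f (mk Z (\<lambda>_. u) ?t) = Ide CP Z" using ini[OF oZ] comp_hom(1)[OF g f] Ide_hom[OF oZ] by blast
  then have Zz: "x = z0" if "x \<in> carrier Z" for x
    using comp_hom(2)[OF g f that] that by (simp add: z0_def)
  obtain k where k: "k \<in> hom CP Z A" using ini[OF A] by blast
  show ?thesis
  proof
    show "ap k z0 \<in> carrier A \<and> (\<forall>f. oper A f (replicate (ar f) (ap k z0)) = ap k z0)"
    proof (intro conjI allI)
      fix f
      have r: "set (replicate (ar f) z0) \<subseteq> carrier Z" "length (replicate (ar f) z0) = ar f" using z0 by auto
      have "oper Z f (replicate (ar f) z0) = z0" by (rule Zz, rule alg_op[of ar Z, OF _ r]) (use oZ in simp)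
      then show "oper A f (replicate (ar f) (ap k z0)) = ap k z0"
        using hm_op[OF hom_D(3)[OF k] r] by simp
    qed (rule ap_in[OF k z0])
    fix x assume x: "x \<in> carrier A \<and> (\<forall>f. oper A f (replicate (ar f) x) = x)"
    have "H Z A (\<lambda>_. x)" by (rule hmI) (use x in \<open>auto simp: map_replicate_const\<close>)
    from mk_hom[OF oZ A this] have "mk Z (\<lambda>_. x) A = k" using ini[OF A] k by blast
    then show "x = ap k z0" using z0 by (metis ap_mk)
  qed
qed

end

section \<open>From protomodularity to terms\<close>

context pointed_class
begin

text \<open>Protomodularity is applied only to pullbacks along \<open>0 \<rightarrow> B\<close>, and
  these are the kernels.\<close>

lemma kernel_pullback:
  assumes G: "ob G" and B: "ob B" and q: "H G B q"
  shows "is_pullback CP (mk (triv u) (\<lambda>_. z B) B) (mk G q B)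
     (mk (sub_alg G {x \<in> carrier G. q x = z B}) (\<lambda>_. u) (triv u))
     (mk (sub_alg G {x \<in> carrier G. q x = z B}) (\<lambda>x. x) G)"
proof -
  let ?t = "triv u" and ?K = "sub_alg G {x \<in> carrier G. q x = z B}"
  have cl: "closed ar G {x \<in> carrier G. q x = z B}" by (rule closed_ker) (use G B q in auto)
  have K: "ob ?K" by (rule ob_sub[OF G cl])
  have tB: "H ?t B (\<lambda>_. z B)" using hm_z B by blast
  note KG = sub_hm[OF cl]
  note arr = mk_hom[OF triv_ob B tB] mk_hom[OF G B q] mk_hom[OF K triv_ob triv_hm] mk_hom[OF K G KG]
  have 1: "Comp CP (mk ?t (\<lambda>_. z B) B) (mk ?K (\<lambda>_. u) ?t) = Comp CP (mk G q B) (mk ?K (\<lambda>x. x) G)"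
    unfolding comp_mk[OF K triv_ob B triv_hm tB] comp_mk[OF K G B KG q] by (simp add: mk_eq)
  have 2: "\<exists>!h. h \<in> hom CP W ?K \<and> Comp CP (mk ?K (\<lambda>_. u) ?t) h = x \<and> Comp CP (mk ?K (\<lambda>x. x) G) h = y"
    if x: "x \<in> hom CP W ?t" and y: "y \<in> hom CP W G"
      and xy: "Comp CP (mk ?t (\<lambda>_. z B) B) x = Comp CP (mk G q B) y" for x y W
  proof
    note Y = hom_D[OF y]
    have "q (ap y w) = z B" if w: "w \<in> carrier W" for w
      using comp_hom(2)[OF x arr(1) w] comp_hom(2)[OF y arr(2) w] xy ap_in[OF x w] ap_in[OF y w] by simp
    then have hK: "H W ?K (ap y)" using ap_in[OF y] by (intro hm_into_sub[OF Y(3)]) auto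
    note m = mk_hom[OF Y(1) K hK]
    show "mk W (ap y) ?K \<in> hom CP W ?K \<and> Comp CP (mk ?K (\<lambda>_. u) ?t) (mk W (ap y) ?K) = x \<and>
      Comp CP (mk ?K (\<lambda>x. x) G) (mk W (ap y) ?K) = y"
    proof (intro conjI m)
      show "Comp CP (mk ?K (\<lambda>_. u) ?t) (mk W (ap y) ?K) = x"
        by (rule hom_eqI[OF comp_hom(1)[OF m arr(3)] x])
          (use comp_hom(2)[OF m arr(3)] ap_in[OF comp_hom(1)[OF m arr(3)]] ap_in[OF x] in auto)
      show "Comp CP (mk ?K (\<lambda>x. x) G) (mk W (ap y) ?K) = y"
        unfolding comp_mk[OF Y(1) K G hK KG] using Y(4) by simp
    qed
    fix h assume h: "h \<in> hom CP W ?K \<and> Comp CP (mk ?K (\<lambda>_. u) ?t) h = x \<and> Comp CP (mk ?K (\<lambda>x. x) G) h = y"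
    then show "h = mk W (ap y) ?K"
      by (intro hom_eqI[OF _ m]) (use comp_hom(2)[OF _ arr(4), of h W] ap_in[of h W ?K] in auto)
  qed
  show ?thesis
    unfolding is_pullback_def
  proof (intro conjI ballI impI)
    fix x y assume xy: "x \<in> Arr CP" "y \<in> Arr CP" and
      e: "Dom CP x = Dom CP y \<and> Cod CP x = Dom CP (mk ?t (\<lambda>_. z B) B) \<and> Cod CP y = Dom CP (mk G q B) \<and>
        Comp CP (mk ?t (\<lambda>_. z B) B) x = Comp CP (mk G q B) y"
    have "x \<in> hom CP (Dom CP x) ?t" "y \<in> hom CP (Dom CP x) G" using xy e by (auto simp: hom_def)
    from 2[OF this] e show "\<exists>!h. h \<in> hom CP (Dom CP x) (Dom CP (mk ?K (\<lambda>_. u) ?t)) \<and>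
        Comp CP (mk ?K (\<lambda>_. u) ?t) h = x \<and> Comp CP (mk ?K (\<lambda>x. x) G) h = y" by simp
  qed (use arr[THEN hom_arr(1)] 1 in simp_all)
qed

text \<open>The subalgebra \<open>T\<close> of the free algebra on \<open>x, y\<close> generated by \<open>y\<close> and the kernel of the
  retraction \<open>x, y \<mapsto> y\<close> is everything, by protomodularity. An expression of \<open>x\<close> in these generators
  yields the Mal'tsev operation (this is the Bourn-Janelidze characterization).\<close>

lemma protomodular_terms:
  assumes pm: "protomodular CP" and all: "\<And>A. vob ar E A \<Longrightarrow> P A"
  shows "\<exists>(mal :: ('f, 'u) alg \<Rightarrow> _) D KK. protomodular_variety ar E mal D KK"
proof -
  have ob: "ob A = vob ar E A" for A using all by blast
  have bu: "(UNIV :: bool set) \<lesssim> (UNIV :: 'u set)"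
    using inf by (simp add: finite_lepoll_infinite)
  obtain F \<eta> where F: "ob F" "range \<eta> \<subseteq> carrier F" "carrier F = gen ar F (range \<eta>)"
    and ext: "\<And>M v. (M, v) \<in> {(M, v). ob M \<and> range v \<subseteq> carrier M} \<Longrightarrow> \<exists>h. H F M h \<and> (\<forall>g :: bool. h (\<eta> g) = v g)"
    by (rule free_ex[OF bu, of "{(M, v). ob M \<and> range v \<subseteq> carrier M}"]) auto
  have vF: "vob ar E F" using F by blast
  define x y where "x = \<eta> True" and "y = \<eta> False"
  have ran: "range \<eta> = {x, y}" by (auto simp: x_def y_def UNIV_bool)
  have xy: "x \<in> carrier F" "y \<in> carrier F" using F(2) ran by auto
  have "\<exists>h. H F M h \<and> h x = a \<and> h y = b" if "vob ar E M" "a \<in> carrier M" "b \<in> carrier M" for M a b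
  proof -
    have "(M, \<lambda>g. if g then a else b) \<in> {(M, v). ob M \<and> range v \<subseteq> carrier M}"
      using that all by auto
    from ext[OF this] obtain h where h: "H F M h" "\<And>g. h (\<eta> g) = (if g then a else b)" by blast
    show ?thesis using h(1) h(2)[of True] h(2)[of False] by (auto simp: x_def y_def)
  qed
  \<comment> \<open>\<open>hh M a b\<close> evaluates binary terms at \<open>(a, b)\<close>: an
    element of \<open>F\<close> is a binary term operation. The operations \<open>D\<close> will be
    \<open>hh\<close> itself.\<close>
  then obtain hh where hh: "\<And>M a b. vob ar E M \<Longrightarrow> a \<in> carrier M \<Longrightarrow> b \<in> carrier M \<Longrightarrow>
      H F M (hh M a b) \<and> hh M a b x = a \<and> hh M a b y = b"
    by metis
  have F_ext: "h w = h' w" if "H F M h" "H F M h'" "h x = h' x" "h y = h' y" "w \<in> carrier F" for h h' M w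
    by (rule hm_agree_gen[of ar F "range \<eta>"]) (use that F ran xy vF in auto)
  define e where "e = hh F y y"
  have e: "H F F e" "e x = y" "e y = y" using hh[OF vF xy(2) xy(2)] by (auto simp: e_def)
  define B where "B = sub_alg F (gen ar F {y})"
  have Bcl: "closed ar F (gen ar F {y})" by (rule gen_closed) (use xy vF in auto)
  have oB: "ob B" unfolding B_def by (rule ob_sub[OF F(1) Bcl])
  have eB: "e w \<in> gen ar F {y}" if "w \<in> carrier F" for w
  proof -
    have "e w \<in> gen ar F (e ` range \<eta>)"
      by (rule hm_gen[OF vob_alg[OF vF] F(2) e(1)]) (use that F(3) in simp)
    then show ?thesis using ran e by simp
  qed
  have eid: "e w = w" if "w \<in> gen ar F {y}" for w
    by (rule hm_agree_gen[OF vob_alg[OF vF] _ e(1) hm_id _ that]) (use xy e in auto)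
  define Ks where "Ks = {w \<in> carrier F. e w = z F}"
  have zB: "z B = z F" using closed_z(2)[OF vF Bcl] by (simp add: B_def)
  have Kcl: "closed ar F Ks" unfolding Ks_def by (rule closed_ker[OF vF vF e(1)])
  define T where "T = gen ar F (Ks \<union> {y})"
  have KyF: "Ks \<union> {y} \<subseteq> carrier F" using xy by (auto simp: Ks_def)
  have Tcl: "closed ar F T" unfolding T_def by (rule gen_closed[OF vob_alg[OF vF] KyF])
  have oT: "ob (sub_alg F T)" by (rule ob_sub[OF F(1) Tcl])
  have TF: "T \<subseteq> carrier F" using Tcl by (simp add: closed_def)
  have KT: "Ks \<subseteq> T" by (auto simp: T_def intro: gen.base)
  have BT: "gen ar F {y} \<subseteq> T" unfolding T_def by (rule gen_mono) simp
  have eFB: "H F B e" unfolding B_def by (rule hm_into_sub[OF e(1) eB])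
  have eTB: "H (sub_alg F T) B e" by (rule hm_sub[OF eFB Tcl])
  have BF: "H B F (\<lambda>x. x)" unfolding B_def by (rule sub_hm[OF Bcl])
  have BTh: "H B (sub_alg F T) (\<lambda>x. x)" by (rule hm_into_sub[OF BF]) (use BT in \<open>auto simp: B_def\<close>)
  have TFh: "H (sub_alg F T) F (\<lambda>x. x)" by (rule sub_hm[OF Tcl])
  fix u :: 'u
  let ?K = "sub_alg F Ks"
  let ?f = "mk (triv u) (\<lambda>_. z B) B"
  have oK: "ob ?K" by (rule ob_sub[OF F(1) Kcl])
  have Keq: "{w \<in> carrier F. e w = z B} = Ks" "{w \<in> carrier (sub_alg F T). e w = z B} = Ks"
    using KT TF by (auto simp: Ks_def zB)
  have pb: "is_pullback CP ?f (mk F e B) (mk ?K (\<lambda>_. u) (triv u)) (mk ?K (\<lambda>x. x) F)"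
    using kernel_pullback[OF F(1) oB eFB, of u] unfolding Keq .
  have pb': "is_pullback CP ?f (mk (sub_alg F T) e B) (mk ?K (\<lambda>_. u) (triv u)) (mk ?K (\<lambda>x. x) (sub_alg F T))"
    using kernel_pullback[OF oT oB eTB, of u] unfolding Keq by simp
  have KTh: "H ?K (sub_alg F T) (\<lambda>x. x)" by (rule hm_into_sub[OF sub_hm[OF Kcl]]) (use KT in auto)
  have iK: "iso CP (Ide CP ?K)"
    unfolding iso_def
    using Ide_hom[OF oK] comp_mk[OF oK oK oK hm_id hm_id]
    by (auto simp: Ide_CP hom_arr intro!: bexI[of _ "Ide CP ?K"])
  have point1: "is_point CP (mk (sub_alg F T) e B) (mk B (\<lambda>x. x) (sub_alg F T))"
    unfolding is_point_def
    using mk_Arr[OF oT oB eTB] mk_hom[OF oB oT BTh] comp_mk[OF oB oT oB BTh eTB] eid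
    by (auto simp: Ide_CP mk_eq) (auto simp: B_def)
  have point2: "is_point CP (mk F e B) (mk B (\<lambda>x. x) F)"
    unfolding is_point_def
    using mk_Arr[OF F(1) oB eFB] mk_hom[OF oB F(1) BF] comp_mk[OF oB F(1) oB BF eFB] eid
    by (auto simp: Ide_CP mk_eq) (auto simp: B_def)
  \<comment> \<open>\<open>T\<close> and \<open>F\<close> are points over \<open>B\<close> with the
    same kernel \<open>Ks\<close>, and the inclusion of \<open>T\<close> into \<open>F\<close>
    restricts to the identity on it; so this inclusion is invertible.\<close>
  have "iso CP (mk (sub_alg F T) (\<lambda>x. x) F)"
    by (rule pm[unfolded protomodular_def, rule_format, of "mk (sub_alg F T) e B" "mk B (\<lambda>x. x) (sub_alg F T)"
          "mk F e B" "mk B (\<lambda>x. x) F" _ ?f _ _ _ _ "Ide CP ?K"])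
      (use point1 point2 pb pb' iK Ide_hom[OF oK] mk_hom[OF oT F(1) TFh] comp_mk[OF oT F(1) oB TFh eFB]
        comp_mk[OF oB oT F(1) BTh TFh] comp_mk[OF oK oK triv_ob hm_id triv_hm]
        comp_mk[OF oK oK F(1) hm_id sub_hm[OF Kcl]] comp_mk[OF oK oT F(1) KTh TFh] in
        \<open>auto simp: Ide_CP\<close>)
  then obtain g where g: "g \<in> hom CP F (sub_alg F T)" "Comp CP (mk (sub_alg F T) (\<lambda>x. x) F) g = Ide CP F"
    by (auto simp: iso_def)
  have "ap g x = x"
    using comp_hom(2)[OF g(1) mk_hom[OF oT F(1) TFh] xy(1)] g(2) ap_in[OF g(1) xy(1)] xy(1) by simp
  then have "x \<in> T" using ap_in[OF g(1) xy(1)] by simp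
  \<comment> \<open>This writes \<open>x = t(k\<^sub>1, ..., k\<^sub>n, y)\<close> with all
    \<open>k\<^sub>i\<close> in the kernel, that is, with binary terms in \<open>x\<close> and
    \<open>y\<close> that vanish on the diagonal.\<close>
  then obtain t where t: "gwf ar t" "gvars t \<subseteq> Ks \<union> {y}" "gval F (\<lambda>g. g) t = x"
    using gen_gval unfolding T_def by metis
  have KsF: "k \<in> carrier F" if "k \<in> Ks" for k using that by (simp add: Ks_def)
  have hF: "hh M a b g \<in> carrier M" if "vob ar E M" "a \<in> carrier M" "b \<in> carrier M" "g \<in> carrier F" for M a b g
    using hm_in[of ar F M "hh M a b" g] hh[OF that(1-3)] that(4) by blast
  have hnat: "h (hh M a b g) = hh N (h a) (h b) g"
    if "vob ar E M" "vob ar E N" "H M N h" "a \<in> carrier M" "b \<in> carrier M" "g \<in> carrier F" for M N h a b g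
  proof -
    have h1: "H F M (hh M a b)" "hh M a b x = a" "hh M a b y = b" using hh[OF that(1,4,5)] by auto
    have h2: "H F N (hh N (h a) (h b))" "hh N (h a) (h b) x = h a" "hh N (h a) (h b) y = h b"
      using hh[OF that(2) hm_in[OF that(3,4)] hm_in[OF that(3,5)]] by auto
    show ?thesis by (rule F_ext[OF hm_comp[OF h1(1) that(3)] h2(1) _ _ that(6)]) (use h1 h2 in auto)
  qed
  have hsame: "hh M a a k = z M" if M: "vob ar E M" "a \<in> carrier M" and k: "k \<in> Ks" for M a k
  proof -
    have h: "H F M (hh M a a)" "hh M a a x = a" "hh M a a y = a" using hh[OF M(1,2,2)] by auto
    have "hh M a a k = hh M a a (e k)"
      by (rule F_ext[OF h(1) hm_comp[OF e(1) h(1)] _ _ KsF[OF k]]) (use h e in auto)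
    then show ?thesis using k z_hm[OF vF M(1) h(1)] by (simp add: Ks_def)
  qed
  \<comment> \<open>That is, \<open>t(k\<^sub>1(a, b), ..., k\<^sub>n(a, b), c)\<close>. For
    \<open>c = b\<close> it returns \<open>a\<close> by the choice of \<open>t\<close>; for
    \<open>a = b\<close> the kernel terms vanish just as they do at \<open>(c, c)\<close>, so it
    returns \<open>c\<close>.\<close>
  define mal where "mal = (\<lambda>M a b c. gval M (\<lambda>g. if g = y then c else hh M a b g) t)"
  have gv: "g \<in> Ks \<or> g = y" if "g \<in> gvars t" for g using t(2) that by blast
  have gvF: "g \<in> carrier F" if "g \<in> gvars t" for g using gv[OF that] KsF xy by auto
  have hx: "gval M (hh M a b) t = a" if "vob ar E M" "a \<in> carrier M" "b \<in> carrier M" for M a b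
    using gval_hm[OF vob_alg[OF vF] _ t(1), of M "hh M a b" "\<lambda>g. g"] hh[OF that] t(3) gvF by auto
  have mal1: "mal M a b b = a" if M: "vob ar E M" "a \<in> carrier M" "b \<in> carrier M" for M a b
  proof -
    have "mal M a b b = gval M (hh M a b) t"
      unfolding mal_def by (rule gval_cong) (use hh[OF M] in auto)
    then show ?thesis using hx[OF M] by simp
  qed
  have mal2: "mal M a a c = c" if M: "vob ar E M" "a \<in> carrier M" "c \<in> carrier M" for M a c
  proof -
    have "mal M a a c = gval M (hh M c c) t"
      unfolding mal_def
    proof (rule gval_cong)
      fix g assume "g \<in> gvars t"
      from gv[OF this] show "(if g = y then c else hh M a a g) = hh M c c g"
        using hsame[OF M(1,2)] hsame[OF M(1,3)] hh[OF M(1,3,3)] by auto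
    qed
    then show ?thesis using hx[OF M(1,3,3)] by simp
  qed
  \<comment> \<open>All elements of \<open>Ks\<close> serve as difference operations. If they vanish
    at \<open>(a, b)\<close>, then \<open>t\<close> takes the same value as at
    \<open>(b, b)\<close>, so \<open>a = b\<close>.\<close>
  have "protomodular_variety ar E mal hh Ks"
  proof (intro protomodular_variety.intro maltsev_class.intro pointed_class.intro alg_class.intro pointed_class_axioms.intro
      maltsev_class_axioms.intro protomodular_variety_axioms.intro)
    fix M :: "('f, 'u) alg" and a b c assume M: "vob ar E M" "a \<in> carrier M" "b \<in> carrier M" "c \<in> carrier M"
    show "mal M a b c \<in> carrier M"
      unfolding mal_def by (rule gval_in[OF vob_alg[OF M(1)] t(1)]) (use hF[OF M(1-3)] M gvF in auto)
    fix N :: "('f, 'u) alg" and h assume N: "vob ar E N" "H M N h"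
    show "h (mal M a b c) = mal N (h a) (h b) (h c)"
      unfolding mal_def
      using gval_hm[OF vob_alg[OF M(1)] N(2) t(1), of "\<lambda>g. if g = y then c else hh M a b g"] hF[OF M(1-3)] M gvF
        gval_cong[of t "\<lambda>g. h (if g = y then c else hh M a b g)" "\<lambda>g. if g = y then h c else hh N (h a) (h b) g" N]
        hnat[OF M(1) N M(2,3)] by auto
  next
    fix M :: "('f, 'u) alg" and a b assume M: "vob ar E M" "a \<in> carrier M" "b \<in> carrier M" and k: "\<And>k. k \<in> Ks \<Longrightarrow> hh M a b k = zr ar M"
    have "a = gval M (hh M a b) t" using hx[OF M] by simp
    also have "\<dots> = gval M (hh M b b) t"
    proof (rule gval_cong)
      fix g assume "g \<in> gvars t"
      from gv[OF this] show "hh M a b g = hh M b b g"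
        using hsame[OF M(1,3)] k hh[OF M] hh[OF M(1,3,3)] by auto
    qed
    also have "\<dots> = b" using hx[OF M(1,3,3)] .
    finally show "a = b" .
  qed (use inf card wfE pt mal1 mal2 hF hnat hsame KsF in auto)
  then show ?thesis by blast
qed

end

section \<open>The chosen limits and colimits, elementwise\<close>

lemma product_univ:
  assumes "is_product C A B p q" and f: "f \<in> hom C W A" and g: "g \<in> hom C W B"
  shows "\<exists>!h. h \<in> hom C W (Dom C p) \<and> Comp C p h = f \<and> Comp C q h = g"
proof -
  have "f \<in> Arr C" "g \<in> Arr C" "Dom C f = Dom C g \<and> Cod C f = A \<and> Cod C g = B"
    using f g by (auto simp: hom_def)
  with assms(1) have "\<exists>!h. h \<in> hom C (Dom C f) (Dom C p) \<and> Comp C p h = f \<and> Comp C q h = g"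
    unfolding is_product_def by blast
  then show ?thesis by (simp only: hom_arr[OF f])
qed

lemma coproduct_univ:
  assumes "is_coproduct C A B i j" and f: "f \<in> hom C A M" and g: "g \<in> hom C B M"
  shows "\<exists>!h. h \<in> hom C (Cod C i) M \<and> Comp C h i = f \<and> Comp C h j = g"
proof -
  have "f \<in> Arr C" "g \<in> Arr C" "Cod C f = Cod C g \<and> Dom C f = A \<and> Dom C g = B"
    using f g by (auto simp: hom_def)
  with assms(1) have "\<exists>!h. h \<in> hom C (Cod C i) (Cod C f) \<and> Comp C h i = f \<and> Comp C h j = g"
    unfolding is_coproduct_def by blast
  then show ?thesis by (simp only: hom_arr[OF f])
qed

lemma kernel_univ:
  assumes "is_kernel C f k" and f: "f \<in> hom C A B" and h: "h \<in> hom C W A"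
    and 0: "Comp C f h = zero_arr C W B"
  shows "\<exists>!u. u \<in> hom C W (Dom C k) \<and> Comp C k u = h"
proof -
  have "h \<in> Arr C" "Cod C h = Dom C f \<and> Comp C f h = zero_arr C (Dom C h) (Cod C f)"
    using f h 0 by (auto simp: hom_def)
  with assms(1) have "\<exists>!u. u \<in> hom C (Dom C h) (Dom C k) \<and> Comp C k u = h"
    unfolding is_kernel_def by blast
  then show ?thesis by (simp only: hom_arr[OF h])
qed

context pointed_class
begin

lemma hom_vob: "f \<in> hom CP A B \<Longrightarrow> vob ar E A" "f \<in> hom CP A B \<Longrightarrow> vob ar E B"
  using hom_D(1,2) by blast+

lemma ap_z: "f \<in> hom CP A B \<Longrightarrow> ap f (z A) = z B"
  using z_hm[OF hom_vob hom_D(3)] .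

lemma is_zero_iff: "is_zero CP Z \<longleftrightarrow> ob Z \<and> carrier Z = {z Z}"
proof
  assume Z: "is_zero CP Z"
  then have oZ: "ob Z" by (simp add: is_zero_def is_initial_def Obj_CP)
  have "\<exists>!f. f \<in> hom CP Z Z" using Z oZ by (simp add: is_zero_def is_initial_def Obj_CP)
  moreover have "mk Z (\<lambda>_. z Z) Z \<in> hom CP Z Z" using mk_hom[OF oZ oZ] hm_z oZ by blast
  ultimately have "mk Z (\<lambda>_. z Z) Z = mk Z (\<lambda>x. x) Z" using mk_hom[OF oZ oZ hm_id] by blast
  then show "ob Z \<and> carrier Z = {z Z}" using oZ z_in[of Z] by (auto simp: mk_eq)
next
  assume Z: "ob Z \<and> carrier Z = {z Z}"
  have "\<exists>!f. f \<in> hom CP Z A" if A: "ob A" for A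
  proof
    show "mk Z (\<lambda>_. z A) A \<in> hom CP Z A" using mk_hom hm_z Z A by blast
    then show "f = mk Z (\<lambda>_. z A) A" if "f \<in> hom CP Z A" for f
      by (intro hom_eqI[OF that]) (use Z ap_z[OF that] in auto)
  qed
  moreover have "\<exists>!f. f \<in> hom CP A Z" if A: "ob A" for A
  proof
    show m: "mk A (\<lambda>_. z Z) Z \<in> hom CP A Z" using mk_hom hm_z Z A by blast
    fix f assume f: "f \<in> hom CP A Z"
    show "f = mk A (\<lambda>_. z Z) Z"
      by (rule hom_eqI[OF f m]) (use Z ap_in[OF f] ap_in[OF m] in auto)
  qed
  ultimately show "is_zero CP Z" using Z by (simp add: is_zero_def is_initial_def is_terminal_def Obj_CP)
qed

lemma triv_zero: "is_zero CP (triv u)"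
  using triv_ob[of u] z_in[of "triv u"] by (auto simp: is_zero_iff)

lemma zero_arr_mk:
  assumes A: "ob A" and B: "ob B"
  shows "zero_arr CP A B = mk A (\<lambda>_. z B) B"
  unfolding zero_arr_def
proof (rule the_equality)
  fix u :: 'u
  let ?t = "triv u"
  have tB: "H ?t B (\<lambda>_. z B)" using hm_z B by blast
  have "mk A (\<lambda>_. z B) B = Comp CP (mk ?t (\<lambda>_. z B) B) (mk A (\<lambda>_. u) ?t)"
    using comp_mk[OF A triv_ob B triv_hm tB] by simp
  then show "\<exists>Z u v. is_zero CP Z \<and> u \<in> hom CP A Z \<and> v \<in> hom CP Z B \<and> mk A (\<lambda>_. z B) B = Comp CP v u"
    using triv_zero mk_hom[OF A triv_ob triv_hm] mk_hom[OF triv_ob B tB] by blast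
next
  fix f assume "\<exists>Z u v. is_zero CP Z \<and> u \<in> hom CP A Z \<and> v \<in> hom CP Z B \<and> f = Comp CP v u"
  then obtain Z u v where Z: "carrier Z = {z Z}" "u \<in> hom CP A Z" "v \<in> hom CP Z B" "f = Comp CP v u"
    unfolding is_zero_iff by blast
  have m: "mk A (\<lambda>_. z B) B \<in> hom CP A B" using mk_hom[OF A B] hm_z B by blast
  show "f = mk A (\<lambda>_. z B) B"
    unfolding Z(4)
    by (rule hom_eqI[OF comp_hom(1)[OF Z(2,3)] m])
      (use comp_hom(2)[OF Z(2,3)] ap_in[OF Z(2)] Z(1) ap_z[OF Z(3)] in auto)
qed

lemma zero_arr_hom: "ob A \<Longrightarrow> ob B \<Longrightarrow> zero_arr CP A B \<in> hom CP A B"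
  using mk_hom[of A B] hm_z[of B A] by (simp add: zero_arr_mk)

lemma ap_zero_arr: "ob A \<Longrightarrow> ob B \<Longrightarrow> x \<in> carrier A \<Longrightarrow> ap (zero_arr CP A B) x = z B"
  by (simp add: zero_arr_mk)

lemma eq_zero_arr:
  assumes "f \<in> hom CP A B"
  shows "f = zero_arr CP A B \<longleftrightarrow> (\<forall>x\<in>carrier A. ap f x = z B)"
proof
  show "\<forall>x\<in>carrier A. ap f x = z B" if "f = zero_arr CP A B"
    using that ap_zero_arr hom_D(1,2)[OF assms] by blast
  show "f = zero_arr CP A B" if "\<forall>x\<in>carrier A. ap f x = z B"
    by (rule hom_eqI[OF assms zero_arr_hom]) (use that ap_zero_arr hom_D(1,2)[OF assms] in auto)
qed

subsection \<open>Products\<close>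

text \<open>The products of the definitions are chosen by \<open>SOME\<close>, so their carriers are
  unknown. What survives the choice is that the projections are jointly bijective.\<close>

definition prodel where
  "prodel A B Q p q \<longleftrightarrow> p \<in> hom CP Q A \<and> q \<in> hom CP Q B \<and>
     (\<forall>a\<in>carrier A. \<forall>b\<in>carrier B. \<exists>w\<in>carrier Q. ap p w = a \<and> ap q w = b) \<and>
     (\<forall>w\<in>carrier Q. \<forall>v\<in>carrier Q. ap p w = ap p v \<and> ap q w = ap q v \<longrightarrow> w = v)"

lemma prodel_univ:
  assumes Q: "prodel A B Q p q" and f: "f \<in> hom CP W A" and g: "g \<in> hom CP W B"
  shows "\<exists>h. h \<in> hom CP W Q \<and> Comp CP p h = f \<and> Comp CP q h = g"
proof -
  have p: "p \<in> hom CP Q A" and q: "q \<in> hom CP Q B" using Q by (auto simp: prodel_def)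
  note W = hom_D(1)[OF f] and Q' = hom_D(1)[OF p]
  obtain h where h: "H W Q h" "\<And>y. y \<in> carrier W \<Longrightarrow> ap p (h y) = ap f y" "\<And>y. y \<in> carrier W \<Longrightarrow> ap q (h y) = ap g y"
    by (rule product_hm[OF _ hom_D(3)[OF p] hom_D(3)[OF q] _ _ _ hom_D(3)[OF f] hom_D(3)[OF g]])
      (use Q W Q' in \<open>auto simp: prodel_def\<close>)
  note m = mk_hom[OF W Q' h(1)]
  have "Comp CP p (mk W h Q) = f"
    by (rule hom_eqI[OF comp_hom(1)[OF m p] f]) (use comp_hom(2)[OF m p] h in auto)
  moreover have "Comp CP q (mk W h Q) = g"
    by (rule hom_eqI[OF comp_hom(1)[OF m q] g]) (use comp_hom(2)[OF m q] h in auto)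
  ultimately show ?thesis using m by blast
qed

lemma prodel_is_product:
  assumes Q: "prodel A B Q p q" shows "is_product CP A B p q"
proof -
  have p: "p \<in> hom CP Q A" and q: "q \<in> hom CP Q B" using Q by (auto simp: prodel_def)
  note a = hom_arr[OF p] hom_arr[OF q]
  show ?thesis
    unfolding is_product_def
  proof (intro conjI ballI impI)
    fix f g assume "f \<in> Arr CP" "g \<in> Arr CP" "Dom CP f = Dom CP g \<and> Cod CP f = A \<and> Cod CP g = B"
    then have f: "f \<in> hom CP (Dom CP f) A" and g: "g \<in> hom CP (Dom CP f) B" by (auto simp: hom_def)
    obtain h where h: "h \<in> hom CP (Dom CP f) Q" "Comp CP p h = f" "Comp CP q h = g"
      using prodel_univ[OF Q f g] by blast
    show "\<exists>!h. h \<in> hom CP (Dom CP f) (Dom CP p) \<and> Comp CP p h = f \<and> Comp CP q h = g"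
    proof
      show "h \<in> hom CP (Dom CP f) (Dom CP p) \<and> Comp CP p h = f \<and> Comp CP q h = g" using h a by simp
      fix k assume "k \<in> hom CP (Dom CP f) (Dom CP p) \<and> Comp CP p k = f \<and> Comp CP q k = g"
      then have k: "k \<in> hom CP (Dom CP f) Q" "Comp CP p k = f" "Comp CP q k = g" using a by auto
      show "k = h"
      proof (rule hom_eqI[OF k(1) h(1)])
        fix x assume x: "x \<in> carrier (Dom CP f)"
        have "ap p (ap k x) = ap p (ap h x)" "ap q (ap k x) = ap q (ap h x)"
          using comp_hom(2)[OF k(1) p x] comp_hom(2)[OF h(1) p x] comp_hom(2)[OF k(1) q x] comp_hom(2)[OF h(1) q x] k h
          by simp_all
        then show "ap k x = ap h x" using Q ap_in[OF k(1) x] ap_in[OF h(1) x] by (auto simp: prodel_def)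
      qed
    qed
  qed (use a in simp_all)
qed

lemma prodel_ex: assumes "ob A" "ob B" shows "\<exists>Q p q. prodel A B Q p q"
proof -
  obtain Q p q where Q: "ob Q" "H Q A p" "H Q B q"
    and *: "\<And>a b. a \<in> carrier A \<Longrightarrow> b \<in> carrier B \<Longrightarrow> \<exists>w\<in>carrier Q. p w = a \<and> q w = b"
    "\<And>w v. w \<in> carrier Q \<Longrightarrow> v \<in> carrier Q \<Longrightarrow> p w = p v \<Longrightarrow> q w = q v \<Longrightarrow> w = v"
    by (rule prod_ex[OF assms]) (rule that)
  have "prodel A B Q (mk Q p A) (mk Q q B)"
    unfolding prodel_def using mk_hom[OF Q(1) assms(1) Q(2)] mk_hom[OF Q(1) assms(2) Q(3)] * by fastforce
  then show ?thesis by blast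
qed

text \<open>Every product is isomorphic to the constructed one, whose elements are known.\<close>

lemma is_product_prodel:
  assumes "ob A" "ob B" and P: "is_product CP A B p q"
  shows "prodel A B (Dom CP p) p q"
proof -
  let ?Q = "Dom CP p"
  have p: "p \<in> hom CP ?Q A" and q: "q \<in> hom CP ?Q B" using P by (auto simp: is_product_def hom_def)
  obtain Q0 p0 q0 where Q0: "prodel A B Q0 p0 q0" using prodel_ex[OF assms(1,2)] by blast
  have p0: "p0 \<in> hom CP Q0 A" and q0: "q0 \<in> hom CP Q0 B" using Q0 by (auto simp: prodel_def)
  have univ: "\<exists>!h. h \<in> hom CP W ?Q \<and> Comp CP p h = f \<and> Comp CP q h = g"
    if "f \<in> hom CP W A" "g \<in> hom CP W B" for f g W
    by (rule product_univ[OF P that])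
  obtain h where h: "h \<in> hom CP Q0 ?Q" "Comp CP p h = p0" "Comp CP q h = q0" using univ[OF p0 q0] by blast
  obtain k where k: "k \<in> hom CP ?Q Q0" "Comp CP p0 k = p" "Comp CP q0 k = q" using prodel_univ[OF Q0 p q] by blast
  note oQ = hom_D(1)[OF p]
  have pk: "ap p (ap h (ap k x)) = ap p x" "ap q (ap h (ap k x)) = ap q x" if "x \<in> carrier ?Q" for x
    using comp_hom(2)[OF h(1) p ap_in[OF k(1) that]] comp_hom(2)[OF k(1) p0 that]
      comp_hom(2)[OF h(1) q ap_in[OF k(1) that]] comp_hom(2)[OF k(1) q0 that] h k by simp_all
  have hk: "Comp CP h k \<in> hom CP ?Q ?Q" by (rule comp_hom(1)[OF k(1) h(1)])
  have "Comp CP p (Comp CP h k) = p"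
    by (rule hom_eqI[OF comp_hom(1)[OF hk p] p]) (use comp_hom(2)[OF hk p] comp_hom(2)[OF k(1) h(1)] pk in simp)
  moreover have "Comp CP q (Comp CP h k) = q"
    by (rule hom_eqI[OF comp_hom(1)[OF hk q] q]) (use comp_hom(2)[OF hk q] comp_hom(2)[OF k(1) h(1)] pk in simp)
  moreover have I: "Ide CP ?Q \<in> hom CP ?Q ?Q" by (rule Ide_hom[OF oQ])
  moreover have "Comp CP p (Ide CP ?Q) = p"
    by (rule hom_eqI[OF comp_hom(1)[OF I p] p]) (use comp_hom(2)[OF I p] in simp)
  moreover have "Comp CP q (Ide CP ?Q) = q"
    by (rule hom_eqI[OF comp_hom(1)[OF I q] q]) (use comp_hom(2)[OF I q] in simp)
  ultimately have hkI: "Comp CP h k = Ide CP ?Q" using univ[OF p q] hk by blast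
  have hkx: "ap h (ap k x) = x" if "x \<in> carrier ?Q" for x
    using comp_hom(2)[OF k(1) h(1) that] that by (simp add: hkI)
  show ?thesis
    unfolding prodel_def
  proof (intro conjI ballI impI p q)
    fix a b assume ab: "a \<in> carrier A" "b \<in> carrier B"
    then obtain w where w: "w \<in> carrier Q0" "ap p0 w = a" "ap q0 w = b" using Q0 unfolding prodel_def by blast
    show "\<exists>w\<in>carrier ?Q. ap p w = a \<and> ap q w = b"
      using comp_hom(2)[OF h(1) p w(1)] comp_hom(2)[OF h(1) q w(1)] h w ap_in[OF h(1) w(1)]
      by (intro bexI[of _ "ap h w"]) auto
  next
    fix w v assume wv: "w \<in> carrier ?Q" "v \<in> carrier ?Q" "ap p w = ap p v \<and> ap q w = ap q v"
    have 1: "ap p0 (ap k w) = ap p0 (ap k v)" "ap q0 (ap k w) = ap q0 (ap k v)"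
      using comp_hom(2)[OF k(1) p0 wv(1)] comp_hom(2)[OF k(1) p0 wv(2)]
        comp_hom(2)[OF k(1) q0 wv(1)] comp_hom(2)[OF k(1) q0 wv(2)] k(2,3) wv(3) by simp_all
    have "\<forall>w\<in>carrier Q0. \<forall>v\<in>carrier Q0. ap p0 w = ap p0 v \<and> ap q0 w = ap q0 v \<longrightarrow> w = v"
      using Q0 by (simp add: prodel_def)
    from bspec[OF bspec[OF this ap_in[OF k(1) wv(1)]] ap_in[OF k(1) wv(2)]] 1
    have "ap k w = ap k v" by simp
    then show "w = v" using hkx[OF wv(1)] hkx[OF wv(2)] by metis
  qed
qed

lemma prod_CP:
  assumes "ob A" "ob B"
  shows "prodel A B (prod_obj CP A B) (proj1 CP A B) (proj2 CP A B)"
proof -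
  have "\<exists>x. case x of (p, q) \<Rightarrow> is_product CP A B p q"
    using prodel_ex[OF assms] prodel_is_product by fastforce
  from someI_ex[OF this, folded product_def]
  have "is_product CP A B (proj1 CP A B) (proj2 CP A B)"
    by (simp add: proj1_def proj2_def case_prod_beta)
  then show ?thesis using is_product_prodel[OF assms] by (simp add: prod_obj_def)
qed

lemma pairing_CP:
  assumes f: "f \<in> hom CP W A" and g: "g \<in> hom CP W B"
  shows "pairing CP f g \<in> hom CP W (prod_obj CP A B)"
    "x \<in> carrier W \<Longrightarrow> ap (proj1 CP A B) (ap (pairing CP f g) x) = ap f x"
    "x \<in> carrier W \<Longrightarrow> ap (proj2 CP A B) (ap (pairing CP f g) x) = ap g x"
proof -
  note Q = prod_CP[OF hom_D(2)[OF f] hom_D(2)[OF g]]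
  have p: "proj1 CP A B \<in> hom CP (prod_obj CP A B) A" "proj2 CP A B \<in> hom CP (prod_obj CP A B) B"
    using Q by (auto simp: prodel_def)
  have "\<exists>!h. h \<in> hom CP W (prod_obj CP A B) \<and> Comp CP (proj1 CP A B) h = f \<and> Comp CP (proj2 CP A B) h = g"
    using product_univ[OF prodel_is_product[OF Q] f g] by (simp only: prod_obj_def)
  from theI'[OF this] have 1: "pairing CP f g \<in> hom CP W (prod_obj CP A B)"
    "Comp CP (proj1 CP A B) (pairing CP f g) = f" "Comp CP (proj2 CP A B) (pairing CP f g) = g"
    by (simp_all add: pairing_def hom_arr[OF f] hom_arr[OF g])
  show "pairing CP f g \<in> hom CP W (prod_obj CP A B)" by (rule 1)
  show "x \<in> carrier W \<Longrightarrow> ap (proj1 CP A B) (ap (pairing CP f g) x) = ap f x"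
    "x \<in> carrier W \<Longrightarrow> ap (proj2 CP A B) (ap (pairing CP f g) x) = ap g x"
    using comp_hom(2)[OF 1(1) p(1)] comp_hom(2)[OF 1(1) p(2)] 1 by auto
qed

subsection \<open>Coproducts\<close>

lemma cop_is_coproduct:
  assumes A: "ob A" "ob B" and c: "cop A B S i j"
  shows "is_coproduct CP A B (mk A i S) (mk B j S)"
proof -
  note C = copD[OF c]
  note m = mk_hom[OF A(1) C(1,3)] mk_hom[OF A(2) C(1,4)]
  show ?thesis
    unfolding is_coproduct_def
  proof (intro conjI ballI impI)
    fix f g assume "f \<in> Arr CP" "g \<in> Arr CP" "Cod CP f = Cod CP g \<and> Dom CP f = A \<and> Dom CP g = B"
    then have f: "f \<in> hom CP A (Cod CP f)" and g: "g \<in> hom CP B (Cod CP f)" by (auto simp: hom_def)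
    let ?M = "Cod CP f"
    have M: "ob ?M" using hom_D(2)[OF f] .
    obtain h where h: "H S ?M h" "\<And>a. a \<in> carrier A \<Longrightarrow> h (i a) = ap f a" "\<And>b. b \<in> carrier B \<Longrightarrow> h (j b) = ap g b"
      by (rule cop_univ[OF c M hom_D(3)[OF f] hom_D(3)[OF g]]) (rule that)
    show "\<exists>!h. h \<in> hom CP (Cod CP (mk A i S)) ?M \<and> Comp CP h (mk A i S) = f \<and> Comp CP h (mk B j S) = g"
    proof
      show "mk S h ?M \<in> hom CP (Cod CP (mk A i S)) ?M \<and> Comp CP (mk S h ?M) (mk A i S) = f \<and>
        Comp CP (mk S h ?M) (mk B j S) = g"
        using mk_hom[OF C(1) M h(1)] comp_mk[OF A(1) C(1) M C(3) h(1)] comp_mk[OF A(2) C(1) M C(4) h(1)]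
          hom_D(4)[OF f] hom_D(4)[OF g] h by (auto simp: mk_eq) (metis mk_eq)+
      fix k assume k: "k \<in> hom CP (Cod CP (mk A i S)) ?M \<and> Comp CP k (mk A i S) = f \<and> Comp CP k (mk B j S) = g"
      then have kh: "k \<in> hom CP S ?M" by simp
      have "ap k s = h s" if "s \<in> carrier S" for s
        by (rule cop_ext[OF c hom_D(3)[OF kh] h(1) _ _ that])
          (use k h comp_hom(2)[OF m(1) kh] comp_hom(2)[OF m(2) kh] in auto)
      then show "k = mk S h ?M"
        by (intro hom_eqI[OF kh mk_hom[OF C(1) M h(1)]]) simp
    qed
  qed (use m[THEN hom_arr(1)] in simp_all)
qed

text \<open>Generation comes from the universal property: the injections factor through the
  subalgebra they generate, and the resulting endomorphism of \<open>Cod CP i\<close> is the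
  identity by uniqueness, so the subalgebra is everything.\<close>

lemma is_coproduct_cop:
  assumes A: "ob A" "ob B" and P: "is_coproduct CP A B i j"
  shows "cop A B (Cod CP i) (ap i) (ap j)" "i \<in> hom CP A (Cod CP i)" "j \<in> hom CP B (Cod CP i)"
proof -
  let ?S = "Cod CP i"
  show i: "i \<in> hom CP A ?S" and j: "j \<in> hom CP B ?S" using P by (auto simp: is_coproduct_def hom_def)
  note oS = hom_D(2)[OF i]
  have univ: "\<exists>!h. h \<in> hom CP ?S M \<and> Comp CP h i = f \<and> Comp CP h j = g"
    if "f \<in> hom CP A M" "g \<in> hom CP B M" for f g M
    by (rule coproduct_univ[OF P that])
  let ?U = "ap i ` carrier A \<union> ap j ` carrier B"
  have U: "?U \<subseteq> carrier ?S" using ap_in[OF i] ap_in[OF j] by auto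
  have cl: "closed ar ?S (gen ar ?S ?U)" by (rule gen_closed[OF _ U]) (use oS in auto)
  let ?G = "sub_alg ?S (gen ar ?S ?U)"
  have oG: "ob ?G" by (rule ob_sub[OF oS cl])
  have iG: "H A ?G (ap i)" by (rule hm_into_sub[OF hom_D(3)[OF i]]) (auto intro: gen.base)
  have jG: "H B ?G (ap j)" by (rule hm_into_sub[OF hom_D(3)[OF j]]) (auto intro: gen.base)
  note m = mk_hom[OF A(1) oG iG] mk_hom[OF A(2) oG jG] mk_hom[OF oG oS sub_hm[OF cl]]
  obtain h where h: "h \<in> hom CP ?S ?G" "Comp CP h i = mk A (ap i) ?G" "Comp CP h j = mk B (ap j) ?G"
    using univ[OF m(1,2)] by blast
  let ?e = "Comp CP (mk ?G (\<lambda>x. x) ?S) h"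
  have e: "?e \<in> hom CP ?S ?S" by (rule comp_hom(1)[OF h(1) m(3)])
  have ex: "ap ?e x = ap h x" if "x \<in> carrier ?S" for x
    using comp_hom(2)[OF h(1) m(3) that] ap_in[OF h(1) that] by simp
  have "Comp CP ?e i = i"
    by (rule hom_eqI[OF comp_hom(1)[OF i e] i])
      (use comp_hom(2)[OF i e] ex ap_in[OF i] comp_hom(2)[OF i h(1)] h(2) in auto)
  moreover have "Comp CP ?e j = j"
    by (rule hom_eqI[OF comp_hom(1)[OF j e] j])
      (use comp_hom(2)[OF j e] ex ap_in[OF j] comp_hom(2)[OF j h(1)] h(3) in auto)
  moreover have I: "Ide CP ?S \<in> hom CP ?S ?S" by (rule Ide_hom[OF oS])
  moreover have "Comp CP (Ide CP ?S) i = i"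
    by (rule hom_eqI[OF comp_hom(1)[OF i I] i]) (use comp_hom(2)[OF i I] ap_in[OF i] in simp)
  moreover have "Comp CP (Ide CP ?S) j = j"
    by (rule hom_eqI[OF comp_hom(1)[OF j I] j]) (use comp_hom(2)[OF j I] ap_in[OF j] in simp)
  ultimately have eI: "?e = Ide CP ?S" using univ[OF i j] e by blast
  have "x \<in> gen ar ?S ?U" if "x \<in> carrier ?S" for x
    using ex[OF that] ap_in[OF h(1) that] that by (simp add: eI)
  then have gen: "carrier ?S = gen ar ?S ?U" using cl by (auto simp: closed_def)
  have "\<exists>h. H ?S M h \<and> (\<forall>a\<in>carrier A. h (ap i a) = f a) \<and> (\<forall>b\<in>carrier B. h (ap j b) = g b)"
    if M: "ob M" "H A M f" "H B M g" for M f g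
  proof -
    obtain k where k: "k \<in> hom CP ?S M" "Comp CP k i = mk A f M" "Comp CP k j = mk B g M"
      using univ[OF mk_hom[OF A(1) M(1,2)] mk_hom[OF A(2) M(1,3)]] by blast
    show ?thesis
      using hom_D(3)[OF k(1)] comp_hom(2)[OF i k(1)] comp_hom(2)[OF j k(1)] k by (intro exI[of _ "ap k"]) auto
  qed
  then show "cop A B ?S (ap i) (ap j)"
    unfolding cop_def using oS hom_D(3)[OF i] hom_D(3)[OF j] gen by blast
qed

lemma coprod_CP:
  assumes "ob A" "ob B"
  shows "cop A B (coprod_obj CP A B) (ap (inj1 CP A B)) (ap (inj2 CP A B))"
    "inj1 CP A B \<in> hom CP A (coprod_obj CP A B)" "inj2 CP A B \<in> hom CP B (coprod_obj CP A B)"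
    "is_coproduct CP A B (inj1 CP A B) (inj2 CP A B)"
proof -
  have "\<exists>x. case x of (p, q) \<Rightarrow> is_coproduct CP A B p q"
    using cop2_ex[OF assms] cop_is_coproduct[OF assms] by (metis (no_types, lifting) case_prod_conv)
  from someI_ex[OF this, folded coproduct_def]
  show c: "is_coproduct CP A B (inj1 CP A B) (inj2 CP A B)"
    by (simp add: inj1_def inj2_def case_prod_beta)
  show "cop A B (coprod_obj CP A B) (ap (inj1 CP A B)) (ap (inj2 CP A B))"
    "inj1 CP A B \<in> hom CP A (coprod_obj CP A B)" "inj2 CP A B \<in> hom CP B (coprod_obj CP A B)"
    using is_coproduct_cop[OF assms c] by (simp_all add: coprod_obj_def)
qed

lemma copairing_CP:
  assumes f: "f \<in> hom CP A M" and g: "g \<in> hom CP B M"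
  shows "copairing CP f g \<in> hom CP (coprod_obj CP A B) M"
    "x \<in> carrier A \<Longrightarrow> ap (copairing CP f g) (ap (inj1 CP A B) x) = ap f x"
    "y \<in> carrier B \<Longrightarrow> ap (copairing CP f g) (ap (inj2 CP A B) y) = ap g y"
proof -
  note C = coprod_CP[OF hom_D(1)[OF f] hom_D(1)[OF g]]
  have "\<exists>!h. h \<in> hom CP (coprod_obj CP A B) M \<and> Comp CP h (inj1 CP A B) = f \<and> Comp CP h (inj2 CP A B) = g"
    using coproduct_univ[OF C(4) f g] by (simp only: coprod_obj_def)
  from theI'[OF this] have 1: "copairing CP f g \<in> hom CP (coprod_obj CP A B) M"
    "Comp CP (copairing CP f g) (inj1 CP A B) = f" "Comp CP (copairing CP f g) (inj2 CP A B) = g"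
    by (simp_all add: copairing_def hom_arr[OF f] hom_arr[OF g])
  show "copairing CP f g \<in> hom CP (coprod_obj CP A B) M" by (rule 1)
  show "x \<in> carrier A \<Longrightarrow> ap (copairing CP f g) (ap (inj1 CP A B) x) = ap f x"
    "y \<in> carrier B \<Longrightarrow> ap (copairing CP f g) (ap (inj2 CP A B) y) = ap g y"
    using comp_hom(2)[OF C(2) 1(1)] comp_hom(2)[OF C(3) 1(1)] 1 by auto
qed

lemma coprod_map_CP:
  assumes f: "f \<in> hom CP A A'" and g: "g \<in> hom CP B B'"
  shows "coprod_map CP f g \<in> hom CP (coprod_obj CP A B) (coprod_obj CP A' B')"
    "x \<in> carrier A \<Longrightarrow> ap (coprod_map CP f g) (ap (inj1 CP A B) x) = ap (inj1 CP A' B') (ap f x)"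
    "y \<in> carrier B \<Longrightarrow> ap (coprod_map CP f g) (ap (inj2 CP A B) y) = ap (inj2 CP A' B') (ap g y)"
proof -
  note C = coprod_CP[OF hom_D(2)[OF f] hom_D(2)[OF g]]
  note c = comp_hom[OF f C(2)] comp_hom[OF g C(3)]
  note d = copairing_CP[OF c(1) c(3)]
  have e: "coprod_map CP f g = copairing CP (Comp CP (inj1 CP A' B') f) (Comp CP (inj2 CP A' B') g)"
    by (simp add: coprod_map_def hom_arr[OF f] hom_arr[OF g])
  show "coprod_map CP f g \<in> hom CP (coprod_obj CP A B) (coprod_obj CP A' B')"
    "x \<in> carrier A \<Longrightarrow> ap (coprod_map CP f g) (ap (inj1 CP A B) x) = ap (inj1 CP A' B') (ap f x)"
    "y \<in> carrier B \<Longrightarrow> ap (coprod_map CP f g) (ap (inj2 CP A B) y) = ap (inj2 CP A' B') (ap g y)"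
    using c d by (simp_all add: e)
qed

subsection \<open>Kernels\<close>

lemma is_kernel_univ:
  assumes f: "f \<in> hom CP A B" and k: "is_kernel CP f k" and h: "h \<in> hom CP W A"
    and 0: "\<And>x. x \<in> carrier W \<Longrightarrow> ap f (ap h x) = z B"
  shows "\<exists>!u. u \<in> hom CP W (Dom CP k) \<and> Comp CP k u = h"
proof -
  have "Comp CP f h = zero_arr CP W B"
    using eq_zero_arr[OF comp_hom(1)[OF h f]] comp_hom(2)[OF h f] 0 by simp
  then show ?thesis by (rule kernel_univ[OF k f h])
qed

lemma kernel_ex:
  assumes f: "f \<in> hom CP A B" shows "\<exists>k. is_kernel CP f k"
proof -
  note F = hom_D[OF f]
  let ?T = "{x \<in> carrier A. ap f x = z B}"
  have cl: "closed ar A ?T" by (rule closed_ker[OF hom_vob[OF f] F(3)])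
  let ?K = "sub_alg A ?T"
  have oK: "ob ?K" by (rule ob_sub[OF F(1) cl])
  note m = mk_hom[OF oK F(1) sub_hm[OF cl]]
  have "is_kernel CP f (mk ?K (\<lambda>x. x) A)"
    unfolding is_kernel_def
  proof (intro conjI ballI impI)
    show "Comp CP f (mk ?K (\<lambda>x. x) A) = zero_arr CP (Dom CP (mk ?K (\<lambda>x. x) A)) (Cod CP f)"
      using eq_zero_arr[OF comp_hom(1)[OF m f]] comp_hom(2)[OF m f] by (simp add: hom_arr[OF f])
    fix h assume h: "h \<in> Arr CP" "Cod CP h = Dom CP f \<and> Comp CP f h = zero_arr CP (Dom CP h) (Cod CP f)"
    let ?W = "Dom CP h"
    have hh: "h \<in> hom CP ?W A" using h by (simp add: hom_def hom_arr[OF f])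
    have "ap f (ap h x) = z B" if "x \<in> carrier ?W" for x
      using eq_zero_arr[OF comp_hom(1)[OF hh f]] comp_hom(2)[OF hh f] h that by (simp add: hom_arr[OF f])
    then have hK: "H ?W ?K (ap h)" by (intro hm_into_sub[OF hom_D(3)[OF hh]]) (use ap_in[OF hh] in auto)
    note mh = mk_hom[OF hom_D(1)[OF hh] oK hK]
    show "\<exists>!u. u \<in> hom CP ?W (Dom CP (mk ?K (\<lambda>x. x) A)) \<and> Comp CP (mk ?K (\<lambda>x. x) A) u = h"
    proof
      show "mk ?W (ap h) ?K \<in> hom CP ?W (Dom CP (mk ?K (\<lambda>x. x) A)) \<and>
        Comp CP (mk ?K (\<lambda>x. x) A) (mk ?W (ap h) ?K) = h"
        using mh comp_mk[OF hom_D(1)[OF hh] oK F(1) hK sub_hm[OF cl]] hom_D(4)[OF hh] by simp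
      fix u assume u: "u \<in> hom CP ?W (Dom CP (mk ?K (\<lambda>x. x) A)) \<and> Comp CP (mk ?K (\<lambda>x. x) A) u = h"
      then have uh: "u \<in> hom CP ?W ?K" by simp
      show "u = mk ?W (ap h) ?K"
        by (rule hom_eqI[OF uh mh]) (use comp_hom(2)[OF uh m] u ap_in[OF uh] in auto)
    qed
  qed (use f m in \<open>simp_all add: hom_def\<close>)
  then show ?thesis by blast
qed

text \<open>Comparison with the kernel given by the subalgebra of zeros of \<open>f\<close>: the two
  factorizations are inverse to each other.\<close>

lemma is_kernel_elem:
  assumes f: "f \<in> hom CP A B" and k: "is_kernel CP f k"
  shows "k \<in> hom CP (Dom CP k) A" "inj_on (ap k) (carrier (Dom CP k))"
    "ap k ` carrier (Dom CP k) = {x \<in> carrier A. ap f x = z B}"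
proof -
  let ?K = "Dom CP k"
  show kh: "k \<in> hom CP ?K A" using k f by (auto simp: is_kernel_def hom_def)
  have "Comp CP f k = zero_arr CP ?K B" using k f by (simp add: is_kernel_def hom_def)
  then have k0: "ap f (ap k x) = z B" if "x \<in> carrier ?K" for x
    using eq_zero_arr[OF comp_hom(1)[OF kh f]] comp_hom(2)[OF kh f] that by simp
  note F = hom_D[OF f]
  let ?T = "{x \<in> carrier A. ap f x = z B}"
  have cl: "closed ar A ?T" by (rule closed_ker[OF hom_vob[OF f] F(3)])
  let ?N = "sub_alg A ?T"
  have oK: "ob ?N" by (rule ob_sub[OF F(1) cl])
  note m = mk_hom[OF oK F(1) sub_hm[OF cl]]
  have "\<exists>!u. u \<in> hom CP ?N ?K \<and> Comp CP k u = mk ?N (\<lambda>x. x) A"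
    by (rule is_kernel_univ[OF f k m]) simp
  then obtain u where u: "u \<in> hom CP ?N ?K" "Comp CP k u = mk ?N (\<lambda>x. x) A" by blast
  have kK: "H ?K ?N (ap k)" by (rule hm_into_sub[OF hom_D(3)[OF kh]]) (use k0 ap_in[OF kh] in auto)
  note mv = mk_hom[OF hom_D(1)[OF kh] oK kK]
  have uk: "ap k (ap u x) = x" if "x \<in> ?T" for x
    using comp_hom(2)[OF u(1) kh] u(2) that by simp
  let ?uv = "Comp CP u (mk ?K (ap k) ?N)"
  have uv: "?uv \<in> hom CP ?K ?K" by (rule comp_hom(1)[OF mv u(1)])
  have uvx: "ap ?uv x = ap u (ap k x)" if "x \<in> carrier ?K" for x
    using comp_hom(2)[OF mv u(1) that] that by simp
  have "Comp CP k ?uv = k"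
    by (rule hom_eqI[OF comp_hom(1)[OF uv kh] kh])
      (use comp_hom(2)[OF uv kh] uvx uk k0 ap_in[OF kh] in auto)
  moreover have I: "Ide CP ?K \<in> hom CP ?K ?K" by (rule Ide_hom[OF hom_D(1)[OF kh]])
  moreover have "Comp CP k (Ide CP ?K) = k"
    by (rule hom_eqI[OF comp_hom(1)[OF I kh] kh]) (use comp_hom(2)[OF I kh] in simp)
  ultimately have "?uv = Ide CP ?K" using is_kernel_univ[OF f k kh k0] uv by blast
  then have "ap u (ap k x) = x" if "x \<in> carrier ?K" for x using uvx[OF that] that by simp
  then show "inj_on (ap k) (carrier ?K)" by (rule inj_on_inverseI)
  show "ap k ` carrier ?K = ?T"
  proof
    show "ap k ` carrier ?K \<subseteq> ?T" using k0 ap_in[OF kh] by auto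
    show "?T \<subseteq> ap k ` carrier ?K"
    proof
      fix x assume x: "x \<in> ?T"
      then have "ap u x \<in> carrier ?K" using ap_in[OF u(1)] by simp
      then show "x \<in> ap k ` carrier ?K" using uk[OF x] by (metis imageI)
    qed
  qed
qed

lemma kernel_CP:
  assumes f: "f \<in> hom CP A B"
  shows "kernel CP f \<in> hom CP (Dom CP (kernel CP f)) A" "inj_on (ap (kernel CP f)) (carrier (Dom CP (kernel CP f)))"
    "ap (kernel CP f) ` carrier (Dom CP (kernel CP f)) = {x \<in> carrier A. ap f x = z B}"
proof -
  have "is_kernel CP f (kernel CP f)" unfolding kernel_def by (rule someI_ex[OF kernel_ex[OF f]])
  from is_kernel_elem[OF f this]
  show "kernel CP f \<in> hom CP (Dom CP (kernel CP f)) A" "inj_on (ap (kernel CP f)) (carrier (Dom CP (kernel CP f)))"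
    "ap (kernel CP f) ` carrier (Dom CP (kernel CP f)) = {x \<in> carrier A. ap f x = z B}" .
qed

subsection \<open>The binary cosmash product\<close>

abbreviation "k1 X Y \<equiv> copairing CP (Ide CP X) (zero_arr CP Y X)"
abbreviation "k2 X Y \<equiv> copairing CP (zero_arr CP X Y) (Ide CP Y)"

lemma cosmash_projections:
  assumes X: "ob X" and Y: "ob Y"
  shows "k1 X Y \<in> hom CP (coprod_obj CP X Y) X" "k2 X Y \<in> hom CP (coprod_obj CP X Y) Y"
    "x \<in> carrier X \<Longrightarrow> ap (k1 X Y) (ap (inj1 CP X Y) x) = x"
    "y \<in> carrier Y \<Longrightarrow> ap (k1 X Y) (ap (inj2 CP X Y) y) = z X"
    "x \<in> carrier X \<Longrightarrow> ap (k2 X Y) (ap (inj1 CP X Y) x) = z Y"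
    "y \<in> carrier Y \<Longrightarrow> ap (k2 X Y) (ap (inj2 CP X Y) y) = y"
  using copairing_CP[OF Ide_hom[OF X] zero_arr_hom[OF Y X]] copairing_CP[OF zero_arr_hom[OF X Y] Ide_hom[OF Y]]
    ap_zero_arr[OF Y X] ap_zero_arr[OF X Y] by simp_all

lemma pairing_zero:
  assumes f: "f \<in> hom CP W A" and g: "g \<in> hom CP W B" and x: "x \<in> carrier W"
  shows "ap (pairing CP f g) x = z (prod_obj CP A B) \<longleftrightarrow> ap f x = z A \<and> ap g x = z B"
proof -
  note Q = prod_CP[OF hom_D(2)[OF f] hom_D(2)[OF g]]
  have p: "proj1 CP A B \<in> hom CP (prod_obj CP A B) A" "proj2 CP A B \<in> hom CP (prod_obj CP A B) B"
    using Q by (auto simp: prodel_def)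
  note pr = pairing_CP[OF f g]
  have i: "ap (pairing CP f g) x \<in> carrier (prod_obj CP A B)" "z (prod_obj CP A B) \<in> carrier (prod_obj CP A B)"
    using ap_in[OF pr(1) x] hom_vob[OF p(1)] by auto
  show ?thesis using pr(2,3)[OF x] ap_z[OF p(1)] ap_z[OF p(2)] Q i unfolding prodel_def by metis
qed

lemma cosmash_CP:
  assumes X: "ob X" and Y: "ob Y"
  shows "cosmash_incl CP X Y \<in> hom CP (cosmash CP X Y) (coprod_obj CP X Y)"
    "inj_on (ap (cosmash_incl CP X Y)) (carrier (cosmash CP X Y))"
    "ap (cosmash_incl CP X Y) ` carrier (cosmash CP X Y) =
      {w \<in> carrier (coprod_obj CP X Y). ap (k1 X Y) w = z X \<and> ap (k2 X Y) w = z Y}"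
proof -
  note k = cosmash_projections[OF X Y]
  note K = kernel_CP[OF pairing_CP(1)[OF k(1,2)], folded cosmash_incl_def, folded cosmash_def]
  show "cosmash_incl CP X Y \<in> hom CP (cosmash CP X Y) (coprod_obj CP X Y)"
    "inj_on (ap (cosmash_incl CP X Y)) (carrier (cosmash CP X Y))" by (rule K)+
  show "ap (cosmash_incl CP X Y) ` carrier (cosmash CP X Y) =
      {w \<in> carrier (coprod_obj CP X Y). ap (k1 X Y) w = z X \<and> ap (k2 X Y) w = z Y}"
    unfolding K(3) using pairing_zero[OF k(1,2)] by auto
qed

lemma cosmash_map_CP:
  assumes f: "f \<in> hom CP X X'" and g: "g \<in> hom CP Y Y'"
  shows "cosmash_map CP f g \<in> hom CP (cosmash CP X Y) (cosmash CP X' Y')"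
    "w \<in> carrier (cosmash CP X Y) \<Longrightarrow>
      ap (cosmash_incl CP X' Y') (ap (cosmash_map CP f g) w) = ap (coprod_map CP f g) (ap (cosmash_incl CP X Y) w)"
proof -
  note F = hom_D[OF f] and G = hom_D[OF g]
  note c = cosmash_CP[OF F(1) G(1)] and c' = cosmash_CP[OF F(2) G(2)]
  note k = cosmash_projections[OF F(1) G(1)] and k' = cosmash_projections[OF F(2) G(2)]
  note m = coprod_map_CP[OF f g]
  note C = coprod_CP(1)[OF F(1) G(1)]
  let ?T = "cosmash CP X Y" and ?T' = "cosmash CP X' Y'" and ?\<kappa> = "cosmash_incl CP X Y" and ?\<kappa>' = "cosmash_incl CP X' Y'"
  have n1: "ap (k1 X' Y') (ap (coprod_map CP f g) s) = ap f (ap (k1 X Y) s)" if "s \<in> carrier (coprod_obj CP X Y)" for s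
    by (rule cop_ext[OF C hm_comp[OF hom_D(3)[OF m(1)] hom_D(3)[OF k'(1)]] hm_comp[OF hom_D(3)[OF k(1)] F(3)] _ _ that])
      (use m k k' ap_in[OF f] ap_in[OF g] ap_z[OF f] in auto)
  have n2: "ap (k2 X' Y') (ap (coprod_map CP f g) s) = ap g (ap (k2 X Y) s)" if "s \<in> carrier (coprod_obj CP X Y)" for s
    by (rule cop_ext[OF C hm_comp[OF hom_D(3)[OF m(1)] hom_D(3)[OF k'(2)]] hm_comp[OF hom_D(3)[OF k(2)] G(3)] _ _ that])
      (use m k k' ap_in[OF f] ap_in[OF g] ap_z[OF g] in auto)
  note mc = comp_hom[OF c(1) m(1)]
  have zero: "ap (k1 X' Y') (ap (Comp CP (coprod_map CP f g) ?\<kappa>) w) = z X' \<and>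
      ap (k2 X' Y') (ap (Comp CP (coprod_map CP f g) ?\<kappa>) w) = z Y'" if w: "w \<in> carrier ?T" for w
  proof -
    have "ap ?\<kappa> w \<in> {w \<in> carrier (coprod_obj CP X Y). ap (k1 X Y) w = z X \<and> ap (k2 X Y) w = z Y}"
      using c(3) w by blast
    then show ?thesis using mc(2)[OF w] n1 n2 ap_z[OF f] ap_z[OF g] by simp
  qed
  note p' = pairing_CP(1)[OF k'(1,2)]
  have isk: "is_kernel CP (pairing CP (k1 X' Y') (k2 X' Y')) ?\<kappa>'"
    unfolding cosmash_incl_def kernel_def by (rule someI_ex[OF kernel_ex[OF p']])
  have "\<exists>!u. u \<in> hom CP ?T (Dom CP ?\<kappa>') \<and> Comp CP ?\<kappa>' u = Comp CP (coprod_map CP f g) ?\<kappa>"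
    by (rule is_kernel_univ[OF p' isk mc(1)])
      (use zero pairing_zero[OF k'(1,2)] ap_in[OF mc(1)] in auto)
  from theI'[OF this] have 1: "cosmash_map CP f g \<in> hom CP ?T ?T'"
    "Comp CP ?\<kappa>' (cosmash_map CP f g) = Comp CP (coprod_map CP f g) ?\<kappa>"
    by (simp_all add: cosmash_map_def hom_arr[OF f] hom_arr[OF g] cosmash_def)
  show "cosmash_map CP f g \<in> hom CP ?T ?T'" by (rule 1)
  show "ap ?\<kappa>' (ap (cosmash_map CP f g) w) = ap (coprod_map CP f g) (ap ?\<kappa> w)" if "w \<in> carrier ?T"
    using comp_hom(2)[OF 1(1) c'(1) that] mc(2)[OF that] 1(2) by simp
qed

end

section \<open>Two-nilpotent objects and the reflection\<close>

lemma coequalizer_univ: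
  assumes "is_coequalizer C f g q" and q: "q \<in> hom C A B" and h: "h \<in> hom C A M"
    and e: "Comp C h f = Comp C h g"
  shows "\<exists>!u. u \<in> hom C B M \<and> Comp C u q = h"
proof -
  have "h \<in> Arr C" "Dom C h = Cod C f \<and> Comp C h f = Comp C h g"
    using assms by (auto simp: hom_def is_coequalizer_def)
  with assms(1) have "\<exists>!u. u \<in> hom C (Cod C q) (Cod C h) \<and> Comp C u q = h"
    unfolding is_coequalizer_def by blast
  then show ?thesis by (simp only: hom_arr[OF q] hom_arr[OF h])
qed

lemma cokernel_univ:
  assumes "is_cokernel C f q" and f: "f \<in> hom C K A" and q: "q \<in> hom C A B" and h: "h \<in> hom C A M"
    and e: "Comp C h f = zero_arr C K M"
  shows "\<exists>!u. u \<in> hom C B M \<and> Comp C u q = h"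
proof -
  have "h \<in> Arr C" "Dom C h = Cod C f \<and> Comp C h f = zero_arr C (Dom C f) (Cod C h)"
    using f h e by (auto simp: hom_def)
  with assms(1) have "\<exists>!u. u \<in> hom C (Cod C q) (Cod C h) \<and> Comp C u q = h"
    unfolding is_cokernel_def by blast
  then show ?thesis by (simp only: hom_arr[OF q] hom_arr[OF h])
qed

lemma (in alg_class) cop_comm: assumes c: "cop A B S i j" shows "cop B A S j i"
proof -
  note C = copD[OF c]
  have "\<exists>h. H S M h \<and> (\<forall>a\<in>carrier B. h (j a) = f a) \<and> (\<forall>b\<in>carrier A. h (i b) = g b)"
    if M: "ob M" "H B M f" "H A M g" for M f g
  proof -
    obtain h where "H S M h" "\<And>a. a \<in> carrier A \<Longrightarrow> h (i a) = g a" "\<And>b. b \<in> carrier B \<Longrightarrow> h (j b) = f b"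
      by (rule cop_univ[OF c M(1,3,2)]) (rule that)
    then show ?thesis by blast
  qed
  then show ?thesis unfolding cop_def using C(1,3,4,5) by (simp add: Un_commute)
qed

lemma (in alg_class) tri_rot: assumes t: "tri A B C W a b c" shows "tri B C A W b c a"
proof -
  note T = triD[OF t]
  have "\<exists>k. H W M k \<and> (\<forall>x\<in>carrier B. k (b x) = f x) \<and> (\<forall>x\<in>carrier C. k (c x) = g x) \<and> (\<forall>x\<in>carrier A. k (a x) = h x)"
    if M: "ob M" "H B M f" "H C M g" "H A M h" for M f g h
  proof -
    obtain k where "H W M k" "\<And>x. x \<in> carrier A \<Longrightarrow> k (a x) = h x"
      "\<And>x. x \<in> carrier B \<Longrightarrow> k (b x) = f x" "\<And>x. x \<in> carrier C \<Longrightarrow> k (c x) = g x"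
      by (rule tri_univ[OF t M(1,4,2,3)]) (rule that)
    then show ?thesis by blast
  qed
  moreover have "b ` carrier B \<union> c ` carrier C \<union> a ` carrier A = a ` carrier A \<union> b ` carrier B \<union> c ` carrier C" by auto
  ultimately show ?thesis unfolding tri_def using T(1,3,4,5,6) by (simp only:) blast
qed

lemma (in alg_class) cop_tri':
  assumes "cop D C W u c" "cop A B D a b"
  shows "tri A B C W (\<lambda>x. u (a x)) (\<lambda>x. u (b x)) c"
  by (rule tri_rot[OF cop_tri[OF cop_comm[OF assms(1)] assms(2)]])

section \<open>Surjections, regular epimorphisms and images\<close>

context pointed_class
begin

text \<open>If \<open>q\<close>, corestricted to its image \<open>I\<close>, extends along
  \<open>q\<close> to \<open>u\<close>, then \<open>u\<close> followed by the inclusion of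
  \<open>I\<close> fixes \<open>q\<close> and is the identity by \<open>epi\<close>; hence
  \<open>I\<close> is all of \<open>B\<close>. Coequalizers and cokernels both meet the two
  conditions.\<close>

lemma surj_via_image:
  assumes q: "q \<in> hom CP A B"
    and ext: "\<And>I. ob I \<Longrightarrow> mk A (ap q) I \<in> hom CP A I \<Longrightarrow> I = sub_alg B (ap q ` carrier A) \<Longrightarrow>
      \<exists>u. u \<in> hom CP B I \<and> Comp CP u q = mk A (ap q) I"
    and epi: "\<And>u v. u \<in> hom CP B B \<Longrightarrow> v \<in> hom CP B B \<Longrightarrow> Comp CP u q = q \<Longrightarrow> Comp CP v q = q \<Longrightarrow> u = v"
  shows "ap q ` carrier A = carrier B"
proof -
  note Q = hom_D[OF q]
  let ?I = "sub_alg B (ap q ` carrier A)"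
  have cl: "closed ar B (ap q ` carrier A)" by (rule hm_range_closed) (use Q in auto)
  have oI: "ob ?I" by (rule ob_sub[OF Q(2) cl])
  have m: "mk A (ap q) ?I \<in> hom CP A ?I" by (rule mk_hom[OF Q(1) oI hm_into_sub[OF Q(3)]]) simp
  have i: "mk ?I (\<lambda>x. x) B \<in> hom CP ?I B" by (rule mk_hom[OF oI Q(2) sub_hm[OF cl]])
  obtain u where u: "u \<in> hom CP B ?I" "Comp CP u q = mk A (ap q) ?I" using ext[OF oI m] by blast
  let ?e = "Comp CP (mk ?I (\<lambda>x. x) B) u"
  note e = comp_hom[OF u(1) i]
  have "Comp CP ?e q = q"
    by (rule hom_eqI[OF comp_hom(1)[OF q e(1)] q])
      (use comp_hom(2)[OF q e(1)] e(2)[OF ap_in[OF q]] comp_hom(2)[OF q u(1)] u(2) in simp)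
  moreover have I: "Ide CP B \<in> hom CP B B" by (rule Ide_hom[OF Q(2)])
  moreover have "Comp CP (Ide CP B) q = q"
    by (rule hom_eqI[OF comp_hom(1)[OF q I] q]) (use comp_hom(2)[OF q I] ap_in[OF q] in simp)
  ultimately have eq: "?e = Ide CP B" using epi e(1) by blast
  show ?thesis
  proof
    show "ap q ` carrier A \<subseteq> carrier B" using ap_in[OF q] by auto
    show "carrier B \<subseteq> ap q ` carrier A"
    proof
      fix x assume x: "x \<in> carrier B"
      have "ap u x \<in> ap q ` carrier A" using ap_in[OF u(1) x] by simp
      moreover have "ap u x = x" using e(2)[OF x] x \<open>ap u x \<in> _\<close> by (simp add: eq)
      ultimately show "x \<in> ap q ` carrier A" by simp
    qed
  qed
qed

lemma regular_epi_surj: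
  assumes q: "q \<in> hom CP A B" and r: "regular_epi CP q"
  shows "ap q ` carrier A = carrier B"
proof -
  obtain f g where c: "is_coequalizer CP f g q" using r by (auto simp: regular_epi_def)
  then have f: "f \<in> hom CP (Dom CP f) A" and g: "g \<in> hom CP (Dom CP f) A" and e: "Comp CP q f = Comp CP q g"
    using q by (auto simp: is_coequalizer_def hom_def)
  show ?thesis
  proof (rule surj_via_image[OF q])
    fix I assume I: "mk A (ap q) I \<in> hom CP A I"
    have "ap q (ap f x) = ap q (ap g x)" if "x \<in> carrier (Dom CP f)" for x
      using comp_hom(2)[OF f q that] comp_hom(2)[OF g q that] e by simp
    then have "Comp CP (mk A (ap q) I) f = Comp CP (mk A (ap q) I) g"
      by (intro hom_eqI[OF comp_hom(1)[OF f I] comp_hom(1)[OF g I]])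
        (use comp_hom(2)[OF f I] comp_hom(2)[OF g I] ap_in[OF f] ap_in[OF g] in simp)
    then show "\<exists>u. u \<in> hom CP B I \<and> Comp CP u q = mk A (ap q) I"
      using coequalizer_univ[OF c q I] by blast
  next
    fix u v assume "u \<in> hom CP B B" "v \<in> hom CP B B" "Comp CP u q = q" "Comp CP v q = q"
    then show "u = v" using coequalizer_univ[OF c q q e] by blast
  qed
qed

lemma surj_factor:
  assumes q: "q \<in> hom CP A B" "ap q ` carrier A = carrier B" and h: "h \<in> hom CP A M"
    and ker: "\<And>x y. x \<in> carrier A \<Longrightarrow> y \<in> carrier A \<Longrightarrow> ap q x = ap q y \<Longrightarrow> ap h x = ap h y"
  shows "\<exists>!u. u \<in> hom CP B M \<and> Comp CP u q = h"
proof -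
  have "is_alg ar A" using hom_vob[OF q(1)] by simp
  from hm_factor[OF hom_D(3)[OF q(1)] q(2) this hom_D(3)[OF h] ker]
  obtain k where k: "H B M k" "\<And>x. x \<in> carrier A \<Longrightarrow> k (ap q x) = ap h x" by blast
  note m = mk_hom[OF hom_D(2)[OF q(1)] hom_D(2)[OF h] k(1)]
  show ?thesis
  proof
    show "mk B k M \<in> hom CP B M \<and> Comp CP (mk B k M) q = h"
      using m by (auto intro!: hom_eqI[OF comp_hom(1)[OF q(1) m] h] simp: comp_hom(2)[OF q(1) m] ap_in[OF q(1)] k(2))
    fix u assume u: "u \<in> hom CP B M \<and> Comp CP u q = h"
    show "u = mk B k M"
    proof (rule hom_eqI[OF _ m])
      show "u \<in> hom CP B M" using u by blast
      fix y assume "y \<in> carrier B"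
      then obtain x where "x \<in> carrier A" "y = ap q x" using q(2) by blast
      then show "ap u y = ap (mk B k M) y"
        using comp_hom(2)[OF q(1), of u M x] u k(2) ap_in[OF q(1)] by simp
    qed
  qed
qed

text \<open>A surjection is the coequalizer of its kernel pair, which is cut out of
  \<open>A \<times> A\<close>.\<close>

lemma surj_regular_epi:
  assumes q: "q \<in> hom CP A B" "ap q ` carrier A = carrier B"
  shows "regular_epi CP q"
proof -
  note oA = hom_D(1)[OF q(1)]
  obtain Q p r where Q: "ob Q" "H Q A p" "H Q A r"
    and ex: "\<And>a b. a \<in> carrier A \<Longrightarrow> b \<in> carrier A \<Longrightarrow> \<exists>w\<in>carrier Q. p w = a \<and> r w = b"
    by (rule prod_ex[OF oA oA]) (rule that)
  let ?T = "{w \<in> carrier Q. ap q (p w) = ap q (r w)}"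
  have cl: "closed ar Q ?T"
    by (rule closed_agree[OF _ hm_comp[OF Q(2) hom_D(3)[OF q(1)]] hm_comp[OF Q(3) hom_D(3)[OF q(1)]]]) (use Q in auto)
  let ?R = "sub_alg Q ?T"
  have oR: "ob ?R" by (rule ob_sub[OF Q(1) cl])
  note f = mk_hom[OF oR oA hm_sub[OF Q(2) cl]] and g = mk_hom[OF oR oA hm_sub[OF Q(3) cl]]
  have "is_coequalizer CP (mk ?R p A) (mk ?R r A) q"
    unfolding is_coequalizer_def
  proof (intro conjI ballI impI)
    show "Comp CP q (mk ?R p A) = Comp CP q (mk ?R r A)"
      by (rule hom_eqI[OF comp_hom(1)[OF f q(1)] comp_hom(1)[OF g q(1)]])
        (use comp_hom(2)[OF f q(1)] comp_hom(2)[OF g q(1)] in simp)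
    fix h assume h: "h \<in> Arr CP" "Dom CP h = Cod CP (mk ?R p A) \<and> Comp CP h (mk ?R p A) = Comp CP h (mk ?R r A)"
    then have hh: "h \<in> hom CP A (Cod CP h)" by (simp add: hom_def)
    have "ap h x = ap h y" if xy: "x \<in> carrier A" "y \<in> carrier A" "ap q x = ap q y" for x y
    proof -
      obtain w where w: "w \<in> carrier Q" "p w = x" "r w = y" using ex xy by blast
      then have "w \<in> carrier ?R" using xy by simp
      then show ?thesis using comp_hom(2)[OF f hh] comp_hom(2)[OF g hh] h w by fastforce
    qed
    from surj_factor[OF q hh this] show "\<exists>!u. u \<in> hom CP (Cod CP q) (Cod CP h) \<and> Comp CP u q = h"
      by (simp only: hom_arr(3)[OF q(1)])
  qed (use q f g in \<open>simp_all add: hom_def\<close>)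
  then show ?thesis unfolding regular_epi_def by blast
qed

text \<open>The chosen image is an arbitrary monomorphism, of which the range is used. The last
  clause is separate because \<open>two_nilpotent\<close> speaks of the domain of the image.\<close>

lemma image_CP:
  assumes f: "f \<in> hom CP A B"
  shows "image CP f \<in> hom CP (Dom CP (image CP f)) B"
    "ap (image CP f) ` carrier (Dom CP (image CP f)) = ap f ` carrier A"
    "(\<And>x. x \<in> carrier A \<Longrightarrow> ap f x = z B) \<Longrightarrow> is_zero CP (Dom CP (image CP f))"
proof -
  note F = hom_D[OF f]
  let ?Q = "\<lambda>m. mono_arr CP m \<and> Cod CP m = Cod CP f \<and>
     (\<exists>e\<in>hom CP (Dom CP f) (Dom CP m). regular_epi CP e \<and> Comp CP m e = f)"
  have "?Q (image CP f)"
    unfolding image_def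
  proof (rule someI)
    let ?I = "sub_alg B (ap f ` carrier A)"
    have cl: "closed ar B (ap f ` carrier A)" by (rule hm_range_closed) (use F in auto)
    have oI: "ob ?I" by (rule ob_sub[OF F(2) cl])
    note i = mk_hom[OF oI F(2) sub_hm[OF cl]]
    have fI: "H A ?I (ap f)" by (rule hm_into_sub[OF F(3)]) simp
    note m = mk_hom[OF F(1) oI fI]
    have "mono_arr CP (mk ?I (\<lambda>x. x) B)"
      unfolding mono_arr_def
    proof (intro conjI ballI impI)
      fix g h assume gh: "g \<in> Arr CP" "h \<in> Arr CP" "Dom CP g = Dom CP h \<and> Cod CP g = Dom CP (mk ?I (\<lambda>x. x) B) \<and>
        Cod CP h = Dom CP (mk ?I (\<lambda>x. x) B) \<and> Comp CP (mk ?I (\<lambda>x. x) B) g = Comp CP (mk ?I (\<lambda>x. x) B) h"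
      then have g: "g \<in> hom CP (Dom CP g) ?I" and h: "h \<in> hom CP (Dom CP g) ?I" by (auto simp: hom_def)
      show "g = h"
        by (rule hom_eqI[OF g h]) (use comp_hom(2)[OF g i] comp_hom(2)[OF h i] ap_in[OF g] ap_in[OF h] gh in force)
    qed (use i in \<open>simp add: hom_def\<close>)
    moreover have "regular_epi CP (mk A (ap f) ?I)" by (rule surj_regular_epi[OF m]) simp
    moreover have "Comp CP (mk ?I (\<lambda>x. x) B) (mk A (ap f) ?I) = f"
      using comp_mk[OF F(1) oI F(2) fI sub_hm[OF cl]] F(4) by simp
    ultimately show "?Q (mk ?I (\<lambda>x. x) B)" using m by (auto simp: hom_arr[OF f])
  qed
  then obtain e where mo: "mono_arr CP (image CP f)" and c: "Cod CP (image CP f) = B"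
    and e: "e \<in> hom CP A (Dom CP (image CP f))" "regular_epi CP e" "Comp CP (image CP f) e = f"
    by (auto simp: hom_arr[OF f])
  let ?m = "image CP f"
  show m: "?m \<in> hom CP (Dom CP ?m) B" using mo c by (simp add: hom_def mono_arr_def)
  note s = regular_epi_surj[OF e(1,2)]
  have me: "ap ?m (ap e x) = ap f x" if "x \<in> carrier A" for x using comp_hom(2)[OF e(1) m that] e(3) by simp
  show "ap ?m ` carrier (Dom CP ?m) = ap f ` carrier A"
    unfolding s[symmetric] image_image by (rule image_cong) (simp_all add: me)
  show "is_zero CP (Dom CP ?m)" if z: "\<And>x. x \<in> carrier A \<Longrightarrow> ap f x = z B"
  proof -
    note oD = hom_D(1)[OF m]
    note za = zero_arr_hom[OF F(1) oD]
    \<comment> \<open>The monomorphism is cancelled as an arrow, giving \<open>e = 0\<close>; since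
      \<open>e\<close> is surjective, its codomain is zero.\<close>
    have "Comp CP ?m e = Comp CP ?m (zero_arr CP A (Dom CP ?m))"
      by (rule hom_eqI[OF comp_hom(1)[OF e(1) m] comp_hom(1)[OF za m]])
        (use comp_hom(2)[OF e(1) m] comp_hom(2)[OF za m] me z ap_zero_arr[OF F(1) oD] ap_z[OF m] in simp)
    then have "e = zero_arr CP A (Dom CP ?m)"
      using mo e(1) za unfolding mono_arr_def by (simp add: hom_def)
    then have "ap e x = z (Dom CP ?m)" if "x \<in> carrier A" for x using ap_zero_arr[OF F(1) oD that] by simp
    then have "carrier (Dom CP ?m) = {z (Dom CP ?m)}"
      using s z_in[OF hom_vob(1)[OF m]] by auto
    then show ?thesis using oD by (simp add: is_zero_iff)
  qed
qed

end

section \<open>Cokernels, the commutator and the reflection onto two-nilpotent algebras\<close>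

context protomodular_variety
begin

lemma CP_V: "CP = Variety ar E"
  by (simp add: CP_def full_subcat_True)

text \<open>Two elements are identified when no homomorphism that kills \<open>m\<close> separates
  them. This is a congruence without any description of normal subalgebras.\<close>

lemma cokernel_ex:
  assumes m: "m \<in> hom CP K A" shows "\<exists>q. is_cokernel CP m q"
proof -
  note vA = hom_vob(2)[OF m] and oK = hom_D(1)[OF m] and oA = hom_D(2)[OF m]
  define kl where "kl M h \<longleftrightarrow> vob ar E M \<and> H A M h \<and> (\<forall>k\<in>carrier K. h (ap m k) = z M)" for M h
  obtain Q \<pi> where Q: "vob ar E Q" "H A Q \<pi>" "\<pi> ` carrier A = carrier Q"
    and \<pi>: "\<And>x y. x \<in> carrier A \<Longrightarrow> y \<in> carrier A \<Longrightarrow> \<pi> x = \<pi> y \<longleftrightarrow> (\<forall>M h. kl M h \<longrightarrow> h x = h y)"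
  proof (rule quot_ex[OF vA, of "\<lambda>x y. \<forall>M h. kl M h \<longrightarrow> h x = h y"])
    fix f xs ys assume *: "set xs \<subseteq> carrier A" "set ys \<subseteq> carrier A" "length xs = ar f"
      "list_all2 (\<lambda>x y. \<forall>M h. kl M h \<longrightarrow> h x = h y) xs ys"
    show "\<forall>M h. kl M h \<longrightarrow> h (oper A f xs) = h (oper A f ys)"
    proof (intro allI impI)
      fix M h assume h: "kl M h"
      have len: "length ys = ar f" using *(3,4) list_all2_lengthD by fastforce
      have "map h xs = map h ys"
        using *(4) h by (auto simp: list_all2_conv_all_nth intro!: nth_equalityI)
      then show "h (oper A f xs) = h (oper A f ys)"
        using h hm_op[of ar A M h, OF _ *(1,3)] hm_op[of ar A M h, OF _ *(2) len] unfolding kl_def by metis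
    qed
  next
    fix x y assume "\<forall>M h. kl M h \<longrightarrow> h x = h y"
    then show "\<forall>M h. kl M h \<longrightarrow> h y = h x" by metis
  next
    fix x y w assume "\<forall>M h. kl M h \<longrightarrow> h x = h y" "\<forall>M h. kl M h \<longrightarrow> h y = h w"
    then show "\<forall>M h. kl M h \<longrightarrow> h x = h w" by metis
  qed (simp, rule that)
  have oQ: "ob Q" using Q by simp
  note q = mk_hom[OF oA oQ Q(2)]
  have \<pi>z: "\<pi> (ap m k) = z Q" if k: "k \<in> carrier K" for k
  proof -
    have "\<pi> (ap m k) = \<pi> (z A)"
      using \<pi>[OF ap_in[OF m k] z_in[OF vA]] z_hm[OF vA] k by (auto simp: kl_def)
    then show ?thesis using z_hm[OF vA Q(1,2)] by simp
  qed
  have "is_cokernel CP m (mk A \<pi> Q)"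
    unfolding is_cokernel_def
  proof (intro conjI ballI impI)
    show "Comp CP (mk A \<pi> Q) m = zero_arr CP (Dom CP m) (Cod CP (mk A \<pi> Q))"
      using eq_zero_arr[OF comp_hom(1)[OF m q]] comp_hom(2)[OF m q] \<pi>z ap_in[OF m] by (simp add: hom_arr[OF m])
    fix h assume h: "h \<in> Arr CP" "Dom CP h = Cod CP m \<and> Comp CP h m = zero_arr CP (Dom CP m) (Cod CP h)"
    then have hh: "h \<in> hom CP A (Cod CP h)" using m by (simp add: hom_def)
    have "kl (Cod CP h) (ap h)"
      using eq_zero_arr[OF comp_hom(1)[OF m hh]] comp_hom(2)[OF m hh] h(2) hom_vob[OF hh] hom_D(3)[OF hh]
      by (simp add: kl_def hom_arr[OF m])
    then have k: "ap h x = ap h y" if "x \<in> carrier A" "y \<in> carrier A" "ap (mk A \<pi> Q) x = ap (mk A \<pi> Q) y" for x y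
      using that \<pi>[OF that(1,2)] by simp
    have "ap (mk A \<pi> Q) ` carrier A = carrier Q" using Q(3) by simp
    from surj_factor[OF q this hh k]
    show "\<exists>!u. u \<in> hom CP (Cod CP (mk A \<pi> Q)) (Cod CP h) \<and> Comp CP u (mk A \<pi> Q) = h" by (simp only: Cod_mk)
  qed (use m q in \<open>simp_all add: hom_def\<close>)
  then show ?thesis by blast
qed

lemma cokernel_CP:
  assumes m: "m \<in> hom CP K A"
  shows "cokernel CP m \<in> hom CP A (Cod CP (cokernel CP m))"
    "ap (cokernel CP m) ` carrier A = carrier (Cod CP (cokernel CP m))"
    "k \<in> carrier K \<Longrightarrow> ap (cokernel CP m) (ap m k) = z (Cod CP (cokernel CP m))"
    "h \<in> hom CP A M \<Longrightarrow> (\<And>k. k \<in> carrier K \<Longrightarrow> ap h (ap m k) = z M) \<Longrightarrow>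
       \<exists>!u. u \<in> hom CP (Cod CP (cokernel CP m)) M \<and> Comp CP u (cokernel CP m) = h"
proof -
  let ?q = "cokernel CP m" and ?Q = "Cod CP (cokernel CP m)"
  have c: "is_cokernel CP m ?q" unfolding cokernel_def by (rule someI_ex[OF cokernel_ex[OF m]])
  show q: "?q \<in> hom CP A ?Q" using c m by (auto simp: is_cokernel_def hom_def)
  have "Comp CP ?q m = zero_arr CP K ?Q" using c m by (simp add: is_cokernel_def hom_def)
  then have z: "ap ?q (ap m k) = z ?Q" if "k \<in> carrier K" for k
    using eq_zero_arr[OF comp_hom(1)[OF m q]] comp_hom(2)[OF m q] that by simp
  then show "k \<in> carrier K \<Longrightarrow> ap ?q (ap m k) = z ?Q" .
  show univ: "\<exists>!u. u \<in> hom CP ?Q M \<and> Comp CP u ?q = h"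
    if h: "h \<in> hom CP A M" and 0: "\<And>k. k \<in> carrier K \<Longrightarrow> ap h (ap m k) = z M" for h M
  proof (rule cokernel_univ[OF c m q h])
    show "Comp CP h m = zero_arr CP K M"
      using eq_zero_arr[OF comp_hom(1)[OF m h]] comp_hom(2)[OF m h] 0 by simp
  qed
  show "ap ?q ` carrier A = carrier ?Q"
  proof (rule surj_via_image[OF q])
    fix I assume I: "ob I" "mk A (ap ?q) I \<in> hom CP A I" "I = sub_alg ?Q (ap ?q ` carrier A)"
    have "closed ar ?Q (ap ?q ` carrier A)"
      by (rule hm_range_closed) (use hom_vob[OF q] hom_D(3)[OF q] in auto)
    then have "z I = z ?Q" using closed_z(2) hom_vob(2)[OF q] I(3) by blast
    then show "\<exists>u. u \<in> hom CP ?Q I \<and> Comp CP u ?q = mk A (ap ?q) I"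
      using univ[OF I(2)] z ap_in[OF m] by auto
  next
    fix u v assume "u \<in> hom CP ?Q ?Q" "v \<in> hom CP ?Q ?Q" "Comp CP u ?q = ?q" "Comp CP v ?q = ?q"
    then show "u = v" using univ[OF q z] by blast
  qed
qed

text \<open>A translation: the bracketed coproduct and the kernel of the map to three binary
  coproducts become \<open>tri\<close> and the joint zeros of \<open>e1\<close>, \<open>e2\<close>,
  \<open>e3\<close>; \<open>\<kappa>\<close> is the codiagonal.\<close>

lemma commutator_CP:
  assumes M: "ob M"
  obtains W a b c e1 e2 e3 \<kappa> where "tri M M M W a b c" "kills M M M W a b c e1 e2 e3" "H W M \<kappa>"
    "\<And>x. x \<in> carrier M \<Longrightarrow> \<kappa> (a x) = x" "\<And>x. x \<in> carrier M \<Longrightarrow> \<kappa> (b x) = x" "\<And>x. x \<in> carrier M \<Longrightarrow> \<kappa> (c x) = x"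
    "commutator3 CP M \<in> hom CP (Dom CP (commutator3 CP M)) M"
    "ap (commutator3 CP M) ` carrier (Dom CP (commutator3 CP M)) =
       \<kappa> ` {w \<in> carrier W. e1 w = z W \<and> e2 w = z W \<and> e3 w = z W}"
    "(\<forall>w\<in>carrier W. e1 w = z W \<and> e2 w = z W \<and> e3 w = z W \<longrightarrow> \<kappa> w = z M) \<longrightarrow>
       is_zero CP (Dom CP (commutator3 CP M))"
proof -
  let ?D = "coprod_obj CP M M"
  let ?W = "coprod_obj CP ?D M"
  note D = coprod_CP[OF M M]
  note oD = copD(1)[OF D(1)]
  note W = coprod_CP[OF oD M]
  note oW = copD(1)[OF W(1)]
  let ?i = "inj1 CP M M" and ?j = "inj2 CP M M" and ?u = "inj1 CP ?D M"
  let ?a = "\<lambda>x. ap ?u (ap ?i x)" and ?b = "\<lambda>x. ap ?u (ap ?j x)" and ?c = "ap (inj2 CP ?D M)"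
  have t: "tri M M M ?W ?a ?b ?c" by (rule cop_tri'[OF W(1) D(1)])
  note T = triD[OF t]
  obtain e1 e2 e3 where k: "kills M M M ?W ?a ?b ?c e1 e2 e3" using kills_ex[OF t] .
  have e: "H ?W ?W e1" "H ?W ?W e2" "H ?W ?W e3" using k by (auto simp: kills_def)
  define kZ where "kZ = copairing CP (Ide CP ?D) (zero_arr CP M ?D)"
  define kY where "kY = copairing CP (copairing CP ?i (zero_arr CP M ?D)) ?j"
  define kX where "kX = copairing CP (copairing CP (zero_arr CP M ?D) ?i) ?j"
  note zMD = zero_arr_hom[OF M oD]
  note Z = copairing_CP[OF Ide_hom[OF oD] zMD, folded kZ_def]
  note Y0 = copairing_CP[OF D(2) zMD] and X0 = copairing_CP[OF zMD D(2)]
  note Y = copairing_CP[OF Y0(1) D(3), folded kY_def] and X = copairing_CP[OF X0(1) D(3), folded kX_def]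
  note inD = ap_in[OF D(2)] ap_in[OF D(3)]
  have kZ: "ap kZ (?a x) = ap ?i x" "ap kZ (?b x) = ap ?j x" "ap kZ (?c x) = z ?D" if "x \<in> carrier M" for x
    using that Z(2,3) inD ap_zero_arr[OF M oD] by simp_all
  have kY: "ap kY (?a x) = ap ?i x" "ap kY (?b x) = z ?D" "ap kY (?c x) = ap ?j x" if "x \<in> carrier M" for x
    using that Y(2,3) Y0(2,3) inD ap_zero_arr[OF M oD] by simp_all
  have kX: "ap kX (?a x) = z ?D" "ap kX (?b x) = ap ?i x" "ap kX (?c x) = ap ?j x" if "x \<in> carrier M" for x
    using that X(2,3) X0(2,3) inD ap_zero_arr[OF M oD] by simp_all
  \<comment> \<open>\<open>q\<close> is a projection to a binary coproduct and \<open>v\<close> the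
    inclusion back; from \<open>v \<circ> q = e\<close> and \<open>q \<circ> e = q\<close> it
    follows that \<open>q\<close> and \<open>e\<close> have the same zeros.\<close>
  have iff: "ap q w = z ?D \<longleftrightarrow> e w = z ?W"
    if q: "q \<in> hom CP ?W ?D" and e: "H ?W ?W e" and v: "H ?D ?W v"
      and ve: "\<And>x. x \<in> carrier M \<Longrightarrow> v (ap q (?a x)) = e (?a x)" "\<And>x. x \<in> carrier M \<Longrightarrow> v (ap q (?b x)) = e (?b x)"
        "\<And>x. x \<in> carrier M \<Longrightarrow> v (ap q (?c x)) = e (?c x)"
      and qe: "\<And>x. x \<in> carrier M \<Longrightarrow> ap q (e (?a x)) = ap q (?a x)" "\<And>x. x \<in> carrier M \<Longrightarrow> ap q (e (?b x)) = ap q (?b x)"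
        "\<And>x. x \<in> carrier M \<Longrightarrow> ap q (e (?c x)) = ap q (?c x)"
      and w: "w \<in> carrier ?W" for q e v w
  proof -
    have 1: "v (ap q w) = e w" by (rule tri_ext[OF t hm_comp[OF hom_D(3)[OF q] v] e _ _ _ w]) (use ve in auto)
    have 2: "ap q (e w) = ap q w"
      by (rule tri_ext[OF t hm_comp[OF e hom_D(3)[OF q]] hom_D(3)[OF q] _ _ _ w]) (use qe in auto)
    have "v (z ?D) = z ?W" using z_hm[OF _ T(2) v] oD by simp
    then show ?thesis using 1 2 ap_z[OF q] by metis
  qed
  note K = k[unfolded kills_def]
  have vz: "v (z ?D) = z ?W" if "H ?D ?W v" for v using z_hm[OF _ T(2) that] oD by simp
  obtain v2 where v2: "H ?D ?W v2" "\<And>x. x \<in> carrier M \<Longrightarrow> v2 (ap ?i x) = ?a x" "\<And>x. x \<in> carrier M \<Longrightarrow> v2 (ap ?j x) = ?c x"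
    by (rule cop_univ[OF D(1) oW T(3,5)]) (rule that)
  obtain v3 where v3: "H ?D ?W v3" "\<And>x. x \<in> carrier M \<Longrightarrow> v3 (ap ?i x) = ?b x" "\<And>x. x \<in> carrier M \<Longrightarrow> v3 (ap ?j x) = ?c x"
    by (rule cop_univ[OF D(1) oW T(4,5)]) (rule that)
  have Zi: "ap kZ w = z ?D \<longleftrightarrow> e1 w = z ?W" if "w \<in> carrier ?W" for w
    by (rule iff[OF Z(1) e(1) hom_D(3)[OF W(2)] _ _ _ _ _ _ that])
      (use K kZ ap_z[OF Z(1)] ap_z[OF W(2)] in simp_all)
  have Yi: "ap kY w = z ?D \<longleftrightarrow> e2 w = z ?W" if "w \<in> carrier ?W" for w
    by (rule iff[OF Y(1) e(2) v2(1) _ _ _ _ _ _ that]) (use K kY v2 vz[OF v2(1)] ap_z[OF Y(1)] in simp_all)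
  have Xi: "ap kX w = z ?D \<longleftrightarrow> e3 w = z ?W" if "w \<in> carrier ?W" for w
    by (rule iff[OF X(1) e(3) v3(1) _ _ _ _ _ _ that]) (use K kX v3 vz[OF v3(1)] ap_z[OF X(1)] in simp_all)
  note pZY = pairing_CP(1)[OF Z(1) Y(1)]
  note p = pairing_CP(1)[OF pZY X(1)]
  have inc: "cosmash3_incl CP M M M = kernel CP (pairing CP (pairing CP kZ kY) kX)"
    by (simp add: cosmash3_incl_def Let_def kZ_def kY_def kX_def)
  note Kr = kernel_CP[OF p, folded inc]
  have Kr3: "ap (cosmash3_incl CP M M M) ` carrier (Dom CP (cosmash3_incl CP M M M)) =
      {w \<in> carrier ?W. e1 w = z ?W \<and> e2 w = z ?W \<and> e3 w = z ?W}"
    unfolding Kr(3) using pairing_zero[OF pZY X(1)] pairing_zero[OF Z(1) Y(1)] Zi Yi Xi by auto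
  note c0 = copairing_CP[OF Ide_hom[OF M] Ide_hom[OF M]]
  note \<kappa> = copairing_CP[OF c0(1) Ide_hom[OF M], folded codiagonal3_def]
  let ?f = "Comp CP (codiagonal3 CP M) (cosmash3_incl CP M M M)"
  note f = comp_hom[OF Kr(1) \<kappa>(1)]
  have "ap ?f ` carrier (Dom CP (cosmash3_incl CP M M M)) =
      ap (codiagonal3 CP M) ` ap (cosmash3_incl CP M M M) ` carrier (Dom CP (cosmash3_incl CP M M M))"
    unfolding image_image by (rule image_cong) (simp_all add: f(2))
  then have r: "ap ?f ` carrier (Dom CP (cosmash3_incl CP M M M)) =
      ap (codiagonal3 CP M) ` {w \<in> carrier ?W. e1 w = z ?W \<and> e2 w = z ?W \<and> e3 w = z ?W}"
    unfolding Kr3 .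
  note im = image_CP[OF f(1), folded commutator3_def]
  show thesis
  proof (rule that[OF t k hom_D(3)[OF \<kappa>(1)] _ _ _ im(1)])
    show "ap (codiagonal3 CP M) (?a x) = x" "ap (codiagonal3 CP M) (?b x) = x" "ap (codiagonal3 CP M) (?c x) = x"
      if "x \<in> carrier M" for x
      using \<kappa>(2,3) c0(2,3) inD that by simp_all
    show "ap (commutator3 CP M) ` carrier (Dom CP (commutator3 CP M)) =
       ap (codiagonal3 CP M) ` {w \<in> carrier ?W. e1 w = z ?W \<and> e2 w = z ?W \<and> e3 w = z ?W}"
      using im(2) r by simp
    show "(\<forall>w\<in>carrier ?W. e1 w = z ?W \<and> e2 w = z ?W \<and> e3 w = z ?W \<longrightarrow> ap (codiagonal3 CP M) w = z M) \<longrightarrow>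
       is_zero CP (Dom CP (commutator3 CP M))"
    proof (intro impI im(3))
      fix x assume 0: "\<forall>w\<in>carrier ?W. e1 w = z ?W \<and> e2 w = z ?W \<and> e3 w = z ?W \<longrightarrow> ap (codiagonal3 CP M) w = z M"
        and "x \<in> carrier (Dom CP (cosmash3_incl CP M M M))"
      then have "ap ?f x \<in> ap (codiagonal3 CP M) ` {w \<in> carrier ?W. e1 w = z ?W \<and> e2 w = z ?W \<and> e3 w = z ?W}"
        using r by blast
      then show "ap ?f x = z M" using 0 by auto
    qed
  qed
qed

lemma two_nilpotent_iff: "two_nilpotent CP M \<longleftrightarrow> vob ar E M \<and> nilp M"
proof (cases "vob ar E M")
  case True
  then have M: "ob M" by simp
  obtain W a b c e1 e2 e3 \<kappa> where t: "tri M M M W a b c" and k: "kills M M M W a b c e1 e2 e3" and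
    \<kappa>: "H W M \<kappa>" "\<And>x. x \<in> carrier M \<Longrightarrow> \<kappa> (a x) = x" "\<And>x. x \<in> carrier M \<Longrightarrow> \<kappa> (b x) = x" "\<And>x. x \<in> carrier M \<Longrightarrow> \<kappa> (c x) = x"
    and c: "commutator3 CP M \<in> hom CP (Dom CP (commutator3 CP M)) M"
    and r: "ap (commutator3 CP M) ` carrier (Dom CP (commutator3 CP M)) =
       \<kappa> ` {w \<in> carrier W. e1 w = z W \<and> e2 w = z W \<and> e3 w = z W}"
    and 0: "(\<forall>w\<in>carrier W. e1 w = z W \<and> e2 w = z W \<and> e3 w = z W \<longrightarrow> \<kappa> w = z M) \<longrightarrow>
       is_zero CP (Dom CP (commutator3 CP M))"
    by (rule commutator_CP[OF M]) (rule that)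
  have "is_zero CP (Dom CP (commutator3 CP M)) \<longleftrightarrow> nilp M"
  proof
    assume "is_zero CP (Dom CP (commutator3 CP M))"
    then have "carrier (Dom CP (commutator3 CP M)) = {z (Dom CP (commutator3 CP M))}" by (simp add: is_zero_iff)
    then have r': "\<kappa> ` {w \<in> carrier W. e1 w = z W \<and> e2 w = z W \<and> e3 w = z W} = {z M}"
      using r ap_z[OF c] by simp
    show "nilp M"
      by (rule nilpI[OF True t k \<kappa>]) (use r' in auto)
  next
    assume n: "nilp M"
    show "is_zero CP (Dom CP (commutator3 CP M))"
      using 0 nilpD[OF n True True True t k \<kappa>(1)] by blast
  qed
  then show ?thesis using True by (simp add: two_nilpotent_def Obj_CP)
qed (simp add: two_nilpotent_def Obj_CP)

lemma Nil2_CP: "Nil2 CP = alg_class.CP ar E nilp"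
proof -
  have "full_subcat (Variety ar E) (two_nilpotent CP) = full_subcat (Variety ar E) nilp"
    unfolding full_subcat_def
    by (intro arg_cong2[where f = "\<lambda>x y. Variety ar E\<lparr>Obj := x, Arr := y\<rparr>"] Collect_cong)
      (auto simp: two_nilpotent_iff Variety_def vob_def)
  then show ?thesis
    unfolding Nil2_def alg_class.CP_def[OF nilp_alg_class] by (simp add: CP_V)
qed

text \<open>The cokernel kills every value of \<open>\<kappa>\<close> on the ternary cosmash
  product, as \<open>nilp_quot\<close> asks. A map \<open>h\<close> to a nilpotent algebra kills
  these values too, by nilpotency applied to \<open>h \<circ> \<kappa>\<close>, and therefore
  factors.\<close>

lemma nil2_CP:
  assumes M: "ob M"
  shows "nil2_unit CP M \<in> hom CP M (nil2 CP M)" "ap (nil2_unit CP M) ` carrier M = carrier (nil2 CP M)"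
    "nilp (nil2 CP M)"
    "h \<in> hom CP M N \<Longrightarrow> nilp N \<Longrightarrow> \<exists>!u. u \<in> hom CP (nil2 CP M) N \<and> Comp CP u (nil2_unit CP M) = h"
proof -
  have v: "vob ar E M" using M by simp
  obtain W a b c e1 e2 e3 \<kappa> where t: "tri M M M W a b c" and k: "kills M M M W a b c e1 e2 e3" and
    \<kappa>: "H W M \<kappa>" "\<And>x. x \<in> carrier M \<Longrightarrow> \<kappa> (a x) = x" "\<And>x. x \<in> carrier M \<Longrightarrow> \<kappa> (b x) = x" "\<And>x. x \<in> carrier M \<Longrightarrow> \<kappa> (c x) = x"
    and c: "commutator3 CP M \<in> hom CP (Dom CP (commutator3 CP M)) M"
    and r: "ap (commutator3 CP M) ` carrier (Dom CP (commutator3 CP M)) =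
       \<kappa> ` {w \<in> carrier W. e1 w = z W \<and> e2 w = z W \<and> e3 w = z W}"
    by (rule commutator_CP[OF M]) (rule that)
  note q = cokernel_CP[OF c, folded nil2_unit_def, folded nil2_def]
  show "nil2_unit CP M \<in> hom CP M (nil2 CP M)" "ap (nil2_unit CP M) ` carrier M = carrier (nil2 CP M)" by (rule q)+
  show "nilp (nil2 CP M)"
  proof (rule nilp_quot[OF v hom_vob(2)[OF q(1)] hom_D(3)[OF q(1)] q(2) t k \<kappa>])
    fix u assume "u \<in> carrier W" "e1 u = z W" "e2 u = z W" "e3 u = z W"
    then have "\<kappa> u \<in> ap (commutator3 CP M) ` carrier (Dom CP (commutator3 CP M))" unfolding r by blast
    then show "ap (nil2_unit CP M) (\<kappa> u) = z (nil2 CP M)" using q(3) by auto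
  qed
  show "\<exists>!u. u \<in> hom CP (nil2 CP M) N \<and> Comp CP u (nil2_unit CP M) = h" if h: "h \<in> hom CP M N" and n: "nilp N"
  proof (rule q(4)[OF h])
    fix x assume "x \<in> carrier (Dom CP (commutator3 CP M))"
    then have "ap (commutator3 CP M) x \<in> \<kappa> ` {w \<in> carrier W. e1 w = z W \<and> e2 w = z W \<and> e3 w = z W}"
      using r by blast
    then obtain w where w: "w \<in> carrier W" "e1 w = z W" "e2 w = z W" "e3 w = z W" "ap (commutator3 CP M) x = \<kappa> w" by blast
    show "ap h (ap (commutator3 CP M) x) = z N"
      using nilpD[OF n v v v t k hm_comp[OF \<kappa>(1) hom_D(3)[OF h]] w(1-4)] w(5) by simp
  qed
qed

lemma nil2_map_CP:
  assumes f: "f \<in> hom CP A B"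
  shows "nil2_map CP f \<in> hom CP (nil2 CP A) (nil2 CP B)"
    "Comp CP (nil2_map CP f) (nil2_unit CP A) = Comp CP (nil2_unit CP B) f"
    "g \<in> hom CP (nil2 CP A) (nil2 CP B) \<Longrightarrow> Comp CP g (nil2_unit CP A) = Comp CP (nil2_unit CP B) f \<Longrightarrow> g = nil2_map CP f"
proof -
  note A = nil2_CP[OF hom_D(1)[OF f]] and B = nil2_CP[OF hom_D(2)[OF f]]
  have ex: "\<exists>!g. g \<in> hom CP (nil2 CP A) (nil2 CP B) \<and> Comp CP g (nil2_unit CP A) = Comp CP (nil2_unit CP B) f"
    by (rule A(4)[OF comp_hom(1)[OF f B(1)] B(3)])
  have def: "nil2_map CP f = (THE g. g \<in> hom CP (nil2 CP A) (nil2 CP B) \<and>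
      Comp CP g (nil2_unit CP A) = Comp CP (nil2_unit CP B) f)"
    by (simp add: nil2_map_def hom_arr[OF f])
  note th = theI'[OF ex, folded def]
  show "nil2_map CP f \<in> hom CP (nil2 CP A) (nil2 CP B)"
    "Comp CP (nil2_map CP f) (nil2_unit CP A) = Comp CP (nil2_unit CP B) f" using th by blast+
  show "g \<in> hom CP (nil2 CP A) (nil2 CP B) \<Longrightarrow> Comp CP g (nil2_unit CP A) = Comp CP (nil2_unit CP B) f \<Longrightarrow> g = nil2_map CP f"
    using ex th by blast
qed

end

section \<open>Abelian objects\<close>

lemma Comp_full [simp]: "Comp (full_subcat C Q) = Comp C"
  and Ide_full [simp]: "Ide (full_subcat C Q) = Ide C"
  by (simp_all add: full_subcat_def)

lemma hom_full: "f \<in> hom (full_subcat C Q) A B \<longleftrightarrow> f \<in> hom C A B \<and> Q A \<and> Q B"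
  by (auto simp: hom_def full_subcat_def)

lemma Obj_full: "A \<in> Obj (full_subcat C Q) \<longleftrightarrow> A \<in> Obj C \<and> Q A"
  by (simp add: full_subcat_def)

context protomodular_variety
begin

lemma is_terminal_CP: "is_terminal CP T \<Longrightarrow> ob T \<and> carrier T = {z T}"
proof -
  assume T: "is_terminal CP T"
  then have oT: "ob T" by (simp add: is_terminal_def Obj_CP)
  have "\<exists>!f. f \<in> hom CP T T" using T oT by (simp add: is_terminal_def Obj_CP)
  then have "zero_arr CP T T = Ide CP T" using zero_arr_hom[OF oT oT] Ide_hom[OF oT] by blast
  then have "x = z T" if "x \<in> carrier T" for x
    using ap_zero_arr[OF oT oT that] that by simp
  then show ?thesis using oT z_in[of T] by auto
qed

text \<open>In the product, \<open>(a, b)\<close> is the \<open>pl\<close> of \<open>(a, 0)\<close>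
  and \<open>(0, b)\<close>. The multiplication preserves \<open>pl\<close> and satisfies the unit
  laws, so it sends \<open>(a, b)\<close> to \<open>pl A a b\<close>; hence \<open>pl\<close> is a
  homomorphism.\<close>

lemma abelian_imp_abl:
  assumes a: "abelian_obj CP A" shows "abl A"
proof -
  have oA: "ob A" using a by (simp add: abelian_obj_def Obj_CP)
  then have vA: "vob ar E A" by simp
  let ?Q = "prod_obj CP A A" and ?p = "proj1 CP A A" and ?q = "proj2 CP A A"
  obtain T m e u where T: "is_terminal CP T" and m: "m \<in> hom CP ?Q A" and e: "e \<in> hom CP T A"
    and u: "u \<in> hom CP A T"
    and m1: "Comp CP m (pairing CP (Ide CP A) (Comp CP e u)) = Ide CP A"
    and m2: "Comp CP m (pairing CP (Comp CP e u) (Ide CP A)) = Ide CP A"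
    using a unfolding abelian_obj_def Let_def by blast
  note I = Ide_hom[OF oA] and eu = comp_hom[OF u e]
  have euz: "ap (Comp CP e u) x = z A" if "x \<in> carrier A" for x
    using eu(2)[OF that] ap_in[OF u that] is_terminal_CP[OF T] ap_z[OF e] by simp
  have Q: "prodel A A ?Q ?p ?q" by (rule prod_CP[OF oA oA])
  have p: "?p \<in> hom CP ?Q A" and q: "?q \<in> hom CP ?Q A" using Q by (auto simp: prodel_def)
  have vQ: "vob ar E ?Q" using hom_vob[OF p] by simp
  note pr1 = pairing_CP[OF I eu(1)] and pr2 = pairing_CP[OF eu(1) I]
  have mp: "ap m w = pl A (ap ?p w) (ap ?q w)" if w: "w \<in> carrier ?Q" for w
  proof -
    let ?a = "ap ?p w" and ?b = "ap ?q w"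
    have ab: "?a \<in> carrier A" "?b \<in> carrier A" using ap_in[OF p w] ap_in[OF q w] .
    let ?v = "ap (pairing CP (Ide CP A) (Comp CP e u)) ?a" and ?v' = "ap (pairing CP (Comp CP e u) (Ide CP A)) ?b"
    have v: "?v \<in> carrier ?Q" "?v' \<in> carrier ?Q" using ap_in[OF pr1(1) ab(1)] ap_in[OF pr2(1) ab(2)] .
    have mv: "ap m ?v = ?a" "ap m ?v' = ?b"
      using comp_hom(2)[OF pr1(1) m ab(1)] comp_hom(2)[OF pr2(1) m ab(2)] m1 m2 ab by simp_all
    have "ap ?p (pl ?Q ?v ?v') = ?a" "ap ?q (pl ?Q ?v ?v') = ?b"
      using pl_hm[OF vQ vA hom_D(3)[OF p] v] pl_hm[OF vQ vA hom_D(3)[OF q] v]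
        pr1(2,3)[OF ab(1)] pr2(2,3)[OF ab(2)] euz ab vA by simp_all
    then have "pl ?Q ?v ?v' = w" using Q w pl_in[OF vQ v] unfolding prodel_def by blast
    then show ?thesis using pl_hm[OF vQ vA hom_D(3)[OF m] v] mv by simp
  qed
  show ?thesis
    unfolding abl_def
  proof (intro conjI vA allI impI, elim conjE)
    fix f xs ys assume *: "set xs \<subseteq> carrier A" "set ys \<subseteq> carrier A" and len: "length xs = ar f" "length ys = ar f"
    have "\<forall>n. \<exists>w. n < ar f \<longrightarrow> w \<in> carrier ?Q \<and> ap ?p w = xs ! n \<and> ap ?q w = ys ! n"
    proof
      fix n
      show "\<exists>w. n < ar f \<longrightarrow> w \<in> carrier ?Q \<and> ap ?p w = xs ! n \<and> ap ?q w = ys ! n"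
      proof (cases "n < ar f")
        case True
        then have "xs ! n \<in> carrier A" "ys ! n \<in> carrier A" using * len by auto
        then show ?thesis using Q unfolding prodel_def by blast
      qed simp
    qed
    then obtain W where W: "\<And>n. n < ar f \<Longrightarrow> W n \<in> carrier ?Q \<and> ap ?p (W n) = xs ! n \<and> ap ?q (W n) = ys ! n" by metis
    define ws where "ws = map W [0..<ar f]"
    have ws: "set ws \<subseteq> carrier ?Q" "length ws = ar f" using W by (auto simp: ws_def)
    have pq: "map (ap ?p) ws = xs" "map (ap ?q) ws = ys" using W len by (auto simp: ws_def intro!: nth_equalityI)
    have "map (ap m) ws = map2 (pl A) (map (ap ?p) ws) (map (ap ?q) ws)"
      unfolding map2_map_map using mp ws(1) by (intro map_cong) auto
    then have ms: "map (ap m) ws = map2 (pl A) xs ys" unfolding pq .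
    have o: "oper ?Q f ws \<in> carrier ?Q" by (rule alg_op[OF vob_alg[OF vQ] ws])
    have "oper A f (map2 (pl A) xs ys) = ap m (oper ?Q f ws)"
      using hm_op[OF hom_D(3)[OF m] ws] ms by simp
    also have "\<dots> = pl A (ap ?p (oper ?Q f ws)) (ap ?q (oper ?Q f ws))" by (rule mp[OF o])
    also have "\<dots> = pl A (oper A f xs) (oper A f ys)"
      using hm_op[OF hom_D(3)[OF p] ws] hm_op[OF hom_D(3)[OF q] ws] pq by simp
    finally show "oper A f (map2 (pl A) xs ys) = pl A (oper A f xs) (oper A f ys)" .
  qed
qed

text \<open>Both sides of the homomorphism law are inverse to \<open>oper A f xs\<close> for
  \<open>pl\<close>, and inverses are unique.\<close>

lemma abl_neg:
  assumes A: "abl A" shows "H A A (sb A (z A))"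
proof (rule hmI)
  note vA = abl_vob[OF A]
  have zz: "z A \<in> carrier A" using vA by simp
  show n: "sb A (z A) x \<in> carrier A" if "x \<in> carrier A" for x using sb_in[OF vA zz that] .
  fix f xs assume *: "set xs \<subseteq> carrier A" "length xs = ar f"
  let ?n = "sb A (z A)"
  let ?o = "oper A f xs" and ?m = "oper A f (map ?n xs)"
  have ns: "set (map ?n xs) \<subseteq> carrier A" "length (map ?n xs) = ar f" using * n by auto
  have o: "?o \<in> carrier A" "?m \<in> carrier A" using alg_op[OF vob_alg[OF vA]] * ns by blast+
  have "pl A ?m ?o = oper A f (map2 (pl A) (map ?n xs) xs)"
    using A *(1) ns *(2) unfolding abl_def by metis
  also have "map2 (pl A) (map ?n xs) xs = map (\<lambda>_. z A) xs"
    using abl_inv[OF A] *(1) by (auto intro!: nth_equalityI simp: subset_iff)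
  also have "oper A f (map (\<lambda>_. z A) xs) = z A" by (rule z_op[OF vA]) (use * in auto)
  finally have 1: "pl A ?m ?o = z A" .
  have "?m = pl A ?m (pl A ?o (?n ?o))"
    using abl_inv[OF A o(1)] abl_comm[OF A o(1) n[OF o(1)]] o vA by simp
  also have "\<dots> = pl A (pl A ?m ?o) (?n ?o)" using abl_assoc[OF A o(2,1) n[OF o(1)]] by simp
  also have "\<dots> = ?n ?o" using 1 n[OF o(1)] vA by simp
  finally show "?n ?o = ?m" by simp
qed

lemma abl_imp_abelian:
  assumes A: "abl A" shows "abelian_obj CP A"
proof -
  note vA = abl_vob[OF A]
  then have oA: "ob A" by simp
  fix t :: 'u
  let ?t = "triv t"
  have oT: "ob ?t" by (rule triv_ob)
  let ?Q = "prod_obj CP A A" and ?p = "proj1 CP A A" and ?q = "proj2 CP A A"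
  have Q: "prodel A A ?Q ?p ?q" by (rule prod_CP[OF oA oA])
  have p: "?p \<in> hom CP ?Q A" and q: "?q \<in> hom CP ?Q A" using Q by (auto simp: prodel_def)
  note oQ = hom_D(1)[OF p]
  let ?Q2 = "prod_obj CP ?Q A" and ?r = "proj1 CP ?Q A" and ?s = "proj2 CP ?Q A"
  have Q2: "prodel ?Q A ?Q2 ?r ?s" by (rule prod_CP[OF oQ oA])
  have r: "?r \<in> hom CP ?Q2 ?Q" and s: "?s \<in> hom CP ?Q2 A" using Q2 by (auto simp: prodel_def)
  define m where "m = mk ?Q (\<lambda>w. pl A (ap ?p w) (ap ?q w)) A"
  have m: "m \<in> hom CP ?Q A"
    unfolding m_def by (rule mk_hom[OF oQ oA abl_hm[OF A _ hom_D(3)[OF p] hom_D(3)[OF q]]]) (use oQ in auto)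
  have mx: "ap m w = pl A (ap ?p w) (ap ?q w)" if "w \<in> carrier ?Q" for w using that by (simp add: m_def)
  define e where "e = zero_arr CP ?t A"
  define u where "u = zero_arr CP A ?t"
  define i where "i = mk A (sb A (z A)) A"
  have e: "e \<in> hom CP ?t A" and u: "u \<in> hom CP A ?t" and i: "i \<in> hom CP A A"
    unfolding e_def u_def i_def by (rule zero_arr_hom[OF oT oA] zero_arr_hom[OF oA oT] mk_hom[OF oA oA abl_neg[OF A]])+
  have ix: "ap i x = sb A (z A) x" if "x \<in> carrier A" for x using that by (simp add: i_def)
  have mpr: "Comp CP m (pairing CP f g) \<in> hom CP W A"
    "x \<in> carrier W \<Longrightarrow> ap (Comp CP m (pairing CP f g)) x = pl A (ap f x) (ap g x)"
    if "f \<in> hom CP W A" "g \<in> hom CP W A" for f g W x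
    using comp_hom[OF pairing_CP(1)[OF that] m] pairing_CP[OF that] mx ap_in[OF pairing_CP(1)[OF that]] by auto
  note I = Ide_hom[OF oA] and eu = comp_hom[OF u e]
  have euz: "ap (Comp CP e u) x = z A" if "x \<in> carrier A" for x
    using eu(2)[OF that] ap_in[OF u that] ap_zero_arr[OF oT oA] by (simp add: e_def)
  have T: "is_terminal CP ?t" using triv_zero by (simp add: is_zero_def)
  note mr = comp_hom[OF r m] and pr = comp_hom[OF r p] and qr = comp_hom[OF r q]
  note qs = mpr[OF qr(1) s]
  have "Comp CP m (pairing CP (Comp CP m ?r) ?s) =
      Comp CP m (pairing CP (Comp CP ?p ?r) (Comp CP m (pairing CP (Comp CP ?q ?r) ?s)))"
  proof (rule hom_eqI[OF mpr(1)[OF mr(1) s] mpr(1)[OF pr(1) qs(1)]])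
    fix x assume x: "x \<in> carrier ?Q2"
    have c: "ap ?p (ap ?r x) \<in> carrier A" "ap ?q (ap ?r x) \<in> carrier A" "ap ?s x \<in> carrier A" "ap ?r x \<in> carrier ?Q"
      using ap_in[OF p ap_in[OF r x]] ap_in[OF q ap_in[OF r x]] ap_in[OF s x] ap_in[OF r x] by auto
    show "ap (Comp CP m (pairing CP (Comp CP m ?r) ?s)) x =
        ap (Comp CP m (pairing CP (Comp CP ?p ?r) (Comp CP m (pairing CP (Comp CP ?q ?r) ?s)))) x"
      unfolding mpr(2)[OF mr(1) s x] mpr(2)[OF pr(1) qs(1) x] qs(2)[OF x] mr(2)[OF x] pr(2)[OF x] qr(2)[OF x] mx[OF c(4)]
      by (rule abl_assoc[OF A c(1-3)])
  qed
  moreover have "Comp CP m (pairing CP (Ide CP A) (Comp CP e u)) = Ide CP A"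
    by (rule hom_eqI[OF mpr(1)[OF I eu(1)] I]) (use mpr(2)[OF I eu(1)] euz vA in simp)
  moreover have "Comp CP m (pairing CP (Comp CP e u) (Ide CP A)) = Ide CP A"
    by (rule hom_eqI[OF mpr(1)[OF eu(1) I] I]) (use mpr(2)[OF eu(1) I] euz vA in simp)
  moreover have "Comp CP m (pairing CP (Ide CP A) i) = Comp CP e u"
  proof (rule hom_eqI[OF mpr(1)[OF I i] eu(1)])
    fix x assume x: "x \<in> carrier A"
    have "sb A (z A) x \<in> carrier A" using sb_in[OF vA z_in[OF vA] x] .
    then show "ap (Comp CP m (pairing CP (Ide CP A) i)) x = ap (Comp CP e u) x"
      using mpr(2)[OF I i x] euz[OF x] x ix[OF x] abl_inv[OF A x] abl_comm[OF A x] by simp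
  qed
  moreover have "Comp CP m (pairing CP i (Ide CP A)) = Comp CP e u"
    by (rule hom_eqI[OF mpr(1)[OF i I] eu(1)]) (use mpr(2)[OF i I] euz ix abl_inv[OF A] in simp)
  moreover have "Comp CP m (pairing CP ?q ?p) = m"
    by (rule hom_eqI[OF mpr(1)[OF q p] m]) (use mpr(2)[OF q p] mx abl_comm[OF A] ap_in[OF p] ap_in[OF q] in simp)
  ultimately show ?thesis
    unfolding abelian_obj_def Let_def using oA T m e i u
    by (intro conjI exI[of _ ?t] exI[of _ m] exI[of _ e] exI[of _ i] exI[of _ u]) (simp_all only: Obj_CP simp_thms)
qed

lemma abelian_iff: "abelian_obj CP A \<longleftrightarrow> abl A"
  using abelian_imp_abl abl_imp_abelian by blast

text \<open>Carries \<open>TT_abl\<close> over to the chosen cosmash object, which embeds into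
  \<open>TA\<close>.\<close>

lemma abl_embed:
  assumes B: "abl B" and A: "vob ar E A" and h: "H A B h" "inj_on h (carrier A)"
  shows "abl A"
  unfolding abl_def
proof (intro conjI A allI impI, elim conjE)
  fix f xs ys assume *: "set xs \<subseteq> carrier A" "set ys \<subseteq> carrier A" "length xs = ar f" "length ys = ar f"
  have s: "set (map h xs) \<subseteq> carrier B" "set (map h ys) \<subseteq> carrier B" using * hm_in[OF h(1)] by auto
  have "h (oper A f (map2 (pl A) xs ys)) = h (pl A (oper A f xs) (oper A f ys))"
    unfolding map2_pl_hm[OF A abl_vob[OF B] h(1) *]
    using B s * unfolding abl_def by (metis length_map)
  moreover have "oper A f (map2 (pl A) xs ys) \<in> carrier A"
    by (rule alg_op[OF vob_alg[OF A] map2_pl_in[OF A *(1,2)]]) (use * in simp)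
  moreover have "pl A (oper A f xs) (oper A f ys) \<in> carrier A"
    using pl_in[OF A] alg_op[OF vob_alg[OF A]] * by blast
  ultimately show "oper A f (map2 (pl A) xs ys) = pl A (oper A f xs) (oper A f ys)"
    using h(2) by (auto dest: inj_onD)
qed

section \<open>The bilinear product preserves colimits\<close>

lemma hom_nil: "f \<in> hom (alg_class.CP ar E nilp) A B \<longleftrightarrow> f \<in> hom CP A B \<and> nilp A \<and> nilp B"
  unfolding alg_class.CP_def[OF nilp_alg_class] CP_V[symmetric] by (rule hom_full)

lemma Ide_nil: "Ide (alg_class.CP ar E nilp) = Ide CP"
  unfolding alg_class.CP_def[OF nilp_alg_class] CP_V[symmetric] by simp

lemma hom_Ab: "f \<in> hom (Ab CP) A B \<longleftrightarrow> f \<in> hom CP A B \<and> abl A \<and> abl B"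
  unfolding Ab_def hom_full abelian_iff ..

lemma Obj_Ab: "A \<in> Obj (Ab CP) \<longleftrightarrow> abl A"
  unfolding Ab_def Obj_full abelian_iff by (auto simp: Obj_CP dest: abl_vob)

lemma Comp_Ab: "Comp (Ab CP) = Comp CP" and Ide_Ab: "Ide (Ab CP) = Ide CP"
  by (simp_all add: Ab_def)

lemma nil2_ob: "ob Y \<Longrightarrow> ob (nil2 CP Y) \<and> nilp (nil2 CP Y)"
  using nil2_CP(1,3) hom_D(2) by blast

lemma nil2_map_Ide: assumes "ob Y" shows "nil2_map CP (Ide CP Y) = Ide CP (nil2 CP Y)"
proof -
  note q = nil2_CP(1)[OF assms] and I = Ide_hom[OF assms] and I' = Ide_hom[OF hom_D(2)[OF nil2_CP(1)[OF assms]]]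
  have "Comp CP (Ide CP (nil2 CP Y)) (nil2_unit CP Y) = Comp CP (nil2_unit CP Y) (Ide CP Y)"
    by (rule hom_eqI[OF comp_hom(1)[OF q I'] comp_hom(1)[OF I q]])
      (use comp_hom(2)[OF q I'] comp_hom(2)[OF I q] ap_in[OF q] in simp)
  then show ?thesis using nil2_map_CP(3)[OF I I'] by simp
qed

lemma nil2_map_ap:
  assumes f: "f \<in> hom CP A B" and x: "x \<in> carrier A"
  shows "ap (nil2_map CP f) (ap (nil2_unit CP A) x) = ap (nil2_unit CP B) (ap f x)"
proof -
  note q = nil2_CP(1)[OF hom_D(1)[OF f]] and q' = nil2_CP(1)[OF hom_D(2)[OF f]] and n = nil2_map_CP[OF f]
  show ?thesis using comp_hom(2)[OF q n(1) x] comp_hom(2)[OF f q' x] n(2) by simp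
qed

lemma nil2_map_comp:
  assumes f: "f \<in> hom CP A B" and g: "g \<in> hom CP B C"
  shows "nil2_map CP (Comp CP g f) = Comp CP (nil2_map CP g) (nil2_map CP f)"
proof -
  note c = comp_hom[OF f g]
  note n = nil2_map_CP(1)[OF f] nil2_map_CP(1)[OF g]
  note nc = comp_hom[OF n]
  note q = nil2_CP(1)[OF hom_D(1)[OF f]] and q' = nil2_CP(1)[OF hom_D(2)[OF g]]
  have "Comp CP (Comp CP (nil2_map CP g) (nil2_map CP f)) (nil2_unit CP A) = Comp CP (nil2_unit CP C) (Comp CP g f)"
    by (rule hom_eqI[OF comp_hom(1)[OF q nc(1)] comp_hom(1)[OF c(1) q']])
      (use comp_hom(2)[OF q nc(1)] comp_hom(2)[OF c(1) q'] nc(2)[OF ap_in[OF q]] c(2)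
        nil2_map_ap[OF f] nil2_map_ap[OF g] ap_in[OF f] in simp)
  then show ?thesis using nil2_map_CP(3)[OF c(1) nc(1)] by simp
qed

lemma tensor_preserves_colimits:
  fixes J :: "('i, 'j) cat"
  assumes X: "ob X" and J: "category J" and JU: "Arr J \<lesssim> (UNIV :: 'u set)"
  shows "is_functor CP (Ab CP) (tensor_functor CP X) \<and>
    preserves_colimits J CP (Ab CP) (tensor_functor CP X)"
proof -
  interpret N: maltsev_class ar E nilp mal by (rule nilp_maltsev_class)
  define K where "K = nil2 CP X"
  have K: "N.ob K" using nil2_ob[OF X] by (simp add: K_def)
  define S where "S = (\<lambda>Y. coprod_obj N.CP K Y)"
  define inn where "inn = (\<lambda>Y. ap (inj1 N.CP K Y))"
  define jn where "jn = (\<lambda>Y. ap (inj2 N.CP K Y))"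
  \<comment> \<open>From here on cosmash products are computed among the two-nilpotent algebras,
    with \<open>nil2 CP X\<close> as the fixed factor.\<close>
  interpret T: nilpotent_class ar E nilp mal K S inn jn
  proof
    show "N.ob K" by (rule K)
    show "nilp B" if "N.ob A" "vob ar E B" "H A B h" "h ` carrier A = carrier B" for A B h
      using nilp_surj that by blast
    show "N.cop K Y (S Y) (inn Y) (jn Y)" if "N.ob Y" for Y
      unfolding S_def inn_def jn_def by (rule N.coprod_CP(1)[OF K that])
    show "w = v" if "N.ob A" "N.ob B" "N.ob C" "N.tri A B C W a b c" "N.kills A B C W a b c e1 e2 e3"
      "w \<in> carrier W" "v \<in> carrier W" "e1 w = e1 v" "e2 w = e2 v" "e3 w = e3 v" for A B C W a b c e1 e2 e3 w v
      using nilp_jointly_monic[of A B C W a b c e1 e2 e3 w v] that by blast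
  qed
  define n where "n = nil2 CP"
  define F where "F = (\<lambda>Y. cosmash N.CP K (n Y))"
  \<comment> \<open>\<open>\<kappa> Y\<close> identifies the chosen object
    \<open>X \<otimes> Y\<close> with \<open>TT (n Y)\<close>; statements about the tensor product
    are transported along it.\<close>
  define \<kappa> where "\<kappa> = (\<lambda>Y. ap (cosmash_incl N.CP K (n Y)))"
  have nob: "N.ob (n Y)" if "ob Y" for Y using nil2_ob[OF that] by (simp add: n_def)
  have r1: "T.r1 Y w = ap (N.k1 K Y) w" and r2: "T.r2 Y w = ap (N.k2 K Y) w"
    if Y: "N.ob Y" and w: "w \<in> carrier (S Y)" for Y w
    using T.S_ext[OF Y T.r1(1)[OF Y] N.hom_D(3)[OF N.cosmash_projections(1)[OF K Y], folded S_def] _ _ w]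
      T.S_ext[OF Y T.r2(1)[OF Y] N.hom_D(3)[OF N.cosmash_projections(2)[OF K Y], folded S_def] _ _ w]
      T.r1[OF Y] T.r2[OF Y] N.cosmash_projections[OF K Y] by (simp_all add: inn_def jn_def)
  have TT: "T.TT Y = {w \<in> carrier (S Y). ap (N.k1 K Y) w = N.z K \<and> ap (N.k2 K Y) w = N.z Y}" if "N.ob Y" for Y
    unfolding T.TT_def using r1[OF that] r2[OF that] by auto
  have oF: "N.ob (F Y)" and \<kappa>: "H (F Y) (T.TA (n Y)) (\<kappa> Y)" "inj_on (\<kappa> Y) (carrier (F Y))"
    "\<kappa> Y ` carrier (F Y) = carrier (T.TA (n Y))" if Y: "ob Y" for Y
  proof -
    note c = N.cosmash_CP[OF K nob[OF Y], folded F_def S_def]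
    have "\<kappa> Y ` carrier (F Y) =
        {w \<in> carrier (S (n Y)). ap (N.k1 K (n Y)) w = N.z K \<and> ap (N.k2 K (n Y)) w = N.z (n Y)}"
      unfolding \<kappa>_def F_def S_def by (rule N.cosmash_CP(3)[OF K nob[OF Y]])
    then have c3: "\<kappa> Y ` carrier (F Y) = T.TT (n Y)" by (simp only: TT[OF nob[OF Y]])
    have c1: "cosmash_incl N.CP K (n Y) \<in> hom N.CP (F Y) (S (n Y))"
      unfolding F_def S_def by (rule N.cosmash_CP(1)[OF K nob[OF Y]])
    show "N.ob (F Y)" by (rule N.hom_D(1)[OF c1])
    show "H (F Y) (T.TA (n Y)) (\<kappa> Y)"
      by (rule hm_into_sub) (use N.hom_D(3)[OF c1] c3 in \<open>auto simp: \<kappa>_def\<close>)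
    show "inj_on (\<kappa> Y) (carrier (F Y))" unfolding F_def \<kappa>_def by (rule N.cosmash_CP(2)[OF K nob[OF Y]])
    show "\<kappa> Y ` carrier (F Y) = carrier (T.TA (n Y))" using c3 by simp
  qed
  have Fabl: "abl (F Y)" if Y: "ob Y" for Y
    by (rule abl_embed[OF T.TT_abl[OF nob[OF Y]] _ \<kappa>(1,2)[OF Y]]) (use oF[OF Y] in blast)
  have Fob: "ob (F Y)" if "ob Y" for Y using oF[OF that] by simp
  have \<kappa>TT: "\<kappa> Y w \<in> T.TT (n Y)" if "ob Y" "w \<in> carrier (F Y)" for Y w
    using hm_in[OF \<kappa>(1)[OF that(1)] that(2)] by simp
  have \<kappa>eq: "w = v" if "ob Y" "w \<in> carrier (F Y)" "v \<in> carrier (F Y)" "\<kappa> Y w = \<kappa> Y v" for Y w v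
    using inj_onD[OF \<kappa>(2)[OF that(1)] that(4,2,3)] .
  define \<tau> where "\<tau> = tensor_map CP (Ide CP X)"
  define \<nu> where "\<nu> f = ap (nil2_map CP f)" for f
  have \<nu>: "H (n Y) (n Y') (\<nu> f)" if "f \<in> hom CP Y Y'" for f Y Y'
    unfolding \<nu>_def n_def by (rule hom_D(3)[OF nil2_map_CP(1)[OF that]])
  have \<tau>: "\<tau> f \<in> hom CP (F Y) (F Y')" "w \<in> carrier (F Y) \<Longrightarrow> \<kappa> Y' (ap (\<tau> f) w) = T.Smap (n Y) (n Y') (\<nu> f) (\<kappa> Y w)"
    if f: "f \<in> hom CP Y Y'" for f Y Y' w
  proof -
    have Y: "ob Y" "ob Y'" using hom_D(1,2)[OF f] by blast+
    have fN: "nil2_map CP f \<in> hom N.CP (n Y) (n Y')"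
      unfolding hom_nil using nil2_map_CP(1)[OF f] nob[OF Y(1)] nob[OF Y(2)] by (simp add: n_def)
    have I: "Ide CP K \<in> hom N.CP K K" unfolding Ide_nil[symmetric] by (rule N.Ide_hom[OF K])
    have \<tau>f: "\<tau> f = cosmash_map N.CP (Ide CP K) (nil2_map CP f)"
      by (simp add: \<tau>_def tensor_map_def Nil2_CP nil2_map_Ide[OF X] K_def)
    note c = N.cosmash_map_CP[OF I fN, folded F_def \<tau>f]
    show "\<tau> f \<in> hom CP (F Y) (F Y')" using c(1) hom_nil unfolding F_def by blast
    show "\<kappa> Y' (ap (\<tau> f) w) = T.Smap (n Y) (n Y') (\<nu> f) (\<kappa> Y w)" if w: "w \<in> carrier (F Y)"
    proof -
      have "ap (coprod_map N.CP (Ide CP K) (nil2_map CP f)) s = T.Smap (n Y) (n Y') (\<nu> f) s"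
        if s: "s \<in> carrier (S (n Y))" for s
      proof (rule T.S_ext[OF nob[OF Y(1)] _ T.Smap(1)[OF nob[OF Y(1)] nob[OF Y(2)] \<nu>[OF f]] _ _ s])
        show "H (S (n Y)) (S (n Y')) (ap (coprod_map N.CP (Ide CP K) (nil2_map CP f)))"
          unfolding S_def by (rule N.hom_D(3)[OF N.coprod_map_CP(1)[OF I fN]])
        fix x assume x: "x \<in> carrier K"
        show "ap (coprod_map N.CP (Ide CP K) (nil2_map CP f)) (inn (n Y) x) = T.Smap (n Y) (n Y') (\<nu> f) (inn (n Y) x)"
          using T.Smap(2)[OF nob[OF Y(1)] nob[OF Y(2)] \<nu>[OF f] x] N.coprod_map_CP(2)[OF I fN x] x by (simp add: inn_def)
      next
        fix y assume y: "y \<in> carrier (n Y)"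
        show "ap (coprod_map N.CP (Ide CP K) (nil2_map CP f)) (jn (n Y) y) = T.Smap (n Y) (n Y') (\<nu> f) (jn (n Y) y)"
          using T.Smap(3)[OF nob[OF Y(1)] nob[OF Y(2)] \<nu>[OF f] y] N.coprod_map_CP(3)[OF I fN y] by (simp add: jn_def \<nu>_def)
      qed
      from this[OF T.TT_S[OF \<kappa>TT[OF Y(1) w]]] c(2) w show ?thesis unfolding \<kappa>_def F_def by simp
    qed
  qed
  have \<tau>I: "\<tau> (Ide CP Y) = Ide CP (F Y)" if Y: "ob Y" for Y
  proof (rule hom_eqI[OF \<tau>(1)[OF Ide_hom[OF Y]] Ide_hom[OF Fob[OF Y]]])
    fix w assume w: "w \<in> carrier (F Y)"
    have wT: "\<kappa> Y w \<in> carrier (S (n Y))" using T.TT_S \<kappa>TT[OF Y w] by blast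
    have "\<kappa> Y (ap (\<tau> (Ide CP Y)) w) = T.Smap (n Y) (n Y) (\<lambda>y. y) (\<kappa> Y w)"
      unfolding \<tau>(2)[OF Ide_hom[OF Y] w]
      by (rule T.Smap_cong[OF nob[OF Y] nob[OF Y] hm_id _ wT]) (simp add: \<nu>_def nil2_map_Ide[OF Y] n_def)
    also have "\<dots> = \<kappa> Y w" by (rule T.Smap_id[OF nob[OF Y] wT])
    finally show "ap (\<tau> (Ide CP Y)) w = ap (Ide CP (F Y)) w"
      using \<kappa>eq[OF Y ap_in[OF \<tau>(1)[OF Ide_hom[OF Y]] w] w] w by simp
  qed
  have \<tau>c: "\<tau> (Comp CP g f) = Comp CP (\<tau> g) (\<tau> f)" if f: "f \<in> hom CP A B" and g: "g \<in> hom CP B C" for f g A B C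
  proof (rule hom_eqI[OF \<tau>(1)[OF comp_hom(1)[OF f g]] comp_hom(1)[OF \<tau>(1)[OF f] \<tau>(1)[OF g]]])
    fix w assume w: "w \<in> carrier (F A)"
    have A: "ob A" and B: "ob B" and C: "ob C" using hom_D(1)[OF f] hom_D(2)[OF f] hom_D(2)[OF g] by blast+
    have wT: "\<kappa> A w \<in> carrier (S (n A))" using T.TT_S \<kappa>TT[OF A w] by blast
    note fw = ap_in[OF \<tau>(1)[OF f] w]
    have "\<kappa> C (ap (Comp CP (\<tau> g) (\<tau> f)) w) = T.Smap (n B) (n C) (\<nu> g) (T.Smap (n A) (n B) (\<nu> f) (\<kappa> A w))"
      using comp_hom(2)[OF \<tau>(1)[OF f] \<tau>(1)[OF g] w] \<tau>(2)[OF g fw] \<tau>(2)[OF f w] by simp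
    also have "\<dots> = T.Smap (n A) (n C) (\<lambda>y. \<nu> g (\<nu> f y)) (\<kappa> A w)"
      by (rule T.Smap_comp[OF nob[OF A] nob[OF B] nob[OF C] \<nu>[OF f] \<nu>[OF g] wT])
    also have "\<dots> = T.Smap (n A) (n C) (\<nu> (Comp CP g f)) (\<kappa> A w)"
      by (rule T.Smap_cong[OF nob[OF A] nob[OF C] \<nu>[OF comp_hom(1)[OF f g]] _ wT])
        (use comp_hom(2)[OF nil2_map_CP(1)[OF f] nil2_map_CP(1)[OF g]] nil2_map_comp[OF f g] in \<open>simp add: \<nu>_def n_def\<close>)
    also have "\<dots> = \<kappa> C (ap (\<tau> (Comp CP g f)) w)" using \<tau>(2)[OF comp_hom(1)[OF f g] w] by simp
    finally show "ap (\<tau> (Comp CP g f)) w = ap (Comp CP (\<tau> g) (\<tau> f)) w"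
      using \<kappa>eq[OF C ap_in[OF \<tau>(1)[OF comp_hom(1)[OF f g]] w] ap_in[OF comp_hom(1)[OF \<tau>(1)[OF f] \<tau>(1)[OF g]] w]] by simp
  qed
  have F: "tensor CP X = F" by (simp add: F_def tensor_def Nil2_CP K_def n_def fun_eq_iff)
  have Ff: "on_obj (tensor_functor CP X) = F" "on_arr (tensor_functor CP X) = \<tau>"
    by (simp_all add: tensor_functor_def F \<tau>_def)
  have "is_functor CP (Ab CP) (tensor_functor CP X)"
    unfolding is_functor_def Ff
  proof (intro conjI ballI impI)
    fix A assume "A \<in> Obj CP"
    then have A: "ob A" by (simp add: Obj_CP)
    show "F A \<in> Obj (Ab CP)" using Fabl[OF A] by (simp add: Obj_Ab)
    show "\<tau> (Ide CP A) = Ide (Ab CP) (F A)" using \<tau>I[OF A] by (simp add: Ide_Ab)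
  next
    fix f assume "f \<in> Arr CP"
    then have f: "f \<in> hom CP (Dom CP f) (Cod CP f)" by (rule arr_hom)
    show "\<tau> f \<in> hom (Ab CP) (F (Dom CP f)) (F (Cod CP f))"
      using \<tau>(1)[OF f] Fabl[OF hom_D(1)[OF f]] Fabl[OF hom_D(2)[OF f]] by (simp add: hom_Ab)
    fix g assume "g \<in> Arr CP" "Cod CP f = Dom CP g"
    then have g: "g \<in> hom CP (Cod CP f) (Cod CP g)" using arr_hom by metis
    show "\<tau> (Comp CP g f) = Comp (Ab CP) (\<tau> g) (\<tau> f)" using \<tau>c[OF f g] by (simp add: Comp_Ab)
  qed
  moreover have "preserves_colimits J CP (Ab CP) (tensor_functor CP X)"
    unfolding preserves_colimits_def Ff
  proof (intro allI impI, elim conjE)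
    fix G :: "('i, 'j, ('f, 'u) alg, ('f, 'u) alg \<times> ('u \<Rightarrow> 'u) \<times> ('f, 'u) alg) fctr" and L c
    assume G: "is_functor J CP G" and Lc: "is_colimit J CP G L c"
    let ?FG = "fctr_comp (tensor_functor CP X) G"
    have FG: "on_obj ?FG i = F (on_obj G i)" "on_arr ?FG a = \<tau> (on_arr G a)" for i a
      by (simp_all add: fctr_comp_def Ff)
    define g where "g = on_obj G"
    have go: "ob (g i)" if "i \<in> Obj J" for i using G that by (simp add: is_functor_def Obj_CP g_def)
    have Ga: "on_arr G a \<in> hom CP (g (Dom J a)) (g (Cod J a))" if "a \<in> Arr J" for a
      using G that by (simp add: is_functor_def g_def)
    have Ja: "Dom J a \<in> Obj J" "Cod J a \<in> Obj J" if "a \<in> Arr J" for a using J that by (auto simp: category_def)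
    have coc: "is_cocone J CP G L c" using Lc by (simp add: is_colimit_def)
    have univ: "\<exists>!h. h \<in> hom CP L M \<and> (\<forall>i\<in>Obj J. Comp CP h (c i) = d i)" if "is_cocone J CP G M d" for M d
      using Lc that by (simp add: is_colimit_def)
    have L: "ob L" using coc by (simp add: is_cocone_def Obj_CP)
    have c: "c i \<in> hom CP (g i) L" if "i \<in> Obj J" for i using coc that by (simp add: is_cocone_def g_def)
    have cc: "Comp CP (c (Cod J a)) (on_arr G a) = c (Dom J a)" if "a \<in> Arr J" for a
      using coc that by (simp add: is_cocone_def)
    \<comment> \<open>Identities embed the objects of \<open>J\<close> into its arrows, so the bound
      on \<open>Arr J\<close> covers both.\<close>
    have "Obj J \<lesssim> Arr J"
    proof -
      have "inj_on (Ide J) (Obj J)" "Ide J ` Obj J \<subseteq> Arr J"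
        using J by (auto simp: category_def hom_def inj_on_def) (metis (no_types, lifting))+
      then show ?thesis by (auto simp: lepoll_def)
    qed
    then have JO: "Obj J \<lesssim> (UNIV :: 'u set)" using JU lepoll_trans by blast
    \<comment> \<open>For cocones only the source, the target and the underlying function of an
      arrow matter, so the reflected diagram is recorded as a set of triples.\<close>
    define Ars where "Ars = {(Dom J a, Cod J a, \<nu> (on_arr G a)) |a. a \<in> Arr J}"
    have Ars: "i \<in> Obj J \<and> j \<in> Obj J \<and> H (n (g i)) (n (g j)) k" if "(i, j, k) \<in> Ars" for i j k
      using that Ja \<nu>[OF Ga] by (auto simp: Ars_def)
    have q: "nil2_unit CP Y \<in> hom CP Y (n Y)" "ap (nil2_unit CP Y) ` carrier Y = carrier (n Y)" if "ob Y" for Y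
      using nil2_CP(1,2)[OF that] by (simp_all add: n_def)
    have \<nu>q: "\<nu> f (ap (nil2_unit CP A) x) = ap (nil2_unit CP B) (ap f x)" if "f \<in> hom CP A B" "x \<in> carrier A" for f A B x
      unfolding \<nu>_def by (rule nil2_map_ap[OF that])
    \<comment> \<open>The colimit cocone factors through the subalgebra it generates, and uniqueness
      makes the composite \<open>L \<rightarrow> L\<close> the identity.\<close>
    have Lgen: "carrier L = gen ar L (\<Union>i\<in>Obj J. ap (c i) ` carrier (g i))"
    proof -
      let ?U = "\<Union>i\<in>Obj J. ap (c i) ` carrier (g i)"
      have U: "?U \<subseteq> carrier L" using ap_in[OF c] by auto
      have cl: "closed ar L (gen ar L ?U)" by (rule gen_closed[OF _ U]) (use L in auto)
      let ?G = "sub_alg L (gen ar L ?U)"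
      have oG: "ob ?G" by (rule ob_sub[OF L cl])
      have cG: "mk (g i) (ap (c i)) ?G \<in> hom CP (g i) ?G" if "i \<in> Obj J" for i
        by (rule mk_hom[OF go[OF that] oG hm_into_sub[OF hom_D(3)[OF c[OF that]]]]) (use that in \<open>auto intro!: gen.base\<close>)
      have "is_cocone J CP G ?G (\<lambda>i. mk (g i) (ap (c i)) ?G)"
        unfolding is_cocone_def
      proof (intro conjI ballI)
        show "?G \<in> Obj CP" using oG by (simp add: Obj_CP)
        show "mk (g i) (ap (c i)) ?G \<in> hom CP (on_obj G i) ?G" if "i \<in> Obj J" for i using cG[OF that] by (simp add: g_def)
        fix a assume a: "a \<in> Arr J"
        show "Comp CP (mk (g (Cod J a)) (ap (c (Cod J a))) ?G) (on_arr G a) = mk (g (Dom J a)) (ap (c (Dom J a))) ?G"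
          by (rule hom_eqI[OF comp_hom(1)[OF Ga[OF a] cG[OF Ja(2)[OF a]]] cG[OF Ja(1)[OF a]]])
            (use comp_hom(2)[OF Ga[OF a] cG[OF Ja(2)[OF a]]] comp_hom(2)[OF Ga[OF a] c[OF Ja(2)[OF a]]] cc[OF a] ap_in[OF Ga[OF a]] in simp)
      qed
      then obtain l where l: "l \<in> hom CP L ?G" "\<And>i. i \<in> Obj J \<Longrightarrow> Comp CP l (c i) = mk (g i) (ap (c i)) ?G"
        using univ by blast
      have i: "mk ?G (\<lambda>x. x) L \<in> hom CP ?G L" by (rule mk_hom[OF oG L sub_hm[OF cl]])
      let ?e = "Comp CP (mk ?G (\<lambda>x. x) L) l"
      note e = comp_hom[OF l(1) i]
      have ex: "ap ?e x = ap l x" if "x \<in> carrier L" for x using e(2)[OF that] ap_in[OF l(1) that] by simp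
      have "Comp CP ?e (c i) = c i" if i: "i \<in> Obj J" for i
        by (rule hom_eqI[OF comp_hom(1)[OF c[OF i] e(1)] c[OF i]])
          (use comp_hom(2)[OF c[OF i] e(1)] ex[OF ap_in[OF c[OF i]]] comp_hom(2)[OF c[OF i] l(1)] l(2)[OF i] in simp)
      moreover have "Comp CP (Ide CP L) (c i) = c i" if i: "i \<in> Obj J" for i
        by (rule hom_eqI[OF comp_hom(1)[OF c[OF i] Ide_hom[OF L]] c[OF i]])
          (use comp_hom(2)[OF c[OF i] Ide_hom[OF L]] ap_in[OF c[OF i]] in simp)
      ultimately have "?e = Ide CP L" using univ[OF coc] e(1) Ide_hom[OF L] by blast
      then have "x \<in> gen ar L ?U" if "x \<in> carrier L" for x using ex[OF that] ap_in[OF l(1) that] that by simp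
      then show ?thesis using cl by (auto simp: closed_def)
    qed
    have nLgen: "carrier (n L) = gen ar (n L) (\<Union>i\<in>Obj J. \<nu> (c i) ` carrier (n (g i)))"
    proof
      let ?U = "\<Union>i\<in>Obj J. ap (c i) ` carrier (g i)" and ?U' = "\<Union>i\<in>Obj J. \<nu> (c i) ` carrier (n (g i))"
      have U: "?U \<subseteq> carrier L" using ap_in[OF c] by auto
      have U': "?U' \<subseteq> carrier (n L)" using hm_in[OF \<nu>[OF c]] by auto
      have sub: "ap (nil2_unit CP L) ` ?U \<subseteq> ?U'"
      proof
        fix y assume "y \<in> ap (nil2_unit CP L) ` ?U"
        then obtain i x where ix: "i \<in> Obj J" "x \<in> carrier (g i)" "y = ap (nil2_unit CP L) (ap (c i) x)" by auto
        then have "y = \<nu> (c i) (ap (nil2_unit CP (g i)) x)" using \<nu>q[OF c[OF ix(1)] ix(2)] by simp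
        then show "y \<in> ?U'" using ix ap_in[OF q(1)[OF go[OF ix(1)]] ix(2)] by blast
      qed
      show "carrier (n L) \<subseteq> gen ar (n L) ?U'"
      proof
        fix y assume "y \<in> carrier (n L)"
        then obtain x where x: "x \<in> carrier L" "y = ap (nil2_unit CP L) x" using q(2)[OF L] by blast
        have "ap (nil2_unit CP L) x \<in> gen ar (n L) (ap (nil2_unit CP L) ` ?U)"
          by (rule hm_gen[OF _ U hom_D(3)[OF q(1)[OF L]]]) (use L x Lgen in auto)
        then show "y \<in> gen ar (n L) ?U'" using gen_mono[OF sub] x by blast
      qed
      show "gen ar (n L) ?U' \<subseteq> carrier (n L)"
        using gen_closed[OF _ U'] nob[OF L] by (auto simp: closed_def)
    qed
    \<comment> \<open>A reflector preserves colimits: a cocone with nilpotent apex on the reflected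
      diagram is pulled back along the units to one on \<open>G\<close> and factored through
      \<open>L\<close>; the factorization passes to \<open>n L\<close> because the apex is
      nilpotent.\<close>
    have nuniv: "\<exists>h. H (n L) M h \<and> (\<forall>i\<in>Obj J. \<forall>x\<in>carrier (n (g i)). h (\<nu> (c i) x) = m i x)"
      if M: "N.ob M" and m: "\<And>i. i \<in> Obj J \<Longrightarrow> H (n (g i)) M (m i)"
        and mc: "\<And>i j k x. (i, j, k) \<in> Ars \<Longrightarrow> x \<in> carrier (n (g i)) \<Longrightarrow> m j (k x) = m i x" for M m
    proof -
      have oM: "ob M" using M by simp
      define d where "d = (\<lambda>i. mk (g i) (\<lambda>x. m i (ap (nil2_unit CP (g i)) x)) M)"
      have d: "d i \<in> hom CP (g i) M" if "i \<in> Obj J" for i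
        unfolding d_def by (rule mk_hom[OF go[OF that] oM hm_comp[OF hom_D(3)[OF q(1)[OF go[OF that]]] m[OF that]]])
      have dx: "ap (d i) x = m i (ap (nil2_unit CP (g i)) x)" if "x \<in> carrier (g i)" for i x
        using that by (simp add: d_def)
      have "is_cocone J CP G M d"
        unfolding is_cocone_def
      proof (intro conjI ballI)
        show "M \<in> Obj CP" using oM by (simp add: Obj_CP)
        show "d i \<in> hom CP (on_obj G i) M" if "i \<in> Obj J" for i using d[OF that] by (simp add: g_def)
        fix a assume a: "a \<in> Arr J"
        have A: "(Dom J a, Cod J a, \<nu> (on_arr G a)) \<in> Ars" using a by (auto simp: Ars_def)
        show "Comp CP (d (Cod J a)) (on_arr G a) = d (Dom J a)"
        proof (rule hom_eqI[OF comp_hom(1)[OF Ga[OF a] d[OF Ja(2)[OF a]]] d[OF Ja(1)[OF a]]])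
          fix x assume x: "x \<in> carrier (g (Dom J a))"
          show "ap (Comp CP (d (Cod J a)) (on_arr G a)) x = ap (d (Dom J a)) x"
            using comp_hom(2)[OF Ga[OF a] d[OF Ja(2)[OF a]] x] dx[OF x] dx[OF ap_in[OF Ga[OF a] x]]
              \<nu>q[OF Ga[OF a] x] mc[OF A ap_in[OF q(1)[OF go[OF Ja(1)[OF a]]] x]] by simp
        qed
      qed
      then obtain l where l: "l \<in> hom CP L M" "\<And>i. i \<in> Obj J \<Longrightarrow> Comp CP l (c i) = d i" using univ by blast
      obtain h where h: "h \<in> hom CP (n L) M" "Comp CP h (nil2_unit CP L) = l"
        using nil2_CP(4)[OF L l(1)] M unfolding n_def by blast
      have "ap h (\<nu> (c i) x) = m i x" if i: "i \<in> Obj J" and x: "x \<in> carrier (n (g i))" for i x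
      proof -
        obtain y where y: "y \<in> carrier (g i)" "x = ap (nil2_unit CP (g i)) y" using x q(2)[OF go[OF i]] by blast
        have "ap h (\<nu> (c i) x) = ap l (ap (c i) y)"
          using \<nu>q[OF c[OF i] y(1)] y(2) comp_hom(2)[OF q(1)[OF L] h(1) ap_in[OF c[OF i] y(1)]] h(2) by simp
        also have "\<dots> = m i x" using comp_hom(2)[OF c[OF i] l(1) y(1)] l(2)[OF i] dx[OF y(1)] y(2) by simp
        finally show ?thesis .
      qed
      then show ?thesis using hom_D(3)[OF h(1)] by blast
    qed
    have \<kappa>i: "\<exists>k. hm ar (T.TA (n Y)) (F Y) k \<and> (\<forall>w\<in>carrier (F Y). k (\<kappa> Y w) = w)" if Y: "ob Y" for Y
      by (rule hm_factor[OF \<kappa>(1)[OF Y] \<kappa>(3)[OF Y] _ hm_id]) (use Fob[OF Y] \<kappa>eq[OF Y] in auto)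
    \<comment> \<open>The inverse of \<open>\<kappa> Y\<close>, as a homomorphism from
      \<open>TA (n Y)\<close> to the chosen tensor product.\<close>
    define LI where "LI Y = (SOME k. hm ar (T.TA (n Y)) (F Y) k \<and> (\<forall>w\<in>carrier (F Y). k (\<kappa> Y w) = w))" for Y
    have li: "hm ar (T.TA (n Y)) (F Y) (LI Y)" "\<And>w. w \<in> carrier (F Y) \<Longrightarrow> LI Y (\<kappa> Y w) = w" if Y: "ob Y" for Y
      using someI_ex[OF \<kappa>i[OF Y], folded LI_def] by blast+
    have TTex: "\<exists>v\<in>carrier (F Y). w = \<kappa> Y v" if "ob Y" "w \<in> T.TT (n Y)" for Y w
      using \<kappa>(3)[OF that(1)] that(2) by auto
    have lS: "LI Y' (T.Smap (n Y) (n Y') (\<nu> f) (\<kappa> Y v)) = ap (\<tau> f) v"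
      if f: "f \<in> hom CP Y Y'" and v: "v \<in> carrier (F Y)" for f Y Y' v
      using \<tau>(2)[OF f v] li(2)[OF hom_D(2)[OF f] ap_in[OF \<tau>(1)[OF f] v]] by simp
    note FL = Fabl[OF L]
    show "is_colimit J (Ab CP) ?FG (F L) (\<tau> \<circ> c)"
      unfolding is_colimit_def
    proof (intro conjI allI impI)
      show "is_cocone J (Ab CP) ?FG (F L) (\<tau> \<circ> c)"
        unfolding is_cocone_def FG
      proof (intro conjI ballI)
        show "F L \<in> Obj (Ab CP)" using FL by (simp add: Obj_Ab)
        show "(\<tau> \<circ> c) i \<in> hom (Ab CP) (F (on_obj G i)) (F L)" if "i \<in> Obj J" for i
          using \<tau>(1)[OF c[OF that]] FL Fabl[OF go[OF that]] by (simp add: hom_Ab g_def)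
        show "Comp (Ab CP) ((\<tau> \<circ> c) (Cod J a)) (\<tau> (on_arr G a)) = (\<tau> \<circ> c) (Dom J a)" if a: "a \<in> Arr J" for a
          using \<tau>c[OF Ga[OF a] c[OF Ja(2)[OF a]]] cc[OF a] by (simp add: Comp_Ab)
      qed
      fix M d assume Md: "is_cocone J (Ab CP) ?FG M d"
      have aM: "abl M" using Md by (simp add: is_cocone_def Obj_Ab)
      have d: "d i \<in> hom CP (F (g i)) M" if "i \<in> Obj J" for i
        using Md that by (simp add: is_cocone_def FG hom_Ab g_def)
      have dcc: "Comp CP (d (Cod J a)) (\<tau> (on_arr G a)) = d (Dom J a)" if "a \<in> Arr J" for a
        using Md that by (simp add: is_cocone_def FG Comp_Ab)
      \<comment> \<open>The cocone \<open>d\<close> on the tensor products, moved along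
        \<open>\<kappa>\<close> to the cosmash products, where \<open>TT_colimit\<close> applies.
        Its apex \<open>M\<close> is known to be abelian, which is what \<open>TT_colimit\<close>
        asks of the target.\<close>
      define D where "D i w = ap (d i) (LI (g i) w)" for i w
      have D: "hm ar (T.TA (n (g i))) M (D i)" if "i \<in> Obj J" for i
        unfolding D_def by (rule hm_comp[OF li(1)[OF go[OF that]] hom_D(3)[OF d[OF that]]])
      have Dc: "D j (T.Smap (n (g i)) (n (g j)) k w) = D i w" if A: "(i, j, k) \<in> Ars" and w: "w \<in> T.TT (n (g i))" for i j k w
      proof -
        obtain a where a: "a \<in> Arr J" "i = Dom J a" "j = Cod J a" "k = \<nu> (on_arr G a)" using A by (auto simp: Ars_def)
        note gi = go[OF Ja(1)[OF a(1)]]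
        obtain v where v: "v \<in> carrier (F (g (Dom J a)))" "w = \<kappa> (g (Dom J a)) v"
          using TTex[OF gi] w a(2) by blast
        have "D j (T.Smap (n (g i)) (n (g j)) k w) = ap (d j) (ap (\<tau> (on_arr G a)) v)"
          using lS[OF Ga[OF a(1)] v(1)] by (simp add: D_def a v(2))
        also have "\<dots> = ap (d i) v"
          using comp_hom(2)[OF \<tau>(1)[OF Ga[OF a(1)]] d[OF Ja(2)[OF a(1)]] v(1)] dcc[OF a(1)] a by simp
        also have "\<dots> = D i w" using li(2)[OF gi v(1)] by (simp add: D_def a(2) v(2))
        finally show ?thesis .
      qed
      have "\<exists>h. hm ar (T.TA (n L)) M h \<and> (\<forall>i\<in>Obj J. \<forall>w\<in>T.TT (n (g i)). h (T.Smap (n (g i)) (n L) (\<nu> (c i)) w) = D i w)"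
        by (rule T.TT_colimit[of "Obj J" "\<lambda>i. n (g i)" Ars M D "n L" "\<lambda>i. \<nu> (c i)", OF JO nob[OF go] Ars aM D Dc nob[OF L] \<nu>[OF c] nuniv])
      then obtain h where h: "hm ar (T.TA (n L)) M h"
        "\<And>i w. i \<in> Obj J \<Longrightarrow> w \<in> T.TT (n (g i)) \<Longrightarrow> h (T.Smap (n (g i)) (n L) (\<nu> (c i)) w) = D i w" by blast
      have oM: "ob M" using abl_vob[OF aM] by simp
      define hh where "hh = mk (F L) (\<lambda>w. h (\<kappa> L w)) M"
      have hh: "hh \<in> hom CP (F L) M" unfolding hh_def by (rule mk_hom[OF Fob[OF L] oM hm_comp[OF \<kappa>(1)[OF L] h(1)]])
      have hhx: "ap hh w = h (\<kappa> L w)" if "w \<in> carrier (F L)" for w using that by (simp add: hh_def)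
      have hd: "Comp CP hh (\<tau> (c i)) = d i" if i: "i \<in> Obj J" for i
      proof (rule hom_eqI[OF comp_hom(1)[OF \<tau>(1)[OF c[OF i]] hh] d[OF i]])
        fix v assume v: "v \<in> carrier (F (g i))"
        show "ap (Comp CP hh (\<tau> (c i))) v = ap (d i) v"
          using comp_hom(2)[OF \<tau>(1)[OF c[OF i]] hh v] hhx[OF ap_in[OF \<tau>(1)[OF c[OF i]] v]] \<tau>(2)[OF c[OF i] v]
            h(2)[OF i \<kappa>TT[OF go[OF i] v]] li(2)[OF go[OF i] v] by (simp add: D_def)
      qed
      show "\<exists>!h. h \<in> hom (Ab CP) (F L) M \<and> (\<forall>i\<in>Obj J. Comp (Ab CP) h ((\<tau> \<circ> c) i) = d i)"
      proof
        show "hh \<in> hom (Ab CP) (F L) M \<and> (\<forall>i\<in>Obj J. Comp (Ab CP) hh ((\<tau> \<circ> c) i) = d i)"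
          using hh hd FL aM by (simp add: hom_Ab Comp_Ab)
        fix k assume "k \<in> hom (Ab CP) (F L) M \<and> (\<forall>i\<in>Obj J. Comp (Ab CP) k ((\<tau> \<circ> c) i) = d i)"
        then have k: "k \<in> hom CP (F L) M" "\<And>i. i \<in> Obj J \<Longrightarrow> Comp CP k (\<tau> (c i)) = d i"
          by (simp_all add: hom_Ab Comp_Ab)
        show "k = hh"
        proof (rule hom_eqI[OF k(1) hh])
          fix w assume w: "w \<in> carrier (F L)"
          \<comment> \<open>A competitor \<open>k\<close> agrees with \<open>hh\<close> on the
            images of the \<open>TT (n (g i))\<close>, which are jointly generating by
            \<open>nLgen\<close>.\<close>
          have "ap k (LI L (\<kappa> L w)) = ap hh (LI L (\<kappa> L w))"
          proof (rule T.TT_colimit_unique[of "Obj J" "\<lambda>i. n (g i)" "n L" "\<lambda>i. \<nu> (c i)" M "\<lambda>w. ap k (LI L w)" "\<lambda>w. ap hh (LI L w)"])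
            show "hm ar (T.TA (n L)) M (\<lambda>w. ap k (LI L w))" "hm ar (T.TA (n L)) M (\<lambda>w. ap hh (LI L w))"
              using hm_comp[OF li(1)[OF L] hom_D(3)[OF k(1)]] hm_comp[OF li(1)[OF L] hom_D(3)[OF hh]] .
            fix i v assume i: "i \<in> Obj J" and v: "v \<in> T.TT (n (g i))"
            obtain y where y: "y \<in> carrier (F (g i))" "v = \<kappa> (g i) y" using TTex[OF go[OF i] v] by blast
            show "ap k (LI L (T.Smap (n (g i)) (n L) (\<nu> (c i)) v)) = ap hh (LI L (T.Smap (n (g i)) (n L) (\<nu> (c i)) v))"
              unfolding y(2) lS[OF c[OF i] y(1)]
              using comp_hom(2)[OF \<tau>(1)[OF c[OF i]] k(1) y(1)] comp_hom(2)[OF \<tau>(1)[OF c[OF i]] hh y(1)] k(2)[OF i] hd[OF i] by simp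
          qed (use nob[OF go] nob[OF L] \<nu>[OF c] nLgen \<kappa>TT[OF L w] in auto)
          then show "ap k w = ap hh w" using li(2)[OF L w] by simp
        qed
      qed
    qed
  qed
  ultimately show ?thesis by blast
qed

end

theorem proposition7p2:
  fixes ar :: "'f \<Rightarrow> nat"
    and E :: "('f tm \<times> 'f tm) set"
    and \<V> :: "(('f, 'u) alg, ('f, 'u) alg \<times> ('u \<Rightarrow> 'u) \<times> ('f, 'u) alg) cat"
    and X :: "('f, 'u) alg"
    and J :: "('i, 'j) cat"
  assumes "infinite (UNIV :: 'u set)" and "(UNIV :: 'f set) \<lesssim> (UNIV :: 'u set)"
    and "\<forall>(s, t)\<in>E. wf_tm ar s \<and> wf_tm ar t"
    and "\<V> = Variety ar E"
    and "semi_abelian \<V>"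
    and "X \<in> Obj \<V>"
    and "category J" and "Arr J \<lesssim> (UNIV :: 'u set)"
  shows "is_functor \<V> (Ab \<V>) (tensor_functor \<V> X) \<and>
         preserves_colimits J \<V> (Ab \<V>) (tensor_functor \<V> X)"
proof -
  have sv: "alg_class ar E (\<lambda>_ :: ('f, 'u) alg. True)"
    by unfold_locales (use assms(1-3) in \<open>auto simp: wfE_def\<close>)
  interpret S: alg_class ar E "\<lambda>_ :: ('f, 'u) alg. True" by (rule sv)
  have V: "S.CP = \<V>" by (simp add: S.CP_def full_subcat_True assms(4))
  have ps: "pointed_class ar E (\<lambda>_ :: ('f, 'u) alg. True)"
  proof (intro pointed_class.intro sv pointed_class_axioms.intro)
    fix A :: "('f, 'u) alg" assume "vob ar E A"
    then show "\<exists>!z. z \<in> carrier A \<and> (\<forall>f. oper A f (replicate (ar f) z) = z)"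
      by (intro S.pointed_pt) (use assms(5) V in \<open>simp_all add: semi_abelian_def\<close>)
  qed
  interpret Q: pointed_class ar E "\<lambda>_ :: ('f, 'u) alg. True" by (rule ps)
  have "\<exists>(mal :: ('f, 'u) alg \<Rightarrow> _) D KK. protomodular_variety ar E mal D KK"
    by (rule Q.protomodular_terms) (use assms(5) V in \<open>simp_all add: semi_abelian_def\<close>)
  then obtain mal :: "('f, 'u) alg \<Rightarrow> 'u \<Rightarrow> 'u \<Rightarrow> 'u \<Rightarrow> 'u" and D KK where vv: "protomodular_variety ar E mal D KK" by blast
  have "vob ar E X" using assms(6) V S.Obj_CP by blast
  then show ?thesis
    using protomodular_variety.tensor_preserves_colimits[OF vv _ assms(7,8), of X] V by simp
qed

end
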